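(* Let $T>0$, $N\in\mathbb{N}$, and let $\{\Omega_t\}_{t\in[0,T]}$ be a family of nonempty, open, bounded subsets of $\mathbb{R}^N$ with Lipschitz boundary which is nondecreasing, i.e. $\Omega_s\subseteq\Omega_t$ for $0\le s\le t\le T$. Let $\mathcal{O}:=\bigcup_{t\in(0,T)}\{t\}\times\Omega_t$, $\Gamma:=\bigcup_{t\in(0,T)}\{t\}\times\partial\Omega_t$, and let $f\in L^2(\mathcal{O})$, $u_0\in H^1_0(\Omega_0)$, $u_1\in L^2(\Omega_0)$. Then there exists a weak solution $u$ of $$\ddot u-\Delta u=f\ \text{in }\mathcal{O},\qquad u=0\ \text{on }\Gamma,\qquad u(0)=u_0,\quad \dot u(0)=u_1\ \text{in }\Omega_0.$$ Moreover $u\in C^0_w([0,T];H^1_0(\Omega_T))$, $\dot u\in L^\infty(0,T;L^2(\Omega_t))$, and $\dot u\in C^0_w([\bar t,T];L^2(\Omega_{\bar t}))$ for every $\bar t\in[0,T)$; furthermore, for every $t\in[0,T]$, $$\frac12\|\dot u(t)\|^2_{L^2(\Omega_t)}+\frac12\|\nabla u(t)\|^2_{L^2(\Omega_t)}\le\frac12\|u_1\|^2_{L^2(\Omega_0)}+\frac12\|\nabla u_0\|^2_{L^2(\Omega_0)}+\int_0^t\langle f(s),\dot u(s)\rangle_{L^2(\Omega_s)}\,\mathrm{d}s.$$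
   Context: Dots denote time derivatives, $\nabla$ the spatial gradient. For a family of normed spaces $\{X_t\}$, $v\in L^p(0,T;X_t)$ means $v(t)\in X_t$ for a.e. $t$ and $t\mapsto\|v(t)\|_{X_t}\in L^p(0,T)$. Solutions are extended by $0$ outside $\mathcal{O}$ (so that membership in spaces over the fixed sets $\Omega_T$, $\Omega_{\bar t}$ makes sense). For a Banach space $X$, $C^0_w([a,b];X)$ is the space of maps $[a,b]\to X$ continuous with respect to the weak topology of $X$. A weak solution is a function $u:\overline{\mathcal{O}}\to\mathbb{R}$ such that: (i) $u\in L^2(0,T;H^1_0(\Omega_t))$ and $\dot u\in L^2(0,T;L^2(\Omega_t))$; (ii) the restriction of $u$ to $[0,T]\times\Omega_0$ is in $C^0([0,T];L^2(\Omega_0))$, and for every $\delta>0$ and open $\Omega'\subseteq\Omega_0$ with $[0,\delta]\times\Omega'\subseteq\mathcal{O}$ the restriction of $\dot u$ to $[0,\delta]\times\Omega'$ is in $C^0([0,\delta];H^{-1}(\Omega'))$; moreover $u(0)=u_0$, $\dot u(0)=u_1$; (iii) $-\int_0^T\langle\dot u,\dot\eta\rangle_{L^2(\Omega_t)}\mathrm{d}t+\int_0^T\langle\nabla u,\nabla\eta\rangle_{L^2(\Omega_t)}\mathrm{d}t=\int_0^T\langle f,\eta\rangle_{L^2(\Omega_t)}\mathrm{d}t$ for every $\eta\in L^2(0,T;H^1_0(\Omega_t))$ with $\dot\eta\in L^2(0,T;L^2(\Omega_t))$ and $\eta(0)=\eta(T)=0$. *)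

theory Defs
  imports "HOL-Analysis.Analysis"
begin

definition pd :: "('a::euclidean_space \<Rightarrow> real) \<Rightarrow> 'a \<Rightarrow> 'a \<Rightarrow> real" where
  "pd f b x = frechet_derivative f (at x) b"

definition grad :: "('a::euclidean_space \<Rightarrow> real) \<Rightarrow> 'a \<Rightarrow> 'a" where
  "grad f x = (\<Sum>b\<in>Basis. pd f b x *\<^sub>R b)"

fun Ck :: "nat \<Rightarrow> ('a::euclidean_space \<Rightarrow> real) \<Rightarrow> bool" where
  "Ck 0 f = continuous_on UNIV f"
| "Ck (Suc k) f = ((\<forall>x. f differentiable (at x)) \<and> (\<forall>b\<in>Basis. Ck k (pd f b)))"

definition smooth :: "('a::euclidean_space \<Rightarrow> real) \<Rightarrow> bool" where
  "smooth f \<longleftrightarrow> (\<forall>k. Ck k f)"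

definition test_fun :: "'a::euclidean_space set \<Rightarrow> ('a \<Rightarrow> real) \<Rightarrow> bool" where
  "test_fun U \<phi> \<longleftrightarrow> smooth \<phi> \<and> compact (closure {x. \<phi> x \<noteq> 0}) \<and> closure {x. \<phi> x \<noteq> 0} \<subseteq> U"

definition L2 :: "'a::euclidean_space set \<Rightarrow> ('a \<Rightarrow> real) \<Rightarrow> bool" where
  "L2 U v \<longleftrightarrow> v \<in> borel_measurable (lebesgue_on U) \<and> integrable (lebesgue_on U) (\<lambda>x. (v x)\<^sup>2)"

definition L2vec :: "'a::euclidean_space set \<Rightarrow> ('a \<Rightarrow> 'b::euclidean_space) \<Rightarrow> bool" where
  "L2vec U G \<longleftrightarrow> G \<in> borel_measurable (lebesgue_on U) \<and> integrable (lebesgue_on U) (\<lambda>x. (norm (G x))\<^sup>2)"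

definition L2ip :: "'a::euclidean_space set \<Rightarrow> ('a \<Rightarrow> real) \<Rightarrow> ('a \<Rightarrow> real) \<Rightarrow> real" where
  "L2ip U v w = (\<integral>x. v x * w x \<partial>lebesgue_on U)"

definition L2sq :: "'a::euclidean_space set \<Rightarrow> ('a \<Rightarrow> real) \<Rightarrow> real" where
  "L2sq U v = L2ip U v v"

definition is_weak_grad :: "'a::euclidean_space set \<Rightarrow> ('a \<Rightarrow> real) \<Rightarrow> ('a \<Rightarrow> 'a) \<Rightarrow> bool" where
  "is_weak_grad U v G \<longleftrightarrow> (\<forall>\<phi>. test_fun U \<phi> \<longrightarrow> (\<forall>b\<in>Basis.
      (\<integral>x. v x * pd \<phi> b x \<partial>lebesgue_on U) = - (\<integral>x. (G x \<bullet> b) * \<phi> x \<partial>lebesgue_on U)))"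

definition H1 :: "'a::euclidean_space set \<Rightarrow> ('a \<Rightarrow> real) \<Rightarrow> bool" where
  "H1 U v \<longleftrightarrow> L2 U v \<and> (\<exists>G. L2vec U G \<and> is_weak_grad U v G)"

text \<open>The weak gradient (unique a.e.; all quantities below only depend on it up to null sets).\<close>
definition wgrad :: "'a::euclidean_space set \<Rightarrow> ('a \<Rightarrow> real) \<Rightarrow> 'a \<Rightarrow> 'a" where
  "wgrad U v = (SOME G. L2vec U G \<and> is_weak_grad U v G)"

definition gradip :: "'a::euclidean_space set \<Rightarrow> ('a \<Rightarrow> real) \<Rightarrow> ('a \<Rightarrow> real) \<Rightarrow> real" where
  "gradip U v w = (\<integral>x. wgrad U v x \<bullet> wgrad U w x \<partial>lebesgue_on U)"

definition gradsq :: "'a::euclidean_space set \<Rightarrow> ('a \<Rightarrow> real) \<Rightarrow> real" where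
  "gradsq U v = gradip U v v"

definition H1norm :: "'a::euclidean_space set \<Rightarrow> ('a \<Rightarrow> real) \<Rightarrow> real" where
  "H1norm U v = sqrt (L2sq U v + gradsq U v)"

definition L2norm :: "'a::euclidean_space set \<Rightarrow> ('a \<Rightarrow> real) \<Rightarrow> real" where
  "L2norm U v = sqrt (L2sq U v)"

definition H10 :: "'a::euclidean_space set \<Rightarrow> ('a \<Rightarrow> real) \<Rightarrow> bool" where
  "H10 U v \<longleftrightarrow> H1 U v \<and> (\<exists>\<phi>s. (\<forall>k. test_fun U (\<phi>s k)) \<and>
      (\<lambda>k. L2sq U (\<lambda>x. \<phi>s k x - v x)) \<longlonglongrightarrow> 0 \<and>
      (\<lambda>k. \<integral>x. (norm (grad (\<phi>s k) x - wgrad U v x))\<^sup>2 \<partial>lebesgue_on U) \<longlonglongrightarrow> 0)"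

text \<open>H^{-1}(U) norm of a function g (in L^2): dual norm w.r.t. H^1_0(U), computed on the
  dense subspace C_c^infinity(U).\<close>
definition Hneg_norm :: "'a::euclidean_space set \<Rightarrow> ('a \<Rightarrow> real) \<Rightarrow> real" where
  "Hneg_norm U g = Sup {\<bar>\<integral>x. g x * \<phi> x \<partial>lebesgue_on U\<bar> | \<phi>. test_fun U \<phi> \<and> H1norm U \<phi> \<le> 1}"

definition bdd_lin_fun :: "(('x \<Rightarrow> real) \<Rightarrow> bool) \<Rightarrow> (('x \<Rightarrow> real) \<Rightarrow> real) \<Rightarrow> (('x \<Rightarrow> real) \<Rightarrow> real) \<Rightarrow> bool" where
  "bdd_lin_fun X nrm lf \<longleftrightarrow>
     (\<forall>v w a b. X v \<longrightarrow> X w \<longrightarrow> lf (\<lambda>x. a * v x + b * w x) = a * lf v + b * lf w) \<and>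
     (\<exists>C. \<forall>v. X v \<longrightarrow> \<bar>lf v\<bar> \<le> C * nrm v)"

definition weakly_cont_on :: "real set \<Rightarrow> (('x \<Rightarrow> real) \<Rightarrow> bool) \<Rightarrow> (('x \<Rightarrow> real) \<Rightarrow> real) \<Rightarrow> (real \<Rightarrow> 'x \<Rightarrow> real) \<Rightarrow> bool" where
  "weakly_cont_on I X nrm v \<longleftrightarrow> (\<forall>t\<in>I. X (v t)) \<and>
     (\<forall>lf. bdd_lin_fun X nrm lf \<longrightarrow> continuous_on I (\<lambda>t. lf (v t)))"

text \<open>Open set with Lipschitz boundary: locally the region below the graph of a Lipschitz
  function, in some orthonormal coordinate system (direction e, hyperplane orthogonal to e).\<close>
definition lipschitz_boundary :: "'x::euclidean_space set \<Rightarrow> bool" where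
  "lipschitz_boundary \<Omega> \<longleftrightarrow> (\<forall>x\<in>frontier \<Omega>. \<exists>r>0. \<exists>e. norm e = 1 \<and> (\<exists>g L. L-lipschitz_on UNIV g \<and>
      \<Omega> \<inter> ball x r = {y \<in> ball x r. y \<bullet> e < g (y - (y \<bullet> e) *\<^sub>R e)}))"

definition Oset :: "real \<Rightarrow> (real \<Rightarrow> 'x set) \<Rightarrow> (real \<times> 'x) set" where
  "Oset T \<Omega> = {(t, x). t \<in> {0<..<T} \<and> x \<in> \<Omega> t}"

text \<open>The fixed cylinder (0,T) x Omega_T on which zero-extended functions live.\<close>
definition Qcyl :: "real \<Rightarrow> (real \<Rightarrow> 'x set) \<Rightarrow> (real \<times> 'x) set" where
  "Qcyl T \<Omega> = {0<..<T} \<times> \<Omega> T"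

definition zero_ext :: "real \<Rightarrow> (real \<Rightarrow> 'x::euclidean_space set) \<Rightarrow> (real \<Rightarrow> 'x \<Rightarrow> real) \<Rightarrow> bool" where
  "zero_ext T \<Omega> v \<longleftrightarrow> (AE t in lebesgue_on {0<..<T}. AE x in lebesgue. x \<notin> \<Omega> t \<longrightarrow> v t x = 0)"

definition jointly_meas :: "real \<Rightarrow> (real \<Rightarrow> 'x::euclidean_space set) \<Rightarrow> (real \<Rightarrow> 'x \<Rightarrow> real) \<Rightarrow> bool" where
  "jointly_meas T \<Omega> v \<longleftrightarrow> (\<lambda>p. v (fst p) (snd p)) \<in> borel_measurable (lebesgue_on (Qcyl T \<Omega>))"

definition L2_L2 :: "real \<Rightarrow> (real \<Rightarrow> 'x::euclidean_space set) \<Rightarrow> (real \<Rightarrow> 'x \<Rightarrow> real) \<Rightarrow> bool" where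
  "L2_L2 T \<Omega> v \<longleftrightarrow> jointly_meas T \<Omega> v \<and> zero_ext T \<Omega> v \<and>
     (AE t in lebesgue_on {0<..<T}. L2 (\<Omega> t) (v t)) \<and>
     integrable (lebesgue_on {0<..<T}) (\<lambda>t. L2sq (\<Omega> t) (v t))"

definition Linf_L2 :: "real \<Rightarrow> (real \<Rightarrow> 'x::euclidean_space set) \<Rightarrow> (real \<Rightarrow> 'x \<Rightarrow> real) \<Rightarrow> bool" where
  "Linf_L2 T \<Omega> v \<longleftrightarrow> jointly_meas T \<Omega> v \<and> zero_ext T \<Omega> v \<and>
     (AE t in lebesgue_on {0<..<T}. L2 (\<Omega> t) (v t)) \<and>
     (\<lambda>t. L2norm (\<Omega> t) (v t)) \<in> borel_measurable (lebesgue_on {0<..<T}) \<and>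
     (\<exists>C. AE t in lebesgue_on {0<..<T}. L2norm (\<Omega> t) (v t) \<le> C)"

definition L2_H10 :: "real \<Rightarrow> (real \<Rightarrow> 'x::euclidean_space set) \<Rightarrow> (real \<Rightarrow> 'x \<Rightarrow> real) \<Rightarrow> bool" where
  "L2_H10 T \<Omega> v \<longleftrightarrow> jointly_meas T \<Omega> v \<and> zero_ext T \<Omega> v \<and>
     (AE t in lebesgue_on {0<..<T}. H10 (\<Omega> t) (v t)) \<and>
     integrable (lebesgue_on {0<..<T}) (\<lambda>t. (H1norm (\<Omega> t) (v t))\<^sup>2)"

definition is_weak_dt :: "real \<Rightarrow> (real \<Rightarrow> 'x::euclidean_space set) \<Rightarrow> (real \<Rightarrow> 'x \<Rightarrow> real) \<Rightarrow> (real \<Rightarrow> 'x \<Rightarrow> real) \<Rightarrow> bool" where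
  "is_weak_dt T \<Omega> v w \<longleftrightarrow> (\<forall>\<phi>. test_fun (Qcyl T \<Omega>) \<phi> \<longrightarrow>
      (\<integral>p. v (fst p) (snd p) * pd \<phi> (1, 0) p \<partial>lebesgue_on (Qcyl T \<Omega>)) =
      - (\<integral>p. w (fst p) (snd p) * \<phi> p \<partial>lebesgue_on (Qcyl T \<Omega>)))"

definition cont_L2_on :: "real set \<Rightarrow> 'x::euclidean_space set \<Rightarrow> (real \<Rightarrow> 'x \<Rightarrow> real) \<Rightarrow> bool" where
  "cont_L2_on I U v \<longleftrightarrow> (\<forall>t\<in>I. L2 U (v t)) \<and>
     (\<forall>t0\<in>I. ((\<lambda>t. L2norm U (\<lambda>x. v t x - v t0 x)) \<longlongrightarrow> 0) (at t0 within I))"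

definition cont_Hneg_on :: "real set \<Rightarrow> 'x::euclidean_space set \<Rightarrow> (real \<Rightarrow> 'x \<Rightarrow> real) \<Rightarrow> bool" where
  "cont_Hneg_on I U v \<longleftrightarrow> (\<forall>t\<in>I. L2 U (v t)) \<and>
     (\<forall>t0\<in>I. ((\<lambda>t. Hneg_norm U (\<lambda>x. v t x - v t0 x)) \<longlongrightarrow> 0) (at t0 within I))"

text \<open>Admissible test functions eta (with weak time derivative etad) for the weak formulation.
  eta(0)=eta(T)=0 refers to the continuous representative of eta in C^0([0,T];L^2(Omega_T)).\<close>
definition admissible_test :: "real \<Rightarrow> (real \<Rightarrow> 'x::euclidean_space set) \<Rightarrow> (real \<Rightarrow> 'x \<Rightarrow> real) \<Rightarrow> (real \<Rightarrow> 'x \<Rightarrow> real) \<Rightarrow> bool" where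
  "admissible_test T \<Omega> \<eta> \<eta>d \<longleftrightarrow> L2_H10 T \<Omega> \<eta> \<and> is_weak_dt T \<Omega> \<eta> \<eta>d \<and> L2_L2 T \<Omega> \<eta>d \<and>
     cont_L2_on {0..T} (\<Omega> T) \<eta> \<and> L2sq (\<Omega> T) (\<eta> 0) = 0 \<and> L2sq (\<Omega> T) (\<eta> T) = 0"

definition weak_solution ::
  "real \<Rightarrow> (real \<Rightarrow> 'x::euclidean_space set) \<Rightarrow> (real \<Rightarrow> 'x \<Rightarrow> real) \<Rightarrow> ('x \<Rightarrow> real) \<Rightarrow> ('x \<Rightarrow> real)
    \<Rightarrow> (real \<Rightarrow> 'x \<Rightarrow> real) \<Rightarrow> (real \<Rightarrow> 'x \<Rightarrow> real) \<Rightarrow> bool" where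
  "weak_solution T \<Omega> f u0 u1 u ud \<longleftrightarrow>
     \<comment> \<open>(i)\<close>
     L2_H10 T \<Omega> u \<and> is_weak_dt T \<Omega> u ud \<and> L2_L2 T \<Omega> ud \<and>
     \<comment> \<open>(ii)\<close>
     cont_L2_on {0..T} (\<Omega> 0) u \<and>
     (\<forall>\<delta> \<Omega>'. 0 < \<delta> \<and> \<delta> < T \<and> open \<Omega>' \<and> \<Omega>' \<subseteq> \<Omega> 0 \<and> (\<forall>t\<in>{0<..\<delta>}. \<Omega>' \<subseteq> \<Omega> t)
        \<longrightarrow> cont_Hneg_on {0..\<delta>} \<Omega>' ud) \<and>
     L2sq (\<Omega> 0) (\<lambda>x. u 0 x - u0 x) = 0 \<and>
     (\<forall>\<delta> \<Omega>'. 0 < \<delta> \<and> \<delta> < T \<and> open \<Omega>' \<and> \<Omega>' \<subseteq> \<Omega> 0 \<and> (\<forall>t\<in>{0<..\<delta>}. \<Omega>' \<subseteq> \<Omega> t)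
        \<longrightarrow> Hneg_norm \<Omega>' (\<lambda>x. ud 0 x - u1 x) = 0) \<and>
     \<comment> \<open>(iii)\<close>
     (\<forall>\<eta> \<eta>d. admissible_test T \<Omega> \<eta> \<eta>d \<longrightarrow>
        - (\<integral>t. L2ip (\<Omega> t) (ud t) (\<eta>d t) \<partial>lebesgue_on {0..T})
        + (\<integral>t. gradip (\<Omega> t) (u t) (\<eta> t) \<partial>lebesgue_on {0..T})
        = (\<integral>t. L2ip (\<Omega> t) (f t) (\<eta> t) \<partial>lebesgue_on {0..T}))"

end

theory Submission
  imports Defs
begin

text \<open>
  The solution is the limit of an implicit time discretisation. At each step one projects onto the
  graph of the gradient on $H^1_0(\Omega_{t_k})$, viewed as a closed subspace of
  $L^2(\mathbb{R}^N) \times L^2(\mathbb{R}^N;\mathbb{R}^N)$; since the domains grow these subspaces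
  are nested, so the previous step is always admissible and the discrete energy inequality follows.
  Convex combinations of the interpolants (Mazur) converge strongly in $L^2$ of space-time, hence at
  almost every time; the equation is linear and the energy convex, so both pass to the limit. The
  remaining times are reached from the right, using the Lipschitz bound for $u$ and the equation,
  tested with functions supported in the smaller domain, for $\dot u$.
\<close>

text \<open>The obstacle is that a velocity or gradient taken at a grid point to the right of
  \<open>t\<close> lies in a space too large for time \<open>t\<close>. The interpolants therefore
  use the left grid point, whose values lie in the spaces of \<open>t\<close>, while the discrete
  equation speaks of the right one. The two are reconciled in a weak sense: against a test function
  of the space at \<open>t\<close> the velocity jump over a cell is of order
  \<open>sqrt tau\<close>, and the shifted gradients have the same limit almost everywhere because
  the gradient is single valued. At an exceptional time each component comes from its own side: the
  position from completeness and its Lipschitz bound, the gradient from the left, where the graphs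
  are contained in the one at \<open>t\<close>, and the velocity from the right, followed by a
  projection onto the space at \<open>t\<close>, which no test function of that space notices. The
  scheme runs beyond \<open>2 * T\<close>, so that \<open>T\<close> too is approached from the
  right. All abstract arguments see the domains only through nested closed subspaces whose graphs
  are single valued and whose first components are total.\<close>

abbreviation LIMSEQ_ascii :: "(nat => 'a::topological_space) => 'a => bool" (infix "---->" 60) where
  "X ----> L \<equiv> (X \<longlongrightarrow> L) sequentially"

section \<open>Hilbert spaces\<close>

text \<open>The parallelogram law, arranged so that a lower bound for the norm of the midpoint
  becomes an upper bound for the distance. Both minimisation arguments below rest on it.\<close>

lemma norm_diff_sq_midpoint:
  fixes x y :: "'h::real_inner"
  shows "(norm (x - y))\<^sup>2 = 2 * (norm x)\<^sup>2 + 2 * (norm y)\<^sup>2 - 4 * (norm ((1/2) *\<^sub>R (x + y)))\<^sup>2"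
  by (simp add: power2_norm_eq_inner inner_add inner_diff inner_commute algebra_simps)

lemma Cauchy_if_dist_sq_le:
  fixes x :: "nat => 'h::real_normed_vector"
  assumes a: "a ----> 0" and le: "!!n m. n <= m ==> (norm (x n - x m))\<^sup>2 <= a n"
  shows "Cauchy x"
proof (rule CauchyI)
  fix e :: real assume e: "0 < e"
  have "eventually (%n. a n < (e/2)\<^sup>2) sequentially"
    using a e by (intro order_tendstoD) auto
  then obtain M where M: "!!n. n \<ge> M ==> a n < (e/2)\<^sup>2"
    by (auto simp: eventually_sequentially)
  have *: "norm (x M - x m) < e/2" if "m \<ge> M" for m
    using le[OF that] M[of M] e by (intro power2_less_imp_less[of _ "e/2"]) auto
  show "\<exists>M. \<forall>m\<ge>M. \<forall>n\<ge>M. norm (x m - x n) < e"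
  proof (intro exI allI impI)
    fix m n assume "m \<ge> M" "n \<ge> M"
    then have "norm (x M - x m) < e/2" "norm (x M - x n) < e/2" using * by auto
    moreover have "norm (x m - x n) <= norm (x M - x n) + norm (x M - x m)"
      using norm_triangle_ineq4[of "x M - x n" "x M - x m"] by simp
    ultimately show "norm (x m - x n) < e" by linarith
  qed
qed

text \<open>A minimising sequence is Cauchy because midpoints of its members stay in
  \<open>S\<close>; orthogonality is the first order condition at the minimum.\<close>

lemma orthogonal_projection:
  fixes S :: "'h::{real_inner,complete_space} set"
  assumes S: "closed S" "subspace S"
  obtains p where "p \<in> S" "!!s. s \<in> S ==> (z - p) \<bullet> s = 0"
proof -
  define A where "A = (%s. (norm (z - s))\<^sup>2) ` S"
  have A: "A \<noteq> {}" "bdd_below A"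
    using S(2) subspace_0 by (auto simp: A_def intro!: bdd_belowI[of _ 0])
  define d where "d = Inf A"
  have dle: "d <= (norm (z - s))\<^sup>2" if "s \<in> S" for s
    unfolding d_def using A that by (intro cInf_lower) (auto simp: A_def)
  have "\<exists>s\<in>S. (norm (z - s))\<^sup>2 < d + 1 / real (Suc n)" for n
  proof -
    have "d < d + 1 / real (Suc n)" by simp
    from cInf_lessD[OF A(1) this[unfolded d_def]] show ?thesis
      by (auto simp: A_def d_def)
  qed
  then obtain s where s: "!!n. s n \<in> S" "!!n. (norm (z - s n))\<^sup>2 < d + 1 / real (Suc n)"
    by metis
  have "Cauchy s"
  proof (rule Cauchy_if_dist_sq_le)
    show "(%n. 4 * (1 / real (Suc n))) ----> 0"
      using tendsto_mult_left[OF LIMSEQ_inverse_real_of_nat, of 4] by (simp add: inverse_eq_divide)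
    fix n m :: nat assume "n <= m"
    have mid: "(1/2) *\<^sub>R (s n + s m) \<in> S"
      using s S(2) by (simp add: subspace_add subspace_scale)
    have "(1/2) *\<^sub>R ((z - s n) + (z - s m)) = z - (1/2) *\<^sub>R (s n + s m)"
      by (simp add: algebra_simps) (metis scaleR_half_double scaleR_add_right)
    then have "(norm ((z - s n) - (z - s m)))\<^sup>2 <= 2 * (norm (z - s n))\<^sup>2 + 2 * (norm (z - s m))\<^sup>2 - 4 * d"
      using norm_diff_sq_midpoint[of "z - s n" "z - s m"] dle[OF mid] by simp
    moreover have "norm ((z - s n) - (z - s m)) = norm (s n - s m)"
      by (simp add: norm_minus_commute)
    moreover have "1 / real (Suc m) <= 1 / real (Suc n)"
      using \<open>n <= m\<close> by (simp add: frac_le)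
    ultimately show "(norm (s n - s m))\<^sup>2 <= 4 * (1 / real (Suc n))"
      using s(2)[of n] s(2)[of m] by simp
  qed
  then obtain p where p: "s ----> p" using Cauchy_convergent convergent_def by blast
  then have pS: "p \<in> S" using S(1) s(1) closed_sequentially by blast
  have "(%n. (norm (z - s n))\<^sup>2) ----> (norm (z - p))\<^sup>2"
    by (intro tendsto_intros p)
  moreover have "(%n. d + 1 / real (Suc n)) ----> d + 0"
    using LIMSEQ_inverse_real_of_nat by (intro tendsto_intros) (simp add: inverse_eq_divide)
  ultimately have pd: "(norm (z - p))\<^sup>2 <= d"
    using s(2) by (intro LIMSEQ_le[of _ _ _ d]) (auto intro: less_imp_le)
  have "(z - p) \<bullet> q = 0" if q: "q \<in> S" for q
  proof (cases "q = 0")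
    case False
    \<comment> \<open>This \<open>c\<close> minimises \<open>norm ((z - p) - c *\<^sub>R q)\<close>;
      as \<open>p\<close> is already optimal, the gain it brings must vanish.\<close>
    define c where "c = ((z - p) \<bullet> q) / (norm q)\<^sup>2"
    have "p + c *\<^sub>R q \<in> S" using pS q S(2) by (simp add: subspace_add subspace_scale)
    from order_trans[OF pd dle[OF this]]
    have "(norm (z - p))\<^sup>2 <= (norm ((z - p) - c *\<^sub>R q))\<^sup>2" by (simp add: diff_diff_eq)
    also have "\<dots> = (norm (z - p))\<^sup>2 - 2 * c * ((z - p) \<bullet> q) + c\<^sup>2 * (norm q)\<^sup>2"
      unfolding power2_norm_eq_inner power2_eq_square[of c]
      by (simp add: inner_diff inner_commute algebra_simps)
    finally have "2 * c * ((z - p) \<bullet> q) <= c\<^sup>2 * (norm q)\<^sup>2" by simp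
    moreover have "c\<^sup>2 * (norm q)\<^sup>2 = c * ((z - p) \<bullet> q)"
      using False by (simp add: c_def power2_eq_square)
    ultimately have "c * ((z - p) \<bullet> q) <= 0" by simp
    then have "((z - p) \<bullet> q)\<^sup>2 / (norm q)\<^sup>2 <= 0" by (simp add: c_def power2_eq_square)
    then show ?thesis using False by (simp add: divide_le_0_iff)
  qed simp
  then show thesis using that pS by blast
qed

text \<open>The part of a vector orthogonal to the kernel spans the complement of the kernel in
  \<open>W\<close>, and \<open>f\<close> is fixed by its value there. Linearity and boundedness are
  asked on \<open>W\<close> only, since the later functionals are transported from function spaces
  that reach no other vectors.\<close>

lemma riesz_on_subspace:
  fixes W :: "'h::{real_inner,complete_space} set"
  assumes W: "closed W" "subspace W"
    and lin: "!!v w a b. v \<in> W ==> w \<in> W ==> f (a *\<^sub>R v + b *\<^sub>R w) = a * f v + b * f w"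
    and bd: "!!v. v \<in> W ==> \<bar>f v\<bar> <= C * norm v"
  obtains w where "w \<in> W" "!!z. z \<in> W ==> f z = w \<bullet> z"
proof -
  have f0: "f 0 = 0" using lin[of 0 0 0 0] subspace_0[OF W(2)] by simp
  have fdiff: "f (v - c *\<^sub>R w) = f v - c * f w" if "v \<in> W" "w \<in> W" for v w c
    using lin[OF that, of 1 "-c"] by simp
  define N where "N = {z \<in> W. f z = 0}"
  have Nsub: "subspace N"
  proof (rule subspaceI)
    show "0 \<in> N" using f0 subspace_0[OF W(2)] by (simp add: N_def)
    show "x + y \<in> N" if "x \<in> N" "y \<in> N" for x y
      using that lin[of x y 1 1] W(2) by (auto simp: N_def subspace_add)
    show "c *\<^sub>R x \<in> N" if "x \<in> N" for x c
      using that lin[of x x c 0] W(2) by (auto simp: N_def subspace_scale)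
  qed
  have Ncl: "closed N"
    unfolding closed_sequential_limits
  proof (intro allI impI, elim conjE)
    fix x l assume x: "\<forall>n. x n \<in> N" "x ----> l"
    have l: "l \<in> W" using x W(1) by (auto simp: N_def closed_sequential_limits)
    have "\<bar>f l\<bar> <= C * norm (l - x n)" for n
    proof -
      have "f (l - x n) = f l" using fdiff[of l "x n" 1] x l by (simp add: N_def)
      then show ?thesis using bd[of "l - x n"] x l W(2) by (simp add: N_def subspace_diff)
    qed
    moreover have "(%n. C * norm (l - x n)) ----> C * norm (l - l)"
      by (intro tendsto_intros x)
    ultimately have "\<bar>f l\<bar> <= C * norm (l - l)"
      by (intro LIMSEQ_le_const) auto
    then show "l \<in> N" using l by (simp add: N_def)
  qed
  show thesis
  proof (cases "N = W")
    case True
    then show ?thesis using that[of 0] subspace_0[OF W(2)] by (auto simp: N_def)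
  next
    case False
    then obtain z0 where z0: "z0 \<in> W" "f z0 \<noteq> 0" by (auto simp: N_def)
    obtain p where p: "p \<in> N" "!!s. s \<in> N ==> (z0 - p) \<bullet> s = 0"
      using orthogonal_projection[OF Ncl Nsub] by metis
    define e where "e = z0 - p"
    have e: "e \<in> W" "f e \<noteq> 0"
      using z0 p(1) fdiff[of z0 p 1] W(2) by (auto simp: e_def N_def subspace_diff)
    have e0: "e \<noteq> 0" using e f0 by auto
    \<comment> \<open>Scaled so that \<open>w \<bullet> e = f e\<close>.\<close>
    define w where "w = (f e / (norm e)\<^sup>2) *\<^sub>R e"
    have "f z = w \<bullet> z" if z: "z \<in> W" for z
    proof -
      have "z - (f z / f e) *\<^sub>R e \<in> N"
        using z e fdiff[of z e "f z / f e"] W(2) by (simp add: N_def subspace_diff subspace_scale)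
      then have "e \<bullet> (z - (f z / f e) *\<^sub>R e) = 0" using p(2) by (simp add: e_def)
      then have "e \<bullet> z = (f z / f e) * (norm e)\<^sup>2"
        by (simp add: inner_diff_right power2_norm_eq_inner)
      then show ?thesis using e e0 by (simp add: w_def)
    qed
    moreover have "w \<in> W" using e W(2) by (simp add: w_def subspace_scale)
    ultimately show ?thesis using that by blast
  qed
qed

lemma subspace_closure:
  fixes S :: "'h::real_normed_vector set"
  assumes "subspace S" shows "subspace (closure S)"
proof (rule subspaceI)
  show "0 \<in> closure S" using assms subspace_0 closure_subset by blast
  show "x + y \<in> closure S" if xy: "x \<in> closure S" "y \<in> closure S" for x y
  proof -
    obtain X Y where "\<forall>n. X n \<in> S" "X ----> x" "\<forall>n. Y n \<in> S" "Y ----> y"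
      using xy unfolding closure_sequential by blast
    then have "\<forall>n. X n + Y n \<in> S" "(%n. X n + Y n) ----> x + y"
      using assms by (auto intro: subspace_add tendsto_add)
    then show ?thesis unfolding closure_sequential by (intro exI conjI)
  qed
  show "c *\<^sub>R x \<in> closure S" if x: "x \<in> closure S" for x c
  proof -
    obtain X where "\<forall>n. X n \<in> S" "X ----> x"
      using x unfolding closure_sequential by blast
    then have "\<forall>n. c *\<^sub>R X n \<in> S" "(%n. c *\<^sub>R X n) ----> c *\<^sub>R x"
      using assms by (auto intro: subspace_scale tendsto_intros)
    then show ?thesis unfolding closure_sequential by (intro exI conjI)
  qed
qed

text \<open>The remainder of \<open>h\<close> after projection onto the closed span lies in
  \<open>S\<close> and is orthogonal to \<open>D\<close>, so totality kills it.\<close>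

lemma in_closure_span_if_total:
  fixes S :: "'h::{real_inner,complete_space} set"
  assumes S: "subspace S" "closed S" "D \<subseteq> S" "h \<in> S"
    and total: "!!s. s \<in> S ==> (!!d. d \<in> D ==> s \<bullet> d = 0) ==> s = 0"
  shows "h \<in> closure (span D)"
proof -
  have cs: "closed (closure (span D))" "subspace (closure (span D))"
    by (auto simp: subspace_closure subspace_span)
  obtain p where p: "p \<in> closure (span D)" "!!s. s \<in> closure (span D) ==> (h - p) \<bullet> s = 0"
    using orthogonal_projection[OF cs] by metis
  have "closure (span D) \<subseteq> S"
    using S by (intro closure_minimal span_minimal) auto
  then have "h - p \<in> S" using p S by (auto intro: subspace_diff)
  moreover have "(h - p) \<bullet> d = 0" if "d \<in> D" for d
    using p(2) that closure_subset span_base by blast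
  ultimately have "h - p = 0" using total by blast
  then show ?thesis using p by simp
qed

text \<open>For a bounded family, weak convergence in the directions of \<open>S\<close> can be
  checked on a total set. Only the directions have to lie in \<open>S\<close>, not the vectors
  \<open>x i\<close>: later a velocity at time \<open>s\<close> is tested in the smaller space of an
  earlier time.\<close>

lemma weak_tendsto_if_total:
  fixes S :: "'h::{real_inner,complete_space} set" and x :: "'i => 'h"
  assumes S: "subspace S" "closed S" "D \<subseteq> S" "h \<in> S"
    and total: "!!s. s \<in> S ==> (!!d. d \<in> D ==> s \<bullet> d = 0) ==> s = 0"
    and bd: "eventually (%i. norm (x i) <= C) F"
    and conv: "!!d. d \<in> D ==> ((%i. x i \<bullet> d) \<longlongrightarrow> y \<bullet> d) F"
  shows "((%i. x i \<bullet> h) \<longlongrightarrow> y \<bullet> h) F"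
proof -
  let ?L = "{h. ((%i. x i \<bullet> h) \<longlongrightarrow> y \<bullet> h) F}"
  have "subspace ?L"
    by (rule subspaceI) (auto simp: inner_add_right intro: tendsto_add tendsto_mult_left)
  then have sp: "span D \<subseteq> ?L"
    using conv by (intro span_minimal) auto
  have hcl: "h \<in> closure (span D)"
    by (rule in_closure_span_if_total[OF S total])
  \<comment> \<open>Bounds \<open>norm (x i - y)\<close>; the summand 1 makes it positive, so that
    \<open>e / (2 * B)\<close> is a legitimate tolerance.\<close>
  define B where "B = max 0 C + norm y + 1"
  have B: "B > 0" by (simp add: B_def max_def add_nonneg_pos)
  show ?thesis
  proof (rule tendstoI)
    fix e :: real assume e: "0 < e"
    obtain d where d: "d \<in> span D" "dist d h < e / (2 * B)"
      using hcl e B unfolding closure_approachable by (metis divide_pos_pos mult_pos_pos zero_less_numeral)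
    have "((%i. x i \<bullet> d) \<longlongrightarrow> y \<bullet> d) F" using sp d by auto
    then have "eventually (%i. dist (x i \<bullet> d) (y \<bullet> d) < e/2) F" using e by (intro tendstoD) auto
    then show "eventually (%i. dist (x i \<bullet> h) (y \<bullet> h) < e) F"
      using bd
    proof eventually_elim
      case (elim i)
      have "\<bar>(x i - y) \<bullet> (h - d)\<bar> <= norm (x i - y) * norm (h - d)"
        by (rule Cauchy_Schwarz_ineq2)
      also have "\<dots> <= B * norm (h - d)"
        using norm_triangle_ineq4[of "x i" y] elim by (intro mult_right_mono) (auto simp: B_def)
      also have "\<dots> < e/2"
        using d(2) B by (simp add: dist_norm norm_minus_commute field_simps)
      finally show ?case
        using elim(1) by (simp add: dist_real_def inner_diff algebra_simps abs_if split: if_splits)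
    qed
  qed
qed

subsection \<open>Convex combinations of tails\<close>

text \<open>Convex weights carried by the indices from \<open>n\<close> to \<open>N\<close>. Since
  the n-th combination ignores all indices below \<open>n\<close>, a limit of the sequence itself
  survives the averaging.\<close>

definition tail_weights :: "nat => nat => (nat => real) => bool" where
  "tail_weights n N l \<longleftrightarrow> (\<forall>m. 0 <= l m) \<and> (\<forall>m. m < n \<or> N < m --> l m = 0) \<and> (\<Sum>m\<le>N. l m) = 1"

lemma tail_weights_sum:
  assumes "tail_weights n N l" "N <= M"
  shows "(\<Sum>m\<le>M. l m *\<^sub>R (x m :: 'h::real_vector)) = (\<Sum>m\<le>N. l m *\<^sub>R x m)"
  using assms by (intro sum.mono_neutral_right) (auto simp: tail_weights_def)

lemma tail_weights_antimono: "tail_weights n N l ==> k <= n ==> tail_weights k N l"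
  by (auto simp: tail_weights_def)

lemma tail_weights_midpoint:
  assumes "tail_weights n N l" "tail_weights n M k"
  shows "tail_weights n (max N M) (%m. (l m + k m) / 2)"
proof -
  have "(\<Sum>m\<le>max N M. l m) = 1" "(\<Sum>m\<le>max N M. k m) = 1"
    using assms tail_weights_sum[OF assms(1), of "max N M" "%_. 1::real"]
      tail_weights_sum[OF assms(2), of "max N M" "%_. 1::real"]
    by (auto simp: tail_weights_def)
  then have "(\<Sum>m\<le>max N M. (l m + k m) / 2) = 1"
    by (simp add: sum_divide_distrib[symmetric] sum.distrib)
  then show ?thesis using assms by (auto simp: tail_weights_def)
qed

lemma tail_weights_single: "tail_weights n n (%m. if m = n then 1 else 0)"
  by (auto simp: tail_weights_def)

lemma norm_convex_sum_le:
  fixes x :: "nat => 'h::real_normed_vector"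
  assumes "tail_weights n N l" "!!m. n <= m ==> norm (x m) <= C"
  shows "norm (\<Sum>m\<le>N. l m *\<^sub>R x m) <= C"
proof -
  have "norm (\<Sum>m\<le>N. l m *\<^sub>R x m) <= (\<Sum>m\<le>N. l m * C)"
  proof (rule sum_norm_le)
    fix m show "norm (l m *\<^sub>R x m) <= l m * C"
      using assms by (cases "m < n") (auto simp: tail_weights_def intro: mult_left_mono)
  qed
  also have "\<dots> = C" using assms(1) by (simp add: tail_weights_def sum_distrib_right[symmetric])
  finally show ?thesis .
qed

lemma tendsto_convex_sum:
  fixes a :: "nat => 'h::real_normed_vector"
  assumes w: "!!n. tail_weights n (N n) (l n)" and a: "a ----> L"
  shows "(%n. \<Sum>m\<le>N n. l n m *\<^sub>R a m) ----> L"
proof (rule LIMSEQ_I)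
  fix e :: real assume "0 < e"
  then obtain n0 where n0: "!!m. m \<ge> n0 ==> norm (a m - L) < e/2"
    using LIMSEQ_D[OF a, of "e/2"] by auto
  have "norm ((\<Sum>m\<le>N n. l n m *\<^sub>R a m) - L) < e" if "n \<ge> n0" for n
  proof -
    have "(\<Sum>m\<le>N n. l n m *\<^sub>R L) = L"
      using w[of n] by (simp add: tail_weights_def scaleR_sum_left[symmetric])
    then have "(\<Sum>m\<le>N n. l n m *\<^sub>R a m) - L = (\<Sum>m\<le>N n. l n m *\<^sub>R (a m - L))"
      by (simp add: scaleR_diff_right sum_subtractf)
    moreover have "norm \<dots> <= e/2"
      using that n0 by (intro norm_convex_sum_le[OF w[of n]]) (simp add: less_imp_le)
    ultimately show ?thesis using \<open>0 < e\<close> by simp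
  qed
  then show "\<exists>no. \<forall>n\<ge>no. norm ((\<Sum>m\<le>N n. l n m *\<^sub>R a m) - L) < e" by blast
qed

text \<open>Jensen's inequality for the squared norm, read off from the nonnegativity of the
  variance around the mean \<open>y\<close>.\<close>

lemma norm_sq_convex_sum_le:
  fixes x :: "nat => 'h::real_inner"
  assumes "tail_weights n N l"
  shows "(norm (\<Sum>m\<le>N. l m *\<^sub>R x m))\<^sup>2 <= (\<Sum>m\<le>N. l m * (norm (x m))\<^sup>2)"
proof -
  define y where "y = (\<Sum>m\<le>N. l m *\<^sub>R x m)"
  have "0 <= (\<Sum>m\<le>N. l m * (norm (x m - y))\<^sup>2)"
    using assms by (intro sum_nonneg) (auto simp: tail_weights_def)
  also have "\<dots> = (\<Sum>m\<le>N. l m * (norm (x m))\<^sup>2 - 2 * (l m *\<^sub>R x m \<bullet> y) + l m * (norm y)\<^sup>2)"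
    by (intro sum.cong) (auto simp: power2_norm_eq_inner inner_diff inner_commute algebra_simps)
  also have "\<dots> = (\<Sum>m\<le>N. l m * (norm (x m))\<^sup>2) - 2 * (y \<bullet> y) + (norm y)\<^sup>2"
    using assms
    by (simp add: sum.distrib sum_subtractf sum_distrib_left[symmetric] sum_distrib_right[symmetric]
        inner_sum_left[symmetric] y_def[symmetric] tail_weights_def del: inner_scaleR_left)
  finally show ?thesis by (simp add: y_def power2_norm_eq_inner)
qed

lemma convex_sum_in_subspace:
  assumes "subspace S" "tail_weights n N l" "!!m. n <= m ==> x m \<in> S"
  shows "(\<Sum>m\<le>N. l m *\<^sub>R x m) \<in> S"
proof (rule subspace_sum[OF assms(1)])
  fix m assume "m \<in> {..N}"
  show "l m *\<^sub>R x m \<in> S"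
    using assms by (cases "m < n") (auto simp: tail_weights_def subspace_0 subspace_scale)
qed

text \<open>Mazur's lemma without weak compactness: almost norm-minimal elements of the convex hulls of
  the tails form a Cauchy sequence by the parallelogram law.\<close>
lemma convergent_convex_sums:
  fixes x :: "nat => 'h::{real_inner,complete_space}"
  assumes B: "!!m. norm (x m) <= B"
  obtains N l where "!!n. tail_weights n (N n) (l n)" "convergent (%n. \<Sum>m\<le>N n. l n m *\<^sub>R x m)"
proof -
  define y where "y = (%(N, l). \<Sum>m\<le>N. l m *\<^sub>R x m)"
  define P where "P n = {(N, l). tail_weights n N l}" for n
  define A where "A n = (%p. (norm (y p))\<^sup>2) ` P n" for n
  have A: "A n \<noteq> {}" "bdd_below (A n)" for n
    using tail_weights_single by (auto simp: A_def P_def intro!: bdd_belowI[of _ 0])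
  define d where "d n = Inf (A n)" for n
  have dle: "d n <= (norm (y p))\<^sup>2" if "p \<in> P n" for n p
    unfolding d_def using A that by (intro cInf_lower) (auto simp: A_def)
  have "\<exists>p\<in>P n. (norm (y p))\<^sup>2 < d n + 1 / real (Suc n)" for n
  proof -
    have "d n < d n + 1 / real (Suc n)" by simp
    from cInf_lessD[OF A(1) this[unfolded d_def]] show ?thesis
      by (auto simp: A_def d_def)
  qed
  then obtain p where p: "!!n. p n \<in> P n" "!!n. (norm (y (p n)))\<^sup>2 < d n + 1 / real (Suc n)"
    by metis
  have Pmono: "P m \<subseteq> P n" if "n <= m" for n m
    using that tail_weights_antimono by (auto simp: P_def)
  \<comment> \<open>The hulls \<open>P n\<close> shrink, so their infima increase. Convergence of
    the infima closes the gap \<open>D - d n\<close>, which is what the parallelogram law leaves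
    over for two near-minimisers from different hulls.\<close>
  have "incseq d"
    unfolding d_def incseq_def A_def using Pmono A
    by (intro allI impI cInf_superset_mono) (auto simp: A_def)
  moreover have dB: "d n <= B\<^sup>2" for n
  proof -
    have "(n, %m. if m = n then 1 else 0) \<in> P n" by (simp add: P_def tail_weights_single)
    from dle[OF this] have "d n <= (norm (y (n, %m. if m = n then 1 else 0)))\<^sup>2" .
    also have "y (n, %m. if m = n then 1 else 0) = x n"
      by (simp add: y_def if_distrib[of "%c. c *\<^sub>R _"] cong: if_cong)
    also have "(norm (x n))\<^sup>2 <= B\<^sup>2" using B by (intro power_mono) auto
    finally show ?thesis .
  qed
  ultimately obtain D where D: "d ----> D" "!!n. d n <= D"
    using incseq_convergent[of d "B\<^sup>2"] by blast
  have "Cauchy (%n. y (p n))"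
  proof (rule Cauchy_if_dist_sq_le)
    have "(%n. 2 * (D - d n) + 4 * inverse (real (Suc n))) ----> 2 * (D - D) + 4 * 0"
      by (intro tendsto_intros D LIMSEQ_inverse_real_of_nat)
    then show "(%n. 2 * (D - d n) + 4 * (1 / real (Suc n))) ----> 0"
      by (simp add: inverse_eq_divide)
    fix n m :: nat assume nm: "n <= m"
    obtain N l where pn: "p n = (N, l)" by force
    obtain M k where pm: "p m = (M, k)" by force
    have tw: "tail_weights n N l" "tail_weights n M k"
      using p(1)[of n] p(1)[of m] pn pm Pmono[OF nm] by (auto simp: P_def)
    have "(1/2) *\<^sub>R (y (p n) + y (p m)) = y (max N M, %i. (l i + k i) / 2)"
      unfolding pn pm y_def prod.case
      unfolding tail_weights_sum[OF tw(1), of "max N M", symmetric, simplified]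
        tail_weights_sum[OF tw(2), of "max N M", symmetric, simplified]
      by (simp add: sum.distrib[symmetric] scaleR_sum_right scaleR_add_left[symmetric] add_divide_distrib
          scaleR_add_right)
    moreover have "(max N M, %i. (l i + k i) / 2) \<in> P n"
      using tail_weights_midpoint[OF tw] by (simp add: P_def)
    ultimately have "d n <= (norm ((1/2) *\<^sub>R (y (p n) + y (p m))))\<^sup>2" using dle by metis
    moreover have "1 / real (Suc m) <= 1 / real (Suc n)"
      using nm by (simp add: frac_le)
    ultimately show "(norm (y (p n) - y (p m)))\<^sup>2 <= 2 * (D - d n) + 4 * (1 / real (Suc n))"
      using norm_diff_sq_midpoint[of "y (p n)" "y (p m)"] p(2)[of n] p(2)[of m] D(2)[of m] by argo
  qed
  then have "convergent (%n. y (p n))" by (rule Cauchy_convergent)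
  then show thesis
    using that[of "%n. fst (p n)" "%n. snd (p n)"] p(1) by (auto simp: P_def y_def case_prod_beta)
qed

section \<open>The Hilbert space of square integrable functions\<close>

text \<open>Borel measurability and \<open>lborel\<close> are chosen because \<open>lborel\<close>
  on a product is the product measure, so that Fubini applies to slices in time; its completion is
  not a product measure.\<close>

definition sqint :: "('a::euclidean_space => 'b::euclidean_space) => bool" where
  "sqint f \<longleftrightarrow> f \<in> borel_measurable borel \<and> integrable lborel (%x. (norm (f x))\<^sup>2)"

lemma sqint_measurable[measurable_dest]: "sqint f ==> f \<in> borel_measurable borel"
  by (simp add: sqint_def)

lemma sqint_iff: "sqint f \<longleftrightarrow> f \<in> borel_measurable borel \<and> (\<integral>\<^sup>+x. ennreal ((norm (f x))\<^sup>2) \<partial>lborel) < \<infinity>"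
  by (auto simp: sqint_def integrable_iff_bounded)

lemma sqint_inner: assumes "sqint f" "sqint g" shows "integrable lborel (%x. f x \<bullet> g x)"
proof (rule Bochner_Integration.integrable_bound)
  show "integrable lborel (%x. (norm (f x))\<^sup>2 + (norm (g x))\<^sup>2)"
    using assms by (auto simp: sqint_def)
  show "(%x. f x \<bullet> g x) \<in> borel_measurable lborel"
    using assms by (auto simp: sqint_def)
  have "\<bar>f x \<bullet> g x\<bar> <= (norm (f x))\<^sup>2 + (norm (g x))\<^sup>2" for x
    using Cauchy_Schwarz_ineq2[of "f x" "g x"] sum_squares_bound[of "norm (f x)" "norm (g x)"]
      mult_nonneg_nonneg[OF norm_ge_zero[of "f x"] norm_ge_zero[of "g x"]] by linarith
  then show "AE x in lborel. norm (f x \<bullet> g x) <= norm ((norm (f x))\<^sup>2 + (norm (g x))\<^sup>2)"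
    by simp
qed

lemma sqint_add: assumes "sqint f" "sqint g" shows "sqint (%x. f x + g x)"
proof -
  have "(norm (f x + g x))\<^sup>2 = (norm (f x))\<^sup>2 + (norm (g x))\<^sup>2 + 2 * (f x \<bullet> g x)" for x
    by (simp add: power2_norm_eq_inner inner_add inner_commute)
  then show ?thesis using assms sqint_inner[OF assms] by (auto simp: sqint_def)
qed

lemma sqint_scaleR: assumes "sqint f" shows "sqint (%x. c *\<^sub>R f x)"
  using assms by (auto simp: sqint_def power_mult_distrib)

lemma sqint_uminus: assumes "sqint f" shows "sqint (%x. - f x)"
  using assms by (auto simp: sqint_def)

lemma sqint_diff: assumes "sqint f" "sqint g" shows "sqint (%x. f x - g x)"
  using sqint_add[OF assms(1) sqint_uminus[OF assms(2)]] by simp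

lemma sqint_zero: "sqint (%x. 0)"
  by (simp add: sqint_def)

definition l2_rel :: "('a::euclidean_space => 'b::euclidean_space) => ('a => 'b) => bool" where
  "l2_rel f g \<longleftrightarrow> sqint f \<and> sqint g \<and> (AE x in lborel. f x = g x)"

lemma part_equivp_l2_rel: "part_equivp l2_rel"
proof (rule part_equivpI)
  show "\<exists>x. l2_rel x x" using sqint_zero by (auto simp: l2_rel_def)
  show "symp l2_rel"
  proof (rule sympI)
    fix x y :: "'c => 'd" assume *: "l2_rel x y"
    then have "AE z in lborel. y z = x z" by (auto simp: l2_rel_def)
    then show "l2_rel y x" using * by (auto simp: l2_rel_def)
  qed
  show "transp l2_rel"
  proof (rule transpI)
    fix x y z :: "'c => 'd" assume *: "l2_rel x y" "l2_rel y z"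
    then have "AE t in lborel. x t = y t" "AE t in lborel. y t = z t" by (auto simp: l2_rel_def)
    then have "AE t in lborel. x t = z t" by eventually_elim simp
    then show "l2_rel x z" using * by (auto simp: l2_rel_def)
  qed
qed

\<comment> \<open>The classes of functions on the whole space form one type, so that the Hilbert
  space lemmas apply through type classes. Domains will enter as subspaces of this type, never as
  types or carriers of their own.\<close>
quotient_type (overloaded) ('a, 'b) l2 = "'a::euclidean_space => 'b::euclidean_space" / partial: l2_rel
  by (rule part_equivp_l2_rel)

lemma sqint_rep: "sqint (rep_l2 x)"
  using Quotient3_rep_reflp[OF Quotient3_l2] by (auto simp: l2_rel_def)

lemma abs_rep_l2: "abs_l2 (rep_l2 x) = x"
  by (rule Quotient3_abs_rep[OF Quotient3_l2])

lemma abs_l2_eq_iff: "sqint f ==> sqint g ==> abs_l2 f = abs_l2 g \<longleftrightarrow> (AE x in lborel. f x = g x)"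
  using Quotient3_rel[OF Quotient3_l2, of f g] by (auto simp: l2_rel_def)

lemma rep_abs_l2: "sqint f ==> AE x in lborel. rep_l2 (abs_l2 f) x = f x"
  using abs_l2_eq_iff[OF sqint_rep, of f "abs_l2 f"] abs_rep_l2[of "abs_l2 f"] by simp

instantiation l2 :: (euclidean_space, euclidean_space) real_inner
begin

lift_definition zero_l2 :: "('a, 'b) l2" is "%x. 0"
  by (simp add: l2_rel_def sqint_zero)
lift_definition plus_l2 :: "('a, 'b) l2 => ('a, 'b) l2 => ('a, 'b) l2" is "%f g x. f x + g x"
  by (auto simp: l2_rel_def sqint_add elim: AE_mp)
lift_definition uminus_l2 :: "('a, 'b) l2 => ('a, 'b) l2" is "%f x. - f x"
  by (auto simp: l2_rel_def sqint_uminus)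
lift_definition minus_l2 :: "('a, 'b) l2 => ('a, 'b) l2 => ('a, 'b) l2" is "%f g x. f x - g x"
  by (auto simp: l2_rel_def sqint_diff elim: AE_mp)
lift_definition scaleR_l2 :: "real => ('a, 'b) l2 => ('a, 'b) l2" is "%c f x. c *\<^sub>R f x"
  by (auto simp: l2_rel_def sqint_scaleR elim: AE_mp)
lift_definition inner_l2 :: "('a, 'b) l2 => ('a, 'b) l2 => real" is "%f g. \<integral>x. f x \<bullet> g x \<partial>lborel"
proof -
  fix f g h k :: "'a => 'b" assume *: "l2_rel f g" "l2_rel h k"
  then have "AE x in lborel. f x = g x" "AE x in lborel. h x = k x" by (auto simp: l2_rel_def)
  then have "AE x in lborel. f x \<bullet> h x = g x \<bullet> k x" by eventually_elim simp
  then show "(\<integral>x. f x \<bullet> h x \<partial>lborel) = (\<integral>x. g x \<bullet> k x \<partial>lborel)"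
    using * by (intro integral_cong_AE) (auto simp: l2_rel_def sqint_def)
qed

definition norm_l2 :: "('a, 'b) l2 => real" where "norm_l2 x = sqrt (inner x x)"
definition sgn_l2 :: "('a, 'b) l2 => ('a, 'b) l2" where "sgn_l2 x = scaleR (inverse (norm x)) x"
definition dist_l2 :: "('a, 'b) l2 => ('a, 'b) l2 => real" where "dist_l2 x y = norm (x - y)"
definition uniformity_l2 :: "(('a, 'b) l2 \<times> ('a, 'b) l2) filter" where
  "uniformity_l2 = (INF e\<in>{0<..}. principal {(x, y). dist x y < e})"
definition open_l2 :: "('a, 'b) l2 set => bool" where
  "open_l2 U = (\<forall>x\<in>U. eventually (%(x', y). x' = x --> y \<in> U) uniformity)"

instance
proof
  fix x y z :: "('a, 'b) l2" and a b r :: real and U :: "('a, 'b) l2 set"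
  show "x + y + z = x + (y + z)" by transfer (auto simp: l2_rel_def sqint_add add.assoc)
  show "x + y = y + x" by transfer (auto simp: l2_rel_def sqint_add add.commute)
  show "0 + x = x" by transfer (auto simp: l2_rel_def sqint_def)
  show "- x + x = 0" by transfer (auto simp: l2_rel_def sqint_def)
  show "x - y = x + - y" by transfer (auto simp: l2_rel_def sqint_diff)
  show "a *\<^sub>R (x + y) = a *\<^sub>R x + a *\<^sub>R y"
    by transfer (auto simp: l2_rel_def scaleR_add_right intro!: sqint_add sqint_scaleR)
  show "(a + b) *\<^sub>R x = a *\<^sub>R x + b *\<^sub>R x"
    by transfer (auto simp: l2_rel_def scaleR_add_left intro!: sqint_add sqint_scaleR)
  show "a *\<^sub>R b *\<^sub>R x = (a * b) *\<^sub>R x"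
    by transfer (auto simp: l2_rel_def intro!: sqint_scaleR)
  show "1 *\<^sub>R x = x" by transfer (auto simp: l2_rel_def)
  show "dist x y = norm (x - y)" by (simp add: dist_l2_def)
  show "sgn x = scaleR (inverse (norm x)) x" by (simp add: sgn_l2_def)
  show "uniformity = (INF e\<in>{0<..}. principal {(x, y::('a,'b) l2). dist x y < e})"
    by (simp add: uniformity_l2_def)
  show "open U = (\<forall>x\<in>U. \<forall>\<^sub>F (x', y) in uniformity. x' = x --> y \<in> U)"
    by (simp add: open_l2_def)
  show "inner x y = inner y x" by transfer (simp add: inner_commute)
  show "inner (x + y) z = inner x z + inner y z"
    by transfer (simp add: l2_rel_def inner_add_left sqint_inner)
  show "inner (r *\<^sub>R x) y = r * inner x y"
    by transfer (simp add: l2_rel_def)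
  show "0 <= inner x x" by transfer simp
  show "inner x x = 0 \<longleftrightarrow> x = 0"
  proof transfer
    fix f :: "'a => 'b" assume "l2_rel f f"
    then have f: "sqint f" by (simp add: l2_rel_def)
    have "(\<integral>x. f x \<bullet> f x \<partial>lborel) = 0 \<longleftrightarrow> (AE x in lborel. f x \<bullet> f x = 0)"
      using sqint_inner[OF f f] by (intro integral_nonneg_eq_0_iff_AE) auto
    then show "(\<integral>x. f x \<bullet> f x \<partial>lborel) = 0 \<longleftrightarrow> l2_rel f (%x. 0)"
      using f by (simp add: l2_rel_def sqint_zero)
  qed
  show "norm x = sqrt (inner x x)" by (simp add: norm_l2_def)
qed

end

lemma abs_l2_add: "sqint f ==> sqint g ==> abs_l2 (%x. f x + g x) = abs_l2 f + abs_l2 g"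
  by (simp add: plus_l2.abs_eq l2_rel_def)

lemma abs_l2_diff: "sqint f ==> sqint g ==> abs_l2 (%x. f x - g x) = abs_l2 f - abs_l2 g"
  by (simp add: minus_l2.abs_eq l2_rel_def)

lemma abs_l2_scaleR: "sqint f ==> abs_l2 (%x. c *\<^sub>R f x) = c *\<^sub>R abs_l2 f"
  by (simp add: scaleR_l2.abs_eq l2_rel_def)

lemma abs_l2_zero: "abs_l2 (%x. 0) = 0"
  by (simp add: zero_l2_def)

lemma sqint_sum: "(!!i. i \<in> I ==> sqint (f i)) ==> sqint (%x. \<Sum>i\<in>I. f i x)"
  by (induction I rule: infinite_finite_induct) (auto simp: sqint_zero sqint_add)

lemma abs_l2_sum: "(!!i. i \<in> I ==> sqint (f i)) ==> abs_l2 (%x. \<Sum>i\<in>I. f i x) = (\<Sum>i\<in>I. abs_l2 (f i))"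
  by (induction I rule: infinite_finite_induct) (auto simp: abs_l2_zero abs_l2_add sqint_sum)

lemma inner_abs_l2: "sqint f ==> sqint g ==> abs_l2 f \<bullet> abs_l2 g = (\<integral>x. f x \<bullet> g x \<partial>lborel)"
  by (simp add: inner_l2.abs_eq l2_rel_def)

lemma norm_abs_l2_sq: "sqint f ==> (norm (abs_l2 f))\<^sup>2 = (\<integral>x. (norm (f x))\<^sup>2 \<partial>lborel)"
  by (simp add: power2_norm_eq_inner inner_abs_l2)

lemma nn_integral_norm_abs_l2:
  "sqint f ==> (\<integral>\<^sup>+x. ennreal ((norm (f x))\<^sup>2) \<partial>lborel) = ennreal ((norm (abs_l2 f))\<^sup>2)"
  by (simp add: norm_abs_l2_sq nn_integral_eq_integral sqint_def)

lemma Cauchy_fast_subseq: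
  fixes X :: "nat => 'h::real_normed_vector"
  assumes "Cauchy X"
  obtains r :: "nat => nat" where "strict_mono r" "!!n k. r n <= k ==> norm (X k - X (r n)) < (1/2) ^ n"
proof -
  have "\<exists>M. \<forall>k\<ge>M. \<forall>j\<ge>M. norm (X k - X j) < (1/2) ^ n" for n :: nat
    using CauchyD[OF assms, of "(1/2) ^ n"] by auto
  then obtain M where M: "!!n k j. k \<ge> M n ==> j \<ge> M n ==> norm (X k - X j) < (1/2) ^ n"
    by metis
  \<comment> \<open>The sum makes \<open>r n\<close> at least \<open>M n\<close>, the summand
    \<open>n\<close> makes \<open>r\<close> strictly increasing.\<close>
  define r where "r n = n + (\<Sum>i\<le>n. M i)" for n
  have "strict_mono r" by (auto simp: strict_mono_Suc_iff r_def)
  moreover have "M n <= r n" for n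
    unfolding r_def using member_le_sum[of n "{..n}" M] by simp
  ultimately show thesis using that M by (meson order_refl order_trans)
qed

lemma quarter_power: "(1/4 :: real) ^ n = ((1/2) ^ n)\<^sup>2"
  by (simp add: power2_eq_square power_mult_distrib[symmetric])

text \<open>The Riesz-Fischer theorem. Along a fast subsequence the squared increments have integral
  at most \<open>(1/4) ^ n\<close>, so even with weights \<open>2 ^ n\<close> their sum is finite
  almost everywhere; that gives a pointwise limit, and Fatou's lemma shows that it is the limit in
  norm.\<close>

instance l2 :: (euclidean_space, euclidean_space) complete_space
proof
  fix X :: "nat => ('a, 'b) l2" assume "Cauchy X"
  then obtain r where r: "strict_mono r" "!!n k. r n <= k ==> norm (X k - X (r n)) < (1/2) ^ n"
    using Cauchy_fast_subseq by blast
  define h where "h n = rep_l2 (X (r n))" for n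
  have h: "sqint (h n)" "abs_l2 (h n) = X (r n)" for n by (auto simp: h_def sqint_rep abs_rep_l2)
  have [measurable]: "h n \<in> borel_measurable borel" for n using h by (simp add: sqint_def)
  have hd: "(\<integral>\<^sup>+x. ennreal ((norm (h m x - h n x))\<^sup>2) \<partial>lborel) = ennreal ((norm (X (r m) - X (r n)))\<^sup>2)" for m n
    using nn_integral_norm_abs_l2[OF sqint_diff[OF h(1) h(1)]] h by (simp add: abs_l2_diff)
  have dle: "(norm (X (r m) - X (r n)))\<^sup>2 <= (1/4) ^ n" if "n <= m" for m n
  proof -
    have "norm (X (r m) - X (r n)) <= (1/2) ^ n"
      using r(2)[of n "r m"] strict_mono_less_eq[OF r(1), of n m] that by simp
    then have "(norm (X (r m) - X (r n)))\<^sup>2 <= ((1/2) ^ n)\<^sup>2" by (intro power_mono) auto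
    then show ?thesis by (simp only: quarter_power)
  qed
  have "(\<integral>\<^sup>+x. (\<Sum>n. ennreal (2 ^ n * (norm (h (Suc n) x - h n x))\<^sup>2)) \<partial>lborel)
      = (\<Sum>n. \<integral>\<^sup>+x. ennreal (2 ^ n * (norm (h (Suc n) x - h n x))\<^sup>2) \<partial>lborel)"
    by (intro nn_integral_suminf) measurable
  also have "\<dots> = (\<Sum>n. ennreal (2 ^ n * (norm (X (r (Suc n)) - X (r n)))\<^sup>2))"
    by (intro suminf_cong) (simp add: ennreal_mult nn_integral_cmult hd)
  also have "\<dots> <= (\<Sum>n. ennreal ((1/2) ^ n))"
  proof (intro suminf_le ennreal_leI)
    fix n :: nat
    have "2 ^ n * (norm (X (r (Suc n)) - X (r n)))\<^sup>2 <= 2 ^ n * (1/4) ^ n"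
      using dle[of n "Suc n"] by (intro mult_left_mono) auto
    then show "2 ^ n * (norm (X (r (Suc n)) - X (r n)))\<^sup>2 <= (1/2) ^ n"
      by (simp add: power_mult_distrib[symmetric])
  qed auto
  also have "\<dots> = ennreal (\<Sum>n. (1/2) ^ n)"
    by (intro suminf_ennreal2) (auto intro: summable_geometric)
  finally have "(\<integral>\<^sup>+x. (\<Sum>n. ennreal (2 ^ n * (norm (h (Suc n) x - h n x))\<^sup>2)) \<partial>lborel) \<noteq> \<infinity>"
    by (auto simp: top_unique)
  then have "AE x in lborel. (\<Sum>n. ennreal (2 ^ n * (norm (h (Suc n) x - h n x))\<^sup>2)) \<noteq> \<infinity>"
    by (intro nn_integral_noteq_infinite) auto
  then have conv: "AE x in lborel. convergent (%n. h n x)"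
  proof eventually_elim
    case (elim x)
    have sm: "summable (%n. 2 ^ n * (norm (h (Suc n) x - h n x))\<^sup>2)"
      using elim by (intro summable_suminf_not_top) (auto simp: top_unique)
    have "summable (%n. h (Suc n) x - h n x)"
    proof (rule summable_comparison_test')
      show "summable (%n. (1/2) ^ n + 2 ^ n * (norm (h (Suc n) x - h n x))\<^sup>2)"
        using sm by (intro summable_add summable_geometric) auto
      fix n :: nat assume "0 <= n"
      define a where "a = norm (h (Suc n) x - h n x)"
      \<comment> \<open>Passes from squares to the increments themselves: an increment is either
        below \<open>(1/2) ^ n\<close> or dominated by its weighted square, and both bounds are
        summable.\<close>
      have "a <= (1/2) ^ n + 2 ^ n * a\<^sup>2"
      proof (cases "a <= (1/2) ^ n")
        case False
        then have "(1/2) ^ n * a <= a * a" by (intro mult_right_mono) (auto simp: a_def)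
        then have "2 ^ n * ((1/2) ^ n * a) <= 2 ^ n * (a * a)" by (intro mult_left_mono) auto
        then have "a <= 2 ^ n * a\<^sup>2"
          by (simp add: power2_eq_square mult.assoc[symmetric] power_mult_distrib[symmetric])
        then show ?thesis by (simp add: add_increasing)
      qed (simp add: add_increasing2)
      then show "norm (h (Suc n) x - h n x) <= (1/2) ^ n + 2 ^ n * (norm (h (Suc n) x - h n x))\<^sup>2"
        by (simp add: a_def)
    qed
    then have "convergent (%n. \<Sum>i<n. h (Suc i) x - h i x)"
      by (simp add: summable_iff_convergent)
    moreover have "(%n. h n x) = (%n. (\<Sum>i<n. h (Suc i) x - h i x) + h 0 x)"
      by (simp add: sum_lessThan_telescope[of "%n. h n x"])
    ultimately show ?case by (simp only: convergent_add_const_right_iff)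
  qed
  define g where "g x = lim (%n. h n x)" for x
  have [measurable]: "g \<in> borel_measurable borel" unfolding g_def by measurable
  have lim: "AE x in lborel. (%n. h n x) ----> g x"
    using conv by eventually_elim (simp add: g_def convergent_LIMSEQ_iff)
  \<comment> \<open>Fatou's lemma in \<open>m\<close> with \<open>n\<close> fixed.\<close>
  have gle: "(\<integral>\<^sup>+x. ennreal ((norm (g x - h n x))\<^sup>2) \<partial>lborel) <= ennreal ((1/4) ^ n)" for n
  proof -
    have "(\<integral>\<^sup>+x. ennreal ((norm (g x - h n x))\<^sup>2) \<partial>lborel)
        = (\<integral>\<^sup>+x. liminf (%m. ennreal ((norm (h m x - h n x))\<^sup>2)) \<partial>lborel)"
    proof (rule nn_integral_cong_AE)
      show "AE x in lborel. ennreal ((norm (g x - h n x))\<^sup>2) = liminf (%m. ennreal ((norm (h m x - h n x))\<^sup>2))"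
        using lim
      proof eventually_elim
        case (elim x)
        have "(%m. ennreal ((norm (h m x - h n x))\<^sup>2)) ----> ennreal ((norm (g x - h n x))\<^sup>2)"
          by (intro tendsto_intros elim tendsto_ennrealI)
        from lim_imp_Liminf[OF sequentially_bot this] show ?case by simp
      qed
    qed
    also have "\<dots> <= liminf (%m. \<integral>\<^sup>+x. ennreal ((norm (h m x - h n x))\<^sup>2) \<partial>lborel)"
      by (intro nn_integral_liminf) auto
    also have "\<dots> <= ennreal ((1/4) ^ n)"
      unfolding hd
    proof (rule Liminf_le)
      show "\<forall>\<^sub>F m in sequentially. ennreal ((norm (X (r m) - X (r n)))\<^sup>2) <= ennreal ((1/4) ^ n)"
        unfolding eventually_sequentially using dle by (intro exI[of _ n] allI impI ennreal_leI) auto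
    qed simp
    finally show ?thesis .
  qed
  have d: "sqint (%x. g x - h n x)" for n
    using gle[of n] by (auto simp: sqint_iff intro: order.strict_trans1)
  have g: "sqint g" using sqint_add[OF d[of 0] h(1)[of 0]] by simp
  have "(norm (abs_l2 g - X (r n)))\<^sup>2 <= (1/4) ^ n" for n
    using gle[of n] nn_integral_norm_abs_l2[OF d[of n]] h g by (simp add: abs_l2_diff)
  then have gn: "(norm (abs_l2 g - X (r n)))\<^sup>2 <= ((1/2) ^ n)\<^sup>2" for n
    by (simp only: quarter_power)
  have nle: "norm (abs_l2 g - X (r n)) <= (1/2) ^ n" for n
    by (rule power2_le_imp_le[OF gn]) simp
  have "X ----> abs_l2 g"
  proof (rule LIMSEQ_I)
    fix e :: real assume "0 < e"
    then obtain n where n: "(1/2) ^ n < e/2" using real_arch_pow_inv[of "e/2" "1/2"] by auto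
    have "norm (X k - abs_l2 g) < e" if "k \<ge> r n" for k
    proof -
      have "norm (X k - abs_l2 g) <= norm (X k - X (r n)) + norm (X (r n) - abs_l2 g)"
        using norm_triangle_ineq[of "X k - X (r n)" "X (r n) - abs_l2 g"] by simp
      then show ?thesis using n r(2)[OF that] nle[of n] by (simp add: norm_minus_commute)
    qed
    then show "\<exists>no. \<forall>k\<ge>no. norm (X k - abs_l2 g) < e" by blast
  qed
  then show "convergent X" by (auto simp: convergent_def)
qed

subsection \<open>Slices of functions of time and space\<close>

text \<open>\<open>abs_l2\<close> of a function that is not square integrable is an unspecified
  element, so statements about slices of general functions hold for almost every time only.\<close>

definition slice :: "(real \<times> 'x => 'b) => real => ('x::euclidean_space, 'b::euclidean_space) l2" where
  "slice R t = abs_l2 (%x. R (t, x))"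

lemma AE_lborel_pair:
  fixes P :: "real \<times> 'x::euclidean_space => bool"
  assumes "AE p in lborel. P p"
  shows "AE t in lborel. AE x in lborel. P (t, x)"
proof (rule lborel_pair.AE_pair)
  show "AE p in lborel \<Otimes>\<^sub>M lborel. P p" unfolding lborel_prod by (rule assms)
qed

lemma slice_measurable:
  assumes "R \<in> borel_measurable borel" shows "(%x. R (t, x)) \<in> borel_measurable borel"
proof -
  have "(%x. (t, x)) \<in> borel \<rightarrow>\<^sub>M borel"
    by (intro borel_measurable_continuous_onI continuous_intros)
  from measurable_compose[OF this assms] show ?thesis .
qed

lemma
  fixes R :: "real \<times> 'x::euclidean_space => 'b::euclidean_space"
  assumes R: "sqint R"
  shows AE_sqint_slice: "AE t in lborel. sqint (%x. R (t, x))"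
    and integrable_slice: "integrable lborel (%t. \<integral>x. (norm (R (t, x)))\<^sup>2 \<partial>lborel)"
    and integral_slice: "(\<integral>t. \<integral>x. (norm (R (t, x)))\<^sup>2 \<partial>lborel \<partial>lborel) = (\<integral>p. (norm (R p))\<^sup>2 \<partial>lborel)"
proof -
  have I: "integrable (lborel \<Otimes>\<^sub>M lborel) (%p. (norm (R p))\<^sup>2)"
    using R by (simp add: lborel_prod sqint_def)
  have "AE t in lborel. integrable lborel (%x. (norm (R (t, x)))\<^sup>2)"
    using lborel_pair.AE_integrable_fst'[OF I] by simp
  then show "AE t in lborel. sqint (%x. R (t, x))"
    by eventually_elim (use R in \<open>auto simp: sqint_def intro: slice_measurable\<close>)
  show "integrable lborel (%t. \<integral>x. (norm (R (t, x)))\<^sup>2 \<partial>lborel)"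
    using lborel_pair.integrable_fst'[OF I] by simp
  show "(\<integral>t. \<integral>x. (norm (R (t, x)))\<^sup>2 \<partial>lborel \<partial>lborel) = (\<integral>p. (norm (R p))\<^sup>2 \<partial>lborel)"
    using lborel_pair.integral_fst'[OF I] by (simp add: lborel_prod)
qed

lemma slice_norm_measurable:
  fixes R :: "real \<times> 'x::euclidean_space => 'b::euclidean_space"
  assumes "sqint R"
  shows "AE t in lborel. (norm (slice R t))\<^sup>2 = (\<integral>x. (norm (R (t, x)))\<^sup>2 \<partial>lborel)"
  using AE_sqint_slice[OF assms] by eventually_elim (simp add: slice_def norm_abs_l2_sq)

text \<open>Curves in the Hilbert space are measured through their scalar products with fixed
  vectors. Measurability is with respect to \<open>lebesgue\<close>, because the slices are under
  control only up to a null set of times.\<close>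

lemma slice_inner_measurable:
  fixes R :: "real \<times> 'x::euclidean_space => 'b::euclidean_space"
  assumes "sqint R"
  shows "(%t. slice R t \<bullet> h) \<in> borel_measurable lebesgue"
proof -
  have [measurable]: "R \<in> borel_measurable borel" "rep_l2 h \<in> borel_measurable borel"
    using assms sqint_rep by (auto simp: sqint_def)
  have "(%t. \<integral>x. R (t, x) \<bullet> rep_l2 h x \<partial>lborel) \<in> borel_measurable lborel"
  proof (rule lborel.borel_measurable_lebesgue_integral)
    have "R \<in> borel_measurable (lborel \<Otimes>\<^sub>M lborel)" by (simp add: lborel_prod)
    then show "(%(t, x). R (t, x) \<bullet> rep_l2 h x) \<in> borel_measurable (lborel \<Otimes>\<^sub>M lborel)"
      by (simp add: case_prod_beta')
  qed
  then have m: "(%t. \<integral>x. R (t, x) \<bullet> rep_l2 h x \<partial>lborel) \<in> borel_measurable lebesgue"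
    by (rule measurable_completion)
  have "AE t in lebesgue. slice R t \<bullet> h = (\<integral>x. R (t, x) \<bullet> rep_l2 h x \<partial>lborel)"
    unfolding AE_completion_iff using AE_sqint_slice[OF assms]
  proof eventually_elim
    case (elim t)
    then show ?case
      using inner_abs_l2[OF elim sqint_rep[of h]] by (simp add: slice_def abs_rep_l2)
  qed
  then have "AE t in lebesgue. (\<integral>x. R (t, x) \<bullet> rep_l2 h x \<partial>lborel) = slice R t \<bullet> h"
    by eventually_elim simp
  then show ?thesis by (rule borel_measurable_AE[OF m])
qed

section \<open>Piecewise constant functions of time and their strongly convergent convex
  combinations\<close>

definition step_index :: "real => real => nat" where
  "step_index \<tau> t = nat \<lfloor>t / \<tau>\<rfloor>"

lemma step_index_measurable[measurable]: "step_index \<tau> \<in> borel \<rightarrow>\<^sub>M count_space UNIV"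
  unfolding step_index_def by measurable

text \<open>Turns a piecewise constant curve into a function on space-time, so that all interpolants
  become vectors of one Hilbert space. One representative is taken for each grid index; being
  countably many, they give a jointly Borel measurable function.\<close>

definition step_fun :: "(nat => ('x, 'b) l2) => real => real => real \<times> 'x::euclidean_space => 'b::euclidean_space" where
  "step_fun c \<tau> L p = indicator {0..<L} (fst p) *\<^sub>R rep_l2 (c (step_index \<tau> (fst p))) (snd p)"

lemma step_fun_slice:
  "sqint (%x. step_fun c \<tau> L (t, x))"
  "slice (step_fun c \<tau> L) t = indicator {0..<L} t *\<^sub>R c (step_index \<tau> t)"
  by (auto simp: step_fun_def slice_def abs_l2_scaleR abs_rep_l2 sqint_rep sqint_scaleR)

lemma sqint_step_fun:
  fixes c :: "nat => ('x::euclidean_space, 'b::euclidean_space) l2"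
  assumes L: "L \<ge> 0" and C: "!!t. t \<in> {0..<L} ==> norm (c (step_index \<tau> t)) <= C"
  shows "sqint (step_fun c \<tau> L)" "(norm (abs_l2 (step_fun c \<tau> L)))\<^sup>2 <= L * C\<^sup>2"
proof -
  have [measurable]: "(%p :: real \<times> 'x. rep_l2 (c k) (snd p)) \<in> borel_measurable borel" for k
    using sqint_rep[of "c k"] by (auto simp: sqint_def borel_prod[symmetric])
  have "(%p :: real \<times> 'x. step_index \<tau> (fst p)) \<in> borel \<rightarrow>\<^sub>M count_space UNIV"
    unfolding borel_prod[symmetric] by measurable
  from measurable_compose_countable[OF _ this, of "%k p. rep_l2 (c k) (snd p)"]
  have [measurable]: "(%p :: real \<times> 'x. rep_l2 (c (step_index \<tau> (fst p))) (snd p)) \<in> borel_measurable borel"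
    by simp
  have "(%p :: real \<times> 'x. indicator {0..<L} (fst p) :: real) \<in> borel_measurable borel"
    unfolding borel_prod[symmetric] by measurable
  then have m[measurable]: "step_fun c \<tau> L \<in> borel_measurable borel"
    unfolding step_fun_def by measurable
  have "(\<integral>\<^sup>+p. ennreal ((norm (step_fun c \<tau> L p))\<^sup>2) \<partial>lborel)
      = (\<integral>\<^sup>+t. \<integral>\<^sup>+x. ennreal ((norm (step_fun c \<tau> L (t, x)))\<^sup>2) \<partial>lborel \<partial>lborel)"
  proof (subst lborel.nn_integral_fst)
    show "(%p. ennreal ((norm (step_fun c \<tau> L p))\<^sup>2)) \<in> borel_measurable (lborel \<Otimes>\<^sub>M lborel)"
      by (simp add: lborel_prod)
  qed (simp add: lborel_prod)
  also have "\<dots> = (\<integral>\<^sup>+t. ennreal ((norm (indicator {0..<L} t *\<^sub>R c (step_index \<tau> t)))\<^sup>2) \<partial>lborel)"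
    using nn_integral_norm_abs_l2[OF step_fun_slice(1)[of c \<tau> L]]
    by (simp add: step_fun_slice(2)[unfolded slice_def])
  also have "\<dots> <= (\<integral>\<^sup>+t. ennreal (C\<^sup>2) * indicator {0..<L} t \<partial>lborel)"
    using C by (intro nn_integral_mono) (auto simp: indicator_def intro!: ennreal_leI power_mono)
  also have "\<dots> = ennreal (L * C\<^sup>2)"
    using L by (subst nn_integral_cmult) (auto simp: ennreal_mult mult.commute)
  finally have le: "(\<integral>\<^sup>+p. ennreal ((norm (step_fun c \<tau> L p))\<^sup>2) \<partial>lborel) <= ennreal (L * C\<^sup>2)" .
  then show s: "sqint (step_fun c \<tau> L)"
    using m by (auto simp: sqint_iff intro: order.strict_trans1)
  show "(norm (abs_l2 (step_fun c \<tau> L)))\<^sup>2 <= L * C\<^sup>2"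
    using le L unfolding nn_integral_norm_abs_l2[OF s] by simp
qed

lemma slice_tendsto_L2:
  fixes R :: "nat => real \<times> 'x::euclidean_space => 'b::euclidean_space"
  assumes R: "!!n. sqint (R n)" and lim: "(%n. abs_l2 (R n)) ----> Z"
  shows "integrable lborel (%t. \<integral>x. (norm (R n (t, x) - rep_l2 Z (t, x)))\<^sup>2 \<partial>lborel)"
    and "(%n. \<integral>t. \<integral>x. (norm (R n (t, x) - rep_l2 Z (t, x)))\<^sup>2 \<partial>lborel \<partial>lborel) ----> 0"
    and "AE t in lborel. \<forall>n. (\<integral>x. (norm (R n (t, x) - rep_l2 Z (t, x)))\<^sup>2 \<partial>lborel)
        = (norm (slice (R n) t - slice (rep_l2 Z) t))\<^sup>2"
proof -
  have s: "sqint (%p. R n p - rep_l2 Z p)" for n by (intro sqint_diff R sqint_rep)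
  show "integrable lborel (%t. \<integral>x. (norm (R n (t, x) - rep_l2 Z (t, x)))\<^sup>2 \<partial>lborel)"
    using integrable_slice[OF s[of n]] by simp
  have "(%n. (norm (abs_l2 (R n) - Z))\<^sup>2) ----> (norm (Z - Z))\<^sup>2"
    by (intro tendsto_intros lim)
  moreover have "(norm (abs_l2 (R n) - Z))\<^sup>2 = (\<integral>t. \<integral>x. (norm (R n (t, x) - rep_l2 Z (t, x)))\<^sup>2 \<partial>lborel \<partial>lborel)" for n
    using norm_abs_l2_sq[OF s[of n]] integral_slice[OF s[of n]]
    by (simp add: abs_l2_diff R sqint_rep abs_rep_l2)
  ultimately show "(%n. \<integral>t. \<integral>x. (norm (R n (t, x) - rep_l2 Z (t, x)))\<^sup>2 \<partial>lborel \<partial>lborel) ----> 0"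
    by simp
  have "AE t in lborel. \<forall>n. sqint (%x. R n (t, x))"
    using AE_sqint_slice[OF R] by (simp add: AE_all_countable)
  then show "AE t in lborel. \<forall>n. (\<integral>x. (norm (R n (t, x) - rep_l2 Z (t, x)))\<^sup>2 \<partial>lborel)
        = (norm (slice (R n) t - slice (rep_l2 Z) t))\<^sup>2"
    using AE_sqint_slice[OF sqint_rep[of Z]]
    by eventually_elim (simp add: slice_def norm_abs_l2_sq sqint_diff flip: abs_l2_diff)
qed

lemma
  fixes c :: "nat => nat => ('x::euclidean_space, 'b::euclidean_space) l2"
  assumes L: "L \<ge> 0" and C: "!!m t. t \<in> {0..<L} ==> norm (c m (step_index (\<tau> m) t)) <= C"
  shows sqint_convex_step: "sqint (%p. \<Sum>m\<le>N. l m *\<^sub>R step_fun (c m) (\<tau> m) L p)"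
    and abs_convex_step: "abs_l2 (%p. \<Sum>m\<le>N. l m *\<^sub>R step_fun (c m) (\<tau> m) L p)
      = (\<Sum>m\<le>N. l m *\<^sub>R abs_l2 (step_fun (c m) (\<tau> m) L))"
    and slice_convex_step: "t \<in> {0..<L} ==> slice (%p. \<Sum>m\<le>N. l m *\<^sub>R step_fun (c m) (\<tau> m) L p) t
      = (\<Sum>m\<le>N. l m *\<^sub>R c m (step_index (\<tau> m) t))"
proof -
  have s: "sqint (step_fun (c m) (\<tau> m) L)" for m by (rule sqint_step_fun(1)[OF L, where C = C]) (rule C)
  show "sqint (%p. \<Sum>m\<le>N. l m *\<^sub>R step_fun (c m) (\<tau> m) L p)"
    by (intro sqint_sum sqint_scaleR s)
  show "abs_l2 (%p. \<Sum>m\<le>N. l m *\<^sub>R step_fun (c m) (\<tau> m) L p)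
      = (\<Sum>m\<le>N. l m *\<^sub>R abs_l2 (step_fun (c m) (\<tau> m) L))"
    by (subst abs_l2_sum) (auto intro!: sqint_scaleR s simp: abs_l2_scaleR s)
  show "slice (%p. \<Sum>m\<le>N. l m *\<^sub>R step_fun (c m) (\<tau> m) L p) t
      = (\<Sum>m\<le>N. l m *\<^sub>R c m (step_index (\<tau> m) t))" if "t \<in> {0..<L}"
    unfolding slice_def using that
    by (subst abs_l2_sum) (auto intro!: sqint_scaleR step_fun_slice(1)
        simp: abs_l2_scaleR step_fun_slice(1) step_fun_slice(2)[unfolded slice_def])
qed

text \<open>The four families are put into one product Hilbert space, so that a single choice of
  weights serves all of them; with separate weights the limits would no longer be related to each
  other. Strong convergence on space-time then gives convergence of the slices at almost every time
  along a subsequence.\<close>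

lemma convex_steps_converge_AE:
  fixes a b :: "nat => nat => ('x::euclidean_space, real) l2" and c d :: "nat => nat => ('x, 'x) l2"
  assumes L: "L \<ge> 0"
    and bd: "!!m t. t \<in> {0..<L} ==> norm (a m (step_index (\<tau> m) t)) <= C"
      "!!m t. t \<in> {0..<L} ==> norm (b m (step_index (\<tau> m) t)) <= C"
      "!!m t. t \<in> {0..<L} ==> norm (c m (step_index (\<tau> m) t)) <= C"
      "!!m t. t \<in> {0..<L} ==> norm (d m (step_index (\<tau> m) t)) <= C"
  obtains N l A B G D where "!!n. tail_weights n (N n) (l n)"
    "sqint A" "sqint B" "sqint G" "sqint D"
    "AE t in lborel. t \<in> {0..<L} --> (%n. \<Sum>m\<le>N n. l n m *\<^sub>R a m (step_index (\<tau> m) t)) ----> slice A t"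
    "AE t in lborel. t \<in> {0..<L} --> (%n. \<Sum>m\<le>N n. l n m *\<^sub>R b m (step_index (\<tau> m) t)) ----> slice B t"
    "AE t in lborel. t \<in> {0..<L} --> (%n. \<Sum>m\<le>N n. l n m *\<^sub>R c m (step_index (\<tau> m) t)) ----> slice G t"
    "AE t in lborel. t \<in> {0..<L} --> (%n. \<Sum>m\<le>N n. l n m *\<^sub>R d m (step_index (\<tau> m) t)) ----> slice D t"
proof -
  define X where "X m = (abs_l2 (step_fun (a m) (\<tau> m) L), abs_l2 (step_fun (b m) (\<tau> m) L),
    abs_l2 (step_fun (c m) (\<tau> m) L), abs_l2 (step_fun (d m) (\<tau> m) L))" for m
  have nb: "norm (abs_l2 (step_fun (e m) (\<tau> m) L)) <= sqrt (L * C\<^sup>2)"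
    if "!!m t. t \<in> {0..<L} ==> norm (e m (step_index (\<tau> m) t)) <= C"
    for e :: "nat => nat => ('x, 'y::euclidean_space) l2" and m
    by (rule real_le_rsqrt, rule sqint_step_fun(2)[OF L]) (rule that)
  have "norm (X m) <= 4 * sqrt (L * C\<^sup>2)" for m
    using norm_Pair_le[of "fst (X m)" "snd (X m)"] norm_Pair_le[of "fst (snd (X m))" "snd (snd (X m))"]
      norm_Pair_le[of "fst (snd (snd (X m)))" "snd (snd (snd (X m)))"]
      nb[of a m, OF bd(1)] nb[of b m, OF bd(2)] nb[of c m, OF bd(3)] nb[of d m, OF bd(4)]
    unfolding X_def fst_conv snd_conv by (smt (verit))
  then obtain N l where w: "!!n. tail_weights n (N n) (l n)"
    and "convergent (%n. \<Sum>m\<le>N n. l n m *\<^sub>R X m)"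
    using convergent_convex_sums by blast
  then obtain Z where Z: "(%n. \<Sum>m\<le>N n. l n m *\<^sub>R X m) ----> Z" by (auto simp: convergent_def)
  define Z1 Z2 Z3 Z4 where "Z1 = fst Z" and "Z2 = fst (snd Z)" and "Z3 = fst (snd (snd Z))" and "Z4 = snd (snd (snd Z))"
  define S :: "(nat => nat => ('x, real) l2) => nat => real \<times> 'x => real"
    where "S e n p = (\<Sum>m\<le>N n. l n m *\<^sub>R step_fun (e m) (\<tau> m) L p)" for e n p
  define S' :: "(nat => nat => ('x, 'x) l2) => nat => real \<times> 'x => 'x"
    where "S' e n p = (\<Sum>m\<le>N n. l n m *\<^sub>R step_fun (e m) (\<tau> m) L p)" for e n p
  note Z' = tendsto_fst[OF Z] tendsto_fst[OF tendsto_snd[OF Z]]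
    tendsto_fst[OF tendsto_snd[OF tendsto_snd[OF Z]]] tendsto_snd[OF tendsto_snd[OF tendsto_snd[OF Z]]]
  have sq: "sqint (S a n)" "sqint (S b n)" "sqint (S' c n)" "sqint (S' d n)" for n
    unfolding S_def S'_def
    using sqint_convex_step[where c = a and C = C, OF L bd(1)] sqint_convex_step[where c = b and C = C, OF L bd(2)]
      sqint_convex_step[where c = c and C = C, OF L bd(3)] sqint_convex_step[where c = d and C = C, OF L bd(4)]
    by blast+
  have ab: "abs_l2 (S a n) = (\<Sum>m\<le>N n. l n m *\<^sub>R abs_l2 (step_fun (a m) (\<tau> m) L))"
    "abs_l2 (S b n) = (\<Sum>m\<le>N n. l n m *\<^sub>R abs_l2 (step_fun (b m) (\<tau> m) L))"
    "abs_l2 (S' c n) = (\<Sum>m\<le>N n. l n m *\<^sub>R abs_l2 (step_fun (c m) (\<tau> m) L))"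
    "abs_l2 (S' d n) = (\<Sum>m\<le>N n. l n m *\<^sub>R abs_l2 (step_fun (d m) (\<tau> m) L))" for n
    unfolding S_def S'_def
    using abs_convex_step[where c = a and C = C, OF L bd(1)] abs_convex_step[where c = b and C = C, OF L bd(2)]
      abs_convex_step[where c = c and C = C, OF L bd(3)] abs_convex_step[where c = d and C = C, OF L bd(4)]
    by blast+
  have lim: "(%n. abs_l2 (S a n)) ----> Z1" "(%n. abs_l2 (S b n)) ----> Z2"
    "(%n. abs_l2 (S' c n)) ----> Z3" "(%n. abs_l2 (S' d n)) ----> Z4"
    using Z' by (simp_all add: ab Z1_def Z2_def Z3_def Z4_def X_def fst_sum snd_sum)
  note s1 = slice_tendsto_L2[OF sq(1) lim(1)] and s2 = slice_tendsto_L2[OF sq(2) lim(2)]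
    and s3 = slice_tendsto_L2[OF sq(3) lim(3)] and s4 = slice_tendsto_L2[OF sq(4) lim(4)]
  \<comment> \<open>Adding the four squared distances produces one integrable quantity tending to
    zero in mean, hence one subsequence and one null set for all four.\<close>
  define J where "J n t = (\<integral>x. (norm (S a n (t, x) - rep_l2 Z1 (t, x)))\<^sup>2 \<partial>lborel)
    + (\<integral>x. (norm (S b n (t, x) - rep_l2 Z2 (t, x)))\<^sup>2 \<partial>lborel)
    + (\<integral>x. (norm (S' c n (t, x) - rep_l2 Z3 (t, x)))\<^sup>2 \<partial>lborel)
    + (\<integral>x. (norm (S' d n (t, x) - rep_l2 Z4 (t, x)))\<^sup>2 \<partial>lborel)" for n t
  have Jnn: "0 <= J n t" for n t unfolding J_def by (intro add_nonneg_nonneg integral_nonneg) auto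
  have Jint: "integrable lborel (J n)" for n
    unfolding J_def by (intro Bochner_Integration.integrable_add s1(1) s2(1) s3(1) s4(1))
  have "(%n. integral\<^sup>L lborel (J n)) ----> 0 + 0 + 0 + 0"
    unfolding J_def
    by (subst Bochner_Integration.integral_add,
        (intro Bochner_Integration.integrable_add s1(1) s2(1) s3(1) s4(1))+)+
      (intro tendsto_add s1(2) s2(2) s3(2) s4(2))
  then have "(%n. \<integral>t. norm (J n t) \<partial>lborel) ----> 0" using Jnn by simp
  from tendsto_L1_AE_subseq[OF Jint this]
  obtain r where r: "strict_mono r" "AE t in lborel. (%n. J (r n) t) ----> 0" by blast
  have to0: "(%n. f n) ----> g" if "!!n. (norm (f n - g))\<^sup>2 <= J (r n) t" "(%n. J (r n) t) ----> 0"
    for f :: "nat => 'z::real_normed_vector" and g t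
  proof -
    have "(%n. (norm (f n - g))\<^sup>2) ----> 0"
      by (rule tendsto_sandwich[OF _ _ tendsto_const that(2)]) (use that(1) in auto)
    then have "(%n. norm (f n - g)) ----> 0" using tendsto_real_sqrt by fastforce
    then show ?thesis by (simp add: LIM_zero_iff tendsto_norm_zero_iff)
  qed
  show thesis
  proof (rule that[of "%n. N (r n)" "%n. l (r n)" "rep_l2 Z1" "rep_l2 Z2" "rep_l2 Z3" "rep_l2 Z4"])
    \<comment> \<open>From \<open>n <= r n\<close>, a combination of indices beyond
      \<open>r n\<close> is also one of indices beyond \<open>n\<close>.\<close>
    show "tail_weights n (N (r n)) (l (r n))" for n
      using w[of "r n"] seq_suble[OF r(1), of n] tail_weights_antimono by blast
    show "sqint (rep_l2 Z1)" "sqint (rep_l2 Z2)" "sqint (rep_l2 Z3)" "sqint (rep_l2 Z4)"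
      by (rule sqint_rep)+
    have le: "AE t in lborel. \<forall>n. (norm (slice (S a (r n)) t - slice (rep_l2 Z1) t))\<^sup>2 <= J (r n) t
      \<and> (norm (slice (S b (r n)) t - slice (rep_l2 Z2) t))\<^sup>2 <= J (r n) t
      \<and> (norm (slice (S' c (r n)) t - slice (rep_l2 Z3) t))\<^sup>2 <= J (r n) t
      \<and> (norm (slice (S' d (r n)) t - slice (rep_l2 Z4) t))\<^sup>2 <= J (r n) t"
      using s1(3) s2(3) s3(3) s4(3)
      by eventually_elim (simp add: J_def add_nonneg_nonneg)
    have all: "AE t in lborel. (%n. slice (S a (r n)) t) ----> slice (rep_l2 Z1) t
        \<and> (%n. slice (S b (r n)) t) ----> slice (rep_l2 Z2) t
        \<and> (%n. slice (S' c (r n)) t) ----> slice (rep_l2 Z3) t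
        \<and> (%n. slice (S' d (r n)) t) ----> slice (rep_l2 Z4) t"
      using le r(2)
    proof eventually_elim
      case (elim t)
      show ?case by (intro conjI; rule to0[of _ _ t]; use elim in simp)
    qed
    have sl: "slice (S e n) t = (\<Sum>m\<le>N n. l n m *\<^sub>R e m (step_index (\<tau> m) t))"
      if "!!m t. t \<in> {0..<L} ==> norm (e m (step_index (\<tau> m) t)) <= C" "t \<in> {0..<L}" for e n t
      unfolding S_def by (rule slice_convex_step[where c = e and \<tau> = \<tau> and C = C, OF L that])
    have sl': "slice (S' e n) t = (\<Sum>m\<le>N n. l n m *\<^sub>R e m (step_index (\<tau> m) t))"
      if "!!m t. t \<in> {0..<L} ==> norm (e m (step_index (\<tau> m) t)) <= C" "t \<in> {0..<L}" for e n t
      unfolding S'_def by (rule slice_convex_step[where c = e and \<tau> = \<tau> and C = C, OF L that])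
    show "AE t in lborel. t \<in> {0..<L} --> (%n. \<Sum>m\<le>N (r n). l (r n) m *\<^sub>R a m (step_index (\<tau> m) t)) ----> slice (rep_l2 Z1) t"
      using all by eventually_elim (use sl[of a, OF bd(1)] in auto)
    show "AE t in lborel. t \<in> {0..<L} --> (%n. \<Sum>m\<le>N (r n). l (r n) m *\<^sub>R b m (step_index (\<tau> m) t)) ----> slice (rep_l2 Z2) t"
      using all by eventually_elim (use sl[of b, OF bd(2)] in auto)
    show "AE t in lborel. t \<in> {0..<L} --> (%n. \<Sum>m\<le>N (r n). l (r n) m *\<^sub>R c m (step_index (\<tau> m) t)) ----> slice (rep_l2 Z3) t"
      using all by eventually_elim (use sl'[of c, OF bd(3)] in auto)
    show "AE t in lborel. t \<in> {0..<L} --> (%n. \<Sum>m\<le>N (r n). l (r n) m *\<^sub>R d m (step_index (\<tau> m) t)) ----> slice (rep_l2 Z4) t"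
      using all by eventually_elim (use sl'[of d, OF bd(4)] in auto)
  qed
qed

subsection \<open>Integrals over half-open time intervals\<close>

text \<open>Half-open intervals match the cells on which \<open>step_index\<close> is constant, so
  that adjacent cells add up without overlap. The measure is complete, so almost everywhere limits
  stay measurable.\<close>

definition tint :: "real => real => (real => real) => real" where
  "tint a b f = (LINT t:{a..<b}|lebesgue. f t)"

abbreviation tintegrable :: "real => real => (real => real) => bool" where
  "tintegrable a b f \<equiv> set_integrable lebesgue {a..<b} f"

lemma ivl_lebesgue[measurable]: "{a..<b::real} \<in> sets lebesgue"
  by (intro sets_completionI_sets) simp

lemma tintegrable_subset: "tintegrable a b f ==> a <= c ==> d <= b ==> tintegrable c d f"
  by (rule set_integrable_subset) auto

lemma tint_combine:
  assumes "a <= b" "b <= c" "tintegrable a c f"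
  shows "tint a c f = tint a b f + tint b c f"
proof -
  have "tintegrable a b f" "tintegrable b c f"
    using assms by (auto intro: tintegrable_subset)
  moreover have "{a..<c} = {a..<b} \<union> {b..<c}" using assms by auto
  ultimately show ?thesis unfolding tint_def by (simp add: set_integral_Un)
qed

lemma tint_empty: "b <= a ==> tint a b f = 0"
  by (simp add: tint_def set_lebesgue_integral_def)

lemma tint_add: "tintegrable a b f ==> tintegrable a b g ==> tint a b (%t. f t + g t) = tint a b f + tint a b g"
  unfolding tint_def by (rule set_integral_add)

lemma tint_diff: "tintegrable a b f ==> tintegrable a b g ==> tint a b (%t. f t - g t) = tint a b f - tint a b g"
  unfolding tint_def by (rule set_integral_diff)

lemma tint_cmult: "tint a b (%t. c * f t) = c * tint a b f"
  unfolding tint_def by simp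

lemma emeasure_ivl_finite: "emeasure lebesgue {a..<b::real} < \<infinity>"
  using emeasure_bounded_finite[of "{a..<b}"] by (simp add: emeasure_completion)

lemma tint_const: "a <= b ==> tint a b (%t. c) = (b - a) * c"
  using emeasure_ivl_finite[of a b] by (simp add: tint_def set_lebesgue_integral_def measure_completion)

lemma tintegrable_const: "tintegrable a b (%t. c)"
  using integrable_real_indicator[OF ivl_lebesgue emeasure_ivl_finite, of a b] by (simp add: set_integrable_def)

lemma tint_cong: "(!!t. a <= t ==> t < b ==> f t = g t) ==> tint a b f = tint a b g"
  unfolding tint_def by (rule set_lebesgue_integral_cong) auto

lemma tint_cong_AE:
  assumes "f \<in> borel_measurable lebesgue" "AE t in lebesgue. t \<in> {a..<b} --> f t = g t"
    and "g \<in> borel_measurable lebesgue"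
  shows "tint a b f = tint a b g"
  unfolding tint_def by (rule set_lebesgue_integral_cong_AE) (use assms in auto)

lemma tint_mono:
  assumes "tintegrable a b f" "tintegrable a b g" "!!t. a <= t ==> t < b ==> f t <= g t"
  shows "tint a b f <= tint a b g"
  unfolding tint_def by (rule set_integral_mono) (use assms in auto)

lemma tint_abs_le:
  assumes "tintegrable a b f" "tintegrable a b g" "AE t in lebesgue. t \<in> {a..<b} --> \<bar>f t\<bar> <= g t"
  shows "\<bar>tint a b f\<bar> <= tint a b g"
proof -
  have "\<bar>tint a b f\<bar> <= (LINT t:{a..<b}|lebesgue. \<bar>f t\<bar>)"
    unfolding tint_def using set_integral_norm_bound[OF assms(1)] by simp
  also have "\<dots> <= tint a b g"
    unfolding tint_def
    by (rule set_integral_mono_AE) (use assms set_integrable_abs[OF assms(1)] in auto)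
  finally show ?thesis .
qed

lemma tintegrable_bound:
  assumes "tintegrable a b g" "f \<in> borel_measurable lebesgue"
    "AE t in lebesgue. t \<in> {a..<b} --> \<bar>f t\<bar> <= g t"
  shows "tintegrable a b f"
  unfolding set_integrable_def
proof (rule Bochner_Integration.integrable_bound)
  show "integrable lebesgue (%t. indicator {a..<b} t *\<^sub>R g t)" using assms(1) by (simp add: set_integrable_def)
  show "(%t. indicator {a..<b} t *\<^sub>R f t) \<in> borel_measurable lebesgue" using assms(2) by measurable
  show "AE t in lebesgue. norm (indicator {a..<b} t *\<^sub>R f t) <= norm (indicator {a..<b} t *\<^sub>R g t)"
    using assms(3) by eventually_elim (auto simp: indicator_def)
qed

lemma tint_sum_intervals:
  assumes "\<tau> \<ge> 0" "tintegrable 0 (real k * \<tau>) f"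
  shows "(\<Sum>j<k. tint (real j * \<tau>) (real (Suc j) * \<tau>) f) = tint 0 (real k * \<tau>) f"
  using assms
proof (induction k)
  case (Suc k)
  have "real k * \<tau> <= real (Suc k) * \<tau>" using Suc.prems by (simp add: mult_right_mono)
  then have "tintegrable 0 (real k * \<tau>) f" using Suc.prems by (auto intro: tintegrable_subset)
  then show ?case
    using Suc \<open>real k * \<tau> <= real (Suc k) * \<tau>\<close> tint_combine[of 0 "real k * \<tau>" "real (Suc k) * \<tau>" f] by simp
qed (simp add: tint_empty)

text \<open>Measurability of the limit is derived, not assumed: it agrees almost everywhere with a
  pointwise \<open>lim\<close>, and the measure is complete.\<close>

lemma tint_dominated_convergence:
  assumes "!!n. f n \<in> borel_measurable lebesgue" "tintegrable a b w"
    "AE t in lebesgue. t \<in> {a..<b} --> (%n. f n t) ----> g t"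
    "!!n. AE t in lebesgue. t \<in> {a..<b} --> \<bar>f n t\<bar> <= w t"
  shows "tintegrable a b g" "(%n. tint a b (f n)) ----> tint a b g"
proof -
  have m: "(%t. indicator {a..<b} t *\<^sub>R f n t) \<in> borel_measurable lebesgue" for n
    using assms(1)[of n] by measurable
  have lim: "AE t in lebesgue. (%n. indicator {a..<b} t *\<^sub>R f n t) ----> indicator {a..<b} t *\<^sub>R g t"
    using assms(3) by eventually_elim (auto simp: indicator_def)
  have "(%t. lim (%n. indicator {a..<b} t *\<^sub>R f n t)) \<in> borel_measurable lebesgue"
    by (intro borel_measurable_lim_metric m)
  moreover have "AE t in lebesgue. lim (%n. indicator {a..<b} t *\<^sub>R f n t) = indicator {a..<b} t *\<^sub>R g t"
    using lim by eventually_elim (rule limI)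
  ultimately have mg: "(%t. indicator {a..<b} t *\<^sub>R g t) \<in> borel_measurable lebesgue"
    by (rule borel_measurable_AE)
  have w: "integrable lebesgue (%t. indicator {a..<b} t *\<^sub>R w t)"
    using assms(2) by (simp add: set_integrable_def)
  have bd: "AE t in lebesgue. norm (indicator {a..<b} t *\<^sub>R f n t) <= indicator {a..<b} t *\<^sub>R w t" for n
    using assms(4)[of n] by eventually_elim (auto simp: indicator_def)
  show "tintegrable a b g" unfolding set_integrable_def
    by (rule integrable_dominated_convergence[OF mg m w lim bd])
  show "(%n. tint a b (f n)) ----> tint a b g" unfolding tint_def set_lebesgue_integral_def
    by (rule integral_dominated_convergence[OF mg m w lim bd])
qed

lemma step_index_eq:
  assumes "0 < \<tau>" "real k * \<tau> <= t" "t < real (Suc k) * \<tau>"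
  shows "step_index \<tau> t = k"
proof -
  have "real k <= t / \<tau>" "t / \<tau> < real k + 1"
    using assms by (auto simp: field_simps)
  then have "\<lfloor>t / \<tau>\<rfloor> = int k" by (simp add: floor_eq_iff)
  then show ?thesis by (simp add: step_index_def)
qed

lemma step_index_bounds:
  assumes "0 < \<tau>" "0 <= t"
  shows "real (step_index \<tau> t) * \<tau> <= t" "t < real (Suc (step_index \<tau> t)) * \<tau>"
proof -
  have "real (step_index \<tau> t) = of_int \<lfloor>t / \<tau>\<rfloor>"
    using assms by (simp add: step_index_def)
  then show "real (step_index \<tau> t) * \<tau> <= t" "t < real (Suc (step_index \<tau> t)) * \<tau>"
    using floor_divide_lower[OF assms(1), of t] floor_divide_upper[OF assms(1), of t] by (auto simp: add.commute)
qed

lemma step_index_measurable_lebesgue: "step_index \<tau> \<in> lebesgue \<rightarrow>\<^sub>M count_space UNIV"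
  by (rule measurable_completion) simp

lemma step_compose_measurable:
  assumes "!!k. f k \<in> borel_measurable lebesgue"
  shows "(%t. f (step_index \<tau> t) t :: real) \<in> borel_measurable lebesgue"
  by (rule measurable_compose_countable[OF assms step_index_measurable_lebesgue])

lemma tint_step:
  assumes "0 < \<tau>" "tintegrable 0 (real k * \<tau>) (%t. f (step_index \<tau> t) t)"
  shows "tint 0 (real k * \<tau>) (%t. f (step_index \<tau> t) t) = (\<Sum>j<k. tint (real j * \<tau>) (real (Suc j) * \<tau>) (f j))"
proof -
  have "(\<Sum>j<k. tint (real j * \<tau>) (real (Suc j) * \<tau>) (%t. f (step_index \<tau> t) t))
      = (\<Sum>j<k. tint (real j * \<tau>) (real (Suc j) * \<tau>) (f j))"
    by (intro sum.cong refl tint_cong) (metis step_index_eq[OF assms(1)])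
  then show ?thesis using tint_sum_intervals[OF less_imp_le[OF assms(1)] assms(2)] by simp
qed

section \<open>Time discretisation in growing Hilbert spaces\<close>

text \<open>\<open>W t\<close> plays the role of the graph of the gradient on $H^1_0(\Omega_t)$ and \<open>P t\<close> that of $L^2(\Omega_t)$.\<close>
locale evolution =
  fixes T :: real and W :: "real => (('x::euclidean_space, real) l2 \<times> ('x, 'x) l2) set"
    and P :: "real => ('x, real) l2 set" and F :: "real \<times> 'x => real"
    and u0 u1 :: "('x, real) l2" and g0 :: "('x, 'x) l2"
  assumes T: "0 < T"
    and W: "!!t. closed (W t)" "!!t. subspace (W t)" "!!s t. 0 <= s ==> s <= t ==> W s \<subseteq> W t"
    and W_single: "!!t g. 0 <= t ==> (0, g) \<in> W t ==> g = 0"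
    and P: "!!t. closed (P t)" "!!t. subspace (P t)" "!!s t. 0 <= s ==> s <= t ==> P s \<subseteq> P t"
    and W_P: "!!t h g. 0 <= t ==> (h, g) \<in> W t ==> h \<in> P t"
    and W_dense: "!!t h. 0 <= t ==> h \<in> P t ==> (!!\<phi> q. (\<phi>, q) \<in> W t ==> h \<bullet> \<phi> = 0) ==> h = 0"
    and F: "sqint F" "AE t in lebesgue. 0 < t --> slice F t \<in> P t"
    and init: "(u0, g0) \<in> W 0" "u1 \<in> P 0"
begin

definition Fs :: "real => ('x, real) l2" where "Fs t = slice F t"
definition Fn :: "real => real" where "Fn t = norm (Fs t)"
definition FM :: real where "FM = (\<integral>t. (Fn t)\<^sup>2 \<partial>lebesgue)"

lemma Fs_measurable: "(%t. Fs t \<bullet> h) \<in> borel_measurable lebesgue"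
  unfolding Fs_def by (rule slice_inner_measurable[OF F(1)])

lemma Fs_inner_le: "\<bar>Fs t \<bullet> h\<bar> <= Fn t * norm h"
  unfolding Fn_def by (rule Cauchy_Schwarz_ineq2)

lemma Fn_sq: "(%t. (Fn t)\<^sup>2) \<in> borel_measurable lebesgue" "integrable lebesgue (%t. (Fn t)\<^sup>2)"
proof -
  have i: "integrable lebesgue (%t. \<integral>x. (norm (F (t, x)))\<^sup>2 \<partial>lborel)"
    using integrable_slice[OF F(1)] by (simp add: integrable_completion borel_measurable_integrable)
  have "AE t in lebesgue. (Fn t)\<^sup>2 = (\<integral>x. (norm (F (t, x)))\<^sup>2 \<partial>lborel)"
    unfolding AE_completion_iff Fn_def Fs_def using slice_norm_measurable[OF F(1)] .
  then have ae: "AE t in lebesgue. (\<integral>x. (norm (F (t, x)))\<^sup>2 \<partial>lborel) = (Fn t)\<^sup>2"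
    by eventually_elim simp
  show m: "(%t. (Fn t)\<^sup>2) \<in> borel_measurable lebesgue"
    by (rule borel_measurable_AE[OF borel_measurable_integrable[OF i] ae])
  show "integrable lebesgue (%t. (Fn t)\<^sup>2)"
    by (rule integrable_cong_AE_imp[OF i m]) (use ae in eventually_elim, simp)
qed

lemma Fn_nonneg: "0 <= Fn t" by (simp add: Fn_def)

lemma Fn_measurable[measurable]: "Fn \<in> borel_measurable lebesgue"
proof -
  have "(%t. sqrt ((Fn t)\<^sup>2)) \<in> borel_measurable lebesgue" using Fn_sq(1) by measurable
  then show ?thesis by (simp add: Fn_nonneg)
qed

lemma Fn_sq_tintegrable: "tintegrable a b (%t. (Fn t)\<^sup>2)"
  unfolding set_integrable_def using Fn_sq(2)
  by (intro integrable_mult_indicator) auto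

lemma Fn_tintegrable: "tintegrable a b Fn"
proof (rule tintegrable_bound)
  show "tintegrable a b (%t. 1 + (Fn t)\<^sup>2)"
    by (intro set_integral_add(1) Fn_sq_tintegrable tintegrable_const)
  have "x <= 1 + x\<^sup>2" for x :: real
    using sum_squares_bound[of x 1] by simp (smt (verit) zero_le_power2)
  then show "AE t in lebesgue. t \<in> {a..<b} --> \<bar>Fn t\<bar> <= 1 + (Fn t)\<^sup>2" by (simp add: Fn_nonneg)
qed simp

lemma tint_Fn_nonneg: "0 <= tint a b Fn"
  unfolding tint_def set_lebesgue_integral_def by (intro Bochner_Integration.integral_nonneg) (simp add: Fn_nonneg)

lemma tint_Fn_mono: "a <= c ==> c <= d ==> d <= b ==> tint c d Fn <= tint a b Fn"
  using tint_combine[of a c b Fn] tint_combine[of c d b Fn] Fn_tintegrable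
    tint_Fn_nonneg[of a c] tint_Fn_nonneg[of d b] by fastforce

lemma FM_nonneg: "0 <= FM" unfolding FM_def by simp

text \<open>A Cauchy-Schwarz estimate obtained from \<open>x <= 1 / s + s * x\<^sup>2\<close> with
  the weight \<open>s = sqrt (b - a)\<close>, which explains the constant \<open>1 + FM\<close>. The
  square root of the length is the modulus of continuity that reappears in all estimates of velocity
  increments.\<close>

lemma tint_Fn_le: assumes "a <= b" shows "tint a b Fn <= (1 + FM) * sqrt (b - a)"
proof (cases "a = b")
  case False
  define s where "s = sqrt (b - a)"
  have s: "s > 0" "s * s = b - a" using assms False by (auto simp: s_def)
  have le: "x <= 1 / s + s * x\<^sup>2" for x :: real
  proof -
    have "0 <= (1 - s * x)\<^sup>2" by simp
    then have "2 * (s * x) <= 1 + s * x * (s * x)" by (simp add: power2_eq_square algebra_simps)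
    moreover have "0 <= 1 + s * x * (s * x)" using zero_le_square[of "s * x"] by linarith
    ultimately have "s * x <= 1 + s * x * (s * x)" by linarith
    then show ?thesis using s by (simp add: field_simps power2_eq_square)
  qed
  have "tint a b Fn <= tint a b (%t. 1 / s + s * (Fn t)\<^sup>2)"
    by (intro tint_mono Fn_tintegrable le set_integral_add(1) tintegrable_const set_integrable_mult_right Fn_sq_tintegrable)
  also have "\<dots> = (b - a) * (1 / s) + s * tint a b (%t. (Fn t)\<^sup>2)"
    using assms by (simp add: tint_add tintegrable_const Fn_sq_tintegrable tint_cmult tint_const)
  also have "\<dots> <= s + s * FM"
  proof -
    have "tint a b (%t. (Fn t)\<^sup>2) <= FM"
      unfolding tint_def FM_def set_lebesgue_integral_def
      using Fn_sq_tintegrable[of a b] Fn_sq(2)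
      by (intro integral_mono) (auto simp: set_integrable_def indicator_def)
    then show ?thesis using s by (simp add: s(2)[symmetric] mult_left_mono)
  qed
  finally show ?thesis by (simp add: s_def algebra_simps)
qed (simp add: tint_empty)

lemma Fs_tintegrable: "tintegrable a b (%t. Fs t \<bullet> h)"
proof (rule tintegrable_bound[OF _ Fs_measurable])
  show "tintegrable a b (%t. Fn t * norm h)" by (intro set_integrable_mult_left Fn_tintegrable)
qed (simp add: Fs_inner_le)

text \<open>The average of the source over an interval, defined weakly: the Riesz theorem represents
  the averaged scalar products, so only scalar integrals occur.\<close>

lemma average_exists:
  assumes "0 < \<tau>"
  shows "\<exists>y. \<forall>h. \<tau> * (y \<bullet> h) = tint a b (%t. Fs t \<bullet> h)"
proof -
  note i = Fs_tintegrable
  obtain w where "!!z. z \<in> UNIV ==> tint a b (%t. Fs t \<bullet> z) / \<tau> = w \<bullet> z"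
  proof (rule riesz_on_subspace[of UNIV "%h. tint a b (%t. Fs t \<bullet> h) / \<tau>" "tint a b Fn / \<tau>"])
    fix v w :: "('x, real) l2" and c d :: real
    have "tint a b (%t. Fs t \<bullet> (c *\<^sub>R v + d *\<^sub>R w)) = c * tint a b (%t. Fs t \<bullet> v) + d * tint a b (%t. Fs t \<bullet> w)"
      by (simp add: inner_add_right tint_add i tint_cmult)
    then show "tint a b (%t. Fs t \<bullet> (c *\<^sub>R v + d *\<^sub>R w)) / \<tau>
        = c * (tint a b (%t. Fs t \<bullet> v) / \<tau>) + d * (tint a b (%t. Fs t \<bullet> w) / \<tau>)"
      by (simp add: add_divide_distrib)
    have "\<bar>tint a b (%t. Fs t \<bullet> v)\<bar> <= tint a b (%t. norm v * Fn t)"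
      by (rule tint_abs_le) (use i Fn_tintegrable Fs_inner_le in \<open>auto simp: mult.commute\<close>)
    then show "\<bar>tint a b (%t. Fs t \<bullet> v) / \<tau>\<bar> <= tint a b Fn / \<tau> * norm v"
      using assms by (simp add: tint_cmult divide_right_mono mult.commute)
  qed auto
  then show ?thesis using assms by (intro exI[of _ w]) (simp add: field_simps)
qed

text \<open>One step of backward Euler. The unknown minimises \<open>(norm u')\<^sup>2 /
  \<tau>\<^sup>2 + (norm g')\<^sup>2 - 2 * (z \<bullet> u')\<close> over pairs in \<open>V\<close>,
  where \<open>z\<close> gathers the old data. With \<open>u' = \<tau> *\<^sub>R a\<close> this
  becomes the squared distance of \<open>(a, g')\<close> to \<open>(\<tau> *\<^sub>R z, 0)\<close>,
  up to a constant, so the minimiser is an orthogonal projection.\<close>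

lemma step_exists:
  fixes u v y :: "('x, real) l2" and V :: "(('x, real) l2 \<times> ('x, 'x) l2) set"
  assumes \<tau>: "0 < \<tau>" and t: "closed V" "subspace V"
  shows "\<exists>u' v' g'. (u', g') \<in> V \<and> u' = u + \<tau> *\<^sub>R v' \<and>
    (\<forall>\<phi> q. (\<phi>, q) \<in> V --> (v' - v) \<bullet> \<phi> + \<tau> * (g' \<bullet> q) = \<tau> * (y \<bullet> \<phi>))"
proof -
  define z where "z = y + (1/\<tau>\<^sup>2) *\<^sub>R u + (1/\<tau>) *\<^sub>R v"
  \<comment> \<open>Rescaling the first component absorbs the weight
    \<open>1 / \<tau>\<^sup>2\<close> into the standard inner product.\<close>
  define V' where "V' = (%p. (\<tau> *\<^sub>R fst p, snd p)) -` V"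
  have "closed V'" unfolding V'_def
    by (intro closed_vimage t continuous_intros)
  moreover have "subspace V'" unfolding V'_def
    by (rule linear_subspace_vimage[OF _ t(2)]) (auto intro!: linearI simp: scaleR_add_right)
  ultimately obtain p where p: "p \<in> V'" "!!s. s \<in> V' ==> ((\<tau> *\<^sub>R z, 0) - p) \<bullet> s = 0"
    using orthogonal_projection by metis
  obtain a g' where pag: "p = (a, g')" by force
  define u' where "u' = \<tau> *\<^sub>R a"
  define v' where "v' = (1/\<tau>) *\<^sub>R (u' - u)"
  have "(u', g') \<in> V" using p(1) by (simp add: V'_def pag u'_def)
  moreover have "u' = u + \<tau> *\<^sub>R v'" using \<tau> by (simp add: v'_def)
  moreover have "(v' - v) \<bullet> \<phi> + \<tau> * (g' \<bullet> q) = \<tau> * (y \<bullet> \<phi>)" if "(\<phi>, q) \<in> V" for \<phi> q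
  proof -
    have "((1/\<tau>) *\<^sub>R \<phi>, q) \<in> V'" using that \<tau> by (simp add: V'_def)
    from p(2)[OF this] have "(1/\<tau>) * ((\<tau> *\<^sub>R z - a) \<bullet> \<phi>) = g' \<bullet> q"
      by (simp add: pag)
    then have "\<tau> * (g' \<bullet> q) = (\<tau> *\<^sub>R z - a) \<bullet> \<phi>" using \<tau> by (simp add: field_simps)
    also have "\<dots> = \<tau> * (y \<bullet> \<phi>) + (1/\<tau>) * (u \<bullet> \<phi>) + v \<bullet> \<phi> - a \<bullet> \<phi>"
      using \<tau> by (simp add: z_def inner_add_left inner_diff_left power2_eq_square distrib_left)
    also have "\<dots> = \<tau> * (y \<bullet> \<phi>) - (v' - v) \<bullet> \<phi>"
      using \<tau> by (simp add: v'_def u'_def inner_diff_left right_diff_distrib)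
    finally show ?thesis by simp
  qed
  ultimately show ?thesis by (intro exI[of _ u'] exI[of _ v'] exI[of _ g'] conjI allI impI) assumption
qed

text \<open>Test functions and new position belong to the space at the end of the cell, and the
  force is the average over the cell. There is no last step: values past the final time are needed
  to approach that time from the right.\<close>

definition scheme where
  "scheme \<tau> u v g y \<longleftrightarrow> u 0 = u0 \<and> v 0 = u1 \<and> g 0 = g0 \<and>
    (\<forall>k. (u k, g k) \<in> W (real k * \<tau>) \<and> u (Suc k) = u k + \<tau> *\<^sub>R v (Suc k)) \<and>
    (\<forall>k \<phi> q. (\<phi>, q) \<in> W (real (Suc k) * \<tau>) -->
       (v (Suc k) - v k) \<bullet> \<phi> + \<tau> * (g (Suc k) \<bullet> q) = \<tau> * (y k \<bullet> \<phi>)) \<and>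
    (\<forall>k h. \<tau> * (y k \<bullet> h) = tint (real k * \<tau>) (real (Suc k) * \<tau>) (%t. Fs t \<bullet> h))"

lemma scheme_exists:
  assumes \<tau>: "0 < \<tau>"
  shows "\<exists>u v g y. scheme \<tau> u v g y"
proof -
  have "\<forall>k. \<exists>y. \<forall>h. \<tau> * (y \<bullet> h) = tint (real k * \<tau>) (real (Suc k) * \<tau>) (%t. Fs t \<bullet> h)"
    using average_exists[OF \<tau>] by blast
  from choice[OF this]
  obtain y where y: "!!k h. \<tau> * (y k \<bullet> h) = tint (real k * \<tau>) (real (Suc k) * \<tau>) (%t. Fs t \<bullet> h)"
    by blast
  define Q where "Q k s s' \<longleftrightarrow> (case s of (u, v, g) => case s' of (u', v', g') =>
    (u', g') \<in> W (real (Suc k) * \<tau>) \<and> u' = u + \<tau> *\<^sub>R v' \<and>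
    (\<forall>\<phi> q. (\<phi>, q) \<in> W (real (Suc k) * \<tau>) --> (v' - v) \<bullet> \<phi> + \<tau> * (g' \<bullet> q) = \<tau> * (y k \<bullet> \<phi>)))"
    for k and s s' :: "('x, real) l2 \<times> ('x, real) l2 \<times> ('x, 'x) l2"
  have "\<exists>s'. Q k s s'" for k s
  proof -
    obtain u v g where s: "s = (u, v, g)" by (metis surj_pair)
    show ?thesis using step_exists[OF \<tau> W(1,2)[of "real (Suc k) * \<tau>"], of u v "y k"]
      unfolding Q_def s by force
  qed
  then obtain nx where nx: "!!k s. Q k s (nx k s)" by metis
  define S where "S = rec_nat (u0, u1, g0) nx"
  have S0: "S 0 = (u0, u1, g0)" and SS: "S (Suc k) = nx k (S k)" for k by (auto simp: S_def)
  define u v g where "u k = fst (S k)" and "v k = fst (snd (S k))" and "g k = snd (snd (S k))" for k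
  have SQ: "Q k (u k, v k, g k) (u (Suc k), v (Suc k), g (Suc k))" for k
    using nx[of k "S k"] by (simp add: u_def v_def g_def SS)
  have S1: "(u (Suc k), g (Suc k)) \<in> W (real (Suc k) * \<tau>)" "u (Suc k) = u k + \<tau> *\<^sub>R v (Suc k)"
    "!!\<phi> q. (\<phi>, q) \<in> W (real (Suc k) * \<tau>) ==> (v (Suc k) - v k) \<bullet> \<phi> + \<tau> * (g (Suc k) \<bullet> q) = \<tau> * (y k \<bullet> \<phi>)" for k
    using SQ[of k] unfolding Q_def prod.case by blast+
  have S2: "u 0 = u0" "v 0 = u1" "g 0 = g0" by (simp_all add: u_def v_def g_def S0)
  have "(u k, g k) \<in> W (real k * \<tau>)" for k
    using init(1) S1(1)[of "k - 1"] S2 by (cases k) auto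
  then have "scheme \<tau> u v g y"
    unfolding scheme_def using S1(2,3) S2 y by blast
  then show ?thesis by blast
qed

end

locale discrete_evolution = evolution +
  fixes \<tau> u v g y
  assumes tau: "0 < \<tau>" and scheme: "scheme \<tau> u v g y"
begin

lemma
  shows u_0: "u 0 = u0" and v_0: "v 0 = u1" and g_0: "g 0 = g0"
    and ug_W: "(u k, g k) \<in> W (real k * \<tau>)"
    and u_Suc: "u (Suc k) = u k + \<tau> *\<^sub>R v (Suc k)"
    and step_eq: "(\<phi>, q) \<in> W (real (Suc k) * \<tau>) ==>
       (v (Suc k) - v k) \<bullet> \<phi> + \<tau> * (g (Suc k) \<bullet> q) = \<tau> * (y k \<bullet> \<phi>)"
    and y_avg: "\<tau> * (y k \<bullet> h) = tint (real k * \<tau>) (real (Suc k) * \<tau>) (%t. Fs t \<bullet> h)"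
  using scheme by (auto simp: scheme_def)

lemma grid_mono: "j <= k ==> real j * \<tau> <= real k * \<tau>" "0 <= real j * \<tau>"
  using tau by (auto intro: mult_right_mono)

lemma v_P: "v k \<in> P (real k * \<tau>)"
proof (cases k)
  case 0 then show ?thesis using init by (simp add: v_0)
next
  case (Suc j)
  have "u k \<in> P (real k * \<tau>)" using W_P[OF grid_mono(2) ug_W] .
  moreover have "u j \<in> P (real k * \<tau>)"
    using W_P[OF grid_mono(2) ug_W[of j]] P(3)[OF grid_mono(2) grid_mono(1)[of j k]] Suc by auto
  moreover have "v k = (1/\<tau>) *\<^sub>R (u k - u j)" using tau u_Suc[of j] Suc by simp
  ultimately show ?thesis using P(2) by (simp add: subspace_scale subspace_diff)
qed

lemma y_norm: "\<tau> * norm (y k) <= tint (real k * \<tau>) (real (Suc k) * \<tau>) Fn"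
proof -
  let ?I = "tint (real k * \<tau>) (real (Suc k) * \<tau>)"
  have "\<tau> * (y k \<bullet> y k) <= \<bar>?I (%t. Fs t \<bullet> y k)\<bar>" unfolding y_avg by simp
  also have "\<dots> <= ?I (%t. norm (y k) * Fn t)"
    by (rule tint_abs_le) (auto simp: Fs_tintegrable Fn_tintegrable Fs_inner_le mult.commute[of "norm (y k)"])
  also have "\<dots> = norm (y k) * ?I Fn" by (rule tint_cmult)
  finally have "norm (y k) * (\<tau> * norm (y k)) <= norm (y k) * ?I Fn"
    unfolding power2_norm_eq_inner[symmetric] power2_eq_square mult.left_commute[of \<tau>] .
  then show ?thesis
    using tint_Fn_nonneg by (cases "y k = 0") (auto simp: mult_le_cancel_left)
qed

text \<open>Twice the discrete energy.\<close>

definition en :: "nat => real" where "en k = (norm (v k))\<^sup>2 + (norm (g k))\<^sup>2"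

text \<open>The equation is tested with the increment of the position and its gradient. This is
  allowed because the old pair also lies in the new graph, and here the growth of the domains is
  decisive. The rest is \<open>2 * (a \<bullet> (a - b)) = (norm a)\<^sup>2 - (norm b)\<^sup>2 +
  (norm (a - b))\<^sup>2\<close>, with the last square, the numerical dissipation, dropped.\<close>

lemma en_step: "en (Suc k) <= en k + 2 * (\<tau> * (y k \<bullet> v (Suc k)))"
proof -
  have "(u k, g k) \<in> W (real (Suc k) * \<tau>)"
    using W(3)[OF grid_mono(2) grid_mono(1)[of k "Suc k"]] ug_W[of k] by auto
  then have "(u (Suc k), g (Suc k)) - (u k, g k) \<in> W (real (Suc k) * \<tau>)"
    using ug_W[of "Suc k"] W(2) by (intro subspace_diff) auto
  then have "(\<tau> *\<^sub>R v (Suc k), g (Suc k) - g k) \<in> W (real (Suc k) * \<tau>)"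
    by (simp add: u_Suc)
  from step_eq[OF this]
  have "\<tau> * ((v (Suc k) - v k) \<bullet> v (Suc k) + g (Suc k) \<bullet> (g (Suc k) - g k)) = \<tau> * (\<tau> * (y k \<bullet> v (Suc k)))"
    by (simp add: algebra_simps)
  then have eq: "(v (Suc k) - v k) \<bullet> v (Suc k) + g (Suc k) \<bullet> (g (Suc k) - g k) = \<tau> * (y k \<bullet> v (Suc k))"
    using tau by simp
  have "0 <= (norm (v (Suc k) - v k))\<^sup>2 + (norm (g (Suc k) - g k))\<^sup>2" by simp
  then show ?thesis using eq
    unfolding en_def power2_norm_eq_inner by (simp add: inner_diff inner_commute)
qed

text \<open>Working with the square root of the energy gives linear growth:
  \<open>?b * ?b <= ?a * ?a + ?c * ?b\<close> forces \<open>?b <= ?a + ?c\<close>, and the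
  increments \<open>?c\<close> sum to an integral of the source.\<close>

lemma en_bound: "sqrt (en k) <= sqrt ((norm u1)\<^sup>2 + (norm g0)\<^sup>2) + 2 * tint 0 (real k * \<tau>) Fn"
proof (induction k)
  case 0
  then show ?case by (simp add: en_def v_0 g_0 tint_empty)
next
  case (Suc k)
  have nn: "0 <= en j" for j by (simp add: en_def)
  let ?a = "sqrt (en k)" and ?b = "sqrt (en (Suc k))" and ?c = "2 * (\<tau> * norm (y k))"
  have "norm (v (Suc k)) <= ?b" unfolding en_def by (intro real_le_rsqrt) simp
  then have "norm (y k) * norm (v (Suc k)) <= norm (y k) * ?b" by (intro mult_left_mono) auto
  then have "y k \<bullet> v (Suc k) <= norm (y k) * ?b" using norm_cauchy_schwarz[of "y k" "v (Suc k)"] by linarith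
  then have "\<tau> * (y k \<bullet> v (Suc k)) <= \<tau> * (norm (y k) * ?b)" using tau by (intro mult_left_mono) auto
  then have "en (Suc k) <= en k + ?c * ?b" using en_step[of k] by (simp add: mult_ac)
  then have sq: "?b * ?b <= ?a * ?a + ?c * ?b" using nn by simp
  have c: "0 <= ?c" using tau by simp
  have "?b <= ?a + ?c"
  proof (rule ccontr)
    assume "\<not> ?b <= ?a + ?c"
    then have *: "?b > ?a + ?c" by simp
    have "?a \<ge> 0" "?b \<ge> 0" using nn by auto
    have "0 < ?b" using * c \<open>?a \<ge> 0\<close> by linarith
    have "(?a + ?c) * ?b < ?b * ?b" by (rule mult_strict_right_mono[OF * \<open>0 < ?b\<close>])
    then have "?a * ?b < ?a * ?a" using sq by (simp add: distrib_right)
    moreover have "?a <= ?b" using * c by linarith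
    then have "?a * ?a <= ?a * ?b" using \<open>?a \<ge> 0\<close> by (rule mult_left_mono)
    ultimately show False by simp
  qed
  moreover have "?c <= 2 * tint (real k * \<tau>) (real (Suc k) * \<tau>) Fn" using y_norm[of k] by simp
  moreover have "tint 0 (real (Suc k) * \<tau>) Fn = tint 0 (real k * \<tau>) Fn + tint (real k * \<tau>) (real (Suc k) * \<tau>) Fn"
    by (rule tint_combine[OF grid_mono(2) grid_mono(1) Fn_tintegrable]) simp
  ultimately show ?case using Suc by simp
qed

end

subsection \<open>Interpolants and their convex combinations\<close>

text \<open>Strong convergence of first components and bounded second components give weak
  convergence of the second ones, without subsequences. Functionals that look at the first component
  only are already total on a single valued graph.\<close>

lemma (in evolution) graph_weak_tendsto:
  assumes t: "0 <= t" and x: "!!n. (x n, p n) \<in> W t" "!!n. norm (p n) <= C" and lim: "x ----> x'" "(x', p') \<in> W t"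
  shows "(%n. p n \<bullet> h) ----> p' \<bullet> h"
proof -
  obtain z where z: "z \<in> W t" "!!s. s \<in> W t ==> ((0, h) - z) \<bullet> s = 0"
    using orthogonal_projection[where S = "W t" and z = "(0, h)", OF W(1,2)] by metis
  \<comment> \<open>The representatives in \<open>W t\<close> of the functionals
    \<open>s \<mapsto> fst s \<bullet> k\<close>. A pair orthogonal to all of them has first
    component zero, hence vanishes by \<open>W_single\<close>.\<close>
  define Dm where "Dm = {d \<in> W t. \<exists>k. \<forall>s\<in>W t. ((k, 0) - d) \<bullet> s = 0}"
  obtain Cx where Cx: "!!n. norm (x n) <= Cx" using lim(1) convergent_imp_bounded
    by (metis UNIV_I bounded_iff imageI range_eqI)
  have "(%n. (x n, p n) \<bullet> z) ----> (x', p') \<bullet> z"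
  proof (rule weak_tendsto_if_total[OF W(2) W(1) _ z(1), of Dm])
    show "Dm \<subseteq> W t" by (auto simp: Dm_def)
    show "\<forall>\<^sub>F n in sequentially. norm (x n, p n) <= Cx + C"
      using Cx x(2) by (auto intro!: always_eventually order_trans[OF norm_Pair_le] add_mono)
    show "s = 0" if s: "s \<in> W t" "!!d. d \<in> Dm ==> s \<bullet> d = 0" for s
    proof -
      obtain d where d: "d \<in> W t" "!!r. r \<in> W t ==> ((fst s, 0) - d) \<bullet> r = 0"
        using orthogonal_projection[where S = "W t" and z = "(fst s, 0)", OF W(1,2)] by metis
      have "d \<in> Dm" unfolding Dm_def using d by blast
      then have "s \<bullet> d = 0" by (rule s(2))
      moreover have "(fst s, 0) \<bullet> s = d \<bullet> s" using d(2)[OF s(1), unfolded inner_diff_left] by simp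
      ultimately have "fst s \<bullet> fst s = 0" by (simp add: inner_commute inner_prod_def)
      then have "fst s = 0" by simp
      then have "(0, snd s) \<in> W t" using s(1) by (metis prod.collapse)
      then have "snd s = 0" by (rule W_single[OF t])
      then show "s = 0" using \<open>fst s = 0\<close> by (simp add: prod_eq_iff)
    qed
    fix d assume "d \<in> Dm"
    then obtain k where k: "d \<in> W t" "!!s. s \<in> W t ==> ((k, 0) - d) \<bullet> s = 0" by (auto simp: Dm_def)
    have eq: "s \<bullet> d = fst s \<bullet> k" if "s \<in> W t" for s
      using k(2)[OF that, unfolded inner_diff_left] by (simp add: inner_commute inner_prod_def)
    have "(%n. x n \<bullet> k) ----> x' \<bullet> k" by (intro tendsto_intros lim)
    then show "(%n. (x n, p n) \<bullet> d) ----> (x', p') \<bullet> d" using eq[OF x(1)] eq[OF lim(2)] by simp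
  qed
  moreover have "s \<bullet> z = snd s \<bullet> h" if "s \<in> W t" for s
    using z(2)[OF that, unfolded inner_diff_left] by (simp add: inner_commute inner_prod_def)
  ultimately show ?thesis using x(1) lim(2) by simp
qed

section \<open>Uniform bounds for the discrete solutions\<close>

locale evolution_seq = evolution +
  fixes u v :: "nat => nat => ('a, real) l2" and g :: "nat => nat => ('a, 'a) l2"
    and y :: "nat => nat => ('a, real) l2"
  assumes scheme_m: "!!m. scheme (T / real (Suc m)) (u m) (v m) (g m) (y m)"
begin

text \<open>Step sizes dividing \<open>T\<close>, so that \<open>T\<close> is the grid point with
  index \<open>Suc m\<close> and sums over the grid telescope exactly to the end point.\<close>

definition tau :: "nat => real" where "tau m = T / real (Suc m)"
definition ix :: "nat => real => nat" where "ix m t = step_index (tau m) t"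

lemma tau_pos: "0 < tau m" using T by (simp add: tau_def)
lemma tau_le: "tau m <= T" using T by (simp add: tau_def field_simps)
lemma tau_antimono: "n <= m ==> tau m <= tau n" using T by (simp add: tau_def frac_le)
lemma tau_tendsto: "tau ----> 0"
  unfolding tau_def using tendsto_mult[OF tendsto_const[of T] LIMSEQ_inverse_real_of_nat]
  by (simp add: divide_inverse)
lemma sqrt_tau_tendsto: "(%m. sqrt (tau m)) ----> 0"
  using tendsto_real_sqrt[OF tau_tendsto] by simp

sublocale D: discrete_evolution T W P F u0 u1 g0 "tau m" "u m" "v m" "g m" "y m" for m
  by unfold_locales (use tau_pos scheme_m in \<open>auto simp: tau_def\<close>)

lemma ix_bounds:
  assumes "0 <= t" shows "real (ix m t) * tau m <= t" "t < real (Suc (ix m t)) * tau m"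
  using step_index_bounds[OF tau_pos assms] by (auto simp: ix_def)

lemma ix_Suc_le: "0 <= t ==> real (Suc (ix m t)) * tau m <= t + tau m"
  using ix_bounds(1)[of t m] by (simp add: distrib_right)

lemma ix_0: "ix m 0 = 0" by (simp add: ix_def step_index_def)

lemma ix_mono: "s <= t ==> ix m s <= ix m t"
  unfolding ix_def step_index_def using tau_pos[of m] by (intro nat_mono floor_mono divide_right_mono) auto

lemma ix_compose_measurable:
  "(!!k. f k \<in> borel_measurable lebesgue) ==> (%t. f (ix m t) t :: real) \<in> borel_measurable lebesgue"
  unfolding ix_def by (rule step_compose_measurable)

text \<open>Times up to \<open>2 * T\<close> are considered, and the grid point following such a
  time lies before \<open>3 * T\<close> because \<open>tau m <= T\<close>; this is why the source is
  integrated up to \<open>3 * T\<close>.\<close>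

definition Cb :: real where "Cb = sqrt ((norm u1)\<^sup>2 + (norm g0)\<^sup>2) + 2 * tint 0 (3 * T) Fn"
definition Cu :: real where "Cu = norm u0 + 3 * T * Cb"

lemma Cb_nonneg: "0 <= Cb" unfolding Cb_def using tint_Fn_nonneg by simp

lemma en_le: assumes "real k * tau m <= 3 * T" shows "sqrt (D.en m k) <= Cb"
  using D.en_bound[of m k] tint_Fn_mono[of 0 0 "real k * tau m" "3 * T"] D.grid_mono(2)[of k m] assms
  by (simp add: Cb_def)

lemma vg_bound:
  assumes "real k * tau m <= 3 * T" shows "norm (v m k) <= Cb" "norm (g m k) <= Cb"
proof -
  have "norm (v m k) <= sqrt (D.en m k)" "norm (g m k) <= sqrt (D.en m k)"
    unfolding D.en_def by (auto intro!: real_le_rsqrt)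
  then show "norm (v m k) <= Cb" "norm (g m k) <= Cb" using en_le[OF assms] by auto
qed

lemma u_diff_bound:
  assumes "j <= k" "real k * tau m <= 3 * T"
  shows "norm (u m k - u m j) <= Cb * (real k * tau m - real j * tau m)"
  using assms
proof (induction k rule: dec_induct)
  case (step k)
  have le: "real k * tau m <= 3 * T" using D.grid_mono(1)[of k "Suc k" m] step by simp
  have "norm (u m (Suc k) - u m j) <= norm (u m k - u m j) + norm (tau m *\<^sub>R v m (Suc k))"
    using norm_triangle_ineq[of "u m k - u m j" "tau m *\<^sub>R v m (Suc k)"] by (simp add: D.u_Suc[of m k] algebra_simps)
  also have "norm (tau m *\<^sub>R v m (Suc k)) <= tau m * Cb"
    using vg_bound(1)[OF step.prems] tau_pos[of m] by (simp add: mult_left_mono)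
  also have "norm (u m k - u m j) <= Cb * (real k * tau m - real j * tau m)" using step.IH le by simp
  finally show ?case by (simp add: algebra_simps)
qed simp

lemma u_bound: assumes "real k * tau m <= 3 * T" shows "norm (u m k) <= Cu"
proof -
  have "norm (u m k - u m 0) <= Cb * (real k * tau m - real 0 * tau m)"
    using u_diff_bound[of 0 k m] assms by simp
  also have "\<dots> <= Cb * (3 * T)" using assms Cb_nonneg by (simp add: mult_left_mono)
  finally have "norm (u m k - u0) <= 3 * T * Cb" by (simp add: D.u_0[of m] mult.commute)
  then show ?thesis unfolding Cu_def using norm_triangle_sub[of "u m k" u0] by linarith
qed

lemma ix_le: assumes "0 <= t" "t < 2 * T"
  shows "real (ix m t) * tau m <= 3 * T" "real (Suc (ix m t)) * tau m <= 3 * T"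
  using ix_bounds(1)[of t m] ix_Suc_le[of t m] tau_le[of m] assms T by linarith+

text \<open>For a first component \<open>d\<close> of \<open>W t\<close> the discrete equation
  bounds the jump by a constant times \<open>sqrt (tau m)\<close>, and such components are total in
  \<open>P t\<close>. Directions outside \<open>P t\<close> are out of reach, so every later use has
  to supply a vector of the space at the very time of the jump.\<close>

lemma jump_to_0:
  assumes t: "0 <= t" "t < 2 * T" and h: "h \<in> P t"
  shows "(%m. (v m (Suc (ix m t)) - v m (ix m t)) \<bullet> h) ----> 0"
proof -
  have "(%m. (v m (Suc (ix m t)) - v m (ix m t)) \<bullet> h) ----> 0 \<bullet> h"
  proof (rule weak_tendsto_if_total[OF P(2) P(1) _ h, of "fst ` W t"])
    show "fst ` W t \<subseteq> P t" using W_P[OF t(1)] by force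
    show "s = 0" if "s \<in> P t" "!!d. d \<in> fst ` W t ==> s \<bullet> d = 0" for s
      using W_dense[OF t(1) that(1)] that(2) by force
    show "\<forall>\<^sub>F m in sequentially. norm (v m (Suc (ix m t)) - v m (ix m t)) <= Cb + Cb"
      using vg_bound(1)[OF ix_le(2)[OF t]] vg_bound(1)[OF ix_le(1)[OF t]]
      by (intro always_eventually allI order_trans[OF norm_triangle_ineq4] add_mono)
    fix d assume "d \<in> fst ` W t"
    then obtain q where dq: "(d, q) \<in> W t" by force
    have le: "norm ((v m (Suc (ix m t)) - v m (ix m t)) \<bullet> d) <= (1 + FM) * sqrt (tau m) * norm d + tau m * (Cb * norm q)" for m
    proof -
      let ?k = "ix m t"
      \<comment> \<open>The right end of the cell lies after \<open>t\<close>, so a test pair of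
        time \<open>t\<close> is admissible in the step.\<close>
      have "(d, q) \<in> W (real (Suc ?k) * tau m)"
        using W(3)[OF t(1), of "real (Suc ?k) * tau m"] ix_bounds(2)[OF t(1), of m] dq by auto
      from D.step_eq[OF this]
      have eq: "(v m (Suc ?k) - v m ?k) \<bullet> d = tau m * (y m ?k \<bullet> d) - tau m * (g m (Suc ?k) \<bullet> q)" by simp
      have "\<bar>y m ?k \<bullet> d\<bar> <= norm (y m ?k) * norm d" by (rule Cauchy_Schwarz_ineq2)
      then have "\<bar>tau m * (y m ?k \<bullet> d)\<bar> <= tau m * norm (y m ?k) * norm d"
        using tau_pos[of m] by (simp add: abs_mult)
      also have "\<dots> <= (1 + FM) * sqrt (tau m) * norm d"
      proof (rule mult_right_mono)
        have "tau m * norm (y m ?k) <= tint (real ?k * tau m) (real (Suc ?k) * tau m) Fn" by (rule D.y_norm)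
        also have "\<dots> <= (1 + FM) * sqrt (real (Suc ?k) * tau m - real ?k * tau m)"
          by (rule tint_Fn_le) (rule D.grid_mono(1), simp)
        finally show "tau m * norm (y m ?k) <= (1 + FM) * sqrt (tau m)" by (simp add: distrib_right)
      qed simp
      finally have 1: "\<bar>tau m * (y m ?k \<bullet> d)\<bar> <= (1 + FM) * sqrt (tau m) * norm d" .
      have "\<bar>g m (Suc ?k) \<bullet> q\<bar> <= norm (g m (Suc ?k)) * norm q" by (rule Cauchy_Schwarz_ineq2)
      also have "\<dots> <= Cb * norm q" by (rule mult_right_mono[OF vg_bound(2)[OF ix_le(2)[OF t]]]) simp
      finally have "\<bar>tau m * (g m (Suc ?k) \<bullet> q)\<bar> <= tau m * (Cb * norm q)"
        using tau_pos[of m] by (simp add: abs_mult)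
      then show ?thesis using 1 unfolding eq real_norm_def by linarith
    qed
    have "(%m. (1 + FM) * sqrt (tau m) * norm d + tau m * (Cb * norm q)) ----> (1 + FM) * 0 * norm d + 0 * (Cb * norm q)"
      by (intro tendsto_intros sqrt_tau_tendsto tau_tendsto)
    then have "(%m. (1 + FM) * sqrt (tau m) * norm d + tau m * (Cb * norm q)) ----> 0" by simp
    then have "(%m. (v m (Suc (ix m t)) - v m (ix m t)) \<bullet> d) ----> 0"
      by (rule Lim_null_comparison[rotated]) (use le in simp)
    then show "(%m. (v m (Suc (ix m t)) - v m (ix m t)) \<bullet> d) ----> 0 \<bullet> d" by simp
  qed
  then show ?thesis by simp
qed

text \<open>Sum of the discrete equations over the cells from \<open>j\<close> to \<open>k\<close>.
  It is enough that the test pair is admissible in the first of these steps, as the later graphs are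
  larger.\<close>

lemma v_diff_eq:
  assumes "(\<phi>, q) \<in> W (real (Suc j) * tau m)" "j <= k" "real k * tau m <= 3 * T"
  shows "(v m k - v m j) \<bullet> \<phi> = tint (real j * tau m) (real k * tau m) (%r. Fs r \<bullet> \<phi> - g m (Suc (ix m r)) \<bullet> q)"
proof -
  let ?H = "%r. Fs r \<bullet> \<phi> - g m (Suc (ix m r)) \<bullet> q"
  have one: "tintegrable (real i * tau m) (real (Suc i) * tau m) ?H \<and>
    tint (real i * tau m) (real (Suc i) * tau m) ?H = (v m (Suc i) - v m i) \<bullet> \<phi>" if "j <= i" for i
  proof -
    let ?a = "real i * tau m" and ?b = "real (Suc i) * tau m"
    have mem: "(\<phi>, q) \<in> W ?b"
      using assms(1) W(3)[OF D.grid_mono(2) D.grid_mono(1)[of "Suc j" "Suc i" m]] that by auto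
    have eq: "?H r = Fs r \<bullet> \<phi> - g m (Suc i) \<bullet> q" if "?a <= r" "r < ?b" for r
      using step_index_eq[OF tau_pos that] by (simp add: ix_def)
    have i: "tintegrable ?a ?b (%r. Fs r \<bullet> \<phi> - g m (Suc i) \<bullet> q)"
      by (intro set_integral_diff(1) Fs_tintegrable tintegrable_const)
    have "tint ?a ?b ?H = tint ?a ?b (%r. Fs r \<bullet> \<phi> - g m (Suc i) \<bullet> q)" by (rule tint_cong[OF eq])
    also have "\<dots> = tau m * (y m i \<bullet> \<phi>) - (?b - ?a) * (g m (Suc i) \<bullet> q)"
      unfolding D.y_avg using D.grid_mono(1)[of i "Suc i" m]
      by (simp add: tint_diff Fs_tintegrable tintegrable_const tint_const)
    also have "?b - ?a = tau m" by (simp add: distrib_right)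
    finally have "tint ?a ?b ?H = (v m (Suc i) - v m i) \<bullet> \<phi>" using D.step_eq[OF mem] by simp
    moreover have "tintegrable ?a ?b ?H = tintegrable ?a ?b (%r. Fs r \<bullet> \<phi> - g m (Suc i) \<bullet> q)"
      by (rule set_integrable_cong) (use eq in auto)
    ultimately show ?thesis using i by simp
  qed
  have "tintegrable (real j * tau m) (real k * tau m) ?H \<and>
    tint (real j * tau m) (real k * tau m) ?H = (v m k - v m j) \<bullet> \<phi>"
    using assms(2)
  proof (induction k rule: dec_induct)
    case base then show ?case by (simp add: tint_empty set_integrable_def)
  next
    case (step k)
    let ?a = "real j * tau m" and ?b = "real k * tau m" and ?c = "real (Suc k) * tau m"
    have ab: "?a <= ?b" "?b <= ?c" using D.grid_mono(1)[of j k m] D.grid_mono(1)[of k "Suc k" m] step by auto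
    have "{?a..<?c} = {?a..<?b} \<union> {?b..<?c}" using ab by auto
    then have i: "tintegrable ?a ?c ?H" using step.IH one[of k] step.hyps by (auto intro: set_integrable_Un)
    then show ?case using tint_combine[OF ab i] step.IH one[of k] step.hyps by (simp add: inner_diff_left)
  qed
  then show ?thesis by simp
qed

end

section \<open>Limits of the convex combinations at almost every time\<close>

locale evolution_limit = evolution_seq +
  fixes N :: "nat => nat" and l :: "nat => nat => real" and A B :: "real \<times> 'a => real" and G D :: "real \<times> 'a => 'a"
  assumes wts: "!!n. tail_weights n (N n) (l n)"
    and sq: "sqint A" "sqint B" "sqint G" "sqint D"
    and lim_A: "AE t in lebesgue. t \<in> {0..<2*T} --> (%n. \<Sum>m\<le>N n. l n m *\<^sub>R u m (ix m t)) ----> slice A t"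
    and lim_B: "AE t in lebesgue. t \<in> {0..<2*T} --> (%n. \<Sum>m\<le>N n. l n m *\<^sub>R v m (ix m t)) ----> slice B t"
    and lim_G: "AE t in lebesgue. t \<in> {0..<2*T} --> (%n. \<Sum>m\<le>N n. l n m *\<^sub>R g m (ix m t)) ----> slice G t"
    and lim_D: "AE t in lebesgue. t \<in> {0..<2*T} --> (%n. \<Sum>m\<le>N n. l n m *\<^sub>R g m (Suc (ix m t))) ----> slice D t"
begin

definition avg :: "nat => (nat => 'b::real_vector) => 'b" where
  "avg n X = (\<Sum>m\<le>N n. l n m *\<^sub>R X m)"

lemma avg_tendsto: "X ----> (x::'b::real_normed_vector) ==> (%n. avg n X) ----> x"
  unfolding avg_def by (rule tendsto_convex_sum[OF wts])

lemma avg_bound: "(!!m. n <= m ==> norm (X m :: 'b::real_normed_vector) <= C) ==> norm (avg n X) <= C"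
  unfolding avg_def by (rule norm_convex_sum_le[OF wts])

lemma avg_inner: "avg n X \<bullet> h = avg n (%m. X m \<bullet> h)"
  by (simp add: avg_def inner_sum_left)

lemma avg_add: "avg n (%m. X m + Y m) = avg n X + avg n Y"
  by (simp add: avg_def scaleR_add_right sum.distrib)

lemma avg_diff: "avg n (%m. X m - Y m) = avg n X - avg n Y"
  by (simp add: avg_def scaleR_diff_right sum_subtractf)

lemma avg_const: "avg n (%m. c) = c"
  using wts[of n] by (simp add: avg_def scaleR_sum_left[symmetric] tail_weights_def)

lemma avg_mono: "(!!m. X m <= (Y m :: real)) ==> avg n X <= avg n Y"
  unfolding avg_def using wts[of n] by (auto intro!: sum_mono mult_left_mono simp: tail_weights_def)

text \<open>Linearity of the integral; stated for all indices because the weights range over an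
  initial segment of them.\<close>

lemma avg_tint:
  assumes "!!m. tintegrable a b (X m)"
  shows "avg n (%m. tint a b (X m)) = tint a b (%t. avg n (%m. X m t))"
proof -
  have "(\<Sum>m\<le>k. c m * tint a b (X m)) = tint a b (%t. \<Sum>m\<le>k. c m * X m t) \<and> tintegrable a b (%t. \<Sum>m\<le>k. c m * X m t)"
    for k :: nat and c :: "nat => real"
  proof (induction k)
    case 0 then show ?case using assms by (simp add: tint_cmult)
  next
    case (Suc k)
    then show ?case using assms by (simp add: tint_add tint_cmult)
  qed
  then show ?thesis by (simp add: avg_def)
qed

lemma avg_measurable: "(!!m. X m \<in> borel_measurable lebesgue) ==> (%t. avg n (%m. X m t) :: real) \<in> borel_measurable lebesgue"
  unfolding avg_def by measurable

text \<open>The gradients at the right grid points are deliberately left out, so that 0 is good: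
  there the three sequences are constantly equal to the initial data, whereas nothing is known about
  the first step.\<close>

definition good :: "real => bool" where
  "good t \<longleftrightarrow> 0 <= t \<and> t < 2 * T \<and> convergent (%n. avg n (%m. u m (ix m t)))
    \<and> convergent (%n. avg n (%m. v m (ix m t))) \<and> convergent (%n. avg n (%m. g m (ix m t)))"

definition U where "U t = lim (%n. avg n (%m. u m (ix m t)))"
definition V where "V t = lim (%n. avg n (%m. v m (ix m t)))"
definition Z where "Z t = lim (%n. avg n (%m. g m (ix m t)))"

lemma good_lims:
  assumes "good t"
  shows "(%n. avg n (%m. u m (ix m t))) ----> U t" "(%n. avg n (%m. v m (ix m t))) ----> V t"
    "(%n. avg n (%m. g m (ix m t))) ----> Z t"
  using assms by (auto simp: good_def U_def V_def Z_def convergent_LIMSEQ_iff)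

lemma good_range: "good t ==> 0 <= t" "good t ==> t < 2 * T"
  by (auto simp: good_def)

lemma good_0: "good 0" "U 0 = u0" "V 0 = u1" "Z 0 = g0"
proof -
  have e: "(%n. avg n (%m. u m (ix m 0))) = (%n. u0)" "(%n. avg n (%m. v m (ix m 0))) = (%n. u1)"
    "(%n. avg n (%m. g m (ix m 0))) = (%n. g0)"
    by (simp_all add: ix_0 D.u_0 D.v_0 D.g_0 avg_const)
  show "good 0" "U 0 = u0" "V 0 = u1" "Z 0 = g0"
    using T by (simp_all add: good_def U_def V_def Z_def e convergent_const)
qed

lemma AE_good: "AE t in lebesgue. t \<in> {0..<2*T} --> good t \<and> U t = slice A t \<and> V t = slice B t"
  using lim_A lim_B lim_G
proof eventually_elim
  case (elim t)
  show ?case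
  proof
    assume t: "t \<in> {0..<2*T}"
    then have "(%n. avg n (%m. u m (ix m t))) ----> slice A t" "(%n. avg n (%m. v m (ix m t))) ----> slice B t"
      "(%n. avg n (%m. g m (ix m t))) ----> slice G t"
      using elim by (auto simp: avg_def)
    then show "good t \<and> U t = slice A t \<and> V t = slice B t"
      using t by (auto simp: good_def U_def V_def convergent_def limI)
  qed
qed

lemma good_dense: assumes "0 <= a" "a < b" "b <= 2 * T" shows "\<exists>t. good t \<and> a < t \<and> t < b"
proof (rule ccontr)
  assume "\<not> ?thesis"
  then have no: "\<not> good t" if "a < t" "t < b" for t using that by blast
  have "AE t in lebesgue. t \<notin> {a<..<b}"
    using AE_good by eventually_elim (use no assms in auto)
  then have "{a<..<b} \<in> null_sets lebesgue" by (subst completion.null_sets_iff_AE) auto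
  then have "negligible {a<..<b}" by (simp add: negligible_iff_null_sets)
  then show False using open_not_negligible[of "{a<..<b}"] assms(2) by auto
qed

text \<open>Interpolation from the left pays off: \<open>real (ix m t) * tau m <= t\<close> puts
  every term, hence every convex combination and its limit, into the closed spaces at
  \<open>t\<close> and not merely into larger ones.\<close>

lemma good_props:
  assumes t: "good t"
  shows "(U t, Z t) \<in> W t" "V t \<in> P t" "norm (V t) <= Cb" "norm (Z t) <= Cb" "norm (U t) <= Cu"
proof -
  have t0: "0 <= t" "t < 2 * T" using t by (auto simp: good_def)
  have le: "real (ix m t) * tau m <= t" for m using ix_bounds(1)[OF t0(1)] .
  have "(u m (ix m t), g m (ix m t)) \<in> W t" for m
    using D.ug_W[of m] W(3)[OF D.grid_mono(2) le] by blast
  then have "avg n (%m. (u m (ix m t), g m (ix m t))) \<in> W t" for n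
    unfolding avg_def by (intro convex_sum_in_subspace[OF W(2) wts])
  moreover have "avg n (%m. (u m (ix m t), g m (ix m t))) = (avg n (%m. u m (ix m t)), avg n (%m. g m (ix m t)))" for n
    by (simp add: avg_def prod_eq_iff fst_sum snd_sum)
  ultimately have "(avg n (%m. u m (ix m t)), avg n (%m. g m (ix m t))) \<in> W t" for n by simp
  then show "(U t, Z t) \<in> W t"
    by (intro closed_sequentially[OF W(1) _ tendsto_Pair[OF good_lims(1,3)[OF t]]]) blast
  have "v m (ix m t) \<in> P t" for m
    using D.v_P[of m] P(3)[OF D.grid_mono(2) le] by blast
  then have "avg n (%m. v m (ix m t)) \<in> P t" for n
    unfolding avg_def by (intro convex_sum_in_subspace[OF P(2) wts])
  then show "V t \<in> P t" by (intro closed_sequentially[OF P(1) _ good_lims(2)[OF t]]) blast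
  show "norm (V t) <= Cb"
    using vg_bound(1)[OF ix_le(1)[OF t0]] by (intro LIMSEQ_le_const2[OF tendsto_norm[OF good_lims(2)[OF t]]] exI[of _ 0] allI impI avg_bound)
  show "norm (Z t) <= Cb"
    using vg_bound(2)[OF ix_le(1)[OF t0]] by (intro LIMSEQ_le_const2[OF tendsto_norm[OF good_lims(3)[OF t]]] exI[of _ 0] allI impI avg_bound)
  show "norm (U t) <= Cu"
    using u_bound[OF ix_le(1)[OF t0]] by (intro LIMSEQ_le_const2[OF tendsto_norm[OF good_lims(1)[OF t]]] exI[of _ 0] allI impI avg_bound)
qed

text \<open>Rounding to the grid costs at most one step, and in the n-th combination every step size
  is at most \<open>tau n\<close>, so the excess disappears in the limit.\<close>

lemma U_lipschitz:
  assumes s: "good s" and t: "good t" and st: "s <= t"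
  shows "norm (U t - U s) <= Cb * (t - s)"
proof -
  have r: "0 <= s" "0 <= t" "t < 2 * T" using s t by (auto simp: good_def)
  have b: "norm (u m (ix m t) - u m (ix m s)) <= Cb * (t - s + tau n)" if "n <= m" for n m
  proof -
    have "norm (u m (ix m t) - u m (ix m s)) <= Cb * (real (ix m t) * tau m - real (ix m s) * tau m)"
      by (rule u_diff_bound[OF ix_mono[OF st] ix_le(1)[OF r(2,3)]])
    also have "\<dots> <= Cb * (t - s + tau n)"
      using ix_bounds(1)[OF r(2), of m] ix_bounds(2)[OF r(1), of m] tau_antimono[OF that]
      by (intro mult_left_mono Cb_nonneg) (simp add: distrib_right)
    finally show ?thesis .
  qed
  have "(%n. norm (avg n (%m. u m (ix m t)) - avg n (%m. u m (ix m s)))) ----> norm (U t - U s)"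
    by (intro tendsto_intros good_lims s t)
  moreover have "(%n. Cb * (t - s + tau n)) ----> Cb * (t - s + 0)"
    by (intro tendsto_intros tau_tendsto)
  ultimately have "norm (U t - U s) <= Cb * (t - s + 0)"
    using b unfolding avg_diff[symmetric] by (intro LIMSEQ_le[of _ _ "%n. Cb * (t - s + tau n)"]) (auto intro!: avg_bound)
  then show ?thesis by simp
qed

text \<open>Positions at the two ends of a cell differ by a step times a bounded velocity, so their
  combinations have the same limit. Both limiting gradients then belong to one position inside
  \<open>W (3 * T)\<close>, and a graph is single valued.\<close>

lemma AE_D_eq: "AE t in lebesgue. t \<in> {0..<2*T} --> slice D t = Z t"
  using AE_good lim_D
proof eventually_elim
  case (elim t)
  show ?case
  proof
    assume t: "t \<in> {0..<2*T}"
    then have gt: "good t" and lD: "(%n. avg n (%m. g m (Suc (ix m t)))) ----> slice D t"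
      using elim by (auto simp: avg_def)
    have t0: "0 <= t" "t < 2 * T" "0 <= 3 * T" "t <= 3 * T" using t T by auto
    have "(%m. u m (Suc (ix m t)) - u m (ix m t)) ----> 0"
    proof (rule Lim_null_comparison)
      show "\<forall>\<^sub>F m in sequentially. norm (u m (Suc (ix m t)) - u m (ix m t)) <= tau m * Cb"
        using vg_bound(1)[OF ix_le(2)[OF t0(1,2)]] tau_pos
        by (auto intro!: always_eventually mult_left_mono simp: D.u_Suc less_imp_le)
      show "(%m. tau m * Cb) ----> 0" using tendsto_mult[OF tau_tendsto tendsto_const[of Cb]] by simp
    qed
    from tendsto_add[OF good_lims(1)[OF gt] avg_tendsto[OF this]]
    have lU: "(%n. avg n (%m. u m (Suc (ix m t)))) ----> U t"
      unfolding avg_add[symmetric] by simp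
    have "(u m (Suc (ix m t)), g m (Suc (ix m t))) \<in> W (3 * T)" for m
      using D.ug_W[of m] W(3)[OF D.grid_mono(2) ix_le(2)[OF t0(1,2)]] by blast
    then have "avg n (%m. (u m (Suc (ix m t)), g m (Suc (ix m t)))) \<in> W (3 * T)" for n
      unfolding avg_def by (intro convex_sum_in_subspace[OF W(2) wts])
    moreover have "avg n (%m. (u m (Suc (ix m t)), g m (Suc (ix m t))))
        = (avg n (%m. u m (Suc (ix m t))), avg n (%m. g m (Suc (ix m t))))" for n
      by (simp add: avg_def prod_eq_iff fst_sum snd_sum)
    ultimately have "(avg n (%m. u m (Suc (ix m t))), avg n (%m. g m (Suc (ix m t)))) \<in> W (3 * T)" for n by simp
    then have "(U t, slice D t) \<in> W (3 * T)"
      by (intro closed_sequentially[OF W(1) _ tendsto_Pair[OF lU lD]]) blast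
    moreover have "(U t, Z t) \<in> W (3 * T)" using good_props(1)[OF gt] W(3)[OF t0(1,4)] by blast
    ultimately have "(U t, slice D t) - (U t, Z t) \<in> W (3 * T)" using W(2) by (intro subspace_diff)
    then have "(0, slice D t - Z t) \<in> W (3 * T)" by simp
    then have "slice D t - Z t = 0" by (rule W_single[OF t0(3)])
    then show "slice D t = Z t" by simp
  qed
qed

end

text \<open>Integration by parts for an absolutely continuous \<open>z\<close> against the weight
  \<open>s - a\<close>: Fubini's theorem on the triangle below the diagonal.\<close>

lemma tint_by_parts:
  assumes ab: "a <= b" and z: "!!s. a <= s ==> s <= b ==> z s = z a + tint a s z'" and i: "tintegrable a b z'"
  shows "tint a b z = (b - a) * z b - tint a b (%s. (s - a) * z' s)"
proof -
  have "(%s. indicator {a..<b} s *\<^sub>R z' s) \<in> borel_measurable lebesgue"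
    using i unfolding set_integrable_def by (rule borel_measurable_integrable)
  \<comment> \<open>A Borel version of the derivative, since Fubini is applied to a product of
    \<open>lborel\<close> measures.\<close>
  then obtain w where w[measurable]: "w \<in> borel_measurable borel" and wz: "AE s in lborel. indicator {a..<b} s *\<^sub>R z' s = w s"
    using completion_ex_borel_measurable_real by (metis measurable_lborel2)
  have wz': "AE s in lebesgue. w s = indicator {a..<b} s *\<^sub>R z' s"
    unfolding AE_completion_iff using wz by eventually_elim simp
  have ml: "w \<in> borel_measurable lebesgue" by (intro measurable_completion) simp
  have "integrable lebesgue w"
    using i wz' ml unfolding set_integrable_def by (subst integrable_cong_AE[OF ml _ wz']) (auto intro: borel_measurable_integrable)
  then have wi: "integrable lborel w" by (simp add: integrable_completion)
  have tw: "tint a s (%r. c r * z' r) = (\<integral>r. w r * (c r * indicator {a..<s} r) \<partial>lborel)"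
    if "s <= b" "c \<in> borel_measurable borel" for s c
  proof -
    have [measurable]: "c \<in> borel_measurable borel" by fact
    have mw: "(%r. w r * (c r * indicator {a..<s} r)) \<in> borel_measurable borel" by measurable
    have "AE r in lebesgue. w r * (c r * indicator {a..<s} r) = indicator {a..<s} r *\<^sub>R (c r * z' r)"
      using wz' by eventually_elim (use that in \<open>auto simp: indicator_def\<close>)
    moreover have "(%r. w r * (c r * indicator {a..<s} r)) \<in> borel_measurable lebesgue"
      by (intro measurable_completion) (use mw in simp)
    ultimately have "(\<integral>r. w r * (c r * indicator {a..<s} r) \<partial>lebesgue) = tint a s (%r. c r * z' r)"
      unfolding tint_def set_lebesgue_integral_def by (intro integral_cong_AE) (auto intro: borel_measurable_AE)
    then show ?thesis using mw by (simp add: integral_completion)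
  qed
  have tw1: "tint a s z' = (\<integral>r. w r * indicator {a..<s} r \<partial>lborel)" if "s <= b" for s
    using tw[OF that, of "%_. 1"] by simp
  \<comment> \<open>The integrand on the triangle of pairs \<open>r < s\<close>; integrating in
    \<open>r\<close> gives \<open>z s - z a\<close>, integrating in \<open>s\<close> gives the
    factor \<open>b - r\<close>.\<close>
  define f where "f = (%s r. indicator {a..<b} s * (indicator {a..<s} r * w r) :: real)"
  have mf[measurable]: "(%p. f (fst p) (snd p)) \<in> borel_measurable (lborel \<Otimes>\<^sub>M lborel)"
  proof -
    have "(%p::real\<times>real. f (fst p) (snd p)) = (%p. indicator {p. a <= fst p \<and> fst p < b \<and> a <= snd p \<and> snd p < fst p} p * w (snd p))"
      by (auto simp: f_def indicator_def)
    moreover have "(%p::real\<times>real. indicator {p. a <= fst p \<and> fst p < b \<and> a <= snd p \<and> snd p < fst p} p * w (snd p)) \<in> borel_measurable (lborel \<Otimes>\<^sub>M lborel)"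
      by measurable
    ultimately show ?thesis by simp
  qed
  have fle: "\<bar>f s r\<bar> <= indicator {a..<b} s * \<bar>w r\<bar>" for s r by (auto simp: f_def indicator_def)
  have fi: "integrable (lborel \<Otimes>\<^sub>M lborel) (%(s, r). f s r)"
  proof (rule Bochner_Integration.integrable_bound)
    show "integrable (lborel \<Otimes>\<^sub>M lborel) (%p. indicator {a..<b} (fst p) * \<bar>w (snd p)\<bar> :: real)"
    proof (rule lborel_pair.Fubini_integrable)
      show "(%p. indicator {a..<b} (fst p) * \<bar>w (snd p)\<bar> :: real) \<in> borel_measurable (lborel \<Otimes>\<^sub>M lborel)" by measurable
      have "integrable lborel (%x. indicator {a..<b} x * (\<integral>r. \<bar>w r\<bar> \<partial>lborel) :: real)"
        using ab by (intro integrable_mult_left integrable_real_indicator) auto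
      then show "integrable lborel (%x. \<integral>y. norm (indicator {a..<b} (fst (x, y)) * \<bar>w (snd (x, y))\<bar> :: real) \<partial>lborel)"
        by (simp add: abs_mult)
      show "AE x in lborel. integrable lborel (%y. indicator {a..<b} (fst (x, y)) * \<bar>w (snd (x, y))\<bar> :: real)"
        using wi by simp
    qed
    show "(%(s, r). f s r) \<in> borel_measurable (lborel \<Otimes>\<^sub>M lborel)" using mf by (simp add: case_prod_beta')
    show "AE p in lborel \<Otimes>\<^sub>M lborel. norm (case p of (s, r) => f s r) <= norm (indicator {a..<b} (fst p) * \<bar>w (snd p)\<bar> :: real)"
      using fle by (auto simp: case_prod_beta' abs_mult)
  qed
  have zs: "z s = z a + (\<integral>r. indicator {a..<s} r * w r \<partial>lborel)" if "a <= s" "s <= b" for s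
    using z[OF that] tw1[OF that(2)] by (simp add: mult.commute)
  have inner: "(\<integral>r. f s r \<partial>lborel) = indicator {a..<b} s * (z s - z a)" for s
    unfolding f_def using zs[of s] by (auto simp: indicator_def)
  have gi: "integrable lborel (%s. indicator {a..<b} s * (z s - z a))"
    using lborel_pair.integrable_fst[OF fi] by (simp add: inner)
  have "tint a b z = tint a b (%s. z a + (z s - z a))" by simp
  also have "\<dots> = (b - a) * z a + tint a b (%s. z s - z a)"
  proof (subst tint_add)
    show "tintegrable a b (%s. z s - z a)" unfolding set_integrable_def
      using gi by (simp add: integrable_completion borel_measurable_integrable)
  qed (use ab in \<open>auto simp: tintegrable_const tint_const\<close>)
  also have "tint a b (%s. z s - z a) = (\<integral>s. indicator {a..<b} s * (z s - z a) \<partial>lborel)"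
    unfolding tint_def set_lebesgue_integral_def using gi by (simp add: integral_completion borel_measurable_integrable)
  also have "\<dots> = (\<integral>s. \<integral>r. f s r \<partial>lborel \<partial>lborel)" by (simp add: inner)
  also have "\<dots> = (\<integral>r. \<integral>s. f s r \<partial>lborel \<partial>lborel)"
    by (rule lborel_pair.Fubini_integral[OF fi, symmetric])
  also have "\<dots> = (\<integral>r. w r * ((b - r) * indicator {a..<b} r) \<partial>lborel)"
  proof (intro Bochner_Integration.integral_cong refl)
    fix r
    have "(\<integral>s. f s r \<partial>lborel) = (\<integral>s. (w r * indicator {a..<b} r) * indicator {r<..<b} s \<partial>lborel)"
      by (intro Bochner_Integration.integral_cong) (auto simp: f_def indicator_def)
    also have "\<dots> = w r * indicator {a..<b} r * measure lborel {r<..<b}" by simp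
    also have "\<dots> = w r * ((b - r) * indicator {a..<b} r)" by (auto simp: indicator_def)
    finally show "(\<integral>s. f s r \<partial>lborel) = w r * ((b - r) * indicator {a..<b} r)" .
  qed
  also have "\<dots> = tint a b (%r. (b - r) * z' r)" by (rule tw[symmetric]) auto
  also have "\<dots> = tint a b (%r. (b - a) * z' r - (r - a) * z' r)" by (simp add: algebra_simps)
  also have "\<dots> = (b - a) * tint a b z' - tint a b (%r. (r - a) * z' r)"
  proof (subst tint_diff)
    have "integrable lebesgue (%r. indicator {a..<b} r *\<^sub>R ((r - a) * z' r))"
    proof (rule Bochner_Integration.integrable_bound)
      show "integrable lebesgue (%r. (b - a) * (indicator {a..<b} r *\<^sub>R z' r))"
        using i by (simp add: set_integrable_def)
      have "(%r. (r - a) * (indicator {a..<b} r *\<^sub>R z' r)) \<in> borel_measurable lebesgue"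
      proof (intro borel_measurable_times)
        show "(%r. r - a) \<in> borel_measurable lebesgue" by (intro measurable_completion) simp
        show "(%r. indicator {a..<b} r *\<^sub>R z' r) \<in> borel_measurable lebesgue"
          using i unfolding set_integrable_def by (rule borel_measurable_integrable)
      qed
      then show "(%r. indicator {a..<b} r *\<^sub>R ((r - a) * z' r)) \<in> borel_measurable lebesgue" by (simp add: mult_ac)
      show "AE r in lebesgue. norm (indicator {a..<b} r *\<^sub>R ((r - a) * z' r)) <= norm ((b - a) * (indicator {a..<b} r *\<^sub>R z' r))"
        by (rule AE_I2) (auto simp: indicator_def abs_mult intro!: mult_right_mono)
    qed
    then show "tintegrable a b (%r. (r - a) * z' r)" by (simp add: set_integrable_def)
  qed (use i in \<open>auto simp: tint_cmult\<close>)
  also have "(b - a) * tint a b z' = (b - a) * (z b - z a)" using z[of b] ab by simp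
  finally show ?thesis by (simp add: algebra_simps)
qed

context evolution
begin

text \<open>An absolutely continuous curve vanishing at both ends, with its derivative understood in
  the weak sense. The majorant \<open>b\<close> is a separate parameter because the same function
  must also be able to dominate the gradients of the test curve.\<close>

definition curve :: "(real => ('x, real) l2) => (real => ('x, real) l2) => (real => real) => bool" where
  "curve E Ed b \<longleftrightarrow> continuous_on {0..T} E \<and> E 0 = 0 \<and> E T = 0 \<and>
    (\<forall>h. (%s. E s \<bullet> h) \<in> borel_measurable lebesgue) \<and> (\<forall>h. (%s. Ed s \<bullet> h) \<in> borel_measurable lebesgue) \<and>
    tintegrable 0 T b \<and> (AE s in lebesgue. s \<in> {0..<T} --> norm (Ed s) <= b s) \<and>
    (\<forall>h s t. 0 <= s --> s <= t --> t <= T --> (E t - E s) \<bullet> h = tint s t (%r. Ed r \<bullet> h))"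

lemma tint_small:
  assumes ab: "a <= b" and X: "X \<in> borel_measurable lebesgue" and c: "0 <= c" "0 <= d"
    and bd: "AE r in lebesgue. r \<in> {a..<b} --> \<bar>X r\<bar> <= Fn r * c + d"
  shows "tintegrable a b X" "\<bar>tint a b X\<bar> <= c * ((1 + FM) * sqrt (b - a)) + d * (b - a)"
proof -
  have i: "tintegrable a b (%r. Fn r * c + d)"
    by (intro set_integral_add(1) set_integrable_mult_left Fn_tintegrable tintegrable_const)
  show X': "tintegrable a b X" by (rule tintegrable_bound[OF i X bd])
  have "\<bar>tint a b X\<bar> <= tint a b (%r. Fn r * c + d)" by (rule tint_abs_le[OF X' i bd])
  also have "\<dots> = c * tint a b Fn + (b - a) * d"
    using ab Fn_tintegrable[of a b] by (simp add: tint_add tintegrable_const tint_const tint_cmult mult.commute[of _ c])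
  also have "\<dots> <= c * ((1 + FM) * sqrt (b - a)) + d * (b - a)"
    using mult_left_mono[OF tint_Fn_le[OF ab] c(1)] by (simp add: mult.commute)
  finally show "\<bar>tint a b X\<bar> <= c * ((1 + FM) * sqrt (b - a)) + d * (b - a)" .
qed

end

context evolution_limit
begin

text \<open>A bound uniform in \<open>m\<close> passes to convex combinations, so dominated
  convergence applies although the functions \<open>X m\<close> themselves need not
  converge.\<close>

lemma avg_tint_tendsto:
  assumes X: "!!m. X m \<in> borel_measurable lebesgue" and w: "tintegrable a b w"
    and bd: "!!m. AE r in lebesgue. r \<in> {a..<b} --> \<bar>X m r\<bar> <= w r"
    and lim: "AE r in lebesgue. r \<in> {a..<b} --> (%n. avg n (%m. X m r)) ----> Y r"
  shows "tintegrable a b Y" "(%n. avg n (%m. tint a b (X m))) ----> tint a b Y"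
proof -
  have bda: "AE r in lebesgue. \<forall>m. r \<in> {a..<b} --> \<bar>X m r\<bar> <= w r"
    by (subst AE_all_countable) (use bd in blast)
  have bd': "AE r in lebesgue. r \<in> {a..<b} --> \<bar>avg n (%m. X m r)\<bar> <= w r" for n
    using bda
  proof eventually_elim
    case (elim r)
    then show ?case using avg_bound[of n "%m. X m r" "w r"] by auto
  qed
  note dc = tint_dominated_convergence[OF avg_measurable[OF X] w lim bd']
  show "tintegrable a b Y" by (rule dc(1))
  have "tintegrable a b (X m)" for m by (rule tintegrable_bound[OF w X bd])
  then show "(%n. avg n (%m. tint a b (X m))) ----> tint a b Y"
    using dc(2) by (simp add: avg_tint)
qed

lemma tint_null_tendsto:
  assumes X: "!!m. X m \<in> borel_measurable lebesgue" and w: "tintegrable a b w"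
    and bd: "!!m. AE r in lebesgue. r \<in> {a..<b} --> \<bar>X m r\<bar> <= w r"
    and lim: "AE r in lebesgue. r \<in> {a..<b} --> (%m. X m r) ----> 0"
  shows "(%m. tint a b (X m)) ----> 0"
  using tint_dominated_convergence(2)[OF X w lim bd] by (simp add: tint_def)

lemma AE_D_bound: "AE t in lebesgue. t \<in> {0..<2*T} --> norm (slice D t) <= Cb"
  using AE_D_eq AE_good by eventually_elim (auto simp: good_props)

lemma H_measurable: "(%r. Fs r \<bullet> \<phi> - slice D r \<bullet> q) \<in> borel_measurable lebesgue"
  by (intro borel_measurable_diff Fs_measurable slice_inner_measurable sq)

lemma inner_bound: "norm x <= c ==> \<bar>x \<bullet> h\<bar> <= c * norm h"
  using Cauchy_Schwarz_ineq2[of x h] mult_right_mono[of "norm x" c "norm h"] by auto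

lemma H_bound: "AE r in lebesgue. r \<in> {0..<2*T} --> \<bar>Fs r \<bullet> \<phi> - slice D r \<bullet> q\<bar> <= Fn r * norm \<phi> + Cb * norm q"
  using AE_D_bound
proof eventually_elim
  case (elim r)
  then show ?case using inner_bound[of "slice D r" Cb q] Fs_inner_le[of r \<phi>] by auto
qed

lemma H_tint:
  assumes "0 <= a" "a <= b" "b <= 2 * T"
  shows "tintegrable a b (%r. Fs r \<bullet> \<phi> - slice D r \<bullet> q)"
    "\<bar>tint a b (%r. Fs r \<bullet> \<phi> - slice D r \<bullet> q)\<bar> <= norm \<phi> * ((1 + FM) * sqrt (b - a)) + Cb * norm q * (b - a)"
proof -
  have "AE r in lebesgue. r \<in> {a..<b} --> \<bar>Fs r \<bullet> \<phi> - slice D r \<bullet> q\<bar> <= Fn r * norm \<phi> + Cb * norm q"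
    using H_bound[of \<phi> q] by eventually_elim (use assms in auto)
  from tint_small[OF assms(2) H_measurable _ _ this] Cb_nonneg
  show "tintegrable a b (%r. Fs r \<bullet> \<phi> - slice D r \<bullet> q)"
    "\<bar>tint a b (%r. Fs r \<bullet> \<phi> - slice D r \<bullet> q)\<bar> <= norm \<phi> * ((1 + FM) * sqrt (b - a)) + Cb * norm q * (b - a)"
    by auto
qed

text \<open>The limit of the summed discrete equation. Its end points are the grid points left of
  \<open>s\<close> and \<open>t\<close>, and correcting this costs integrals over two pieces no
  longer than one step, which are of order \<open>sqrt (tau m)\<close>.\<close>

lemma V_diff:
  assumes st: "good s" "good t" "s <= t" and tb: "0 <= tb" "tb <= s" and \<phi>: "(\<phi>, q) \<in> W tb"
  shows "(V t - V s) \<bullet> \<phi> = tint s t (%r. Fs r \<bullet> \<phi> - slice D r \<bullet> q)"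
proof -
  have r: "0 <= s" "0 <= t" "t < 2 * T" "s < 2 * T" using st by (auto simp: good_def)
  define X where "X m r = Fs r \<bullet> \<phi> - g m (Suc (ix m r)) \<bullet> q" for m r
  have Xm: "X m \<in> borel_measurable lebesgue" for m
    unfolding X_def by (intro borel_measurable_diff Fs_measurable ix_compose_measurable[of "%k t. g m (Suc k) \<bullet> q"]) simp
  have Xb: "\<bar>X m r\<bar> <= Fn r * norm \<phi> + Cb * norm q" if "0 <= r" "r < 2 * T" for m r
    using inner_bound[OF vg_bound(2)[OF ix_le(2)[OF that]], of m q] Fs_inner_le[of r \<phi>] by (simp add: X_def)
  have small: "tintegrable a b (X m) \<and> \<bar>tint a b (X m)\<bar> <= norm \<phi> * ((1 + FM) * sqrt (b - a)) + Cb * norm q * (b - a)"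
    if "0 <= a" "a <= b" "b < 2 * T" for a b m
  proof -
    have "AE r in lebesgue. r \<in> {a..<b} --> \<bar>X m r\<bar> <= Fn r * norm \<phi> + Cb * norm q"
      using Xb[of _ m] that by (intro AE_I2) auto
    from tint_small[OF that(2) Xm _ _ this] Cb_nonneg show ?thesis by auto
  qed
  define \<epsilon> where "\<epsilon> m = norm \<phi> * ((1 + FM) * sqrt (tau m)) + Cb * norm q * tau m" for m
  have e0: "\<epsilon> ----> 0"
  proof -
    have "\<epsilon> ----> norm \<phi> * ((1 + FM) * 0) + Cb * norm q * 0"
      unfolding \<epsilon>_def by (intro tendsto_intros sqrt_tau_tendsto tau_tendsto)
    then show ?thesis by simp
  qed
  have smalle: "\<bar>tint a b (X m)\<bar> <= \<epsilon> m" if "0 <= a" "a <= b" "b < 2 * T" "b - a <= tau m" for a b m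
  proof -
    have "norm \<phi> * ((1 + FM) * sqrt (b - a)) <= norm \<phi> * ((1 + FM) * sqrt (tau m))"
      using that FM_nonneg by (intro mult_left_mono) auto
    moreover have "Cb * norm q * (b - a) <= Cb * norm q * tau m"
      using that Cb_nonneg by (intro mult_left_mono) auto
    ultimately show ?thesis using small[OF that(1-3), of m] by (simp add: \<epsilon>_def)
  qed
  \<comment> \<open>The defect of the discrete equation on the true interval from \<open>s\<close>
    to \<open>t\<close>; it equals the difference of the integrals over two partial cells.\<close>
  define d where "d m = (v m (ix m t) - v m (ix m s)) \<bullet> \<phi> - tint s t (X m)" for m
  have "d ----> 0"
  proof (rule Lim_null_comparison)
    show "(%m. \<epsilon> m + \<epsilon> m) ----> 0" using tendsto_add[OF e0 e0] by simp
    show "\<forall>\<^sub>F m in sequentially. norm (d m) <= \<epsilon> m + \<epsilon> m"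
    proof (rule always_eventually, rule allI)
      fix m
      let ?k = "ix m t" and ?j = "ix m s"
      let ?a = "real ?j * tau m" and ?b = "real ?k * tau m"
      have j: "0 <= ?a" "?a <= s" "s < ?a + tau m" "?a <= ?b" "?b <= t" "t < ?b + tau m"
        using ix_bounds[OF r(1), of m] ix_bounds[OF r(2), of m] D.grid_mono[of ?j m] D.grid_mono(1)[OF ix_mono[OF st(3)], of m m]
        by (auto simp: distrib_right)
      have "(\<phi>, q) \<in> W (real (Suc ?j) * tau m)"
        using \<phi> W(3)[OF tb(1), of "real (Suc ?j) * tau m"] ix_bounds(2)[OF r(1), of m] tb(2) by auto
      from v_diff_eq[OF this ix_mono[OF st(3)] ix_le(1)[OF r(2,3)]]
      have 1: "(v m ?k - v m ?j) \<bullet> \<phi> = tint ?a ?b (X m)" by (simp add: X_def[abs_def])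
      have i: "tintegrable ?a t (X m)" using small[of ?a t m] j r by simp
      have 2: "tint ?a t (X m) = tint ?a ?b (X m) + tint ?b t (X m)" by (rule tint_combine[OF j(4,5) i])
      have 3: "tint ?a t (X m) = tint ?a s (X m) + tint s t (X m)" by (rule tint_combine[OF j(2) st(3) i])
      have "d m = tint ?a s (X m) - tint ?b t (X m)" using 1 2 3 by (simp add: d_def)
      moreover have "\<bar>tint ?a s (X m)\<bar> <= \<epsilon> m" by (rule smalle) (use j r in auto)
      moreover have "\<bar>tint ?b t (X m)\<bar> <= \<epsilon> m" by (rule smalle) (use j r in auto)
      ultimately show "norm (d m) <= \<epsilon> m + \<epsilon> m" by simp
    qed
  qed
  then have "(%n. avg n d) ----> 0" by (rule avg_tendsto)
  moreover have "(%n. avg n d) ----> (V t - V s) \<bullet> \<phi> - tint s t (%r. Fs r \<bullet> \<phi> - slice D r \<bullet> q)"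
  proof -
    have "avg n d = (avg n (%m. v m (ix m t)) - avg n (%m. v m (ix m s))) \<bullet> \<phi> - avg n (%m. tint s t (X m))" for n
      unfolding d_def by (simp add: avg_diff avg_inner inner_diff_left)
    moreover have "(%n. avg n (%m. tint s t (X m))) ----> tint s t (%r. Fs r \<bullet> \<phi> - slice D r \<bullet> q)"
    proof (rule avg_tint_tendsto(2)[OF Xm])
      show "tintegrable s t (%r. Fn r * norm \<phi> + Cb * norm q)"
        by (intro set_integral_add(1) set_integrable_mult_left Fn_tintegrable tintegrable_const)
      show "AE r in lebesgue. r \<in> {s..<t} --> \<bar>X m r\<bar> <= Fn r * norm \<phi> + Cb * norm q" for m
        using Xb[of _ m] r by (intro AE_I2) auto
      show "AE r in lebesgue. r \<in> {s..<t} --> (%n. avg n (%m. X m r)) ----> Fs r \<bullet> \<phi> - slice D r \<bullet> q"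
        using lim_D
      proof eventually_elim
        case (elim x)
        show ?case
        proof
          assume "x \<in> {s..<t}"
          then have "(%n. avg n (%m. g m (Suc (ix m x)))) ----> slice D x" using elim r by (auto simp: avg_def)
          then have "(%n. Fs x \<bullet> \<phi> - avg n (%m. g m (Suc (ix m x))) \<bullet> q) ----> Fs x \<bullet> \<phi> - slice D x \<bullet> q"
            by (intro tendsto_intros)
          then show "(%n. avg n (%m. X m x)) ----> Fs x \<bullet> \<phi> - slice D x \<bullet> q"
            by (simp add: X_def avg_diff avg_const avg_inner)
        qed
      qed
    qed
    ultimately show ?thesis by (auto intro!: tendsto_intros good_lims st)
  qed
  ultimately show ?thesis using LIMSEQ_unique by fastforce
qed

lemma en_sum:
  assumes "real k * tau m <= 3 * T"
  shows "tintegrable 0 (real k * tau m) (%r. Fs r \<bullet> v m (Suc (ix m r)))"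
    "D.en m k <= (norm u1)\<^sup>2 + (norm g0)\<^sup>2 + 2 * tint 0 (real k * tau m) (%r. Fs r \<bullet> v m (Suc (ix m r)))"
proof -
  let ?X = "%r. Fs r \<bullet> v m (Suc (ix m r))"
  have Xm: "?X \<in> borel_measurable lebesgue"
    by (intro ix_compose_measurable[of "%k t. Fs t \<bullet> v m (Suc k)"] Fs_measurable)
  have i: "tintegrable 0 (real k * tau m) ?X" if "real k * tau m <= 3 * T" for k
  proof (rule tintegrable_bound[OF _ Xm])
    show "tintegrable 0 (real k * tau m) (%r. Fn r * Cb)" by (intro set_integrable_mult_left Fn_tintegrable)
    have "\<bar>?X r\<bar> <= Fn r * Cb" if r: "0 <= r" "r < real k * tau m" for r
    proof -
      have "real (ix m r) * tau m < real k * tau m" using ix_bounds(1)[OF r(1), of m] r by linarith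
      then have "Suc (ix m r) <= k" using tau_pos[of m] by simp
      then have "real (Suc (ix m r)) * tau m <= 3 * T"
        using D.grid_mono(1)[of "Suc (ix m r)" k m] \<open>real k * tau m <= 3 * T\<close> by linarith
      from vg_bound(1)[OF this] show ?thesis
        using Fs_inner_le[of r "v m (Suc (ix m r))"] mult_left_mono[OF _ Fn_nonneg, of "norm (v m (Suc (ix m r)))" Cb r] by linarith
    qed
    then show "AE r in lebesgue. r \<in> {0..<real k * tau m} --> \<bar>?X r\<bar> <= Fn r * Cb" by (intro AE_I2) auto
  qed
  show "tintegrable 0 (real k * tau m) ?X" by (rule i[OF assms])
  show "D.en m k <= (norm u1)\<^sup>2 + (norm g0)\<^sup>2 + 2 * tint 0 (real k * tau m) ?X"
    using assms
  proof (induction k)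
    case 0
    then show ?case by (simp add: D.en_def D.v_0 D.g_0 tint_empty)
  next
    case (Suc k)
    let ?a = "real k * tau m" and ?b = "real (Suc k) * tau m"
    have ab: "?a <= ?b" by (rule D.grid_mono(1)) simp
    have "tint ?a ?b ?X = tint ?a ?b (%r. Fs r \<bullet> v m (Suc k))"
      by (rule tint_cong) (simp add: ix_def step_index_eq[OF tau_pos, of k m])
    then have "tint ?a ?b ?X = tau m * (y m k \<bullet> v m (Suc k))" by (simp add: D.y_avg)
    moreover have "tint 0 ?b ?X = tint 0 ?a ?X + tint ?a ?b ?X"
      by (rule tint_combine[OF D.grid_mono(2) ab i[OF Suc.prems]])
    moreover have "D.en m k <= (norm u1)\<^sup>2 + (norm g0)\<^sup>2 + 2 * tint 0 ?a ?X" using Suc ab by simp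
    ultimately show ?case using D.en_step[of m k] by linarith
  qed
qed

lemma FB_measurable: "(%r. Fs r \<bullet> v m (ix m r)) \<in> borel_measurable lebesgue"
  by (intro ix_compose_measurable[of "%k t. Fs t \<bullet> v m k"] Fs_measurable)

lemma FB_tint:
  assumes "0 <= a" "b <= 2 * T"
  shows "tintegrable a b (%r. Fs r \<bullet> slice B r)"
    "(%n. avg n (%m. tint a b (%r. Fs r \<bullet> v m (ix m r)))) ----> tint a b (%r. Fs r \<bullet> slice B r)"
    "AE r in lebesgue. r \<in> {a..<b} --> \<bar>Fs r \<bullet> slice B r\<bar> <= Fn r * Cb"
proof -
  have w: "tintegrable a b (%r. Fn r * Cb)" by (intro set_integrable_mult_left Fn_tintegrable)
  have bd: "AE r in lebesgue. r \<in> {a..<b} --> \<bar>Fs r \<bullet> v m (ix m r)\<bar> <= Fn r * Cb" for m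
  proof (rule AE_I2, rule impI)
    fix r assume "r \<in> {a..<b}"
    then have "0 <= r" "r < 2 * T" using assms by auto
    from vg_bound(1)[OF ix_le(1)[OF this]]
    show "\<bar>Fs r \<bullet> v m (ix m r)\<bar> <= Fn r * Cb"
      using Fs_inner_le[of r "v m (ix m r)"] mult_left_mono[OF _ Fn_nonneg, of "norm (v m (ix m r))" Cb r] by fastforce
  qed
  have lim: "AE r in lebesgue. r \<in> {a..<b} --> (%n. avg n (%m. Fs r \<bullet> v m (ix m r))) ----> Fs r \<bullet> slice B r"
    using lim_B
  proof eventually_elim
    case (elim r)
    show ?case
    proof
      assume "r \<in> {a..<b}"
      then have "(%n. avg n (%m. v m (ix m r))) ----> slice B r" using elim assms by (auto simp: avg_def)
      then have "(%n. avg n (%m. v m (ix m r) \<bullet> Fs r)) ----> slice B r \<bullet> Fs r"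
        unfolding avg_inner[symmetric] by (intro tendsto_intros)
      then show "(%n. avg n (%m. Fs r \<bullet> v m (ix m r))) ----> Fs r \<bullet> slice B r"
        unfolding inner_commute[of "Fs r"] .
    qed
  qed
  from avg_tint_tendsto[OF FB_measurable w bd lim]
  show "tintegrable a b (%r. Fs r \<bullet> slice B r)"
    "(%n. avg n (%m. tint a b (%r. Fs r \<bullet> v m (ix m r)))) ----> tint a b (%r. Fs r \<bullet> slice B r)" by auto
  show "AE r in lebesgue. r \<in> {a..<b} --> \<bar>Fs r \<bullet> slice B r\<bar> <= Fn r * Cb"
    using AE_good
  proof eventually_elim
    case (elim r)
    show ?case
    proof
      assume "r \<in> {a..<b}"
      then have "norm (slice B r) <= Cb" using elim assms good_props(3)[of r] by auto
      then show "\<bar>Fs r \<bullet> slice B r\<bar> <= Fn r * Cb"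
        using Fs_inner_le[of r "slice B r"] mult_left_mono[OF _ Fn_nonneg, of "norm (slice B r)" Cb r] by linarith
    qed
  qed
qed

definition E0 :: real where "E0 = (norm u1)\<^sup>2 / 2 + (norm g0)\<^sup>2 / 2"

text \<open>Convexity of the squared norm carries the discrete inequality to the limit. The discrete
  source term pairs the force with the new velocity; the old one may be substituted because the
  force at time \<open>r\<close> lies in \<open>P r\<close>, where the jump vanishes weakly.\<close>

lemma energy_good:
  assumes t: "good t"
  shows "(norm (V t))\<^sup>2 / 2 + (norm (Z t))\<^sup>2 / 2 <= E0 + tint 0 t (%r. Fs r \<bullet> slice B r)"
proof -
  have r: "0 <= t" "t < 2 * T" using t by (auto simp: good_def)
  define X where "X m r = Fs r \<bullet> v m (ix m r)" for m r
  define Y where "Y m r = Fs r \<bullet> v m (Suc (ix m r))" for m r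
  have Xm: "X m \<in> borel_measurable lebesgue" and Ym: "Y m \<in> borel_measurable lebesgue" for m
    unfolding X_def Y_def
    by (intro ix_compose_measurable[of "%k t. Fs t \<bullet> v m k"] ix_compose_measurable[of "%k t. Fs t \<bullet> v m (Suc k)"] Fs_measurable)+
  have vb: "\<bar>Fs r \<bullet> h\<bar> <= Fn r * Cb" if "norm h <= Cb" for r h
    using Fs_inner_le[of r h] mult_left_mono[OF that Fn_nonneg, of r] by linarith
  have Xb: "\<bar>X m r\<bar> <= Fn r * Cb" and Yb: "\<bar>Y m r\<bar> <= Fn r * Cb" if "0 <= r" "r < 2 * T" for m r
    unfolding X_def Y_def using vg_bound(1)[OF ix_le(1)[OF that]] vg_bound(1)[OF ix_le(2)[OF that]] by (auto intro: vb)
  have w: "tintegrable 0 t (%r. Fn r * Cb)" by (intro set_integrable_mult_left Fn_tintegrable)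
  have Xi: "tintegrable 0 t (X m)" and Yi: "tintegrable 0 t (Y m)" for m
    by (rule tintegrable_bound[OF w Xm], use Xb r in auto) (rule tintegrable_bound[OF w Ym], use Yb r in auto)
  \<comment> \<open>Collects the two errors of the source term: old instead of new velocity, and the
    incomplete last cell up to \<open>t\<close>.\<close>
  define \<rho> where "\<rho> m = tint 0 t (%r. Y m r - X m r) - tint (real (ix m t) * tau m) t (Y m)" for m
  have "(%m. tint 0 t (%r. Y m r - X m r)) ----> 0"
  proof (rule tint_null_tendsto)
    show "(%r. Y m r - X m r) \<in> borel_measurable lebesgue" for m by (intro borel_measurable_diff Xm Ym)
    show "tintegrable 0 t (%r. 2 * (Fn r * Cb))" using w by (rule set_integrable_mult_right)
    show "AE r in lebesgue. r \<in> {0..<t} --> \<bar>Y m r - X m r\<bar> <= 2 * (Fn r * Cb)" for m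
    proof (rule AE_I2, rule impI)
      fix x assume "x \<in> {0..<t}"
      then show "\<bar>Y m x - X m x\<bar> <= 2 * (Fn x * Cb)" using Xb[of x m] Yb[of x m] r by auto
    qed
    \<comment> \<open>The force is known to lie in its space for positive times only.\<close>
    have "AE r in lebesgue. r \<noteq> 0" by (simp add: AE_completion_iff AE_lborel_singleton)
    then show "AE r in lebesgue. r \<in> {0..<t} --> (%m. Y m r - X m r) ----> 0"
      using F(2)
    proof eventually_elim
      case (elim x)
      show ?case
      proof
        assume "x \<in> {0..<t}"
        then have x: "0 <= x" "x < 2 * T" "Fs x \<in> P x" using elim r by (auto simp: Fs_def)
        from jump_to_0[OF this] show "(%m. Y m x - X m x) ----> 0"
          by (simp add: X_def Y_def inner_diff_left inner_diff_right inner_commute)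
      qed
    qed
  qed
  moreover have "(%m. tint (real (ix m t) * tau m) t (Y m)) ----> 0"
  proof (rule Lim_null_comparison)
    show "\<forall>\<^sub>F m in sequentially. norm (tint (real (ix m t) * tau m) t (Y m)) <= Cb * ((1 + FM) * sqrt (tau m))"
    proof (rule always_eventually, rule allI)
      fix m
      let ?a = "real (ix m t) * tau m"
      have a: "0 <= ?a" "?a <= t" "t - ?a <= tau m"
        using ix_bounds[OF r(1), of m] D.grid_mono(2)[of "ix m t" m] by (auto simp: distrib_right)
      have "AE r in lebesgue. r \<in> {?a..<t} --> \<bar>Y m r\<bar> <= Fn r * Cb + 0"
      proof (rule AE_I2, rule impI)
        fix x assume x: "x \<in> {?a..<t}"
        then have "0 <= x" using order_trans[OF a(1)] by simp
        then show "\<bar>Y m x\<bar> <= Fn x * Cb + 0" using Yb[of x m] x r by simp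
      qed
      from tint_small(2)[OF a(2) Ym Cb_nonneg _ this]
      have "\<bar>tint ?a t (Y m)\<bar> <= Cb * ((1 + FM) * sqrt (t - ?a))" by simp
      also have "\<dots> <= Cb * ((1 + FM) * sqrt (tau m))"
        using a FM_nonneg Cb_nonneg by (intro mult_left_mono) auto
      finally show "norm (tint ?a t (Y m)) <= Cb * ((1 + FM) * sqrt (tau m))" by simp
    qed
    have "(%m. Cb * ((1 + FM) * sqrt (tau m))) ----> Cb * ((1 + FM) * 0)" by (intro tendsto_intros sqrt_tau_tendsto)
    then show "(%m. Cb * ((1 + FM) * sqrt (tau m))) ----> 0" by simp
  qed
  ultimately have "\<rho> ----> 0 - 0" unfolding \<rho>_def by (intro tendsto_diff)
  then have "(%n. avg n \<rho>) ----> 0" by (simp add: avg_tendsto)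
  then have "(%n. E0 + avg n (%m. tint 0 t (X m)) + avg n \<rho>) ----> E0 + tint 0 t (%r. Fs r \<bullet> slice B r) + 0"
    unfolding X_def using r by (intro tendsto_add tendsto_const FB_tint(2)) auto
  moreover have "(%n. (norm (avg n (%m. v m (ix m t))))\<^sup>2 / 2 + (norm (avg n (%m. g m (ix m t))))\<^sup>2 / 2)
      ----> (norm (V t))\<^sup>2 / 2 + (norm (Z t))\<^sup>2 / 2"
    by (intro tendsto_intros good_lims t) auto
  moreover have "(norm (avg n (%m. v m (ix m t))))\<^sup>2 / 2 + (norm (avg n (%m. g m (ix m t))))\<^sup>2 / 2
      <= E0 + avg n (%m. tint 0 t (X m)) + avg n \<rho>" for n
  proof -
    have "(norm (avg n (%m. v m (ix m t))))\<^sup>2 <= avg n (%m. (norm (v m (ix m t)))\<^sup>2)"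
      "(norm (avg n (%m. g m (ix m t))))\<^sup>2 <= avg n (%m. (norm (g m (ix m t)))\<^sup>2)"
      using norm_sq_convex_sum_le[OF wts[of n], of "%m. v m (ix m t)"]
        norm_sq_convex_sum_le[OF wts[of n], of "%m. g m (ix m t)"] by (auto simp: avg_def)
    moreover have "avg n (%m. (norm (v m (ix m t)))\<^sup>2) + avg n (%m. (norm (g m (ix m t)))\<^sup>2) = avg n (%m. D.en m (ix m t))"
      by (simp add: avg_add[symmetric] D.en_def)
    moreover have "avg n (%m. D.en m (ix m t)) <= avg n (%m. 2 * E0 + (tint 0 t (X m) + tint 0 t (X m)) + (\<rho> m + \<rho> m))"
    proof (rule avg_mono)
      fix m
      let ?a = "real (ix m t) * tau m"
      have a: "0 <= ?a" "?a <= t" using ix_bounds[OF r(1), of m] D.grid_mono(2)[of "ix m t" m] by auto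
      have "tint 0 ?a (Y m) = tint 0 t (Y m) - tint ?a t (Y m)" using tint_combine[OF a Yi] by simp
      also have "tint 0 t (Y m) = tint 0 t (%r. Y m r - X m r) + tint 0 t (X m)" using Xi Yi by (simp add: tint_diff)
      finally have "tint 0 ?a (Y m) = tint 0 t (X m) + \<rho> m" by (simp add: \<rho>_def)
      then show "D.en m (ix m t) <= 2 * E0 + (tint 0 t (X m) + tint 0 t (X m)) + (\<rho> m + \<rho> m)"
        using en_sum(2)[OF ix_le(1)[OF r], of m] by (simp add: Y_def[abs_def] E0_def)
    qed
    ultimately show ?thesis unfolding avg_add avg_const by linarith
  qed
  ultimately have "(norm (V t))\<^sup>2 / 2 + (norm (Z t))\<^sup>2 / 2 <= E0 + tint 0 t (%r. Fs r \<bullet> slice B r) + 0"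
    by (intro LIMSEQ_le) blast+
  then show ?thesis by simp
qed

end

section \<open>The weak time derivative and the weak equation in the limit\<close>

context evolution_limit
begin

lemma T_grid: "real (Suc m) * tau m = T" by (simp add: tau_def)

lemma ix_lt: assumes "0 <= s" "s < T" shows "ix m s < Suc m"
proof -
  have "real (ix m s) * tau m < real (Suc m) * tau m" using ix_bounds(1)[OF assms(1), of m] assms by (simp only: T_grid)
  then show ?thesis using tau_pos[of m] by simp
qed

lemma tint_grid:
  assumes "tintegrable 0 T (%t. f (ix m t) t)"
  shows "tint 0 T (%t. f (ix m t) t) = (\<Sum>j<Suc m. tint (real j * tau m) (real (Suc j) * tau m) (f j))"
  using tint_step[OF tau_pos, of "Suc m" m f] assms unfolding T_grid ix_def by blast

lemma grid_le_T: "j <= Suc m ==> real j * tau m <= T"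
  using D.grid_mono(1)[of j "Suc m" m] by (simp only: T_grid)

lemma curve_tint:
  assumes "curve E Ed b" "0 <= s" "t <= T"
  shows "tintegrable s t (%r. Ed r \<bullet> h)"
proof (rule tintegrable_subset[OF _ assms(2,3)])
  show "tintegrable 0 T (%r. Ed r \<bullet> h)"
  proof (rule tintegrable_bound)
    show "tintegrable 0 T (%r. b r * norm h)" using assms(1) by (intro set_integrable_mult_left) (simp add: curve_def)
    show "(%r. Ed r \<bullet> h) \<in> borel_measurable lebesgue" using assms(1) by (simp add: curve_def)
    have "AE r in lebesgue. r \<in> {0..<T} --> norm (Ed r) <= b r" using assms(1) by (simp add: curve_def)
    then show "AE r in lebesgue. r \<in> {0..<T} --> \<bar>Ed r \<bullet> h\<bar> <= b r * norm h"
      by eventually_elim (auto intro: inner_bound)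
  qed
qed

lemma curve_bounded:
  assumes "curve E Ed b" obtains M where "!!s. s \<in> {0..T} ==> norm (E s) <= M"
proof -
  have "bounded (E ` {0..T})"
    using assms by (intro compact_imp_bounded compact_continuous_image) (auto simp: curve_def)
  then obtain M where "\<forall>x\<in>E ` {0..T}. norm x <= M" unfolding bounded_iff by blast
  then show thesis by (intro that[of M]) blast
qed

lemma curve_uniform:
  assumes E: "curve E Ed b" and e: "0 < e"
  shows "\<forall>\<^sub>F m in sequentially. \<forall>s. 0 <= s --> s < T --> norm (E s - E (real (ix m s) * tau m)) <= e"
proof -
  have "uniformly_continuous_on {0..T} E"
    using E by (intro compact_uniformly_continuous) (auto simp: curve_def)
  then obtain d where d: "0 < d" "!!x x'. x \<in> {0..T} ==> x' \<in> {0..T} ==> dist x' x < d ==> dist (E x') (E x) < e"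
    using e unfolding uniformly_continuous_on_def by metis
  have "\<forall>\<^sub>F m in sequentially. tau m < d" using tau_tendsto d(1) by (rule order_tendstoD)
  then show ?thesis
  proof eventually_elim
    case (elim m)
    show ?case
    proof (intro allI impI)
      fix s assume s: "0 <= s" "s < T"
      have "s < real (ix m s) * tau m + tau m" using ix_bounds(2)[OF s(1), of m] by (simp add: distrib_right)
      then have "dist s (real (ix m s) * tau m) < d" using ix_bounds(1)[OF s(1), of m] elim by (simp add: dist_real_def)
      moreover have "real (ix m s) * tau m \<in> {0..T}" using ix_bounds(1)[OF s(1), of m] s D.grid_mono(2)[of "ix m s" m] by auto
      ultimately have "dist (E s) (E (real (ix m s) * tau m)) < e" using d(2)[of "real (ix m s) * tau m" s] s by auto
      then show "norm (E s - E (real (ix m s) * tau m)) <= e" by (simp add: dist_norm)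
    qed
  qed
qed

lemma curve_pointwise:
  assumes E: "curve E Ed b" and s: "0 <= s" "s < T"
  shows "(%m. E (real (ix m s) * tau m)) ----> E s"
proof (rule LIMSEQ_I)
  fix e :: real assume "0 < e"
  then have "\<forall>\<^sub>F m in sequentially. \<forall>s. 0 <= s --> s < T --> norm (E s - E (real (ix m s) * tau m)) <= e / 2"
    by (intro curve_uniform[OF E]) simp
  then have "\<forall>\<^sub>F m in sequentially. norm (E (real (ix m s) * tau m) - E s) < e"
  proof eventually_elim
    case (elim m)
    then have "norm (E s - E (real (ix m s) * tau m)) <= e / 2" using s by blast
    then show ?case using \<open>0 < e\<close> by (simp add: norm_minus_commute)
  qed
  then show "\<exists>no. \<forall>n\<ge>no. norm (E (real (ix n s) * tau n) - E s) < e" by (simp add: eventually_sequentially)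
qed

lemma B_avg: "AE r in lebesgue. r \<in> {0..<T} --> (\<forall>h. (%n. avg n (%m. v m (ix m r) \<bullet> h)) ----> slice B r \<bullet> h)"
  using lim_B
proof eventually_elim
  case (elim r)
  show ?case
  proof (intro impI allI)
    fix h assume "r \<in> {0..<T}"
    then have "(%n. avg n (%m. v m (ix m r))) ----> slice B r" using elim T by (auto simp: avg_def)
    then show "(%n. avg n (%m. v m (ix m r) \<bullet> h)) ----> slice B r \<bullet> h"
      unfolding avg_inner[symmetric] by (intro tendsto_intros)
  qed
qed

lemma v_bd: assumes "r \<in> {0..<T}" shows "norm (v m (ix m r)) <= Cb" "norm (v m (Suc (ix m r))) <= Cb"
    "norm (g m (Suc (ix m r))) <= Cb" "norm (u m (ix m r)) <= Cu"
proof -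
  have "0 <= r" "r < 2 * T" using assms T by auto
  from ix_le[OF this] show "norm (v m (ix m r)) <= Cb" "norm (v m (Suc (ix m r))) <= Cb"
    "norm (g m (Suc (ix m r))) <= Cb" "norm (u m (ix m r)) <= Cu"
    by (auto intro: vg_bound u_bound)
qed

text \<open>Summation by parts: the differences of \<open>\<Phi>\<close> along the grid move to the
  positions as velocities. The values of \<open>\<Phi>\<close> are then frozen at the left grid
  points, an error that uniform boundedness and pointwise convergence remove.\<close>

lemma weak_dt:
  assumes \<Phi>: "curve \<Phi> \<Phi>d b"
  shows "tint 0 T (%s. slice A s \<bullet> \<Phi>d s) = - tint 0 T (%s. slice B s \<bullet> \<Phi> s)"
proof -
  obtain M where M: "!!s. s \<in> {0..T} ==> norm (\<Phi> s) <= M" using curve_bounded[OF \<Phi>] by blast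
  have bi: "tintegrable 0 T b" and bAE: "AE s in lebesgue. s \<in> {0..<T} --> norm (\<Phi>d s) <= b s"
    and m\<Phi>: "!!h. (%s. \<Phi> s \<bullet> h) \<in> borel_measurable lebesgue" "!!h. (%s. \<Phi>d s \<bullet> h) \<in> borel_measurable lebesgue"
    and \<Phi>eq: "!!h s t. 0 <= s ==> s <= t ==> t <= T ==> (\<Phi> t - \<Phi> s) \<bullet> h = tint s t (%r. \<Phi>d r \<bullet> h)"
    and \<Phi>0: "\<Phi> 0 = 0" "\<Phi> T = 0"
    using \<Phi> by (auto simp: curve_def)
  have m\<Phi>': "(%s. h \<bullet> \<Phi> s) \<in> borel_measurable lebesgue" "(%s. h \<bullet> \<Phi>d s) \<in> borel_measurable lebesgue" for h
    using m\<Phi>[of h] by (simp_all add: inner_commute)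
  define X where "X m s = u m (ix m s) \<bullet> \<Phi>d s" for m s
  define Y where "Y m s = v m (ix m s) \<bullet> \<Phi> s" for m s
  define Y' where "Y' m s = v m (ix m s) \<bullet> \<Phi> (real (ix m s) * tau m)" for m s
  have Xm: "X m \<in> borel_measurable lebesgue" for m
    unfolding X_def by (rule ix_compose_measurable[of "%k s. u m k \<bullet> \<Phi>d s"]) (rule m\<Phi>'(2))
  have Ym: "Y m \<in> borel_measurable lebesgue" for m
    unfolding Y_def by (rule ix_compose_measurable[of "%k s. v m k \<bullet> \<Phi> s"]) (rule m\<Phi>'(1))
  have Y'm: "Y' m \<in> borel_measurable lebesgue" for m
    unfolding Y'_def by (rule ix_compose_measurable[of "%k s. v m k \<bullet> \<Phi> (real k * tau m)"]) simp
  have Xb: "AE s in lebesgue. s \<in> {0..<T} --> \<bar>X m s\<bar> <= b s * Cu" for m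
    using bAE
  proof eventually_elim
    case (elim s)
    show ?case
    proof
      assume s: "s \<in> {0..<T}"
      have "\<bar>X m s\<bar> <= Cu * norm (\<Phi>d s)" unfolding X_def by (rule inner_bound[OF v_bd(4)[OF s]])
      also have "\<dots> <= Cu * b s"
        using elim s order_trans[OF norm_ge_zero v_bd(4)[OF s]] by (intro mult_left_mono) auto
      finally show "\<bar>X m s\<bar> <= b s * Cu" by (simp add: mult.commute)
    qed
  qed
  have vb: "\<bar>v m (ix m s) \<bullet> h\<bar> <= Cb * M" if "s \<in> {0..<T}" "norm h <= M" for m s h
    using v_bd(1)[OF that(1), of m] that(2) Cauchy_Schwarz_ineq2[of "v m (ix m s)" h]
      mult_mono[of "norm (v m (ix m s))" Cb "norm h" M] Cb_nonneg by auto
  have gT: "real (ix m s) * tau m \<in> {0..T}" if "s \<in> {0..<T}" for m s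
    using that ix_bounds(1)[of s m] D.grid_mono(2)[of "ix m s" m] by auto
  have Yb: "\<bar>Y m s\<bar> <= Cb * M" and Y'b: "\<bar>Y' m s\<bar> <= Cb * M" if "s \<in> {0..<T}" for m s
    unfolding Y_def Y'_def using that by (auto intro!: vb M gT)
  have Xi: "tintegrable 0 T (X m)" for m
    by (rule tintegrable_bound[OF _ Xm Xb]) (intro set_integrable_mult_left bi)
  have Yi: "tintegrable 0 T (Y m)" for m
    by (rule tintegrable_bound[where g = "%_. Cb * M", OF tintegrable_const Ym], rule AE_I2) (use Yb in simp)
  have Y'i: "tintegrable 0 T (Y' m)" for m
    by (rule tintegrable_bound[where g = "%_. Cb * M", OF tintegrable_const Y'm], rule AE_I2) (use Y'b in simp)
  have disc: "tint 0 T (X m) = - tint 0 T (Y' m)" for m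
  proof -
    let ?t = "%k. real k * tau m"
    have "tint 0 T (X m) = (\<Sum>k<Suc m. tint (?t k) (?t (Suc k)) (%s. u m k \<bullet> \<Phi>d s))"
      using tint_grid[of "%k s. u m k \<bullet> \<Phi>d s" m] Xi[of m] unfolding X_def[abs_def] by blast
    also have "\<dots> = (\<Sum>k<Suc m. u m k \<bullet> (\<Phi> (?t (Suc k)) - \<Phi> (?t k)))"
    proof (intro sum.cong refl)
      fix k assume "k \<in> {..<Suc m}"
      then have "?t (Suc k) <= T" by (intro grid_le_T) auto
      from \<Phi>eq[OF D.grid_mono(2) D.grid_mono(1) this, of k "u m k"]
      show "tint (?t k) (?t (Suc k)) (%s. u m k \<bullet> \<Phi>d s) = u m k \<bullet> (\<Phi> (?t (Suc k)) - \<Phi> (?t k))"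
        unfolding inner_commute[of "u m k"] by simp
    qed
    finally have 1: "tint 0 T (X m) = (\<Sum>k<Suc m. u m k \<bullet> (\<Phi> (?t (Suc k)) - \<Phi> (?t k)))" .
    have "tint 0 T (Y' m) = (\<Sum>k<Suc m. tint (?t k) (?t (Suc k)) (%s. v m k \<bullet> \<Phi> (?t k)))"
      using tint_grid[of "%k s. v m k \<bullet> \<Phi> (?t k)" m] Y'i[of m] unfolding Y'_def[abs_def] by blast
    also have "\<dots> = (\<Sum>k<Suc m. tau m * (v m k \<bullet> \<Phi> (?t k)))"
    proof (intro sum.cong refl)
      fix k
      show "tint (?t k) (?t (Suc k)) (%s. v m k \<bullet> \<Phi> (?t k)) = tau m * (v m k \<bullet> \<Phi> (?t k))"
        using D.grid_mono(1)[of k "Suc k" m] by (subst tint_const) (auto simp: distrib_right)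
    qed
    finally have 2: "tint 0 T (Y' m) = (\<Sum>k<Suc m. tau m * (v m k \<bullet> \<Phi> (?t k)))" .
    \<comment> \<open>The position increment carries \<open>v m (Suc k)\<close> while the sum
      contains \<open>v m k\<close>; this shift of the index produces boundary terms only, and they
      vanish for \<open>n = Suc m\<close> because \<open>\<Phi>\<close> is zero at both
      ends.\<close>
    have "(\<Sum>k<n. u m k \<bullet> (\<Phi> (?t (Suc k)) - \<Phi> (?t k))) + (\<Sum>k<n. tau m * (v m k \<bullet> \<Phi> (?t k)))
        = u m n \<bullet> \<Phi> (?t n) - u m 0 \<bullet> \<Phi> (?t 0) - tau m * (v m n \<bullet> \<Phi> (?t n)) + tau m * (v m 0 \<bullet> \<Phi> (?t 0))" for n
    proof (induction n)
      case (Suc n)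
      have "u m (Suc n) \<bullet> \<Phi> (?t (Suc n)) = u m n \<bullet> \<Phi> (?t (Suc n)) + tau m * (v m (Suc n) \<bullet> \<Phi> (?t (Suc n)))"
        unfolding D.u_Suc[of m n] by (simp add: inner_add_left)
      then show ?case using Suc unfolding sum.lessThan_Suc inner_diff_right by linarith
    qed simp
    from this[of "Suc m"] have "(\<Sum>k<Suc m. u m k \<bullet> (\<Phi> (?t (Suc k)) - \<Phi> (?t k))) + (\<Sum>k<Suc m. tau m * (v m k \<bullet> \<Phi> (?t k))) = 0"
      unfolding T_grid by (simp add: \<Phi>0)
    then show ?thesis unfolding 1 2 by linarith
  qed
  have "(%m. tint 0 T (%s. Y m s - Y' m s)) ----> 0"
  proof (rule tint_null_tendsto)
    show "(%s. Y m s - Y' m s) \<in> borel_measurable lebesgue" for m by (intro borel_measurable_diff Ym Y'm)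
    show "tintegrable 0 T (%s. Cb * M + Cb * M)" by (rule tintegrable_const)
    show "AE s in lebesgue. s \<in> {0..<T} --> \<bar>Y m s - Y' m s\<bar> <= Cb * M + Cb * M" for m
      using Yb[of _ m] Y'b[of _ m] by (intro AE_I2 impI order_trans[OF abs_triangle_ineq4] add_mono) auto
    show "AE s in lebesgue. s \<in> {0..<T} --> (%m. Y m s - Y' m s) ----> 0"
    proof (rule AE_I2, rule impI)
      fix s assume s: "s \<in> {0..<T}"
      show "(%m. Y m s - Y' m s) ----> 0"
      proof (rule Lim_null_comparison)
        show "\<forall>\<^sub>F m in sequentially. norm (Y m s - Y' m s) <= Cb * norm (\<Phi> s - \<Phi> (real (ix m s) * tau m))"
          using inner_bound[OF v_bd(1)[OF s]] by (auto simp: Y_def Y'_def inner_diff_right[symmetric])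
        have "(%m. Cb * norm (\<Phi> s - \<Phi> (real (ix m s) * tau m))) ----> Cb * norm (\<Phi> s - \<Phi> s)"
          using s by (intro tendsto_intros curve_pointwise[OF \<Phi>]) auto
        then show "(%m. Cb * norm (\<Phi> s - \<Phi> (real (ix m s) * tau m))) ----> 0" by simp
      qed
    qed
  qed
  then have "(%m. tint 0 T (X m) + tint 0 T (Y m)) ----> 0" using Yi Y'i by (simp add: disc tint_diff)
  then have "(%n. avg n (%m. tint 0 T (X m)) + avg n (%m. tint 0 T (Y m))) ----> 0"
    unfolding avg_add[symmetric] by (rule avg_tendsto)
  moreover have "(%n. avg n (%m. tint 0 T (X m)) + avg n (%m. tint 0 T (Y m)))
      ----> tint 0 T (%s. slice A s \<bullet> \<Phi>d s) + tint 0 T (%s. slice B s \<bullet> \<Phi> s)"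
  proof (intro tendsto_add)
    show "(%n. avg n (%m. tint 0 T (X m))) ----> tint 0 T (%s. slice A s \<bullet> \<Phi>d s)"
    proof (rule avg_tint_tendsto(2)[OF Xm _ Xb])
      show "tintegrable 0 T (%s. b s * Cu)" by (intro set_integrable_mult_left bi)
      show "AE r in lebesgue. r \<in> {0..<T} --> (%n. avg n (%m. X m r)) ----> slice A r \<bullet> \<Phi>d r"
        using lim_A
      proof eventually_elim
        case (elim r)
        show ?case
        proof
          assume "r \<in> {0..<T}"
          then have "(%n. avg n (%m. u m (ix m r))) ----> slice A r" using elim T by (auto simp: avg_def)
          then show "(%n. avg n (%m. X m r)) ----> slice A r \<bullet> \<Phi>d r"
            unfolding X_def avg_inner[symmetric] by (intro tendsto_intros)
        qed
      qed
    qed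
    show "(%n. avg n (%m. tint 0 T (Y m))) ----> tint 0 T (%s. slice B s \<bullet> \<Phi> s)"
    proof (rule avg_tint_tendsto(2)[OF Ym tintegrable_const])
      show "AE r in lebesgue. r \<in> {0..<T} --> \<bar>Y m r\<bar> <= Cb * M" for m using Yb by auto
      show "AE r in lebesgue. r \<in> {0..<T} --> (%n. avg n (%m. Y m r)) ----> slice B r \<bullet> \<Phi> r"
        using B_avg by eventually_elim (simp add: Y_def)
    qed
  qed
  ultimately have "tint 0 T (%s. slice A s \<bullet> \<Phi>d s) + tint 0 T (%s. slice B s \<bullet> \<Phi> s) = 0" using LIMSEQ_unique by blast
  then show ?thesis by simp
qed

text \<open>Against a test curve frozen at the left grid points the averaged force and the true one
  have equal integrals, cell by cell. Unfreezing costs the uniform modulus of \<open>E\<close> times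
  the total mass of the averaged force, which stays bounded.\<close>

lemma source_tendsto:
  assumes E: "curve E Ed b"
  shows "tintegrable 0 T (%s. y m (ix m s) \<bullet> E s)"
    "(%m. tint 0 T (%s. y m (ix m s) \<bullet> E s)) ----> tint 0 T (%s. Fs s \<bullet> E s)"
proof -
  obtain M where M: "!!s. s \<in> {0..T} ==> norm (E s) <= M" using curve_bounded[OF E] by blast
  have mE: "!!h. (%s. E s \<bullet> h) \<in> borel_measurable lebesgue" using E by (simp add: curve_def)
  have mE': "(%s. h \<bullet> E s) \<in> borel_measurable lebesgue" for h using mE[of h] by (simp add: inner_commute)
  define Em where "Em m s = E (real (ix m s) * tau m)" for m s
  have gT: "real (ix m s) * tau m \<in> {0..T}" if "s \<in> {0..<T}" for m s
    using that ix_bounds(1)[of s m] D.grid_mono(2)[of "ix m s" m] by auto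
  define Q where "Q = tint 0 T Fn"
  have Q: "0 <= Q" unfolding Q_def by (rule tint_Fn_nonneg)
  \<comment> \<open>A crude bound that deteriorates as the step shrinks; it serves integrability for
    fixed \<open>m\<close>, whereas the uniform control is \<open>yQ\<close>.\<close>
  have yq: "norm (y m (ix m s)) <= Q / tau m" if "s \<in> {0..<T}" for m s
  proof -
    have "tau m * norm (y m (ix m s)) <= tint (real (ix m s) * tau m) (real (Suc (ix m s)) * tau m) Fn" by (rule D.y_norm)
    also have "\<dots> <= Q" unfolding Q_def
      by (rule tint_Fn_mono[OF D.grid_mono(2) D.grid_mono(1) grid_le_T]) (use ix_lt[of s m] that in auto)
    finally show ?thesis using tau_pos[of m] by (simp add: pos_le_divide_eq mult.commute)
  qed
  have ym: "(%s. y m (ix m s) \<bullet> E s) \<in> borel_measurable lebesgue"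
    "(%s. y m (ix m s) \<bullet> Em m s) \<in> borel_measurable lebesgue"
    "(%s. Fs s \<bullet> Em m s) \<in> borel_measurable lebesgue" "(%s. norm (y m (ix m s))) \<in> borel_measurable lebesgue" for m
    unfolding Em_def
    by (rule ix_compose_measurable[of "%k s. y m k \<bullet> E s"], rule mE',
        rule ix_compose_measurable[of "%k s. y m k \<bullet> E (real k * tau m)"], simp,
        rule ix_compose_measurable[of "%k s. Fs s \<bullet> E (real k * tau m)"], rule Fs_measurable,
        rule ix_compose_measurable[of "%k s. norm (y m k)"], simp)
  have yb: "\<bar>y m (ix m s) \<bullet> h\<bar> <= Q / tau m * M" if "s \<in> {0..<T}" "norm h <= M" for m s h
    using inner_bound[OF yq[OF that(1)], of m h] mult_left_mono[OF that(2), of "Q / tau m"] Q tau_pos[of m] by auto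
  show yi: "tintegrable 0 T (%s. y m (ix m s) \<bullet> E s)" for m
    by (rule tintegrable_bound[where g = "%_. Q / tau m * M", OF tintegrable_const ym(1)], rule AE_I2) (use yb M in simp)
  have yi': "tintegrable 0 T (%s. y m (ix m s) \<bullet> Em m s)" for m
    by (rule tintegrable_bound[where g = "%_. Q / tau m * M", OF tintegrable_const ym(2)], rule AE_I2) (use yb M gT in \<open>simp add: Em_def\<close>)
  have yn: "tintegrable 0 T (%s. norm (y m (ix m s)))" for m
    by (rule tintegrable_bound[where g = "%_. Q / tau m", OF tintegrable_const ym(4)], rule AE_I2) (use yq in simp)
  have Fb: "\<bar>Fs s \<bullet> Em m s\<bar> <= Fn s * M" if "s \<in> {0..<T}" for m s
    using Fs_inner_le[of s "Em m s"] mult_left_mono[OF M[OF gT[OF that]] Fn_nonneg, of s m] by (simp add: Em_def)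
  have FM': "tintegrable 0 T (%s. Fn s * M)" by (intro set_integrable_mult_left Fn_tintegrable)
  have lim1: "(%m. tint 0 T (%s. Fs s \<bullet> Em m s)) ----> tint 0 T (%s. Fs s \<bullet> E s)"
  proof (rule tint_dominated_convergence(2)[OF ym(3) FM'])
    show "AE s in lebesgue. s \<in> {0..<T} --> (%m. Fs s \<bullet> Em m s) ----> Fs s \<bullet> E s"
      unfolding Em_def by (intro AE_I2 impI tendsto_intros curve_pointwise[OF E]) auto
    show "AE s in lebesgue. s \<in> {0..<T} --> \<bar>Fs s \<bullet> Em m s\<bar> <= Fn s * M" for m using Fb by auto
  qed
  have Fi: "tintegrable 0 T (%s. Fs s \<bullet> Em m s)" for m
    by (rule tintegrable_bound[OF FM' ym(3)]) (use Fb in auto)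
  have eq: "tint 0 T (%s. y m (ix m s) \<bullet> Em m s) = tint 0 T (%s. Fs s \<bullet> Em m s)" for m
  proof -
    have "tint 0 T (%s. y m (ix m s) \<bullet> Em m s) = (\<Sum>k<Suc m. tint (real k * tau m) (real (Suc k) * tau m) (%s. y m k \<bullet> E (real k * tau m)))"
      using tint_grid[of "%k s. y m k \<bullet> E (real k * tau m)" m] yi'[of m] unfolding Em_def by blast
    also have "\<dots> = (\<Sum>k<Suc m. tint (real k * tau m) (real (Suc k) * tau m) (%s. Fs s \<bullet> E (real k * tau m)))"
    proof (intro sum.cong refl)
      fix k
      show "tint (real k * tau m) (real (Suc k) * tau m) (%s. y m k \<bullet> E (real k * tau m))
          = tint (real k * tau m) (real (Suc k) * tau m) (%s. Fs s \<bullet> E (real k * tau m))"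
        unfolding D.y_avg[symmetric] using D.grid_mono(1)[of k "Suc k" m] by (subst tint_const) (auto simp: distrib_right)
    qed
    also have "\<dots> = tint 0 T (%s. Fs s \<bullet> Em m s)"
      using tint_grid[of "%k s. Fs s \<bullet> E (real k * tau m)" m] Fi[of m] unfolding Em_def by metis
    finally show ?thesis .
  qed
  have yQ: "tint 0 T (%s. norm (y m (ix m s))) <= Q" for m
  proof -
    have "tint 0 T (%s. norm (y m (ix m s))) = (\<Sum>k<Suc m. tint (real k * tau m) (real (Suc k) * tau m) (%s. norm (y m k)))"
      using tint_grid[of "%k s. norm (y m k)" m] yn[of m] by blast
    also have "\<dots> = (\<Sum>k<Suc m. tau m * norm (y m k))"
    proof (intro sum.cong refl)
      fix k
      show "tint (real k * tau m) (real (Suc k) * tau m) (%s. norm (y m k)) = tau m * norm (y m k)"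
        using D.grid_mono(1)[of k "Suc k" m] by (subst tint_const) (auto simp: distrib_right)
    qed
    also have "\<dots> <= (\<Sum>k<Suc m. tint (real k * tau m) (real (Suc k) * tau m) Fn)"
      by (intro sum_mono D.y_norm)
    also have "\<dots> = Q" unfolding Q_def
      using tint_sum_intervals[of "tau m" "Suc m" Fn] tau_pos[of m] Fn_tintegrable by (simp only: T_grid less_imp_le)
    finally show ?thesis .
  qed
  have lim2: "(%m. tint 0 T (%s. y m (ix m s) \<bullet> E s) - tint 0 T (%s. y m (ix m s) \<bullet> Em m s)) ----> 0"
  proof (rule LIMSEQ_I)
    fix e :: real assume e: "0 < e"
    have "0 < e / (2 * (Q + 1))" using e Q by simp
    from curve_uniform[OF E this]
    have "\<forall>\<^sub>F m in sequentially. norm (tint 0 T (%s. y m (ix m s) \<bullet> E s) - tint 0 T (%s. y m (ix m s) \<bullet> Em m s) - 0) < e"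
    proof eventually_elim
      case (elim m)
      let ?e = "e / (2 * (Q + 1))"
      have "\<bar>tint 0 T (%s. y m (ix m s) \<bullet> E s - y m (ix m s) \<bullet> Em m s)\<bar> <= tint 0 T (%s. ?e * norm (y m (ix m s)))"
      proof (rule tint_abs_le)
        show "tintegrable 0 T (%s. y m (ix m s) \<bullet> E s - y m (ix m s) \<bullet> Em m s)" by (intro set_integral_diff(1) yi yi')
        show "tintegrable 0 T (%s. ?e * norm (y m (ix m s)))" by (intro set_integrable_mult_right yn)
        show "AE s in lebesgue. s \<in> {0..<T} --> \<bar>y m (ix m s) \<bullet> E s - y m (ix m s) \<bullet> Em m s\<bar> <= ?e * norm (y m (ix m s))"
        proof (rule AE_I2, rule impI)
          fix s assume "s \<in> {0..<T}"
          then have "norm (E s - Em m s) <= ?e" using elim by (auto simp: Em_def)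
          from inner_bound[OF this, of "y m (ix m s)"]
          show "\<bar>y m (ix m s) \<bullet> E s - y m (ix m s) \<bullet> Em m s\<bar> <= ?e * norm (y m (ix m s))"
            by (simp add: inner_diff_left inner_commute)
        qed
      qed
      also have "\<dots> = ?e * tint 0 T (%s. norm (y m (ix m s)))" by (rule tint_cmult)
      also have "\<dots> <= ?e * Q" using e Q by (intro mult_left_mono yQ) auto
      also have "\<dots> < e" using e Q by (simp add: field_simps) (smt (verit) mult_nonneg_nonneg)
      finally show ?case by (simp add: tint_diff yi yi')
    qed
    then show "\<exists>no. \<forall>n\<ge>no. norm (tint 0 T (%s. y n (ix n s) \<bullet> E s) - tint 0 T (%s. y n (ix n s) \<bullet> Em n s) - 0) < e"
      by (simp add: eventually_sequentially)
  qed
  from tendsto_add[OF lim2 lim1] show "(%m. tint 0 T (%s. y m (ix m s) \<bullet> E s)) ----> tint 0 T (%s. Fs s \<bullet> E s)"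
    by (simp add: eq)
qed

text \<open>The piecewise linear interpolant of the velocities. It is continuous and its slope is
  the discrete acceleration, so integration by parts creates no terms at interior grid
  points.\<close>

definition vt :: "nat => real => ('a, real) l2" where
  "vt m s = v m (ix m s) + ((s - real (ix m s) * tau m) / tau m) *\<^sub>R (v m (Suc (ix m s)) - v m (ix m s))"

text \<open>On each cell \<open>tint_by_parts\<close> moves the derivative to the test curve; the
  boundary values telescope over the grid and vanish at 0 and \<open>T\<close>.\<close>

lemma acceleration_by_parts:
  assumes E: "curve E Ed b"
  shows "tintegrable 0 T (%s. (v m (Suc (ix m s)) - v m (ix m s)) \<bullet> E s / tau m)"
    "tintegrable 0 T (%s. vt m s \<bullet> Ed s)"
    "tint 0 T (%s. (v m (Suc (ix m s)) - v m (ix m s)) \<bullet> E s / tau m) = - tint 0 T (%s. vt m s \<bullet> Ed s)"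
proof -
  obtain M where M: "!!s. s \<in> {0..T} ==> norm (E s) <= M" using curve_bounded[OF E] by blast
  have bi: "tintegrable 0 T b" and bAE: "AE s in lebesgue. s \<in> {0..<T} --> norm (Ed s) <= b s"
    and mE: "!!h. (%s. E s \<bullet> h) \<in> borel_measurable lebesgue" "!!h. (%s. Ed s \<bullet> h) \<in> borel_measurable lebesgue"
    and Eeq: "!!h s t. 0 <= s ==> s <= t ==> t <= T ==> (E t - E s) \<bullet> h = tint s t (%r. Ed r \<bullet> h)"
    and E00: "E 0 = 0" "E T = 0"
    using E by (auto simp: curve_def)
  have mE': "(%s. h \<bullet> E s) \<in> borel_measurable lebesgue" for h using mE(1)[of h] by (simp add: inner_commute)
  let ?t = "%k. real k * tau m" and ?c = "%k. (1 / tau m) *\<^sub>R (v m (Suc k) - v m k)"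
  define f where "f k s = ?c k \<bullet> E s" for k s
  define w where "w k s = v m k \<bullet> Ed s + (s - ?t k) * (?c k \<bullet> Ed s)" for k s
  have f_eq: "f (ix m s) s = (v m (Suc (ix m s)) - v m (ix m s)) \<bullet> E s / tau m" for s by (simp add: f_def)
  have w_eq: "w (ix m s) s = vt m s \<bullet> Ed s" for s
    by (simp add: w_def vt_def inner_add_left)
  have fm: "(%s. f (ix m s) s) \<in> borel_measurable lebesgue"
    by (rule ix_compose_measurable) (unfold f_def, rule mE')
  have wm: "(%s. w (ix m s) s) \<in> borel_measurable lebesgue"
  proof (rule ix_compose_measurable)
    fix k
    have 1: "(%s. h \<bullet> Ed s) \<in> borel_measurable lebesgue" for h using mE(2)[of h] by (simp add: inner_commute)
    have 2: "(%s. s - ?t k) \<in> borel_measurable lebesgue" by (intro measurable_completion) simp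
    show "w k \<in> borel_measurable lebesgue" unfolding w_def
      by (intro borel_measurable_add borel_measurable_times 1 2)
  qed
  have dv: "norm (v m (Suc (ix m s)) - v m (ix m s)) <= Cb + Cb" if "s \<in> {0..<T}" for s
    using v_bd(1,2)[OF that, of m] by (intro order_trans[OF norm_triangle_ineq4] add_mono)
  have th: "0 <= (s - ?t (ix m s)) / tau m" "(s - ?t (ix m s)) / tau m <= 1" if "s \<in> {0..<T}" for s
    using ix_bounds[of s m] that tau_pos[of m] by (auto simp: field_simps)
  have vtb: "norm (vt m s) <= 3 * Cb" if "s \<in> {0..<T}" for s
  proof -
    have "norm (((s - ?t (ix m s)) / tau m) *\<^sub>R (v m (Suc (ix m s)) - v m (ix m s))) <= 1 * (Cb + Cb)"
      unfolding norm_scaleR using th[OF that] dv[OF that] by (intro mult_mono) auto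
    then show ?thesis using v_bd(1)[OF that, of m] norm_triangle_ineq[of "v m (ix m s)"] unfolding vt_def by (smt (verit))
  qed
  have fi: "tintegrable 0 T (%s. f (ix m s) s)"
  proof (rule tintegrable_bound[OF tintegrable_const fm])
    show "AE s in lebesgue. s \<in> {0..<T} --> \<bar>f (ix m s) s\<bar> <= (Cb + Cb) * M / tau m"
    proof (rule AE_I2, rule impI)
      fix s assume s: "s \<in> {0..<T}"
      have "\<bar>(v m (Suc (ix m s)) - v m (ix m s)) \<bullet> E s\<bar> <= (Cb + Cb) * norm (E s)" by (rule inner_bound[OF dv[OF s]])
      also have "\<dots> <= (Cb + Cb) * M" using s Cb_nonneg by (intro mult_left_mono M) auto
      finally show "\<bar>f (ix m s) s\<bar> <= (Cb + Cb) * M / tau m"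
        unfolding f_eq abs_divide using tau_pos[of m] by (simp add: divide_right_mono)
    qed
  qed
  then show "tintegrable 0 T (%s. (v m (Suc (ix m s)) - v m (ix m s)) \<bullet> E s / tau m)" unfolding f_eq .
  have wi: "tintegrable 0 T (%s. w (ix m s) s)"
  proof (rule tintegrable_bound[OF _ wm])
    show "tintegrable 0 T (%s. 3 * Cb * b s)" by (intro set_integrable_mult_right bi)
    show "AE s in lebesgue. s \<in> {0..<T} --> \<bar>w (ix m s) s\<bar> <= 3 * Cb * b s"
      using bAE
    proof eventually_elim
      case (elim s)
      show ?case
      proof
        assume s: "s \<in> {0..<T}"
        have "\<bar>vt m s \<bullet> Ed s\<bar> <= 3 * Cb * norm (Ed s)" by (rule inner_bound[OF vtb[OF s]])
        also have "\<dots> <= 3 * Cb * b s" using elim s Cb_nonneg by (intro mult_left_mono) auto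
        finally show "\<bar>w (ix m s) s\<bar> <= 3 * Cb * b s" unfolding w_eq .
      qed
    qed
  qed
  then show "tintegrable 0 T (%s. vt m s \<bullet> Ed s)" unfolding w_eq .
  have cell: "tint (?t k) (?t (Suc k)) (f k) = v m (Suc k) \<bullet> E (?t (Suc k)) - v m k \<bullet> E (?t k) - tint (?t k) (?t (Suc k)) (w k)"
    if "k < Suc m" for k
  proof -
    let ?a = "?t k" and ?b = "?t (Suc k)"
    have ab: "0 <= ?a" "?a <= ?b" "?b <= T" "?b - ?a = tau m"
      using that D.grid_mono(2)[of k m] D.grid_mono(1)[of k "Suc k" m] grid_le_T[of "Suc k" m] by (auto simp: distrib_right)
    have i: "tintegrable ?a ?b (%r. h \<bullet> Ed r)" for h
      using curve_tint[OF E ab(1,3), of h] by (simp add: inner_commute)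
    have "tint ?a ?b (f k) = (?b - ?a) * f k ?b - tint ?a ?b (%s. (s - ?a) * (?c k \<bullet> Ed s))"
    proof (rule tint_by_parts[OF ab(2) _ i])
      fix s assume s: "?a <= s" "s <= ?b"
      have "(E s - E ?a) \<bullet> ?c k = tint ?a s (%r. Ed r \<bullet> ?c k)" using s ab by (intro Eeq) auto
      then show "f k s = f k ?a + tint ?a s (%r. ?c k \<bullet> Ed r)"
        unfolding f_def inner_commute[of "?c k"] inner_diff_left by simp
    qed
    moreover have "(?b - ?a) * f k ?b = v m (Suc k) \<bullet> E ?b - v m k \<bullet> E ?b"
      unfolding ab(4) f_def using tau_pos[of m] by (simp add: inner_diff_left)
    moreover have "tint ?a ?b (w k) = tint ?a ?b (%r. v m k \<bullet> Ed r) + tint ?a ?b (%s. (s - ?a) * (?c k \<bullet> Ed s))"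
      unfolding w_def
    proof (rule tint_add[OF i])
      show "tintegrable ?a ?b (%s. (s - ?a) * (?c k \<bullet> Ed s))"
      proof (rule tintegrable_bound)
        show "tintegrable ?a ?b (%s. tau m * \<bar>?c k \<bullet> Ed s\<bar>)" by (intro set_integrable_mult_right set_integrable_abs i)
        have "(%s. ?c k \<bullet> Ed s) \<in> borel_measurable lebesgue" using mE(2)[of "?c k"] by (simp only: inner_commute)
        then show "(%s. (s - ?a) * (?c k \<bullet> Ed s)) \<in> borel_measurable lebesgue"
          by (intro borel_measurable_times) (auto intro!: measurable_completion simp del: inner_scaleR_left)
        show "AE s in lebesgue. s \<in> {?a..<?b} --> \<bar>(s - ?a) * (?c k \<bullet> Ed s)\<bar> <= tau m * \<bar>?c k \<bullet> Ed s\<bar>"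
          unfolding abs_mult using ab(4) by (intro AE_I2 impI mult_right_mono) auto
      qed
    qed
    moreover have "tint ?a ?b (%r. v m k \<bullet> Ed r) = v m k \<bullet> E ?b - v m k \<bullet> E ?a"
      using Eeq[OF ab(1,2,3), of "v m k"] unfolding inner_diff_left inner_commute[of "v m k"] by simp
    ultimately show ?thesis by linarith
  qed
  have "tint 0 T (%s. f (ix m s) s) + tint 0 T (%s. w (ix m s) s)
      = (\<Sum>k<Suc m. tint (?t k) (?t (Suc k)) (f k) + tint (?t k) (?t (Suc k)) (w k))"
    unfolding tint_grid[where f = f and m = m, OF fi] tint_grid[where f = w and m = m, OF wi] by (rule sum.distrib[symmetric])
  also have "\<dots> = (\<Sum>k<Suc m. v m (Suc k) \<bullet> E (?t (Suc k)) - v m k \<bullet> E (?t k))"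
    by (intro sum.cong refl) (use cell in simp)
  also have "\<dots> = v m (Suc m) \<bullet> E (?t (Suc m)) - v m 0 \<bullet> E (?t 0)"
    by (rule sum_lessThan_telescope[of "%k. v m k \<bullet> E (?t k)"])
  also have "\<dots> = 0" unfolding T_grid by (simp add: E00)
  finally show "tint 0 T (%s. (v m (Suc (ix m s)) - v m (ix m s)) \<bullet> E s / tau m) = - tint 0 T (%s. vt m s \<bullet> Ed s)"
    unfolding f_eq w_eq by linarith
qed

text \<open>The pair \<open>(E s, q s)\<close> is admissible in the step of the cell containing
  \<open>s\<close>, because the graph at \<open>s\<close> is contained in the one at the end of the
  cell. After integration by parts the linear interpolant \<open>vt\<close> is replaced by the left
  velocity, which is harmless since \<open>Ed s\<close> lies in \<open>P s\<close> and
  \<open>jump_to_0\<close> applies.\<close>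

lemma weak_form:
  assumes E: "curve E Ed b"
    and q: "AE s in lebesgue. s \<in> {0..<T} --> (E s, q s) \<in> W s \<and> norm (q s) <= b s"
    and Ed: "AE s in lebesgue. s \<in> {0..<T} --> Ed s \<in> P s"
  shows "- tint 0 T (%s. slice B s \<bullet> Ed s) + tint 0 T (%s. slice D s \<bullet> q s) = tint 0 T (%s. Fs s \<bullet> E s)"
proof -
  have bi: "tintegrable 0 T b" and bAE: "AE s in lebesgue. s \<in> {0..<T} --> norm (Ed s) <= b s"
    and mE: "!!h. (%s. E s \<bullet> h) \<in> borel_measurable lebesgue" "!!h. (%s. Ed s \<bullet> h) \<in> borel_measurable lebesgue"
    using E by (auto simp: curve_def)
  have mE': "(%s. h \<bullet> E s) \<in> borel_measurable lebesgue" "(%s. h \<bullet> Ed s) \<in> borel_measurable lebesgue" for h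
    using mE[of h] by (simp_all add: inner_commute)
  \<comment> \<open>No measurability of \<open>q\<close> is assumed. The discrete equation
    identifies the pairing of \<open>q\<close> with the new gradient, almost everywhere, with the
    measurable \<open>R m\<close>.\<close>
  define X where "X m s = indicator {0..<T} s * (g m (Suc (ix m s)) \<bullet> q s)" for m s
  define R where "R m s = y m (ix m s) \<bullet> E s - (v m (Suc (ix m s)) - v m (ix m s)) \<bullet> E s / tau m" for m s
  define Y where "Y m s = v m (ix m s) \<bullet> Ed s" for m s
  note acc = acceleration_by_parts[OF E] and src = source_tendsto[OF E]
  have Rm: "R m \<in> borel_measurable lebesgue" for m
    unfolding R_def
    by (rule ix_compose_measurable[of "%k s. y m k \<bullet> E s - (v m (Suc k) - v m k) \<bullet> E s / tau m"])
      (intro borel_measurable_diff borel_measurable_divide borel_measurable_const mE'(1))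
  have XR: "AE s in lebesgue. indicator {0..<T} s * R m s = X m s" for m
    using q
  proof eventually_elim
    case (elim s)
    show ?case
    proof (cases "s \<in> {0..<T}")
      case True
      then have s: "0 <= s" "(E s, q s) \<in> W s" using elim by auto
      then have "(E s, q s) \<in> W (real (Suc (ix m s)) * tau m)"
        using W(3)[OF s(1), of "real (Suc (ix m s)) * tau m"] ix_bounds(2)[OF s(1), of m] by auto
      from D.step_eq[OF this]
      have "tau m * (g m (Suc (ix m s)) \<bullet> q s) = tau m * (y m (ix m s) \<bullet> E s) - (v m (Suc (ix m s)) - v m (ix m s)) \<bullet> E s" by simp
      also have "\<dots> = tau m * R m s" unfolding R_def using tau_pos[of m] by (simp add: right_diff_distrib)
      finally have "g m (Suc (ix m s)) \<bullet> q s = R m s" using tau_pos[of m] by simp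
      then show ?thesis by (simp add: X_def)
    qed (simp add: X_def)
  qed
  have Xm: "X m \<in> borel_measurable lebesgue" for m
    by (rule borel_measurable_AE[OF _ XR]) (intro borel_measurable_times borel_measurable_indicator ivl_lebesgue Rm)
  have Xt: "tint 0 T (X m) = tint 0 T (R m)" for m
  proof (rule tint_cong_AE[OF Xm _ Rm])
    show "AE s in lebesgue. s \<in> {0..<T} --> X m s = R m s" using XR[of m] by eventually_elim auto
  qed
  have Ym: "Y m \<in> borel_measurable lebesgue" for m
    unfolding Y_def by (rule ix_compose_measurable[of "%k s. v m k \<bullet> Ed s"]) (rule mE'(2))
  have Yb: "AE s in lebesgue. s \<in> {0..<T} --> \<bar>Y m s\<bar> <= Cb * b s" for m
    using bAE
  proof eventually_elim
    case (elim s)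
    show ?case
    proof
      assume s: "s \<in> {0..<T}"
      have "\<bar>Y m s\<bar> <= Cb * norm (Ed s)" unfolding Y_def by (rule inner_bound[OF v_bd(1)[OF s]])
      also have "\<dots> <= Cb * b s" using elim s Cb_nonneg by (intro mult_left_mono) auto
      finally show "\<bar>Y m s\<bar> <= Cb * b s" .
    qed
  qed
  have Cbi: "tintegrable 0 T (%s. Cb * b s)" by (intro set_integrable_mult_right bi)
  have Yi: "tintegrable 0 T (Y m)" for m by (rule tintegrable_bound[OF Cbi Ym Yb])
  have Xb: "AE s in lebesgue. s \<in> {0..<T} --> \<bar>X m s\<bar> <= Cb * b s" for m
    using q
  proof eventually_elim
    case (elim s)
    show ?case
    proof
      assume s: "s \<in> {0..<T}"
      have "\<bar>g m (Suc (ix m s)) \<bullet> q s\<bar> <= Cb * norm (q s)" by (rule inner_bound[OF v_bd(3)[OF s]])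
      also have "\<dots> <= Cb * b s" using elim s Cb_nonneg by (intro mult_left_mono) auto
      finally show "\<bar>X m s\<bar> <= Cb * b s" using s by (simp add: X_def)
    qed
  qed
  have "(%m. tint 0 T (%s. vt m s \<bullet> Ed s - Y m s)) ----> 0"
  proof (rule tint_null_tendsto)
    have vtm: "(%s. vt m s \<bullet> Ed s) \<in> borel_measurable lebesgue" for m
    proof -
      have 1: "(%s. h \<bullet> Ed s) \<in> borel_measurable lebesgue" for h using mE(2)[of h] by (simp add: inner_commute)
      have 2: "(%s. (s - real k * tau m) / tau m) \<in> borel_measurable lebesgue" for k by (intro measurable_completion) simp
      have "(%s. (%k s. v m k \<bullet> Ed s + ((s - real k * tau m) / tau m) * ((v m (Suc k) - v m k) \<bullet> Ed s)) (ix m s) s) \<in> borel_measurable lebesgue"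
        by (rule ix_compose_measurable) (intro borel_measurable_add borel_measurable_times 1 2)
      then show ?thesis by (simp add: vt_def inner_add_left)
    qed
    show "(%s. vt m s \<bullet> Ed s - Y m s) \<in> borel_measurable lebesgue" for m by (intro borel_measurable_diff vtm Ym)
    have le: "\<bar>vt m s \<bullet> Ed s - Y m s\<bar> <= \<bar>(v m (Suc (ix m s)) - v m (ix m s)) \<bullet> Ed s\<bar>" if s: "s \<in> {0..<T}" for m s
    proof -
      have "0 <= (s - real (ix m s) * tau m) / tau m" "(s - real (ix m s) * tau m) / tau m <= 1"
        using ix_bounds[of s m] s tau_pos[of m] by (auto simp: field_simps)
      then have "\<bar>(s - real (ix m s) * tau m) / tau m\<bar> * \<bar>(v m (Suc (ix m s)) - v m (ix m s)) \<bullet> Ed s\<bar>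
          <= 1 * \<bar>(v m (Suc (ix m s)) - v m (ix m s)) \<bullet> Ed s\<bar>" by (intro mult_right_mono) auto
      then show ?thesis unfolding vt_def Y_def inner_add_left inner_scaleR_left abs_mult[symmetric] by simp
    qed
    show "tintegrable 0 T (%s. (Cb + Cb) * b s)" by (intro set_integrable_mult_right bi)
    show "AE s in lebesgue. s \<in> {0..<T} --> \<bar>vt m s \<bullet> Ed s - Y m s\<bar> <= (Cb + Cb) * b s" for m
      using bAE
    proof eventually_elim
      case (elim s)
      show ?case
      proof
        assume s: "s \<in> {0..<T}"
        have "norm (v m (Suc (ix m s)) - v m (ix m s)) <= Cb + Cb"
          using v_bd(1,2)[OF s, of m] by (intro order_trans[OF norm_triangle_ineq4] add_mono)
        from inner_bound[OF this, of "Ed s"] le[OF s, of m]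
        have "\<bar>vt m s \<bullet> Ed s - Y m s\<bar> <= (Cb + Cb) * norm (Ed s)" by linarith
        also have "\<dots> <= (Cb + Cb) * b s" using elim s Cb_nonneg by (intro mult_left_mono) auto
        finally show "\<bar>vt m s \<bullet> Ed s - Y m s\<bar> <= (Cb + Cb) * b s" .
      qed
    qed
    show "AE s in lebesgue. s \<in> {0..<T} --> (%m. vt m s \<bullet> Ed s - Y m s) ----> 0"
      using Ed
    proof eventually_elim
      case (elim s)
      show ?case
      proof
        assume s: "s \<in> {0..<T}"
        then have "0 <= s" "s < 2 * T" "Ed s \<in> P s" using elim T by auto
        from tendsto_rabs_zero[OF jump_to_0[OF this]]
        show "(%m. vt m s \<bullet> Ed s - Y m s) ----> 0"
          by (rule Lim_null_comparison[rotated]) (use le[OF s] in auto)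
      qed
    qed
  qed
  note lim0 = tendsto_add[OF src(2) this]
  have eq: "(%m. tint 0 T (%s. y m (ix m s) \<bullet> E s) + tint 0 T (%s. vt m s \<bullet> Ed s - Y m s))
      = (%m. tint 0 T (X m) - tint 0 T (Y m))"
  proof
    fix m
    have "tint 0 T (R m) = tint 0 T (%s. y m (ix m s) \<bullet> E s) + tint 0 T (%s. vt m s \<bullet> Ed s)"
      unfolding R_def[abs_def] using tint_diff[OF src(1) acc(1)] acc(3) by simp
    then show "tint 0 T (%s. y m (ix m s) \<bullet> E s) + tint 0 T (%s. vt m s \<bullet> Ed s - Y m s) = tint 0 T (X m) - tint 0 T (Y m)"
      unfolding Xt tint_diff[OF acc(2) Yi] by simp
  qed
  have "(%m. tint 0 T (X m) - tint 0 T (Y m)) ----> tint 0 T (%s. Fs s \<bullet> E s)"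
    using lim0 unfolding eq by simp
  then have "(%n. avg n (%m. tint 0 T (X m)) - avg n (%m. tint 0 T (Y m))) ----> tint 0 T (%s. Fs s \<bullet> E s)"
    unfolding avg_diff[symmetric] by (rule avg_tendsto)
  moreover have "(%n. avg n (%m. tint 0 T (X m)) - avg n (%m. tint 0 T (Y m)))
      ----> tint 0 T (%s. slice D s \<bullet> q s) - tint 0 T (%s. slice B s \<bullet> Ed s)"
  proof (rule tendsto_diff)
    show "(%n. avg n (%m. tint 0 T (X m))) ----> tint 0 T (%s. slice D s \<bullet> q s)"
    proof (rule avg_tint_tendsto(2)[OF Xm Cbi Xb])
      show "AE r in lebesgue. r \<in> {0..<T} --> (%n. avg n (%m. X m r)) ----> slice D r \<bullet> q r"
        using lim_D
      proof eventually_elim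
        case (elim r)
        show ?case
        proof
          assume r: "r \<in> {0..<T}"
          then have "(%n. avg n (%m. g m (Suc (ix m r)))) ----> slice D r" using elim T by (auto simp: avg_def)
          then have "(%n. avg n (%m. g m (Suc (ix m r)) \<bullet> q r)) ----> slice D r \<bullet> q r"
            unfolding avg_inner[symmetric] by (intro tendsto_intros)
          then show "(%n. avg n (%m. X m r)) ----> slice D r \<bullet> q r" using r by (simp add: X_def)
        qed
      qed
    qed
    show "(%n. avg n (%m. tint 0 T (Y m))) ----> tint 0 T (%s. slice B s \<bullet> Ed s)"
    proof (rule avg_tint_tendsto(2)[OF Ym Cbi Yb])
      show "AE r in lebesgue. r \<in> {0..<T} --> (%n. avg n (%m. Y m r)) ----> slice B r \<bullet> Ed r"
        using B_avg by eventually_elim (simp add: Y_def)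
    qed
  qed
  ultimately have "tint 0 T (%s. slice D s \<bullet> q s) - tint 0 T (%s. slice B s \<bullet> Ed s) = tint 0 T (%s. Fs s \<bullet> E s)"
    using LIMSEQ_unique by blast
  then show ?thesis by simp
qed

end

subsection \<open>Representatives at every time\<close>

context evolution_limit
begin

text \<open>Conditions on a possible value at \<open>t\<close>, expressed through good times only,
  so that they make sense at exceptional times. They determine the triple: good times accumulate at
  \<open>t\<close> from the right, \<open>fst\<close> of \<open>W t\<close> is total in
  \<open>P t\<close>, and the graph is single valued.\<close>

definition rep_at :: "real => ('a, real) l2 => ('a, real) l2 => ('a, 'a) l2 => bool" where
  "rep_at t a w z \<longleftrightarrow> (\<forall>s. good s --> norm (U s - a) <= Cb * \<bar>s - t\<bar>) \<and> (a, z) \<in> W t \<and> norm z <= Cb \<and> w \<in> P t \<and> norm w <= Cb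
    \<and> (\<forall>s \<phi> q. good s --> t <= s --> (\<phi>, q) \<in> W t --> (V s - w) \<bullet> \<phi> = tint t s (%r. Fs r \<bullet> \<phi> - slice D r \<bullet> q))"

lemma U_lipschitz_abs: "good s ==> good t ==> norm (U s - U t) <= Cb * \<bar>s - t\<bar>"
  using U_lipschitz[of s t] U_lipschitz[of t s] by (cases "s <= t") (auto simp: norm_minus_commute abs_if)

lemma rep_at_good: assumes t: "good t" shows "rep_at t (U t) (V t) (Z t)"
  unfolding rep_at_def
proof (intro conjI allI impI)
  show "norm (U s - U t) <= Cb * \<bar>s - t\<bar>" if "good s" for s by (rule U_lipschitz_abs[OF that t])
  show "(V s - V t) \<bullet> \<phi> = tint t s (%r. Fs r \<bullet> \<phi> - slice D r \<bullet> q)" if "good s" "t <= s" "(\<phi>, q) \<in> W t" for s \<phi> q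
    by (rule V_diff[OF t that(1,2) good_range(1)[OF t] order_refl that(3)])
qed (rule good_props[OF t])+

lemma H_tint_tendsto_0:
  assumes t: "0 <= t" and s: "!!n. t <= s n" "!!n. s n <= 2 * T" "s ----> t"
  shows "(%n. tint t (s n) (%r. Fs r \<bullet> \<phi> - slice D r \<bullet> q)) ----> 0"
proof (rule Lim_null_comparison)
  show "\<forall>\<^sub>F n in sequentially. norm (tint t (s n) (%r. Fs r \<bullet> \<phi> - slice D r \<bullet> q))
      <= norm \<phi> * ((1 + FM) * sqrt (s n - t)) + Cb * norm q * (s n - t)"
    using H_tint(2)[OF t s(1,2)] by (intro always_eventually allI) simp
  have "(%n. norm \<phi> * ((1 + FM) * sqrt (s n - t)) + Cb * norm q * (s n - t)) ----> norm \<phi> * ((1 + FM) * sqrt (t - t)) + Cb * norm q * (t - t)"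
    by (intro tendsto_intros s(3))
  then show "(%n. norm \<phi> * ((1 + FM) * sqrt (s n - t)) + Cb * norm q * (s n - t)) ----> 0" by simp
qed

text \<open>Almost all times up to \<open>2 * T\<close> are good, so even \<open>T\<close> can be
  approached from the right.\<close>

lemma right_sequence:
  assumes "0 <= t" "t <= T"
  obtains s where "!!n. good (s n)" "!!n. t < s n" "s ----> t"
proof -
  have "\<exists>s. good s \<and> t < s \<and> s < t + tau n" for n
    using good_dense[of t "t + tau n"] assms tau_pos[of n] tau_le[of n] by auto
  then obtain s where s: "!!n. good (s n)" "!!n. t < s n" "!!n. s n < t + tau n" by metis
  have "s ----> t"
  proof (rule tendsto_sandwich[OF _ _ tendsto_const])
    show "(%n. t + tau n) ----> t" using tendsto_add[OF tendsto_const[of t] tau_tendsto] by simp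
  qed (use s in \<open>auto intro!: always_eventually less_imp_le\<close>)
  then show thesis using that s by blast
qed

lemma left_sequence:
  assumes "0 < t" "t <= T"
  obtains s where "!!n. good (s n)" "!!n. s n < t" "s ----> t"
proof -
  have "\<exists>s. good s \<and> max 0 (t - tau n) < s \<and> s < t" for n
    using good_dense[of "max 0 (t - tau n)" t] assms tau_pos[of n] T by auto
  then obtain s where s: "!!n. good (s n)" "!!n. max 0 (t - tau n) < s n" "!!n. s n < t" by metis
  have "s ----> t"
  proof (rule tendsto_sandwich[OF _ _ _ tendsto_const])
    show "(%n. t - tau n) ----> t" using tendsto_diff[OF tendsto_const[of t] tau_tendsto] by simp
    show "\<forall>\<^sub>F n in sequentially. t - tau n <= s n" using s(2) by (auto intro!: always_eventually less_imp_le)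
  qed (use s in \<open>auto intro!: always_eventually less_imp_le\<close>)
  then show thesis using that s by blast
qed

text \<open>The three components need different one-sided limits. Positions converge from either
  side by their Lipschitz bound. Gradients and velocities are merely bounded, so convex combinations
  are taken, each on the side that keeps what is required of the limit.\<close>

lemma rep_at_exists:
  assumes t: "0 <= t" "t <= T"
  shows "\<exists>a w z. rep_at t a w z"
proof (cases "good t")
  case True
  then show ?thesis using rep_at_good by blast
next
  case False
  then have t0: "0 < t" using good_0(1) t by (cases "t = 0") auto
  obtain s where s: "!!n. good (s n)" "!!n. t < s n" "s ----> t" using right_sequence[OF t] by blast
  \<comment> \<open>Gradients are taken from the left, where the graphs are contained in the closed
    \<open>W t\<close>; limits from the right would only be known to lie in the larger
    graphs.\<close>
  obtain r where r: "!!n. good (r n)" "!!n. r n < t" "r ----> t" using left_sequence[OF t0 t(2)] by blast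
  have "Cauchy (%n. U (s n))"
  proof (rule CauchyI)
    fix e :: real assume e: "0 < e"
    have "Cauchy s" using s(3) by (rule LIMSEQ_imp_Cauchy)
    then obtain M where M: "!!m n. m \<ge> M ==> n \<ge> M ==> norm (s m - s n) < e / (Cb + 1)"
      using CauchyD[of s "e / (Cb + 1)"] e Cb_nonneg by (metis add_nonneg_pos divide_pos_pos zero_less_one)
    have "norm (U (s m) - U (s n)) < e" if "m \<ge> M" "n \<ge> M" for m n
    proof -
      have "norm (U (s m) - U (s n)) <= Cb * \<bar>s m - s n\<bar>" by (rule U_lipschitz_abs[OF s(1) s(1)])
      also have "\<dots> <= (Cb + 1) * \<bar>s m - s n\<bar>" by (simp add: mult_right_mono)
      also have "\<dots> < e" using M[OF that] Cb_nonneg by (simp add: pos_less_divide_eq mult.commute)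
      finally show ?thesis .
    qed
    then show "\<exists>M. \<forall>m\<ge>M. \<forall>n\<ge>M. norm (U (s m) - U (s n)) < e" by blast
  qed
  then obtain a where a: "(%n. U (s n)) ----> a" using Cauchy_convergent convergent_def by blast
  have aL: "norm (U x - a) <= Cb * \<bar>x - t\<bar>" if "good x" for x
  proof (rule LIMSEQ_le)
    show "(%n. norm (U x - U (s n))) ----> norm (U x - a)" by (intro tendsto_intros a)
    show "(%n. Cb * \<bar>x - s n\<bar>) ----> Cb * \<bar>x - t\<bar>" by (intro tendsto_intros s)
    show "\<exists>N. \<forall>n\<ge>N. norm (U x - U (s n)) <= Cb * \<bar>x - s n\<bar>" using U_lipschitz_abs[OF that s(1)] by blast
  qed
  have Ur: "(%n. U (r n)) ----> a"
  proof -
    have "(%n. U (r n) - a) ----> 0"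
    proof (rule Lim_null_comparison)
      show "\<forall>\<^sub>F n in sequentially. norm (U (r n) - a) <= Cb * \<bar>r n - t\<bar>" using aL[OF r(1)] by simp
      have "(%n. Cb * \<bar>r n - t\<bar>) ----> Cb * \<bar>t - t\<bar>" by (intro tendsto_intros r)
      then show "(%n. Cb * \<bar>r n - t\<bar>) ----> 0" by simp
    qed
    then show ?thesis by (simp add: LIM_zero_iff)
  qed
  obtain N1 l1 where w1: "!!n. tail_weights n (N1 n) (l1 n)" "convergent (%n. \<Sum>m\<le>N1 n. l1 n m *\<^sub>R Z (r m))"
    using convergent_convex_sums[of "%n. Z (r n)" Cb] good_props(4)[OF r(1)] by blast
  then obtain z where z: "(%n. \<Sum>m\<le>N1 n. l1 n m *\<^sub>R Z (r m)) ----> z" by (auto simp: convergent_def)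
  have za: "(a, z) \<in> W t"
  proof (rule closed_sequentially[OF W(1)])
    show "(%n. (\<Sum>m\<le>N1 n. l1 n m *\<^sub>R U (r m), \<Sum>m\<le>N1 n. l1 n m *\<^sub>R Z (r m))) ----> (a, z)"
      by (intro tendsto_Pair z tendsto_convex_sum[OF w1(1) Ur])
    fix n
    have "(U (r m), Z (r m)) \<in> W t" for m
      using good_props(1)[OF r(1)] W(3)[OF good_range(1)[OF r(1)] less_imp_le[OF r(2)]] by blast
    then have "(\<Sum>m\<le>N1 n. l1 n m *\<^sub>R (U (r m), Z (r m))) \<in> W t" by (intro convex_sum_in_subspace[OF W(2) w1(1)])
    moreover have "(\<Sum>m\<le>N1 n. l1 n m *\<^sub>R (U (r m), Z (r m))) = (\<Sum>m\<le>N1 n. l1 n m *\<^sub>R U (r m), \<Sum>m\<le>N1 n. l1 n m *\<^sub>R Z (r m))"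
      by (simp add: prod_eq_iff fst_sum snd_sum)
    ultimately show "(\<Sum>m\<le>N1 n. l1 n m *\<^sub>R U (r m), \<Sum>m\<le>N1 n. l1 n m *\<^sub>R Z (r m)) \<in> W t" by simp
  qed
  have zb: "norm z <= Cb"
    using norm_convex_sum_le[where x = "%m. Z (r m)" and C = Cb, OF w1(1) good_props(4)[OF r(1)]]
    by (intro LIMSEQ_le_const2[OF tendsto_norm[OF z]] exI[of _ 0] allI impI)
  obtain N2 l2 where w2: "!!n. tail_weights n (N2 n) (l2 n)" "convergent (%n. \<Sum>m\<le>N2 n. l2 n m *\<^sub>R V (s m))"
    using convergent_convex_sums[of "%n. V (s n)" Cb] good_props(3)[OF s(1)] by blast
  then obtain w0 where w0: "(%n. \<Sum>m\<le>N2 n. l2 n m *\<^sub>R V (s m)) ----> w0" by (auto simp: convergent_def)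
  have w0b: "norm w0 <= Cb"
    using norm_convex_sum_le[where x = "%m. V (s m)" and C = Cb, OF w2(1) good_props(3)[OF s(1)]]
    by (intro LIMSEQ_le_const2[OF tendsto_norm[OF w0]] exI[of _ 0] allI impI)
  \<comment> \<open>Velocities come from the right, where the increment formula holds for all test
    pairs of \<open>W t\<close>, but there they may leave \<open>P t\<close>. The projection brings
    them back, and since test functions lie in \<open>P t\<close> their scalar products do not
    change.\<close>
  obtain w where w: "w \<in> P t" "!!h. h \<in> P t ==> (w0 - w) \<bullet> h = 0" using orthogonal_projection[OF P(1,2)] by metis
  have "norm w * norm w <= norm w0 * norm w"
    using w(2)[OF w(1)] norm_cauchy_schwarz[of w0 w] by (simp add: inner_diff_left power2_norm_eq_inner[symmetric] power2_eq_square)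
  then have wb: "norm w <= Cb" using w0b by (cases "w = 0") (auto simp: Cb_nonneg)
  have "(V x - w) \<bullet> \<phi> = tint t x (%r. Fs r \<bullet> \<phi> - slice D r \<bullet> q)" if x: "good x" "t <= x" "(\<phi>, q) \<in> W t" for x \<phi> q
  proof -
    let ?H = "%r. Fs r \<bullet> \<phi> - slice D r \<bullet> q"
    have tx: "t < x" using False x by (cases "t = x") auto
    have x2: "x < 2 * T" by (rule good_range(2)[OF x(1)])
    have "\<forall>\<^sub>F n in sequentially. s n < x" using s(3) tx by (rule order_tendstoD)
    then have "\<forall>\<^sub>F n in sequentially. V x \<bullet> \<phi> - tint t x ?H + tint t (s n) ?H = V (s n) \<bullet> \<phi>"
    proof eventually_elim
      case (elim n)
      have "(V x - V (s n)) \<bullet> \<phi> = tint (s n) x ?H"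
        by (rule V_diff[OF s(1) x(1) less_imp_le[OF elim] t(1) less_imp_le[OF s(2)] x(3)])
      moreover have "tint t x ?H = tint t (s n) ?H + tint (s n) x ?H"
        by (rule tint_combine[OF less_imp_le[OF s(2)] less_imp_le[OF elim] H_tint(1)[OF t(1) x(2)]]) (use x2 in simp)
      ultimately show ?case by (simp add: inner_diff_left)
    qed
    moreover have "(%n. V x \<bullet> \<phi> - tint t x ?H + tint t (s n) ?H) ----> V x \<bullet> \<phi> - tint t x ?H + 0"
      using s good_range(2)[OF s(1)] by (intro tendsto_intros H_tint_tendsto_0[OF t(1)]) (auto intro: less_imp_le)
    ultimately have "(%n. V (s n) \<bullet> \<phi>) ----> V x \<bullet> \<phi> - tint t x ?H"
      using Lim_transform_eventually by fastforce
    from tendsto_convex_sum[OF w2(1) this]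
    have "(%n. (\<Sum>m\<le>N2 n. l2 n m *\<^sub>R V (s m)) \<bullet> \<phi>) ----> V x \<bullet> \<phi> - tint t x ?H" by (simp add: inner_sum_left)
    moreover have "(%n. (\<Sum>m\<le>N2 n. l2 n m *\<^sub>R V (s m)) \<bullet> \<phi>) ----> w0 \<bullet> \<phi>" by (intro tendsto_intros w0)
    ultimately have "w0 \<bullet> \<phi> = V x \<bullet> \<phi> - tint t x ?H" using LIMSEQ_unique by blast
    moreover have "w0 \<bullet> \<phi> = w \<bullet> \<phi>" using w(2)[OF W_P[OF t(1) x(3)]] by (simp add: inner_diff_left)
    ultimately show ?thesis by (simp add: inner_diff_left)
  qed
  then have "rep_at t a w z" unfolding rep_at_def using aL za zb w(1) wb by blast
  then show ?thesis by blast
qed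

text \<open>Weak continuity from the right, in the directions of \<open>P t\<close> for the velocity
  and in all directions for the gradient.\<close>

lemma rep_at_weak_tendsto:
  assumes t: "0 <= t" "t <= T" and rep: "rep_at t a w z"
    and s: "!!n. good (s n)" "!!n. t < s n" "s ----> t"
  shows "h \<in> P t ==> (%n. V (s n) \<bullet> h) ----> w \<bullet> h" "(%n. Z (s n) \<bullet> k) ----> z \<bullet> k"
proof -
  have r: "!!x. good x ==> norm (U x - a) <= Cb * \<bar>x - t\<bar>" "(a, z) \<in> W t" "w \<in> P t"
    "!!x \<phi> q. good x ==> t <= x ==> (\<phi>, q) \<in> W t ==> (V x - w) \<bullet> \<phi> = tint t x (%r. Fs r \<bullet> \<phi> - slice D r \<bullet> q)"
    using rep unfolding rep_at_def by blast+
  show "(%n. V (s n) \<bullet> h) ----> w \<bullet> h" if "h \<in> P t"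
  proof (rule weak_tendsto_if_total[OF P(2) P(1) _ that, of "fst ` W t"])
    show "fst ` W t \<subseteq> P t" using W_P[OF t(1)] by force
    show "x = 0" if "x \<in> P t" "!!d. d \<in> fst ` W t ==> x \<bullet> d = 0" for x
      using W_dense[OF t(1) that(1)] that(2) by force
    show "\<forall>\<^sub>F n in sequentially. norm (V (s n)) <= Cb" using good_props(3)[OF s(1)] by simp
    fix d assume "d \<in> fst ` W t"
    then obtain q where dq: "(d, q) \<in> W t" by force
    have "V (s n) \<bullet> d = w \<bullet> d + tint t (s n) (%r. Fs r \<bullet> d - slice D r \<bullet> q)" for n
      using r(4)[OF s(1) less_imp_le[OF s(2)] dq, of n] by (simp add: inner_diff_left)
    moreover have "(%n. w \<bullet> d + tint t (s n) (%r. Fs r \<bullet> d - slice D r \<bullet> q)) ----> w \<bullet> d + 0"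
      using s good_range(2)[OF s(1)] by (intro tendsto_intros H_tint_tendsto_0[OF t(1)]) (auto intro: less_imp_le)
    ultimately show "(%n. V (s n) \<bullet> d) ----> w \<bullet> d" by simp
  qed
  have "(%n. U (s n) - a) ----> 0"
  proof (rule Lim_null_comparison)
    show "\<forall>\<^sub>F n in sequentially. norm (U (s n) - a) <= Cb * \<bar>s n - t\<bar>" using r(1)[OF s(1)] by simp
    have "(%n. Cb * \<bar>s n - t\<bar>) ----> Cb * \<bar>t - t\<bar>" by (intro tendsto_intros s)
    then show "(%n. Cb * \<bar>s n - t\<bar>) ----> 0" by simp
  qed
  then have Us: "(%n. U (s n)) ----> a" by (simp add: LIM_zero_iff)
  have T2: "0 <= 2 * T" using T by simp
  show "(%n. Z (s n) \<bullet> k) ----> z \<bullet> k"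
  proof (rule graph_weak_tendsto[OF T2 _ good_props(4)[OF s(1)] Us])
    show "(U (s n), Z (s n)) \<in> W (2 * T)" for n
      using good_props(1)[OF s(1)] W(3)[OF good_range(1)[OF s(1)] less_imp_le[OF good_range(2)[OF s(1)]]] by blast
    show "(a, z) \<in> W (2 * T)" using r(2) W(3)[of t "2 * T"] t T by auto
  qed
qed

text \<open>Weak lower semicontinuity along good times decreasing to \<open>t\<close>, in elementary
  form: the good values are paired with \<open>w\<close> and \<open>z\<close>, the product is
  bounded by half the sum of squares, and half of the limit is absorbed on the left.\<close>

lemma rep_at_energy:
  assumes t: "0 <= t" "t <= T" and rep: "rep_at t a w z"
  shows "(norm w)\<^sup>2 / 2 + (norm z)\<^sup>2 / 2 <= E0 + tint 0 t (%r. Fs r \<bullet> slice B r)"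
proof -
  obtain s where s: "!!n. good (s n)" "!!n. t < s n" "s ----> t" using right_sequence[OF t] by blast
  have wP: "w \<in> P t" using rep by (simp add: rep_at_def)
  let ?e = "(norm w)\<^sup>2 / 2 + (norm z)\<^sup>2 / 2" and ?X = "%r. Fs r \<bullet> slice B r"
  have "(%n. V (s n) \<bullet> w + Z (s n) \<bullet> z) ----> w \<bullet> w + z \<bullet> z"
    by (intro tendsto_add rep_at_weak_tendsto[OF t rep s] wP)
  moreover have "(%n. E0 + (tint 0 t ?X + tint t (s n) ?X) + ?e) ----> E0 + (tint 0 t ?X + 0) + ?e"
  proof (intro tendsto_add tendsto_const)
    show "(%n. tint t (s n) ?X) ----> 0"
    proof (rule Lim_null_comparison)
      show "\<forall>\<^sub>F n in sequentially. norm (tint t (s n) ?X) <= Cb * ((1 + FM) * sqrt (s n - t))"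
      proof (rule always_eventually, rule allI)
        fix n
        have i: "tintegrable t (s n) ?X" using FB_tint(1)[of t "s n"] t good_range(2)[OF s(1), of n] by simp
        have w: "tintegrable t (s n) (%r. Fn r * Cb)" by (intro set_integrable_mult_left Fn_tintegrable)
        have "\<bar>tint t (s n) ?X\<bar> <= tint t (s n) (%r. Fn r * Cb)"
          using FB_tint(3)[of t "s n"] t good_range(2)[OF s(1), of n] by (intro tint_abs_le[OF i w]) simp
        also have "\<dots> = Cb * tint t (s n) Fn" by (simp add: mult.commute[of _ Cb] tint_cmult)
        also have "\<dots> <= Cb * ((1 + FM) * sqrt (s n - t))"
          using s(2)[of n] by (intro mult_left_mono tint_Fn_le Cb_nonneg) simp
        finally show "norm (tint t (s n) ?X) <= Cb * ((1 + FM) * sqrt (s n - t))" by simp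
      qed
      have "(%n. Cb * ((1 + FM) * sqrt (s n - t))) ----> Cb * ((1 + FM) * sqrt (t - t))" by (intro tendsto_intros s)
      then show "(%n. Cb * ((1 + FM) * sqrt (s n - t))) ----> 0" by simp
    qed
  qed
  moreover have "V (s n) \<bullet> w + Z (s n) \<bullet> z <= E0 + (tint 0 t ?X + tint t (s n) ?X) + ?e" for n
  proof -
    have am: "x \<bullet> y <= (norm x)\<^sup>2 / 2 + (norm y)\<^sup>2 / 2" for x y :: "'z::real_inner"
    proof -
      have "0 <= (x - y) \<bullet> (x - y)" by simp
      then show ?thesis by (simp add: power2_norm_eq_inner inner_diff inner_commute)
    qed
    have "V (s n) \<bullet> w + Z (s n) \<bullet> z <= ((norm (V (s n)))\<^sup>2 / 2 + (norm (Z (s n)))\<^sup>2 / 2) + ?e"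
      using am[of "V (s n)" w] am[of "Z (s n)" z] by linarith
    also have "(norm (V (s n)))\<^sup>2 / 2 + (norm (Z (s n)))\<^sup>2 / 2 <= E0 + tint 0 (s n) ?X" by (rule energy_good[OF s(1)])
    also have "tint 0 (s n) ?X = tint 0 t ?X + tint t (s n) ?X"
      by (rule tint_combine[OF t(1) less_imp_le[OF s(2)] FB_tint(1)]) (use good_range(2)[OF s(1), of n] in auto)
    finally show ?thesis by simp
  qed
  ultimately have "w \<bullet> w + z \<bullet> z <= E0 + (tint 0 t ?X + 0) + ?e" by (intro LIMSEQ_le) blast+
  then show ?thesis by (simp add: power2_norm_eq_inner[symmetric])
qed

lemma rep_at_U_lipschitz:
  assumes "0 <= t" "t <= T" "rep_at t a w z" "rep_at s a' w' z'" "0 <= s" "s <= T"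
  shows "norm (a - a') <= Cb * \<bar>t - s\<bar>"
proof -
  obtain r where r: "!!n. good (r n)" "!!n. t < r n" "r ----> t" using right_sequence[OF assms(1,2)] by blast
  have "norm (a - a') <= Cb * \<bar>r n - t\<bar> + Cb * \<bar>r n - s\<bar>" for n
  proof -
    have "norm (U (r n) - a) <= Cb * \<bar>r n - t\<bar>" "norm (U (r n) - a') <= Cb * \<bar>r n - s\<bar>"
      using assms(3,4) r(1)[of n] unfolding rep_at_def by blast+
    then show ?thesis using norm_triangle_ineq4[of "U (r n) - a'" "U (r n) - a"] by simp
  qed
  moreover have "(%n. Cb * \<bar>r n - t\<bar> + Cb * \<bar>r n - s\<bar>) ----> Cb * \<bar>t - t\<bar> + Cb * \<bar>t - s\<bar>" by (intro tendsto_intros r)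
  ultimately have "norm (a - a') <= Cb * \<bar>t - t\<bar> + Cb * \<bar>t - s\<bar>" by (intro LIMSEQ_le_const) auto
  then show ?thesis by simp
qed

text \<open>Both values are compared with one good time beyond \<open>t\<close>, and the increments
  are subtracted.\<close>

lemma rep_at_V_diff:
  assumes "rep_at s a w z" "rep_at t a' w' z'" "0 <= tb" "tb <= s" "s <= t" "t <= T" "(\<phi>, q) \<in> W tb"
  shows "(w' - w) \<bullet> \<phi> = tint s t (%r. Fs r \<bullet> \<phi> - slice D r \<bullet> q)"
proof -
  let ?H = "%r. Fs r \<bullet> \<phi> - slice D r \<bullet> q"
  have s0: "0 <= s" "0 <= t" using assms by auto
  obtain r :: "nat => real" where r: "!!n. good (r n)" "!!n. t < r n" "r ----> t" using right_sequence[OF s0(2) assms(6)] by blast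
  have "(\<phi>, q) \<in> W s" "(\<phi>, q) \<in> W t" using assms W(3)[of tb s] W(3)[of tb t] by auto
  then have "(V (r 0) - w) \<bullet> \<phi> = tint s (r 0) ?H" "(V (r 0) - w') \<bullet> \<phi> = tint t (r 0) ?H"
    using assms(1,2,5) r(1)[of 0] r(2)[of 0] unfolding rep_at_def by auto
  moreover have "tint s (r 0) ?H = tint s t ?H + tint t (r 0) ?H"
    using r(2)[of 0] good_range(2)[OF r(1)[of 0]] assms(5) by (intro tint_combine H_tint(1) s0) auto
  ultimately show ?thesis by (simp add: inner_diff_left)
qed

end

lemma (in evolution_seq) limit_exists:
  "\<exists>N l A B G D. evolution_limit T W P F u0 u1 g0 u v g y N l A B G D"
proof -
  have T2: "0 <= 2 * T" using T by simp
  define C where "C = Cb + Cu"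
  have Cu0: "0 <= Cu" unfolding Cu_def using T Cb_nonneg by simp
  have ix': "step_index (tau m) t = ix m t" for m t by (simp add: ix_def)
  have bd: "norm (u m (step_index (tau m) t)) <= C" "norm (v m (step_index (tau m) t)) <= C"
    "norm (g m (step_index (tau m) t)) <= C" "norm (g m (Suc (step_index (tau m) t))) <= C" if "t \<in> {0..<2*T}" for m t
  proof -
    have "0 <= t" "t < 2 * T" using that by auto
    note le = ix_le[OF this, of m]
    show "norm (u m (step_index (tau m) t)) <= C" "norm (v m (step_index (tau m) t)) <= C"
      "norm (g m (step_index (tau m) t)) <= C" "norm (g m (Suc (step_index (tau m) t))) <= C"
      unfolding ix' C_def using u_bound[OF le(1)] vg_bound[OF le(1)] vg_bound[OF le(2)] Cu0 Cb_nonneg by linarith+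
  qed
  obtain N l A B G D where "!!n. tail_weights n (N n) (l n)" "sqint A" "sqint B" "sqint G" "sqint D"
    "AE t in lborel. t \<in> {0..<2*T} --> (%n. \<Sum>m\<le>N n. l n m *\<^sub>R u m (step_index (tau m) t)) ----> slice A t"
    "AE t in lborel. t \<in> {0..<2*T} --> (%n. \<Sum>m\<le>N n. l n m *\<^sub>R v m (step_index (tau m) t)) ----> slice B t"
    "AE t in lborel. t \<in> {0..<2*T} --> (%n. \<Sum>m\<le>N n. l n m *\<^sub>R g m (step_index (tau m) t)) ----> slice G t"
    "AE t in lborel. t \<in> {0..<2*T} --> (%n. \<Sum>m\<le>N n. l n m *\<^sub>R g m (Suc (step_index (tau m) t))) ----> slice D t"
    by (rule convex_steps_converge_AE[where a = u and b = v and c = g and d = "%m k. g m (Suc k)" and \<tau> = tau and C = C, OF T2 bd]) (assumption+, (rule that; assumption))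
  then have "evolution_limit T W P F u0 u1 g0 u v g y N l A B G D"
    by (unfold_locales) (simp_all add: AE_completion_iff ix')
  then show ?thesis by blast
qed

text \<open>All that the partial differential equation needs from the abstract scheme, free of grids
  and convex combinations.\<close>

lemma (in evolution) solution_exists:
  "\<exists>A B D U V Z C. sqint A \<and> sqint B \<and> sqint D \<and> U 0 = u0 \<and> V 0 = u1 \<and> Z 0 = g0 \<and>
    (AE t in lebesgue. t \<in> {0..<T} --> U t = slice A t \<and> V t = slice B t \<and> Z t = slice D t) \<and>
    (\<forall>t\<in>{0..T}. (U t, Z t) \<in> W t \<and> V t \<in> P t \<and> norm (V t) <= C \<and> norm (Z t) <= C \<and>
      (norm (V t))\<^sup>2 / 2 + (norm (Z t))\<^sup>2 / 2 <= (norm u1)\<^sup>2 / 2 + (norm g0)\<^sup>2 / 2 + tint 0 t (%r. Fs r \<bullet> slice B r)) \<and>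
    (\<forall>s\<in>{0..T}. \<forall>t\<in>{0..T}. norm (U t - U s) <= C * \<bar>t - s\<bar>) \<and>
    (\<forall>tb s t \<phi> q. 0 <= tb --> tb <= s --> s <= t --> t <= T --> (\<phi>, q) \<in> W tb -->
      (V t - V s) \<bullet> \<phi> = tint s t (%r. Fs r \<bullet> \<phi> - slice D r \<bullet> q) \<and>
      \<bar>tint s t (%r. Fs r \<bullet> \<phi> - slice D r \<bullet> q)\<bar> <= norm \<phi> * ((1 + FM) * sqrt (t - s)) + C * norm q * (t - s)) \<and>
    (\<forall>\<Phi> \<Phi>d b. curve \<Phi> \<Phi>d b --> tint 0 T (%s. slice A s \<bullet> \<Phi>d s) = - tint 0 T (%s. slice B s \<bullet> \<Phi> s)) \<and>
    (\<forall>E Ed b q. curve E Ed b --> (AE s in lebesgue. s \<in> {0..<T} --> (E s, q s) \<in> W s \<and> norm (q s) <= b s) -->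
      (AE s in lebesgue. s \<in> {0..<T} --> Ed s \<in> P s) -->
      - tint 0 T (%s. slice B s \<bullet> Ed s) + tint 0 T (%s. slice D s \<bullet> q s) = tint 0 T (%s. Fs s \<bullet> E s))"
proof -
  have "\<forall>m. \<exists>x. case x of (u, v, g, y) => scheme (T / real (Suc m)) u v g y"
    using scheme_exists T by fastforce
  from choice[OF this] obtain x where x: "!!m. case x m of (u, v, g, y) => scheme (T / real (Suc m)) u v g y" by blast
  define u v g y where "u m = fst (x m)" and "v m = fst (snd (x m))" and "g m = fst (snd (snd (x m)))" and "y m = snd (snd (snd (x m)))" for m
  have sch: "scheme (T / real (Suc m)) (u m) (v m) (g m) (y m)" for m
    using x[of m] by (simp add: u_def v_def g_def y_def case_prod_beta)
  interpret S: evolution_seq T W P F u0 u1 g0 u v g y by unfold_locales (rule sch)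
  obtain N l A B G D where "evolution_limit T W P F u0 u1 g0 u v g y N l A B G D" using S.limit_exists by blast
  then interpret L: evolution_limit T W P F u0 u1 g0 u v g y N l A B G D .
  \<comment> \<open>At good times the actual limits are chosen, which secures the initial values and
    the agreement with the slices almost everywhere.\<close>
  have "\<forall>t. \<exists>p. t \<in> {0..T} --> (if L.good t then p = (L.U t, L.V t, L.Z t) else True) \<and> (case p of (a, w, z) => L.rep_at t a w z)"
  proof
    fix t
    show "\<exists>p. t \<in> {0..T} --> (if L.good t then p = (L.U t, L.V t, L.Z t) else True) \<and> (case p of (a, w, z) => L.rep_at t a w z)"
      using L.rep_at_exists[of t] L.rep_at_good[of t] by (cases "L.good t") auto
  qed
  from choice[OF this] obtain p where p: "\<forall>t. t \<in> {0..T} --> (if L.good t then p t = (L.U t, L.V t, L.Z t) else True) \<and> (case p t of (a, w, z) => L.rep_at t a w z)"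
    by (rule exE)
  have p1: "p t = (L.U t, L.V t, L.Z t)" if "t \<in> {0..T}" "L.good t" for t using p[rule_format, OF that(1)] that(2) by simp
  have p2: "case p t of (a, w, z) => L.rep_at t a w z" if "t \<in> {0..T}" for t using p[rule_format, OF that] by (rule conjunct2)
  define U V Z where "U t = fst (p t)" and "V t = fst (snd (p t))" and "Z t = snd (snd (p t))" for t
  have rep: "L.rep_at t (U t) (V t) (Z t)" if "t \<in> {0..T}" for t
    using p2[OF that] by (simp add: U_def V_def Z_def case_prod_beta)
  have good: "U t = L.U t" "V t = L.V t" "Z t = L.Z t" if "t \<in> {0..T}" "L.good t" for t
    using p1[OF that] by (simp_all add: U_def V_def Z_def)
  have T0: "0 \<in> {0..T}" using T by simp
  show ?thesis
  proof (rule exI[of _ A], rule exI[of _ B], rule exI[of _ D], rule exI[of _ U], rule exI[of _ V], rule exI[of _ Z], rule exI[of _ S.Cb],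
      intro conjI)
    show "sqint A" "sqint B" "sqint D" by (rule L.sq)+
    show "U 0 = u0" "V 0 = u1" "Z 0 = g0" using good[OF T0 L.good_0(1)] L.good_0 by auto
    show "AE t in lebesgue. t \<in> {0..<T} --> U t = slice A t \<and> V t = slice B t \<and> Z t = slice D t"
      using L.AE_good L.AE_D_eq by eventually_elim (use good in auto)
    show "\<forall>t\<in>{0..T}. (U t, Z t) \<in> W t \<and> V t \<in> P t \<and> norm (V t) <= S.Cb \<and> norm (Z t) <= S.Cb \<and>
      (norm (V t))\<^sup>2 / 2 + (norm (Z t))\<^sup>2 / 2 <= (norm u1)\<^sup>2 / 2 + (norm g0)\<^sup>2 / 2 + tint 0 t (%r. Fs r \<bullet> slice B r)"
    proof
      fix t assume t: "t \<in> {0..T}"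
      then show "(U t, Z t) \<in> W t \<and> V t \<in> P t \<and> norm (V t) <= S.Cb \<and> norm (Z t) <= S.Cb \<and>
        (norm (V t))\<^sup>2 / 2 + (norm (Z t))\<^sup>2 / 2 <= (norm u1)\<^sup>2 / 2 + (norm g0)\<^sup>2 / 2 + tint 0 t (%r. Fs r \<bullet> slice B r)"
        using rep[OF t] L.rep_at_energy[OF _ _ rep[OF t]] by (simp add: L.rep_at_def L.E0_def)
    qed
    show "\<forall>s\<in>{0..T}. \<forall>t\<in>{0..T}. norm (U t - U s) <= S.Cb * \<bar>t - s\<bar>"
      using L.rep_at_U_lipschitz[OF _ _ rep rep] by auto
    show "\<forall>tb s t \<phi> q. 0 <= tb --> tb <= s --> s <= t --> t <= T --> (\<phi>, q) \<in> W tb -->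
      (V t - V s) \<bullet> \<phi> = tint s t (%r. Fs r \<bullet> \<phi> - slice D r \<bullet> q) \<and>
      \<bar>tint s t (%r. Fs r \<bullet> \<phi> - slice D r \<bullet> q)\<bar> <= norm \<phi> * ((1 + FM) * sqrt (t - s)) + S.Cb * norm q * (t - s)"
    proof (intro allI impI conjI)
      fix tb s t \<phi> q assume a: "0 <= tb" "tb <= s" "s <= t" "t <= T" "(\<phi>, q) \<in> W tb"
      then have "s \<in> {0..T}" "t \<in> {0..T}" by auto
      from L.rep_at_V_diff[OF rep[OF this(1)] rep[OF this(2)] a]
      show "(V t - V s) \<bullet> \<phi> = tint s t (%r. Fs r \<bullet> \<phi> - slice D r \<bullet> q)" .
      show "\<bar>tint s t (%r. Fs r \<bullet> \<phi> - slice D r \<bullet> q)\<bar> <= norm \<phi> * ((1 + FM) * sqrt (t - s)) + S.Cb * norm q * (t - s)"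
        using a T by (intro L.H_tint(2)) auto
    qed
    show "\<forall>\<Phi> \<Phi>d b. curve \<Phi> \<Phi>d b --> tint 0 T (%s. slice A s \<bullet> \<Phi>d s) = - tint 0 T (%s. slice B s \<bullet> \<Phi> s)"
      using L.weak_dt by blast
    show "\<forall>E Ed b q. curve E Ed b --> (AE s in lebesgue. s \<in> {0..<T} --> (E s, q s) \<in> W s \<and> norm (q s) <= b s) -->
      (AE s in lebesgue. s \<in> {0..<T} --> Ed s \<in> P s) -->
      - tint 0 T (%s. slice B s \<bullet> Ed s) + tint 0 T (%s. slice D s \<bullet> q s) = tint 0 T (%s. Fs s \<bullet> E s)"
      by (intro allI impI L.weak_form)
  qed
qed

section \<open>Smooth functions\<close>

lemma pd_eqI: "(f has_derivative f') (at x) ==> pd f b x = f' b"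
  using frechet_derivative_at by (fastforce simp: pd_def)

lemma has_derivative_pd: "f differentiable (at x) ==> (f has_derivative (%b. pd f b x)) (at x)"
  unfolding pd_def using frechet_derivative_works by auto

lemma Ck_Suc_imp: "Ck (Suc k) f ==> Ck k f"
proof (induction k arbitrary: f)
  case 0
  then show ?case
    by (simp add: continuous_at_imp_continuous_on differentiable_imp_continuous_within)
qed auto

lemma Ck_const: "Ck k (%x. c)"
proof (induction k arbitrary: c)
  case (Suc k)
  have "pd (%x::'a. c) b = (%x. 0)" for b by (rule ext, rule pd_eqI) simp
  then show ?case using Suc by simp
qed simp

lemma Ck_add: "Ck k f ==> Ck k g ==> Ck k (%x. f x + g x)"
proof (induction k arbitrary: f g)
  case (Suc k)
  have "pd (%x. f x + g x) b = (%x. pd f b x + pd g b x)" for b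
    using Suc.prems by (intro ext pd_eqI has_derivative_add has_derivative_pd) auto
  then show ?case using Suc by (auto intro: differentiable_add)
qed (auto intro: continuous_intros)

lemma Ck_mult: "Ck k f ==> Ck k g ==> Ck k (%x. f x * g x)"
proof (induction k arbitrary: f g)
  case (Suc k)
  have "pd (%x. f x * g x) b = (%x. f x * pd g b x + pd f b x * g x)" for b
    using Suc.prems by (intro ext pd_eqI has_derivative_mult has_derivative_pd) auto
  then show ?case using Suc.prems Ck_Suc_imp[OF Suc.prems(1)] Ck_Suc_imp[OF Suc.prems(2)]
    by (auto intro!: differentiable_mult Ck_add Suc.IH)
qed (auto intro: continuous_intros)

lemma Ck_cmult: "Ck k f ==> Ck k (%x. c * f x)"
  using Ck_mult[OF Ck_const] .

lemma Ck_prod: "(!!i. i \<in> I ==> Ck k (f i)) ==> Ck k (%x. \<Prod>i\<in>I. f i x)"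
  by (induction I rule: infinite_finite_induct) (auto intro: Ck_mult Ck_const)

lemma Ck_sum: "(!!i. i \<in> I ==> Ck k (f i)) ==> Ck k (%x. \<Sum>i\<in>I. f i x)"
  by (induction I rule: infinite_finite_induct) (auto intro: Ck_add Ck_const)

lemma Ck_inverse: "Ck k f ==> (!!x. f x \<noteq> 0) ==> Ck k (%x. inverse (f x))"
proof (induction k arbitrary: f)
  case (Suc k)
  have d: "((%x. inverse (f x)) has_derivative (%b. - (inverse (f x) * pd f b x * inverse (f x)))) (at x)" for x
    using Suc.prems by (intro Deriv.has_derivative_inverse has_derivative_pd) auto
  have "pd (%x. inverse (f x)) b = (%x. (-1) * (inverse (f x) * pd f b x * inverse (f x)))" for b
    using pd_eqI[OF d] by auto
  moreover have "Ck k (%x. (-1) * (inverse (f x) * pd f b x * inverse (f x)))" if "b \<in> Basis" for b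
    using Suc.prems Ck_Suc_imp[OF Suc.prems(1)] that by (intro Ck_cmult Ck_mult Suc.IH) auto
  ultimately show ?case using d by (auto simp: differentiable_def)
qed (auto intro!: continuous_intros)

text \<open>The partial derivatives of the composition are directional derivatives of
  \<open>f\<close> along images of basis vectors. \<open>Ck\<close> controls basis directions only,
  so these are expanded in the basis.\<close>

lemma Ck_compose_affine:
  fixes f :: "'b::euclidean_space => real" and A :: "'a::euclidean_space => 'b"
  assumes A: "bounded_linear A"
  shows "Ck k f ==> Ck k (%x. f (A x + d))"
proof (induction k arbitrary: f)
  case 0
  have "continuous_on UNIV (%x. A x + d)"
    using A by (intro continuous_intros linear_continuous_on)
  then show ?case using 0 by (auto intro: continuous_on_compose2)
next
  case (Suc k)
  have der: "((%x. f (A x + d)) has_derivative (%b. pd f (A b) (A x + d))) (at x)" for x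
  proof -
    have "((%x. A x + d) has_derivative (%b. A b)) (at x)"
      using bounded_linear_imp_has_derivative[OF A] by (auto intro!: derivative_eq_intros)
    moreover have "(f has_derivative (%b. pd f b (A x + d))) (at (A x + d))"
      using Suc.prems by (auto intro: has_derivative_pd)
    ultimately show ?thesis using diff_chain_at by (fastforce simp: o_def)
  qed
  have lin: "pd f w z = (\<Sum>i\<in>Basis. (w \<bullet> i) * pd f i z)" for w z
  proof -
    have "linear (%b. pd f b z)"
      using Suc.prems has_derivative_linear has_derivative_pd by fastforce
    then have "pd f (\<Sum>i\<in>Basis. (w \<bullet> i) *\<^sub>R i) z = (\<Sum>i\<in>Basis. (w \<bullet> i) *\<^sub>R pd f i z)"
      by (simp add: linear_sum[of "%b. pd f b z"] linear_cmul[of "%b. pd f b z"] del: real_scaleR_def)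
    then show ?thesis by (simp add: euclidean_representation)
  qed
  have "pd (%x. f (A x + d)) b = (%x. \<Sum>i\<in>Basis. (A b \<bullet> i) * pd f i (A x + d))" for b
    by (rule ext, subst pd_eqI[OF der], rule lin)
  moreover have "Ck k (%x. \<Sum>i\<in>Basis. (A b \<bullet> i) * pd f i (A x + d))" for b
    using Suc by (intro Ck_sum Ck_cmult Suc.IH) auto
  ultimately show ?case using der by (auto simp: differentiable_def)
qed

lemma Ck_Suc_real:
  fixes f :: "real => real"
  assumes "!!x. (f has_real_derivative f' x) (at x)" "Ck k f'"
  shows "Ck (Suc k) f"
proof -
  have "pd f 1 = f'"
  proof
    fix x show "pd f 1 x = f' x"
      using pd_eqI[OF assms(1)[of x, unfolded has_field_derivative_def]] by simp
  qed
  then show ?thesis using assms by (auto simp: has_field_derivative_def differentiable_def)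
qed

section \<open>A smooth step function\<close>

definition flat :: "nat => real => real" where
  "flat k x = (if 0 < x then inverse x ^ k * exp (- inverse x) else 0)"

lemma flat_tendsto_right: "(flat k \<longlongrightarrow> 0) (at_right 0)"
proof -
  have "((%x. inverse x ^ k / exp (inverse x)) \<longlongrightarrow> (0::real)) (at_right 0)"
    using filterlim_compose[OF tendsto_power_div_exp_0 filterlim_inverse_at_top_right] .
  moreover have "\<forall>\<^sub>F x in at_right (0::real). inverse x ^ k / exp (inverse x) = flat k x"
    using eventually_at_right_less[of 0] by eventually_elim (simp add: flat_def exp_minus divide_inverse)
  ultimately show ?thesis by (rule Lim_transform_eventually)
qed

text \<open>The powers of \<open>inverse x\<close> are part of the family so that it is closed under
  differentiation; smoothness of all members then follows by one induction.\<close>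

lemma flat_has_derivative:
  "(flat k has_real_derivative (flat (k + 2) x + (- real k) * flat (k + 1) x)) (at x)"
proof -
  consider "x > 0" | "x < 0" | "x = 0" by linarith
  then show ?thesis
  proof cases
    case 1
    have "((%x. inverse x ^ k * exp (- inverse x)) has_real_derivative
        (flat (k + 2) x + (- real k) * flat (k + 1) x)) (at x)"
    proof -
      have "((%x. inverse x ^ k * exp (- inverse x)) has_real_derivative
          (real k * (- (inverse x * inverse x)) * inverse x ^ (k - 1)) * exp (- inverse x)
          + inverse x ^ k * (exp (- inverse x) * (inverse x * inverse x))) (at x)"
        using 1 by (auto intro!: derivative_eq_intros simp: power2_eq_square)
      moreover have "(real k * (- (inverse x * inverse x)) * inverse x ^ (k - 1)) * exp (- inverse x)
          + inverse x ^ k * (exp (- inverse x) * (inverse x * inverse x))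
          = flat (k + 2) x + (- real k) * flat (k + 1) x"
        using 1 by (cases k) (auto simp: flat_def algebra_simps)
      ultimately show ?thesis by (simp only:)
    qed
    then show ?thesis
      by (rule has_field_derivative_transform_within_open[where S = "{0<..}"]) (use 1 in \<open>auto simp: flat_def\<close>)
  next
    case 2
    have "((%x. 0) has_real_derivative (flat (k + 2) x + (- real k) * flat (k + 1) x)) (at x)"
      using 2 by (simp add: flat_def)
    then show ?thesis
      by (rule has_field_derivative_transform_within_open[where S = "{..<0}"]) (use 2 in \<open>auto simp: flat_def\<close>)
  next
    case 3
    \<comment> \<open>From the right the difference quotient at 0 is the next member of the family,
      \<open>flat (Suc k)\<close>, whose limit is known.\<close>
    have "((%h. flat k h / h) \<longlongrightarrow> 0) (at 0)"
      unfolding filterlim_at_split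
    proof
      have "\<forall>\<^sub>F h in at_left 0. 0 = flat k h / h"
        by (rule eventually_at_leftI[of "-1"]) (auto simp: flat_def)
      then show "((%h. flat k h / h) \<longlongrightarrow> 0) (at_left 0)" by (rule Lim_transform_eventually[OF tendsto_const])
      have "\<forall>\<^sub>F h in at_right 0. flat (Suc k) h = flat k h / h"
        by (rule eventually_at_rightI[of 0 1]) (auto simp: flat_def divide_inverse mult_ac)
      then show "((%h. flat k h / h) \<longlongrightarrow> 0) (at_right 0)" by (rule Lim_transform_eventually[OF flat_tendsto_right])
    qed
    then show ?thesis using 3 by (simp add: DERIV_def flat_def[of _ 0])
  qed
qed

lemma Ck_flat: "Ck n (flat k)"
proof (induction n arbitrary: k)
  case 0
  show ?case
    using DERIV_isCont[OF flat_has_derivative] by (simp add: continuous_at_imp_continuous_on)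
next
  case (Suc n)
  show ?case by (rule Ck_Suc_real[OF flat_has_derivative]) (intro Ck_add Ck_cmult Suc)
qed

text \<open>A smooth transition from 0 on the left of 0 to 1 on the right of 1; at every point at
  least one of the two terms of the denominator is positive.\<close>

definition smooth_step :: "real => real" where
  "smooth_step x = flat 0 x * inverse (flat 0 x + flat 0 (1 - x))"

lemma flat_denom: "0 < flat 0 x + flat 0 (1 - x)"
  by (auto simp: flat_def add_nonneg_pos add_pos_pos)

lemma Ck_smooth_step: "Ck k smooth_step"
proof -
  have "Ck k (%x. flat 0 (- x + 1))"
    by (rule Ck_compose_affine[OF bounded_linear_minus[OF bounded_linear_ident] Ck_flat])
  then have "Ck k (%x. flat 0 (1 - x))" by (simp add: add.commute[of _ 1])
  then have "Ck k (%x. flat 0 x * inverse (flat 0 x + flat 0 (1 - x)))"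
    using flat_denom by (intro Ck_mult Ck_inverse Ck_add Ck_flat) (auto simp: less_imp_neq[THEN not_sym])
  then show ?thesis by (simp add: smooth_step_def[abs_def])
qed

lemma smooth_step_simps: "x <= 0 ==> smooth_step x = 0" "1 <= x ==> smooth_step x = 1"
  "0 <= smooth_step x" "smooth_step x <= 1"
proof -
  have nn: "0 <= flat 0 y" for y by (simp add: flat_def)
  show "x <= 0 ==> smooth_step x = 0" by (simp add: smooth_step_def flat_def)
  show "1 <= x ==> smooth_step x = 1" by (simp add: smooth_step_def flat_def)
  show "0 <= smooth_step x" using nn flat_denom[of x] by (simp add: smooth_step_def less_imp_le)
  show "smooth_step x <= 1" using nn[of "1 - x"] flat_denom[of x]
    by (simp add: smooth_step_def divide_inverse[symmetric])
qed

subsection \<open>Test functions\<close>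

lemma
  assumes "test_fun U \<phi>"
  shows test_fun_Ck: "Ck k \<phi>" and test_fun_smooth: "smooth \<phi>"
    and test_fun_compact: "compact (closure {x. \<phi> x \<noteq> 0})"
    and test_fun_support: "closure {x. \<phi> x \<noteq> 0} \<subseteq> U"
    and test_fun_differentiable: "\<phi> differentiable (at x)"
    and test_fun_continuous: "continuous_on S \<phi>"
    and test_fun_pd_continuous: "b \<in> Basis ==> continuous_on S (pd \<phi> b)"
proof -
  show s: "smooth \<phi>" and c: "compact (closure {x. \<phi> x \<noteq> 0})" "closure {x. \<phi> x \<noteq> 0} \<subseteq> U"
    using assms by (auto simp: test_fun_def)
  show "Ck k \<phi>" using s by (simp add: smooth_def)
  have "Ck 1 \<phi>" "Ck 0 \<phi>" using s by (auto simp: smooth_def)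
  then show "\<phi> differentiable (at x)" "continuous_on S \<phi>" "b \<in> Basis ==> continuous_on S (pd \<phi> b)"
    by (auto intro: continuous_on_subset)
qed

lemma test_fun_outside: "test_fun U \<phi> ==> x \<notin> U ==> \<phi> x = 0"
  using test_fun_support[of U \<phi>] closure_subset[of "{x. \<phi> x \<noteq> 0}"] by auto

lemma pd_outside_support:
  assumes "x \<notin> closure {x. \<phi> x \<noteq> 0}" shows "pd \<phi> b x = 0"
proof -
  have "((%x. 0) has_derivative (%b. 0)) (at x)" by simp
  then have "(\<phi> has_derivative (%b. 0)) (at x)"
  proof (rule has_derivative_transform_within_open)
    show "open (- closure {x. \<phi> x \<noteq> 0})" by (intro open_Compl closed_closure)
    fix y assume "y \<in> - closure {x. \<phi> x \<noteq> 0}"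
    then show "0 = \<phi> y" using closure_subset[of "{x. \<phi> x \<noteq> 0}"] by auto
  qed (use assms in simp)
  then show ?thesis by (rule pd_eqI)
qed

lemma test_fun_pd_outside: "test_fun U \<phi> ==> x \<notin> U ==> pd \<phi> b x = 0"
  by (rule pd_outside_support) (use test_fun_support[of U \<phi>] in auto)

lemma test_funI:
  assumes "!!k. Ck k \<phi>" "compact K" "K \<subseteq> U" "!!x. x \<notin> K ==> \<phi> x = 0"
  shows "test_fun U \<phi>"
proof -
  have "closure {x. \<phi> x \<noteq> 0} \<subseteq> K"
    using assms by (intro closure_minimal compact_imp_closed) auto
  moreover have "compact (closure {x. \<phi> x \<noteq> 0})"
  proof -
    have "{x. \<phi> x \<noteq> 0} \<subseteq> K" using assms(4) by auto
    then show ?thesis using bounded_subset[OF compact_imp_bounded[OF assms(2)]] by (simp add: compact_closure)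
  qed
  ultimately show ?thesis using assms by (auto simp: test_fun_def smooth_def)
qed

lemma test_fun_mono: "test_fun U \<phi> ==> U \<subseteq> V ==> test_fun V \<phi>"
  by (auto simp: test_fun_def)

lemma test_fun_linear:
  assumes "test_fun U \<phi>" "test_fun U \<psi>" shows "test_fun U (%x. a * \<phi> x + c * \<psi> x)"
proof (rule test_funI)
  show "Ck k (%x. a * \<phi> x + c * \<psi> x)" for k
    using assms by (intro Ck_add Ck_cmult test_fun_Ck)
  let ?K = "closure {x. \<phi> x \<noteq> 0} \<union> closure {x. \<psi> x \<noteq> 0}"
  show "compact ?K" by (intro compact_Un test_fun_compact[OF assms(1)] test_fun_compact[OF assms(2)])
  show "?K \<subseteq> U" by (intro Un_least test_fun_support[OF assms(1)] test_fun_support[OF assms(2)])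
  show "a * \<phi> x + c * \<psi> x = 0" if "x \<notin> ?K" for x
  proof -
    have "x \<notin> {x. \<phi> x \<noteq> 0}" "x \<notin> {x. \<psi> x \<noteq> 0}"
      using that closure_subset[of "{x. \<phi> x \<noteq> 0}"] closure_subset[of "{x. \<psi> x \<noteq> 0}"] by blast+
    then show ?thesis by simp
  qed
qed

lemma test_fun_mult:
  assumes "test_fun U \<phi>" "test_fun V \<psi>" shows "test_fun U (%x. \<phi> x * \<psi> x)"
proof (rule test_funI)
  show "Ck k (%x. \<phi> x * \<psi> x)" for k using assms by (intro Ck_mult test_fun_Ck)
  show "compact (closure {x. \<phi> x \<noteq> 0})" "closure {x. \<phi> x \<noteq> 0} \<subseteq> U"
    by (rule test_fun_compact[OF assms(1)], rule test_fun_support[OF assms(1)])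
  show "\<phi> x * \<psi> x = 0" if "x \<notin> closure {x. \<phi> x \<noteq> 0}" for x
    using that closure_subset[of "{x. \<phi> x \<noteq> 0}"] by auto
qed

lemma test_fun_zero: "test_fun U (%x. 0)"
  by (rule test_funI[of _ "{}"]) (auto intro: Ck_const)

lemma pd_linear:
  assumes "test_fun U \<phi>" "test_fun U \<psi>"
  shows "pd (%x. a * \<phi> x + c * \<psi> x) b x = a * pd \<phi> b x + c * pd \<psi> b x"
proof (rule pd_eqI)
  note d = has_derivative_pd[OF test_fun_differentiable[OF assms(1)]] has_derivative_pd[OF test_fun_differentiable[OF assms(2)]]
  show "((%x. a * \<phi> x + c * \<psi> x) has_derivative (%b. a * pd \<phi> b x + c * pd \<psi> b x)) (at x)"
    by (intro has_derivative_add has_derivative_mult_right d)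
qed

lemma pd_mult:
  assumes "test_fun U \<phi>" "test_fun V \<psi>"
  shows "pd (%x. \<phi> x * \<psi> x) b x = \<phi> x * pd \<psi> b x + pd \<phi> b x * \<psi> x"
  by (rule pd_eqI[OF has_derivative_mult[OF has_derivative_pd[OF test_fun_differentiable[OF assms(1)]]
          has_derivative_pd[OF test_fun_differentiable[OF assms(2)]]]])

lemma grad_inner: "b \<in> Basis ==> grad f x \<bullet> b = pd f b x"
  by (simp add: grad_def inner_sum_left inner_Basis if_distrib cong: if_cong)

lemma compact_support_integrable:
  fixes f :: "'a::euclidean_space => 'b::euclidean_space"
  assumes "continuous_on UNIV f" "compact K" "!!x. x \<notin> K ==> f x = 0"
  shows "integrable lborel f" "sqint f"
proof -
  have "integrable lborel (%x. indicator K x *\<^sub>R f x)"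
    using assms by (intro borel_integrable_compact) (auto intro: continuous_on_subset)
  moreover have "(%x. indicator K x *\<^sub>R f x) = f" using assms(3) by (auto simp: indicator_def)
  ultimately show "integrable lborel f" by simp
  have "integrable lborel (%x. indicator K x *\<^sub>R (norm (f x))\<^sup>2)"
    using assms by (intro borel_integrable_compact) (auto intro!: continuous_intros continuous_on_subset[of UNIV f])
  moreover have "(%x. indicator K x *\<^sub>R (norm (f x))\<^sup>2) = (%x. (norm (f x))\<^sup>2)"
  proof
    fix x show "indicator K x *\<^sub>R (norm (f x))\<^sup>2 = (norm (f x))\<^sup>2" using assms(3)[of x] by (cases "x \<in> K") auto
  qed
  ultimately show "sqint f" using assms(1) by (simp add: sqint_def borel_measurable_continuous_onI)
qed

lemma test_fun_integrable:
  assumes \<phi>: "test_fun U \<phi>"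
  shows "integrable lborel \<phi>" "sqint \<phi>" "b \<in> Basis ==> integrable lborel (pd \<phi> b)"
    "b \<in> Basis ==> sqint (pd \<phi> b)" "sqint (grad \<phi>)"
proof -
  note K = test_fun_compact[OF \<phi>]
  have out: "x \<notin> closure {x. \<phi> x \<noteq> 0} ==> \<phi> x = 0" for x using closure_subset[of "{x. \<phi> x \<noteq> 0}"] by auto
  show "integrable lborel \<phi>" "sqint \<phi>"
    by (rule compact_support_integrable[OF test_fun_continuous[OF \<phi>] K out]; assumption)+
  show "b \<in> Basis ==> integrable lborel (pd \<phi> b)" "b \<in> Basis ==> sqint (pd \<phi> b)"
    by (rule compact_support_integrable[OF test_fun_pd_continuous[OF \<phi>] K pd_outside_support]; assumption)+
  show "sqint (grad \<phi>)"
  proof (rule compact_support_integrable(2)[OF _ K])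
    show "continuous_on UNIV (grad \<phi>)"
      unfolding grad_def[abs_def] by (intro continuous_intros test_fun_pd_continuous[OF \<phi>])
    show "grad \<phi> x = 0" if "x \<notin> closure {x. \<phi> x \<noteq> 0}" for x
      using pd_outside_support[OF that] by (simp add: grad_def)
  qed
qed

lemma integral_lborel_translate:
  fixes f :: "'a::euclidean_space => real"
  assumes "f \<in> borel_measurable borel"
  shows "(\<integral>x. f (c + x) \<partial>lborel) = (\<integral>x. f x \<partial>lborel)"
proof -
  have "(\<integral>x. f x \<partial>lborel) = (\<integral>x. f x \<partial>distr lborel borel ((+) c))" by (simp add: lborel_distr_plus)
  also have "\<dots> = (\<integral>x. f (c + x) \<partial>lborel)" using assms by (intro integral_distr) auto
  finally show ?thesis by simp
qed

lemma integrable_lborel_translate: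
  fixes f :: "'a::euclidean_space => real"
  assumes "integrable lborel f" shows "integrable lborel (%x. f (c + x))"
proof -
  have "integrable (distr lborel borel ((+) c)) f" using assms by (simp add: lborel_distr_plus)
  then show ?thesis by (rule integrable_distr[rotated]) simp
qed

text \<open>Translation invariance makes all difference quotients have integral zero.\<close>
lemma integral_pd_eq_0:
  assumes \<phi>: "test_fun U \<phi>" and b: "b \<in> Basis"
  shows "(\<integral>x. pd \<phi> b x \<partial>lborel) = 0"
proof -
  \<comment> \<open>Shifts of length at most 1 keep all difference quotients supported in one ball
    of radius \<open>R + 1\<close>, which supplies the integrable majorant.\<close>
  define h where "h n = 1 / real (Suc n)" for n
  have h: "0 < h n" "h n <= 1" for n by (auto simp: h_def)
  have h0: "h ----> 0" unfolding h_def using LIMSEQ_inverse_real_of_nat by (simp add: inverse_eq_divide)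
  define q where "q n x = (\<phi> (h n *\<^sub>R b + x) - \<phi> x) / h n" for n x
  have [measurable]: "\<phi> \<in> borel_measurable borel" "pd \<phi> b \<in> borel_measurable borel"
    using test_fun_integrable[OF \<phi>] b by (auto simp: sqint_def)
  obtain R where R: "!!x. x \<in> closure {x. \<phi> x \<noteq> 0} ==> norm x <= R"
    using compact_imp_bounded[OF test_fun_compact[OF \<phi>]] bounded_iff by blast
  have "compact (pd \<phi> b ` closure {x. \<phi> x \<noteq> 0})"
    by (intro compact_continuous_image test_fun_pd_continuous[OF \<phi> b] test_fun_compact[OF \<phi>])
  then obtain M0 where M0: "!!x. x \<in> closure {x. \<phi> x \<noteq> 0} ==> \<bar>pd \<phi> b x\<bar> <= M0"
    using compact_imp_bounded bounded_iff by (metis image_eqI real_norm_def)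
  define M where "M = max 0 M0"
  have M: "\<bar>pd \<phi> b x\<bar> <= M" for x
    using M0[of x] pd_outside_support[of x \<phi> b] by (cases "x \<in> closure {x. \<phi> x \<noteq> 0}") (auto simp: M_def)
  have der: "((%s. \<phi> (s *\<^sub>R b + x)) has_real_derivative pd \<phi> b (s *\<^sub>R b + x)) (at s within S)" for s x S
  proof -
    have d1: "((%s. s *\<^sub>R b + x) has_derivative (%d. d *\<^sub>R b)) (at s within S)"
      by (auto intro!: derivative_eq_intros)
    have hd: "(\<phi> has_derivative (%c. pd \<phi> c (s *\<^sub>R b + x))) (at (s *\<^sub>R b + x))"
      by (rule has_derivative_pd[OF test_fun_differentiable[OF \<phi>]])
    have "((%s. \<phi> (s *\<^sub>R b + x)) has_derivative (%d. pd \<phi> (d *\<^sub>R b) (s *\<^sub>R b + x))) (at s within S)"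
      using has_derivative_compose[OF d1 hd] .
    moreover have "pd \<phi> (d *\<^sub>R b) (s *\<^sub>R b + x) = pd \<phi> b (s *\<^sub>R b + x) * d" for d
      using linear_cmul[OF has_derivative_linear[OF hd], of d b] by (simp add: mult.commute)
    ultimately show ?thesis by (simp add: has_field_derivative_def)
  qed
  have qM: "\<bar>q n x\<bar> <= M" for n x
  proof -
    have "norm (\<phi> (h n *\<^sub>R b + x) - \<phi> (0 *\<^sub>R b + x)) <= M * norm (h n - 0)"
      by (rule field_differentiable_bound[of UNIV "%s. \<phi> (s *\<^sub>R b + x)" "%s. pd \<phi> b (s *\<^sub>R b + x)"])
        (use der M in auto)
    then show ?thesis using h(1)[of n] by (simp add: q_def field_simps abs_mult)
  qed
  have q0: "q n x = 0" if "norm x > R + 1" for n x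
  proof -
    have "norm x <= norm (h n *\<^sub>R b + x) + norm (h n *\<^sub>R b)"
      using norm_triangle_ineq4[of "h n *\<^sub>R b + x" "h n *\<^sub>R b"] by simp
    moreover have "norm (h n *\<^sub>R b) <= 1" using h[of n] b by (simp add: norm_Basis)
    ultimately have "norm (h n *\<^sub>R b + x) > R" "norm x > R" using that by auto
    then have "\<phi> (h n *\<^sub>R b + x) = 0" "\<phi> x = 0"
      using R closure_subset[of "{x. \<phi> x \<noteq> 0}"] by (force simp: not_le[symmetric])+
    then show ?thesis by (simp add: q_def)
  qed
  have "(%n. \<integral>x. q n x \<partial>lborel) ----> (\<integral>x. pd \<phi> b x \<partial>lborel)"
  proof (rule integral_dominated_convergence)
    show "integrable lborel (%x. M * indicator (cball 0 (R + 1)) x :: real)"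
      by (intro integrable_mult_right integrable_real_indicator) (auto intro: emeasure_bounded_finite[simplified])
    show "AE x in lborel. norm (q n x) <= M * indicator (cball 0 (R + 1)) x" for n
      using qM[of n] q0[of _ n] by (auto simp: indicator_def intro!: AE_I2)
    show "q n \<in> borel_measurable lborel" for n unfolding q_def by measurable
    show "AE x in lborel. (%n. q n x) ----> pd \<phi> b x"
    proof (rule AE_I2)
      fix x
      have "((%s. (\<phi> (s *\<^sub>R b + x) - \<phi> x) / s) \<longlongrightarrow> pd \<phi> b x) (at 0)"
        using der[of x 0 UNIV] by (simp add: DERIV_def)
      moreover have "filterlim h (at 0) sequentially"
        using h0 h(1) by (auto simp: filterlim_at less_imp_neq[THEN not_sym])
      ultimately show "(%n. q n x) ----> pd \<phi> b x" unfolding q_def by (rule filterlim_compose)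
    qed
  qed simp
  moreover have "(\<integral>x. q n x \<partial>lborel) = 0" for n
    unfolding q_def
    using integrable_lborel_translate[OF test_fun_integrable(1)[OF \<phi>], of "h n *\<^sub>R b"] test_fun_integrable(1)[OF \<phi>]
      integral_lborel_translate[of \<phi> "h n *\<^sub>R b"] by simp
  ultimately show ?thesis by (simp add: LIMSEQ_const_iff)
qed

text \<open>The product of the two test functions has a partial derivative with integral zero. The
  sets \<open>U\<close> and \<open>V\<close> may differ, one compact support being enough.\<close>

lemma integral_by_parts_pd:
  assumes \<phi>: "test_fun U \<phi>" and \<psi>: "test_fun V \<psi>" and b: "b \<in> Basis"
  shows "(\<integral>x. \<phi> x * pd \<psi> b x \<partial>lborel) = - (\<integral>x. pd \<phi> b x * \<psi> x \<partial>lborel)"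
proof -
  have i: "integrable lborel (%x. \<phi> x * pd \<psi> b x)" "integrable lborel (%x. pd \<phi> b x * \<psi> x)"
    using sqint_inner[OF test_fun_integrable(2)[OF \<phi>] test_fun_integrable(4)[OF \<psi> b]]
      sqint_inner[OF test_fun_integrable(4)[OF \<phi> b] test_fun_integrable(2)[OF \<psi>]] by auto
  have "0 = (\<integral>x. \<phi> x * pd \<psi> b x + pd \<phi> b x * \<psi> x \<partial>lborel)"
    using integral_pd_eq_0[OF test_fun_mult[OF \<phi> \<psi>] b] by (simp add: pd_mult[OF \<phi> \<psi>])
  then show ?thesis using i by simp
qed

section \<open>The fundamental lemma of the calculus of variations\<close>

definition box_cutoff :: "'a::euclidean_space => 'a => nat => 'a => real" where
  "box_cutoff a b n x = (\<Prod>i\<in>Basis. smooth_step (real n * (x \<bullet> i - a \<bullet> i)) * smooth_step (real n * (b \<bullet> i - x \<bullet> i)))"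

lemma test_fun_box_cutoff:
  assumes "cbox a b \<subseteq> U" shows "test_fun U (box_cutoff a b n)"
proof (rule test_funI[OF _ compact_cbox assms])
  fix k
  have "Ck k (%x. smooth_step (c * (x \<bullet> i) + d))" for c d and i :: 'a
  proof -
    have "bounded_linear (%x::'a. c * (x \<bullet> i))"
      by (intro bounded_linear_const_mult bounded_linear_inner_left)
    from Ck_compose_affine[OF this Ck_smooth_step] show ?thesis .
  qed
  then have "Ck k (%x. smooth_step (real n * (x \<bullet> i) + - real n * (a \<bullet> i)) * smooth_step (- real n * (x \<bullet> i) + real n * (b \<bullet> i)))" for i :: 'a
    by (intro Ck_mult)
  then have "Ck k (%x. \<Prod>i\<in>Basis. smooth_step (real n * (x \<bullet> i) + - real n * (a \<bullet> i)) * smooth_step (- real n * (x \<bullet> i) + real n * (b \<bullet> i)))"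
    by (intro Ck_prod)
  moreover have "box_cutoff a b n = (%x. \<Prod>i\<in>Basis. smooth_step (real n * (x \<bullet> i) + - real n * (a \<bullet> i)) * smooth_step (- real n * (x \<bullet> i) + real n * (b \<bullet> i)))"
    by (simp add: box_cutoff_def[abs_def] algebra_simps)
  ultimately show "Ck k (box_cutoff a b n)" by simp
next
  fix x assume "x \<notin> cbox a b"
  then obtain i where i: "i \<in> Basis" "x \<bullet> i < a \<bullet> i \<or> b \<bullet> i < x \<bullet> i" by (auto simp: mem_box not_le)
  then have "real n * (x \<bullet> i - a \<bullet> i) <= 0 \<or> real n * (b \<bullet> i - x \<bullet> i) <= 0" by (auto simp: mult_le_0_iff)
  then have "smooth_step (real n * (x \<bullet> i - a \<bullet> i)) * smooth_step (real n * (b \<bullet> i - x \<bullet> i)) = 0"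
    by (auto simp: smooth_step_simps)
  then show "box_cutoff a b n x = 0" unfolding box_cutoff_def using i(1) by (intro prod_zero) auto
qed

lemma box_cutoff_bounds: "0 <= box_cutoff a b n x" "box_cutoff a b n x <= 1"
  unfolding box_cutoff_def
  by (auto intro!: prod_nonneg prod_le_1 mult_le_one simp: smooth_step_simps)

text \<open>The factor \<open>n\<close> makes the ramps steeper while they stay inside the box, so
  the limit is the indicator of the open box.\<close>

lemma box_cutoff_tendsto: "(%n. box_cutoff a b n x) ----> indicator (box a b) x"
proof (cases "x \<in> box a b")
  case True
  have 1: "\<forall>\<^sub>F n in sequentially. smooth_step (real n * d) = 1" if "0 < d" for d
  proof -
    obtain n0 :: nat where "1 / d < real n0" using reals_Archimedean2 by blast
    then have "1 <= real n * d" if "n \<ge> n0" for n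
    proof -
      have "1 < real n0 * d" using \<open>1 / d < real n0\<close> \<open>0 < d\<close> by (simp add: pos_divide_less_eq)
      also have "\<dots> <= real n * d" using that \<open>0 < d\<close> by (intro mult_right_mono) auto
      finally show ?thesis by simp
    qed
    then show ?thesis unfolding eventually_sequentially using smooth_step_simps(2) by blast
  qed
  have "\<forall>\<^sub>F n in sequentially. \<forall>i\<in>Basis. smooth_step (real n * (x \<bullet> i - a \<bullet> i)) * smooth_step (real n * (b \<bullet> i - x \<bullet> i)) = 1"
  proof (subst eventually_ball_finite_distrib, simp, rule ballI)
    fix i :: 'a assume "i \<in> Basis"
    then have "0 < x \<bullet> i - a \<bullet> i" "0 < b \<bullet> i - x \<bullet> i" using True by (auto simp: mem_box)
    from 1[OF this(1)] 1[OF this(2)]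
    show "\<forall>\<^sub>F n in sequentially. smooth_step (real n * (x \<bullet> i - a \<bullet> i)) * smooth_step (real n * (b \<bullet> i - x \<bullet> i)) = 1"
      by eventually_elim simp
  qed
  then have "\<forall>\<^sub>F n in sequentially. box_cutoff a b n x = 1"
    by eventually_elim (simp add: box_cutoff_def)
  then show ?thesis using True by (simp add: tendsto_eventually)
next
  case False
  then obtain i where i: "i \<in> Basis" "x \<bullet> i <= a \<bullet> i \<or> b \<bullet> i <= x \<bullet> i" by (auto simp: mem_box not_less)
  then have "real n * (x \<bullet> i - a \<bullet> i) <= 0 \<or> real n * (b \<bullet> i - x \<bullet> i) <= 0" for n :: nat by (auto simp: mult_le_0_iff)
  then have "smooth_step (real n * (x \<bullet> i - a \<bullet> i)) * smooth_step (real n * (b \<bullet> i - x \<bullet> i)) = 0" for n :: nat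
    by (metis mult_eq_0_iff smooth_step_simps(1))
  then have "box_cutoff a b n x = 0" for n unfolding box_cutoff_def using i(1) by (intro prod_zero) auto
  then show ?thesis using False by simp
qed

lemma sqint_integrable_on_bounded:
  fixes f :: "'a::euclidean_space => real"
  assumes "sqint f" "bounded A" "A \<in> sets borel"
  shows "integrable lborel (%x. f x * indicator A x)"
proof (rule Bochner_Integration.integrable_bound)
  have "integrable lborel (indicator A :: 'a => real)"
    using emeasure_bounded_finite[OF assms(2)] assms(3) by (intro integrable_real_indicator) auto
  then show "integrable lborel (%x. indicator A x + (norm (f x))\<^sup>2)" using assms(1) by (auto simp: sqint_def)
  show "(%x. f x * indicator A x) \<in> borel_measurable lborel" using assms by (auto simp: sqint_def)
  have "\<bar>c\<bar> <= 1 + c\<^sup>2" for c :: real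
    using sum_squares_bound[of "\<bar>c\<bar>" 1] zero_le_power2[of c] by simp
  then show "AE x in lborel. norm (f x * indicator A x) <= norm (indicator A x + (norm (f x))\<^sup>2)"
    by (auto simp: indicator_def)
qed

text \<open>The positive and the negative part of \<open>f\<close> are densities of two measures
  that agree on boxes. Boxes form an intersection stable generator, so the measures coincide, and
  testing with the sets where \<open>f\<close> has a fixed sign gives the claim.\<close>

lemma AE_zero_if_box_integrals_zero:
  fixes f :: "'a::euclidean_space => real"
  assumes f: "integrable lborel f" and z: "!!a b. (\<integral>x. f x * indicator (box a b) x \<partial>lborel) = 0"
  shows "AE x in lborel. f x = 0"
proof -
  have [measurable]: "f \<in> borel_measurable borel" using borel_measurable_integrable[OF f] by simp
  define M1 where "M1 = density lborel (%x. ennreal (f x))"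
  define M2 where "M2 = density lborel (%x. ennreal (- f x))"
  have ip: "integrable lborel (%x. max 0 (f x) * indicator A x)" "integrable lborel (%x. max 0 (- f x) * indicator A x)"
    if "A \<in> sets borel" for A
    using that by (auto intro!: integrable_real_mult_indicator integrable_max f)
  have e1: "emeasure M1 A = ennreal (\<integral>x. max 0 (f x) * indicator A x \<partial>lborel)" if "A \<in> sets borel" for A
  proof -
    have "emeasure M1 A = (\<integral>\<^sup>+x. ennreal (max 0 (f x) * indicator A x) \<partial>lborel)"
      using that by (auto simp: M1_def emeasure_density indicator_def max_def ennreal_neg intro!: nn_integral_cong)
    then show ?thesis using ip(1)[OF that] by (simp add: nn_integral_eq_integral)
  qed
  have e2: "emeasure M2 A = ennreal (\<integral>x. max 0 (- f x) * indicator A x \<partial>lborel)" if "A \<in> sets borel" for A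
  proof -
    have "emeasure M2 A = (\<integral>\<^sup>+x. ennreal (max 0 (- f x) * indicator A x) \<partial>lborel)"
      using that by (auto simp: M2_def emeasure_density indicator_def max_def ennreal_neg intro!: nn_integral_cong)
    then show ?thesis using ip(2)[OF that] by (simp add: nn_integral_eq_integral)
  qed
  have "M1 = M2"
  proof (rule measure_eqI_generator_eq)
    let ?E = "range (%(a, b). box a b::'a set)"
    show "Int_stable ?E" by (auto simp: Int_stable_def box_Int_box)
    show "?E \<subseteq> Pow UNIV" "sets M1 = sigma_sets UNIV ?E" "sets M2 = sigma_sets UNIV ?E"
      by (simp_all add: borel_eq_box M1_def M2_def)
    let ?A = "%n::nat. box (- (real n *\<^sub>R One)) (real n *\<^sub>R One) :: 'a set"
    show "range ?A \<subseteq> ?E" "(\<Union>i. ?A i) = UNIV" unfolding UN_box_eq_UNIV by auto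
    show "emeasure M1 (?A i) \<noteq> \<infinity>" for i by (simp add: e1)
    show "emeasure M1 X = emeasure M2 X" if "X \<in> ?E" for X
    proof -
      obtain p where "X = (case p of (a, b) => box a b)" using \<open>X \<in> ?E\<close> by blast
      then obtain a b where X: "X = box a b" by (cases p) simp
      have "(\<integral>x. max 0 (f x) * indicator X x - max 0 (- f x) * indicator X x \<partial>lborel) = (\<integral>x. f x * indicator X x \<partial>lborel)"
        by (intro Bochner_Integration.integral_cong) (auto simp: max_def)
      then have "(\<integral>x. max 0 (f x) * indicator X x \<partial>lborel) = (\<integral>x. max 0 (- f x) * indicator X x \<partial>lborel)"
        using z[of a b] ip[of X] X by simp
      then show ?thesis using X by (simp add: e1 e2)
    qed
  qed
  then have eq: "(\<integral>x. max 0 (f x) * indicator A x \<partial>lborel) = (\<integral>x. max 0 (- f x) * indicator A x \<partial>lborel)" if "A \<in> sets borel" for A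
    using e1[OF that] e2[OF that] by (simp add: Bochner_Integration.integral_nonneg)
  have "(\<integral>x. max 0 (f x) * indicator {x. 0 < f x} x \<partial>lborel) = (\<integral>x. max 0 (- f x) * indicator {x. 0 < f x} x \<partial>lborel)"
    by (rule eq) measurable
  also have "\<dots> = 0" by (rule integral_eq_zero_AE) (auto simp: indicator_def)
  finally have "(\<integral>x. max 0 (f x) * indicator {x. 0 < f x} x \<partial>lborel) = 0" .
  then have p: "AE x in lborel. max 0 (f x) * indicator {x. 0 < f x} x = 0"
    by (subst integral_nonneg_eq_0_iff_AE[symmetric]) (auto intro: ip)
  have "(\<integral>x. max 0 (- f x) * indicator {x. f x < 0} x \<partial>lborel) = (\<integral>x. max 0 (f x) * indicator {x. f x < 0} x \<partial>lborel)"
    by (rule eq[symmetric]) measurable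
  also have "\<dots> = 0" by (rule integral_eq_zero_AE) (auto simp: indicator_def)
  finally have "(\<integral>x. max 0 (- f x) * indicator {x. f x < 0} x \<partial>lborel) = 0" .
  then have n: "AE x in lborel. max 0 (- f x) * indicator {x. f x < 0} x = 0"
    by (subst integral_nonneg_eq_0_iff_AE[symmetric]) (auto intro: ip)
  show ?thesis using p n by eventually_elim (auto simp: indicator_def max_def split: if_splits)
qed

text \<open>Smooth cutoffs show that integrals over boxes with closure in \<open>U\<close> vanish.
  This is localised to one such box, and \<open>U\<close> is exhausted by countably many of
  them.\<close>

lemma fundamental_lemma:
  fixes f :: "'a::euclidean_space => real"
  assumes U: "open U" and f: "sqint f" and z: "!!\<phi>. test_fun U \<phi> ==> (\<integral>x. f x * \<phi> x \<partial>lborel) = 0"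
  shows "AE x in lborel. x \<in> U --> f x = 0"
proof -
  have [measurable]: "f \<in> borel_measurable borel" using f by (simp add: sqint_def)
  have bx: "(\<integral>x. f x * indicator (box a b) x \<partial>lborel) = 0" if ab: "cbox a b \<subseteq> U" for a b
  proof -
    have "(%n. \<integral>x. f x * box_cutoff a b n x \<partial>lborel) ----> (\<integral>x. f x * indicator (box a b) x \<partial>lborel)"
    proof (rule integral_dominated_convergence)
      show "integrable lborel (%x. \<bar>f x * indicator (cbox a b) x\<bar>)"
        using sqint_integrable_on_bounded[OF f, of "cbox a b"] by simp
      show "(%x. f x * box_cutoff a b n x) \<in> borel_measurable lborel" for n
        using test_fun_integrable(2)[OF test_fun_box_cutoff[OF ab, of n]] by (auto simp: sqint_def)
      show "AE x in lborel. (%n. f x * box_cutoff a b n x) ----> f x * indicator (box a b) x"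
        by (intro AE_I2 tendsto_mult tendsto_const box_cutoff_tendsto)
      have "\<bar>f x * box_cutoff a b n x\<bar> <= \<bar>f x * indicator (cbox a b) x\<bar>" for n x
        using test_fun_outside[OF test_fun_box_cutoff[of a b "cbox a b" n], of x] box_cutoff_bounds[of a b n x]
        by (cases "x \<in> cbox a b") (auto simp: abs_mult mult_left_le)
      then show "AE x in lborel. norm (f x * box_cutoff a b n x) <= \<bar>f x * indicator (cbox a b) x\<bar>" for n by simp
    qed simp
    then show ?thesis using z[OF test_fun_box_cutoff[OF ab]] by (simp add: LIMSEQ_const_iff)
  qed
  \<comment> \<open>Inside a fixed box the previous lemma is available: the intersection with any
    other box is again a box, and its closure remains in \<open>U\<close>.\<close>
  have cb: "AE x in lborel. x \<in> box c d --> f x = 0" if cd: "cbox c d \<subseteq> U" for c d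
  proof -
    have "AE x in lborel. f x * indicator (box c d) x = 0"
    proof (rule AE_zero_if_box_integrals_zero)
      show "integrable lborel (%x. f x * indicator (box c d) x)"
        by (rule sqint_integrable_on_bounded[OF f]) auto
      fix a b :: 'a
      obtain p q where pq: "box c d \<inter> box a b = box p q" using box_Int_box by blast
      show "(\<integral>x. f x * indicator (box c d) x * indicator (box a b) x \<partial>lborel) = 0"
      proof (cases "box p q = {}")
        case True
        have "(%x. f x * indicator (box c d) x * indicator (box a b) x) = (%x. 0)"
        proof
          fix x
          have "x \<notin> box c d \<or> x \<notin> box a b" using pq True by blast
          then show "f x * indicator (box c d) x * indicator (box a b) x = 0" by auto
        qed
        then show ?thesis by simp
      next
        case False
        then have "cbox p q = closure (box p q)" by (simp add: closure_box)
        also have "\<dots> \<subseteq> closure (box c d)" using pq by (intro closure_mono) auto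
        also have "\<dots> \<subseteq> cbox c d" by (rule closure_minimal) (auto simp: box_subset_cbox)
        finally have "cbox p q \<subseteq> U" using cd by simp
        from bx[OF this] have "(\<integral>x. f x * indicator (box p q) x \<partial>lborel) = 0" .
        moreover have "(%x. f x * indicator (box c d) x * indicator (box a b) x) = (%x. f x * indicator (box p q) x)"
          unfolding pq[symmetric] by (simp add: indicator_inter_arith mult.assoc)
        ultimately show ?thesis by simp
      qed
    qed
    then show ?thesis by eventually_elim (auto simp: indicator_def)
  qed
  obtain \<D> where \<D>: "countable \<D>" "\<D> \<subseteq> Pow U" "!!X. X \<in> \<D> ==> \<exists>a b. X = cbox a b" "\<Union>\<D> = U"
    using open_countable_Union_open_cbox[OF U] by metis
  have "AE x in lborel. \<forall>X\<in>\<D>. x \<in> X --> f x = 0"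
  proof (rule AE_ball_countable[THEN iffD2, OF \<D>(1)], rule ballI)
    fix X assume X: "X \<in> \<D>"
    then obtain a b where ab: "X = cbox a b" using \<D>(3) by blast
    have "cbox a b \<subseteq> U" using X ab \<D>(2) by auto
    note c = cb[OF this]
    \<comment> \<open>The exhaustion uses closed boxes while \<open>cb\<close> speaks about open
      ones; the faces are negligible.\<close>
    have "cbox a b - box a b \<in> null_sets lebesgue"
      using negligible_frontier_interval[of a b] by (simp add: negligible_iff_null_sets)
    then have "AE x in lebesgue. x \<notin> cbox a b - box a b" by (rule AE_not_in)
    then have "AE x in lborel. x \<notin> cbox a b - box a b" by (simp only: AE_completion_iff)
    then show "AE x in lborel. x \<in> X --> f x = 0" using c by eventually_elim (auto simp: ab)
  qed
  then show ?thesis by eventually_elim (use \<D>(4) in auto)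
qed

section \<open>Sobolev spaces as subspaces of a Hilbert space\<close>

lemma l2_eqI:
  assumes "AE x in lebesgue. rep_l2 h x = rep_l2 k x" shows "h = k"
proof -
  have "abs_l2 (rep_l2 h) = abs_l2 (rep_l2 k)"
    using assms abs_l2_eq_iff[OF sqint_rep sqint_rep, of h k] by (simp add: AE_completion_iff)
  then show ?thesis by (simp add: abs_rep_l2)
qed

lemma borel_version:
  fixes f :: "'a::euclidean_space => 'b::euclidean_space"
  assumes "f \<in> borel_measurable lebesgue"
  obtains g where "g \<in> borel_measurable borel" "AE x in lebesgue. f x = g x"
proof -
  have "\<forall>b. \<exists>g\<in>borel_measurable lborel. AE x in lborel. f x \<bullet> b = g x"
  proof
    fix b
    have "(%x. f x \<bullet> b) \<in> borel_measurable lebesgue" using assms by simp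
    from completion_ex_borel_measurable_real[OF this] show "\<exists>g\<in>borel_measurable lborel. AE x in lborel. f x \<bullet> b = g x" .
  qed
  then obtain g where g: "!!b. g b \<in> borel_measurable lborel" "!!b. AE x in lborel. f x \<bullet> b = g b x" by metis
  have "(%x. \<Sum>b\<in>Basis. g b x *\<^sub>R b) \<in> borel_measurable borel" using g(1) by simp
  moreover have "AE x in lebesgue. f x = (\<Sum>b\<in>Basis. g b x *\<^sub>R b)"
  proof -
    have "AE x in lborel. \<forall>b\<in>Basis. f x \<bullet> b = g b x" using g(2) by (intro AE_finite_allI) auto
    then have "AE x in lborel. f x = (\<Sum>b\<in>Basis. g b x *\<^sub>R b)"
    proof eventually_elim
      case (elim x)
      have "f x = (\<Sum>b\<in>Basis. (f x \<bullet> b) *\<^sub>R b)" by (simp add: euclidean_representation)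
      also have "\<dots> = (\<Sum>b\<in>Basis. g b x *\<^sub>R b)" using elim by (intro sum.cong) auto
      finally show ?case .
    qed
    then show ?thesis by (simp only: AE_completion_iff)
  qed
  ultimately show thesis by (rule that)
qed

lemma rep_lebesgue: "rep_l2 h \<in> borel_measurable lebesgue"
  using sqint_rep[of h] by (intro measurable_completion) (simp add: sqint_def)

lemma L2_iff_L2vec: "L2 U v \<longleftrightarrow> L2vec U v"
  by (simp add: L2_def L2vec_def)

text \<open>Extension by zero as a class of functions on the whole space. A choice is made because
  \<open>v\<close> is only Lebesgue measurable on \<open>U\<close>, while \<open>sqint\<close> asks
  for a Borel measurable representative.\<close>

definition emb :: "'a set => ('a => 'b) => ('a::euclidean_space, 'b::euclidean_space) l2" where
  "emb U v = (SOME h. AE x in lebesgue. rep_l2 h x = indicator U x *\<^sub>R v x)"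

lemma rep_emb:
  fixes v :: "'a::euclidean_space => 'b::euclidean_space"
  assumes U: "U \<in> sets lebesgue" and v: "L2vec U v"
  shows "AE x in lebesgue. rep_l2 (emb U v) x = indicator U x *\<^sub>R v x"
proof -
  have "(%x. indicator U x *\<^sub>R v x) \<in> borel_measurable lebesgue"
    using v U by (simp add: L2vec_def borel_measurable_restrict_space_iff)
  then obtain g where g: "g \<in> borel_measurable borel" "AE x in lebesgue. indicator U x *\<^sub>R v x = g x"
    using borel_version by blast
  have gl: "(%x. (norm (g x))\<^sup>2) \<in> borel_measurable borel" using g(1) by measurable
  have i: "integrable lebesgue (%x. indicator U x *\<^sub>R (norm (v x))\<^sup>2)"
    using v U by (simp add: L2vec_def integrable_restrict_space)
  have "integrable lebesgue (%x. (norm (g x))\<^sup>2)"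
  proof (rule integrable_cong_AE_imp[OF i])
    show "(%x. (norm (g x))\<^sup>2) \<in> borel_measurable lebesgue" using gl by (intro measurable_completion) simp
    show "AE x in lebesgue. indicator U x *\<^sub>R (norm (v x))\<^sup>2 = (norm (g x))\<^sup>2"
      using g(2)
    proof eventually_elim
      case (elim x)
      have "(norm (g x))\<^sup>2 = (norm (indicator U x *\<^sub>R v x))\<^sup>2" by (simp only: elim)
      then show ?case by (simp add: indicator_def)
    qed
  qed
  then have s: "sqint g" using g(1) gl by (simp add: sqint_def integrable_completion)
  have "AE x in lebesgue. rep_l2 (abs_l2 g) x = g x" using rep_abs_l2[OF s] by (simp only: AE_completion_iff)
  then have "AE x in lebesgue. rep_l2 (abs_l2 g) x = indicator U x *\<^sub>R v x" using g(2) by eventually_elim simp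
  then show ?thesis unfolding emb_def by (rule someI[where P = "%h. AE x in lebesgue. rep_l2 h x = indicator U x *\<^sub>R v x"])
qed

lemma emb_eqI:
  assumes "AE x in lebesgue. rep_l2 h x = indicator U x *\<^sub>R v x" shows "emb U v = h"
proof (rule l2_eqI)
  have "AE x in lebesgue. rep_l2 (emb U v) x = indicator U x *\<^sub>R v x"
    unfolding emb_def by (rule someI[where P = "%h. AE x in lebesgue. rep_l2 h x = indicator U x *\<^sub>R v x"]) (rule assms)
  then show "AE x in lebesgue. rep_l2 (emb U v) x = rep_l2 h x" using assms by eventually_elim simp
qed

lemma L2vec_rep:
  fixes h :: "('a::euclidean_space, 'b::euclidean_space) l2"
  assumes U: "U \<in> sets lebesgue" and w: "w \<in> borel_measurable lebesgue" "AE x in lebesgue. x \<in> U --> w x = rep_l2 h x"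
  shows "L2vec U w"
proof -
  have m: "w \<in> borel_measurable (lebesgue_on U)" using w(1) by (rule measurable_restrict_space1)
  have i0: "integrable lebesgue (%x. (norm (rep_l2 h x))\<^sup>2)"
  proof (subst integrable_completion)
    show "(%x. (norm (rep_l2 h x))\<^sup>2) \<in> borel_measurable lborel" using sqint_rep[of h] by (auto simp: sqint_def)
  qed (use sqint_rep[of h] in \<open>simp add: sqint_def\<close>)
  have "integrable lebesgue (%x. indicator U x *\<^sub>R (norm (w x))\<^sup>2)"
  proof (rule Bochner_Integration.integrable_bound[OF i0])
    show "(%x. indicator U x *\<^sub>R (norm (w x))\<^sup>2) \<in> borel_measurable lebesgue" using w(1) U by measurable
    show "AE x in lebesgue. norm (indicator U x *\<^sub>R (norm (w x))\<^sup>2) <= norm ((norm (rep_l2 h x))\<^sup>2)"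
      using w(2) by eventually_elim (auto simp: indicator_def)
  qed
  then show ?thesis using m U by (simp add: L2vec_def integrable_restrict_space)
qed

lemma integral_inner_emb:
  fixes v w :: "'a::euclidean_space => 'b::euclidean_space"
  assumes U: "U \<in> sets lebesgue" and v: "L2vec U v" and w: "L2vec U w"
  shows "(\<integral>x. v x \<bullet> w x \<partial>lebesgue_on U) = emb U v \<bullet> emb U w"
proof -
  have mU: "(%x. indicator U x *\<^sub>R v x) \<in> borel_measurable lebesgue" "(%x. indicator U x *\<^sub>R w x) \<in> borel_measurable lebesgue"
    using v w U by (auto simp: L2vec_def borel_measurable_restrict_space_iff)
  have e: "indicator U x *\<^sub>R (v x \<bullet> w x) = (indicator U x *\<^sub>R v x) \<bullet> (indicator U x *\<^sub>R w x)" for x by (simp add: indicator_def)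
  have "(\<integral>x. v x \<bullet> w x \<partial>lebesgue_on U) = (\<integral>x. (indicator U x *\<^sub>R v x) \<bullet> (indicator U x *\<^sub>R w x) \<partial>lebesgue)"
    using U by (subst integral_restrict_space) (simp_all only: e, simp)
  also have "\<dots> = (\<integral>x. rep_l2 (emb U v) x \<bullet> rep_l2 (emb U w) x \<partial>lebesgue)"
  proof (rule integral_cong_AE)
    show "AE x in lebesgue. (indicator U x *\<^sub>R v x) \<bullet> (indicator U x *\<^sub>R w x) = rep_l2 (emb U v) x \<bullet> rep_l2 (emb U w) x"
      using rep_emb[OF U v] rep_emb[OF U w] by eventually_elim simp
  qed (intro borel_measurable_inner mU rep_lebesgue)+
  also have "\<dots> = (\<integral>x. rep_l2 (emb U v) x \<bullet> rep_l2 (emb U w) x \<partial>lborel)"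
    using borel_measurable_integrable[OF sqint_inner[OF sqint_rep[of "emb U v"] sqint_rep[of "emb U w"]]] by (rule integral_completion)
  also have "\<dots> = emb U v \<bullet> emb U w" using inner_abs_l2[OF sqint_rep sqint_rep, of "emb U v" "emb U w"] by (simp add: abs_rep_l2)
  finally show ?thesis .
qed

lemma L2ip_emb: "U \<in> sets lebesgue ==> L2 U v ==> L2 U w ==> L2ip U v w = emb U v \<bullet> emb U w"
  using integral_inner_emb[of U v w] by (simp add: L2ip_def L2_iff_L2vec)

lemma L2sq_emb: "U \<in> sets lebesgue ==> L2 U v ==> L2sq U v = (norm (emb U v))\<^sup>2"
  by (simp add: L2sq_def L2ip_emb power2_norm_eq_inner)

lemma L2vec_linear:
  assumes U: "U \<in> sets lebesgue" and v: "L2vec U v" and w: "L2vec U w"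
  shows "L2vec U (%x. a *\<^sub>R v x + b *\<^sub>R w x)" "emb U (%x. a *\<^sub>R v x + b *\<^sub>R w x) = a *\<^sub>R emb U v + b *\<^sub>R emb U w"
proof -
  let ?k = "a *\<^sub>R emb U v + b *\<^sub>R emb U w"
  have "?k = abs_l2 (%x. a *\<^sub>R rep_l2 (emb U v) x + b *\<^sub>R rep_l2 (emb U w) x)"
    by (simp add: abs_l2_add abs_l2_scaleR sqint_scaleR sqint_rep abs_rep_l2)
  then have "AE x in lborel. rep_l2 ?k x = a *\<^sub>R rep_l2 (emb U v) x + b *\<^sub>R rep_l2 (emb U w) x"
    using rep_abs_l2[OF sqint_add[OF sqint_scaleR[OF sqint_rep] sqint_scaleR[OF sqint_rep]]] by metis
  then have "AE x in lebesgue. rep_l2 ?k x = a *\<^sub>R rep_l2 (emb U v) x + b *\<^sub>R rep_l2 (emb U w) x" by (simp only: AE_completion_iff)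
  then have k: "AE x in lebesgue. rep_l2 ?k x = indicator U x *\<^sub>R (a *\<^sub>R v x + b *\<^sub>R w x)"
    using rep_emb[OF U v] rep_emb[OF U w] by eventually_elim (simp add: indicator_def)
  then show "emb U (%x. a *\<^sub>R v x + b *\<^sub>R w x) = ?k" by (rule emb_eqI)
  have m: "(%x. a *\<^sub>R v x + b *\<^sub>R w x) \<in> borel_measurable (lebesgue_on U)"
    using v w by (auto simp: L2vec_def)
  have "L2vec U (%x. indicator U x *\<^sub>R (a *\<^sub>R v x + b *\<^sub>R w x))"
  proof (rule L2vec_rep[OF U])
    show "(%x. indicator U x *\<^sub>R (a *\<^sub>R v x + b *\<^sub>R w x)) \<in> borel_measurable lebesgue"
      using m U by (simp add: borel_measurable_restrict_space_iff)
    show "AE x in lebesgue. x \<in> U --> indicator U x *\<^sub>R (a *\<^sub>R v x + b *\<^sub>R w x) = rep_l2 ?k x"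
      using k by eventually_elim simp
  qed
  then have "integrable lebesgue (%x. indicator U x *\<^sub>R (norm (indicator U x *\<^sub>R (a *\<^sub>R v x + b *\<^sub>R w x)))\<^sup>2)"
    using U by (simp add: L2vec_def integrable_restrict_space)
  moreover have "(%x. indicator U x *\<^sub>R (norm (indicator U x *\<^sub>R (a *\<^sub>R v x + b *\<^sub>R w x)))\<^sup>2) = (%x. indicator U x *\<^sub>R (norm (a *\<^sub>R v x + b *\<^sub>R w x))\<^sup>2)"
    by (auto simp: indicator_def)
  ultimately show "L2vec U (%x. a *\<^sub>R v x + b *\<^sub>R w x)" using m U by (simp add: L2vec_def integrable_restrict_space)
qed

lemma L2_diff:
  assumes U: "U \<in> sets lebesgue" and v: "L2 U v" and w: "L2 U w"
  shows "L2 U (%x. v x - w x)" "emb U (%x. v x - w x) = emb U v - emb U w"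
  using L2vec_linear[OF U, of v w 1 "-1"] v w by (simp_all add: L2_iff_L2vec)

lemma L2vec_diff:
  assumes U: "U \<in> sets lebesgue" and v: "L2vec U v" and w: "L2vec U w"
  shows "L2vec U (%x. v x - w x)" "emb U (%x. v x - w x) = emb U v - emb U w"
  using L2vec_linear[OF U v w, of 1 "-1"] by simp_all

lemma norm_sq_emb_diff:
  assumes U: "U \<in> sets lebesgue" and v: "L2vec U v" and w: "L2vec U w"
  shows "(\<integral>x. (norm (v x - w x))\<^sup>2 \<partial>lebesgue_on U) = (norm (emb U v - emb U w))\<^sup>2"
  using integral_inner_emb[OF U L2vec_diff(1)[OF U v w] L2vec_diff(1)[OF U v w]]
  by (simp add: L2vec_diff(2)[OF U v w] power2_norm_eq_inner)

subsection \<open>Functions supported in a set\<close>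

text \<open>The model of the square integrable functions on \<open>U\<close>. Extension by zero
  places the spaces of all domains in one Hilbert space, where they are nested when the domains
  are.\<close>

definition supp_in :: "'a set => ('a::euclidean_space, 'b::euclidean_space) l2 set" where
  "supp_in U = {h. AE x in lebesgue. x \<notin> U --> rep_l2 h x = 0}"

lemma emb_supp_in: "U \<in> sets lebesgue ==> L2vec U v ==> emb U v \<in> supp_in U"
  unfolding supp_in_def using rep_emb[of U v] by (auto elim: eventually_mono)

lemma emb_rep:
  assumes "h \<in> supp_in U" "AE x in lebesgue. x \<in> U --> w x = rep_l2 h x"
  shows "emb U w = h"
proof (rule emb_eqI)
  have "AE x in lebesgue. x \<notin> U --> rep_l2 h x = 0" using assms(1) by (simp add: supp_in_def)
  then show "AE x in lebesgue. rep_l2 h x = indicator U x *\<^sub>R w x"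
    using assms(2) by eventually_elim (auto simp: indicator_def)
qed

lemma supp_in_mono: "U \<subseteq> V ==> supp_in U \<subseteq> supp_in V"
  by (auto simp: supp_in_def elim: eventually_mono)

lemma inner_rep: "h \<bullet> k = (\<integral>x. rep_l2 h x \<bullet> rep_l2 k x \<partial>lborel)"
  using inner_abs_l2[OF sqint_rep sqint_rep, of h k] by (simp add: abs_rep_l2)

text \<open>Written as an orthogonal complement, the space is visibly closed and a subspace.\<close>

lemma supp_in_eq_orthogonal:
  fixes U :: "'a::euclidean_space set"
  assumes U: "U \<in> sets borel"
  shows "supp_in U = (\<Inter>k\<in>{k. AE x in lebesgue. x \<in> U --> rep_l2 k x = 0}. {h :: ('a, 'b::euclidean_space) l2. h \<bullet> k = 0})" (is "_ = ?R")
proof (intro set_eqI iffI)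
  fix h :: "('a, 'b) l2" assume h: "h \<in> supp_in U"
  show "h \<in> ?R"
  proof (intro INT_I CollectI)
    fix k :: "('a, 'b) l2" assume "k \<in> {k. AE x in lebesgue. x \<in> U --> rep_l2 k x = 0}"
    then have k: "AE x in lborel. x \<in> U --> rep_l2 k x = 0" by (simp add: AE_completion_iff)
    have "AE x in lborel. x \<notin> U --> rep_l2 h x = 0" using h by (simp add: supp_in_def AE_completion_iff)
    then have "AE x in lborel. rep_l2 h x \<bullet> rep_l2 k x = 0" using k by eventually_elim auto
    then show "h \<bullet> k = 0" unfolding inner_rep by (rule integral_eq_zero_AE)
  qed
next
  fix h :: "('a, 'b) l2" assume h: "h \<in> ?R"
  \<comment> \<open>The part of \<open>h\<close> outside \<open>U\<close>; it is one of the vectors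
    to which \<open>h\<close> is orthogonal, and
    \<open>h \<bullet> k = k \<bullet> k\<close>.\<close>
  define k where "k = abs_l2 (%x. indicator (- U) x *\<^sub>R rep_l2 h x)"
  have m: "(%x. indicator (- U) x *\<^sub>R rep_l2 h x) \<in> borel_measurable borel"
    using sqint_rep[of h] U by (auto simp: sqint_def)
  have s: "sqint (%x. indicator (- U) x *\<^sub>R rep_l2 h x)"
  proof -
    have "integrable lborel (%x. (norm (indicator (- U) x *\<^sub>R rep_l2 h x))\<^sup>2)"
    proof (rule Bochner_Integration.integrable_bound)
      show "integrable lborel (%x. (norm (rep_l2 h x))\<^sup>2)" using sqint_rep[of h] by (simp add: sqint_def)
      show "(%x. (norm (indicator (- U) x *\<^sub>R rep_l2 h x))\<^sup>2) \<in> borel_measurable lborel" using m by measurable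
    qed (auto simp: indicator_def)
    then show ?thesis using m by (simp add: sqint_def)
  qed
  have kr: "AE x in lborel. rep_l2 k x = indicator (- U) x *\<^sub>R rep_l2 h x" unfolding k_def by (rule rep_abs_l2[OF s])
  then have "AE x in lborel. x \<in> U --> rep_l2 k x = 0" by eventually_elim auto
  then have "h \<bullet> k = 0" using h by (auto simp: AE_completion_iff)
  moreover have "h \<bullet> k = k \<bullet> k"
    unfolding inner_rep
  proof (rule integral_cong_AE)
    show "AE x in lborel. rep_l2 h x \<bullet> rep_l2 k x = rep_l2 k x \<bullet> rep_l2 k x"
      using kr by eventually_elim (auto simp: indicator_def)
  qed (use sqint_rep[of h] sqint_rep[of k] in \<open>auto simp: sqint_def\<close>)
  ultimately have "k = 0" by simp
  then have "AE x in lborel. rep_l2 k x = 0"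
    using rep_abs_l2[OF sqint_zero] unfolding abs_l2_zero by simp
  then have "AE x in lborel. x \<notin> U --> rep_l2 h x = 0" using kr by eventually_elim auto
  then show "h \<in> supp_in U" by (simp add: supp_in_def AE_completion_iff)
qed

lemma closed_supp_in: "U \<in> sets borel ==> closed (supp_in U)"
  unfolding supp_in_eq_orthogonal by (intro closed_INT ballI closed_Collect_eq continuous_intros)

lemma subspace_supp_in: "U \<in> sets borel ==> subspace (supp_in U)"
  unfolding supp_in_eq_orthogonal
  by (intro subspace_Inter) (auto simp: subspace_def inner_add_left)

subsection \<open>The graph of the gradient\<close>

text \<open>The model of the space with zero boundary values, each function paired with its
  gradient. As a closure of graphs of test functions it is closed by construction and grows with the
  domain.\<close>

definition grad_graph :: "'x::euclidean_space set => (('x, real) l2 \<times> ('x, 'x) l2) set" where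
  "grad_graph U = closure {(abs_l2 \<phi>, abs_l2 (grad \<phi>)) |\<phi>. test_fun U \<phi>}"

lemma grad_linear:
  assumes "test_fun U \<phi>" "test_fun U \<psi>"
  shows "grad (%x. a * \<phi> x + c * \<psi> x) = (%x. a *\<^sub>R grad \<phi> x + c *\<^sub>R grad \<psi> x)"
  by (rule ext) (simp add: grad_def pd_linear[OF assms] scaleR_add_left sum.distrib scaleR_sum_right)

lemma subspace_grad_graph: "subspace (grad_graph U)"
  unfolding grad_graph_def
proof (rule subspace_closure, rule subspaceI)
  let ?G = "{(abs_l2 \<phi>, abs_l2 (grad \<phi>)) |\<phi>. test_fun U \<phi>}"
  have comb: "(a *\<^sub>R abs_l2 \<phi> + c *\<^sub>R abs_l2 \<psi>, a *\<^sub>R abs_l2 (grad \<phi>) + c *\<^sub>R abs_l2 (grad \<psi>)) \<in> ?G"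
    if t: "test_fun U \<phi>" "test_fun U \<psi>" for a c \<phi> \<psi>
  proof -
    note s = test_fun_integrable(2,5)[OF t(1)] test_fun_integrable(2,5)[OF t(2)]
    have "abs_l2 (%x. a * \<phi> x + c * \<psi> x) = a *\<^sub>R abs_l2 \<phi> + c *\<^sub>R abs_l2 \<psi>"
      using abs_l2_add[OF sqint_scaleR[OF s(1), of a] sqint_scaleR[OF s(3), of c]] s by (simp add: abs_l2_scaleR[symmetric])
    moreover have "abs_l2 (grad (%x. a * \<phi> x + c * \<psi> x)) = a *\<^sub>R abs_l2 (grad \<phi>) + c *\<^sub>R abs_l2 (grad \<psi>)"
      unfolding grad_linear[OF t] using abs_l2_add[OF sqint_scaleR[OF s(2), of a] sqint_scaleR[OF s(4), of c]] s by (simp add: abs_l2_scaleR)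
    ultimately show ?thesis using test_fun_linear[OF t, of a c] by (intro CollectI exI[of _ "%x. a * \<phi> x + c * \<psi> x"]) simp
  qed
  show "0 \<in> ?G" using comb[OF test_fun_zero test_fun_zero, of 0 0] by (simp add: zero_prod_def)
  show "x + y \<in> ?G" if "x \<in> ?G" "y \<in> ?G" for x y
  proof -
    obtain \<phi> \<psi> where t: "test_fun U \<phi>" "test_fun U \<psi>" "x = (abs_l2 \<phi>, abs_l2 (grad \<phi>))" "y = (abs_l2 \<psi>, abs_l2 (grad \<psi>))"
      using \<open>x \<in> ?G\<close> \<open>y \<in> ?G\<close> by blast
    show ?thesis using comb[OF t(1,2), of 1 1] unfolding t(3,4) by simp
  qed
  show "c *\<^sub>R x \<in> ?G" if "x \<in> ?G" for x c
  proof -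
    obtain \<phi> where t: "test_fun U \<phi>" "x = (abs_l2 \<phi>, abs_l2 (grad \<phi>))" using \<open>x \<in> ?G\<close> by blast
    show ?thesis using comb[OF t(1,1), of c 0] unfolding t(2) by simp
  qed
qed

lemma closed_grad_graph: "closed (grad_graph U)" by (simp add: grad_graph_def)

lemma grad_graph_mono: "U \<subseteq> V ==> grad_graph U \<subseteq> grad_graph V"
  unfolding grad_graph_def using test_fun_mono by (intro closure_mono) blast

lemma test_fun_in_grad_graph: "test_fun U \<phi> ==> (abs_l2 \<phi>, abs_l2 (grad \<phi>)) \<in> grad_graph U"
  unfolding grad_graph_def by (rule subsetD[OF closure_subset], intro CollectI exI[of _ \<phi>] conjI refl)

lemma rep_abs_lebesgue: "sqint f ==> AE x in lebesgue. rep_l2 (abs_l2 f) x = f x"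
  using rep_abs_l2[of f] by (simp only: AE_completion_iff)

lemma abs_supp_in:
  assumes "sqint f" "!!x. x \<notin> U ==> f x = 0" shows "abs_l2 f \<in> supp_in U"
  unfolding supp_in_def using rep_abs_lebesgue[OF assms(1)] assms(2) by (auto elim: eventually_mono)

lemma grad_outside: "test_fun U \<phi> ==> x \<notin> U ==> grad \<phi> x = 0"
  by (simp add: grad_def test_fun_pd_outside)

lemma grad_graph_supp:
  assumes U: "open U" and hg: "(h, g) \<in> grad_graph U"
  shows "h \<in> supp_in U" "g \<in> supp_in U"
proof -
  have "grad_graph U \<subseteq> supp_in U \<times> supp_in U"
    unfolding grad_graph_def
  proof (rule closure_minimal)
    show "{(abs_l2 \<phi>, abs_l2 (grad \<phi>)) |\<phi>. test_fun U \<phi>} \<subseteq> supp_in U \<times> supp_in U"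
      using test_fun_integrable test_fun_outside grad_outside by (auto intro!: abs_supp_in)
    show "closed (supp_in U \<times> supp_in U :: (('a, real) l2 \<times> ('a, 'a) l2) set)" using U by (intro closed_Times closed_supp_in) auto
  qed
  then show "h \<in> supp_in U" "g \<in> supp_in U" using hg by auto
qed

lemma sqint_scaleR_vec: "sqint \<psi> ==> sqint (%x. \<psi> x *\<^sub>R (b :: 'b::euclidean_space))" for \<psi> :: "'a::euclidean_space => real"
  by (auto simp: sqint_def power_mult_distrib)

text \<open>Integration by parts holds for test functions and survives the closure, both sides being
  continuous. The second function may be tested on any set \<open>V\<close>, because the first one
  already has compact support.\<close>

lemma grad_graph_weak:
  assumes hg: "(h, g) \<in> grad_graph U" and \<psi>: "test_fun V \<psi>" and b: "b \<in> Basis"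
  shows "h \<bullet> abs_l2 (pd \<psi> b) = - (g \<bullet> abs_l2 (%x. \<psi> x *\<^sub>R b))"
proof -
  let ?S = "{p. fst p \<bullet> abs_l2 (pd \<psi> b) = - (snd p \<bullet> abs_l2 (%x. \<psi> x *\<^sub>R b))}"
  have "grad_graph U \<subseteq> ?S" unfolding grad_graph_def
  proof (rule closure_minimal)
    show "closed ?S" by (intro closed_Collect_eq continuous_intros)
    show "{(abs_l2 \<phi>, abs_l2 (grad \<phi>)) |\<phi>. test_fun U \<phi>} \<subseteq> ?S"
    proof (clarsimp)
      fix \<phi> assume \<phi>: "test_fun U \<phi>"
      have "abs_l2 \<phi> \<bullet> abs_l2 (pd \<psi> b) = (\<integral>x. \<phi> x * pd \<psi> b x \<partial>lborel)"
        by (simp add: inner_abs_l2 test_fun_integrable[OF \<phi>] test_fun_integrable[OF \<psi>] b)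
      also have "\<dots> = - (\<integral>x. pd \<phi> b x * \<psi> x \<partial>lborel)" by (rule integral_by_parts_pd[OF \<phi> \<psi> b])
      also have "(\<integral>x. pd \<phi> b x * \<psi> x \<partial>lborel) = abs_l2 (grad \<phi>) \<bullet> abs_l2 (%x. \<psi> x *\<^sub>R b)"
        by (simp add: inner_abs_l2 test_fun_integrable[OF \<phi>] sqint_scaleR_vec test_fun_integrable[OF \<psi>] grad_inner[OF b] mult.commute)
      finally show "abs_l2 \<phi> \<bullet> abs_l2 (pd \<psi> b) = - (abs_l2 (grad \<phi>) \<bullet> abs_l2 (%x. \<psi> x *\<^sub>R b))" .
    qed
  qed
  then show ?thesis using hg by auto
qed

lemma l2_zero_if_test_zero:
  fixes k :: "('x::euclidean_space, 'b::euclidean_space) l2"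
  assumes U: "open U" and k: "k \<in> supp_in U"
    and z: "!!\<psi> b. test_fun U \<psi> ==> b \<in> Basis ==> k \<bullet> abs_l2 (%x. \<psi> x *\<^sub>R b) = 0"
  shows "k = 0"
proof -
  have "AE x in lborel. x \<in> U --> rep_l2 k x \<bullet> b = 0" if b: "b \<in> Basis" for b
  proof (rule fundamental_lemma[OF U])
    show "sqint (%x. rep_l2 k x \<bullet> b)"
    proof -
      have m: "rep_l2 k \<in> borel_measurable borel" using sqint_rep[of k] by (simp add: sqint_def)
      have "integrable lborel (%x. (norm (rep_l2 k x \<bullet> b))\<^sup>2)"
      proof (rule Bochner_Integration.integrable_bound)
        show "integrable lborel (%x. (norm (rep_l2 k x))\<^sup>2)" using sqint_rep[of k] by (simp add: sqint_def)
        show "(%x. (norm (rep_l2 k x \<bullet> b))\<^sup>2) \<in> borel_measurable lborel" using m by simp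
        show "AE x in lborel. norm ((norm (rep_l2 k x \<bullet> b))\<^sup>2) <= norm ((norm (rep_l2 k x))\<^sup>2)"
          using Basis_le_norm[OF b] by (auto intro!: AE_I2 power_mono simp: abs_le_square_iff[symmetric])
      qed
      then show ?thesis using m by (simp add: sqint_def)
    qed
    fix \<psi> assume \<psi>: "test_fun U \<psi>"
    have "k \<bullet> abs_l2 (%x. \<psi> x *\<^sub>R b) = (\<integral>x. rep_l2 k x \<bullet> (\<psi> x *\<^sub>R b) \<partial>lborel)"
      using inner_abs_l2[OF sqint_rep[of k] sqint_scaleR_vec[OF test_fun_integrable(2)[OF \<psi>], of b]] by (simp add: abs_rep_l2)
    then show "(\<integral>x. (rep_l2 k x \<bullet> b) * \<psi> x \<partial>lborel) = 0" using z[OF \<psi> b] by (simp add: mult.commute)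
  qed
  then have "AE x in lborel. \<forall>b\<in>Basis. x \<in> U --> rep_l2 k x \<bullet> b = 0" by (intro AE_finite_allI) auto
  then have "AE x in lebesgue. \<forall>b\<in>Basis. x \<in> U --> rep_l2 k x \<bullet> b = 0" by (simp only: AE_completion_iff)
  moreover have "AE x in lebesgue. x \<notin> U --> rep_l2 k x = 0" using k by (simp add: supp_in_def)
  moreover have "AE x in lebesgue. rep_l2 (0 :: ('x, 'b) l2) x = 0" using rep_abs_lebesgue[OF sqint_zero] unfolding abs_l2_zero .
  ultimately have "AE x in lebesgue. rep_l2 k x = rep_l2 0 x"
  proof eventually_elim
    case (elim x)
    then show ?case by (cases "x \<in> U") (auto intro: euclidean_eqI)
  qed
  then show ?thesis by (rule l2_eqI)
qed

text \<open>The gradient is closable: a limit of gradients of functions tending to zero is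
  orthogonal to all test fields, so the fundamental lemma makes it vanish.\<close>

lemma grad_graph_single: assumes "open U" "(0, g) \<in> grad_graph U" shows "g = 0"
proof (rule l2_zero_if_test_zero[OF assms(1) grad_graph_supp(2)[OF assms]])
  fix \<psi> :: "'a => real" and b :: 'a assume "test_fun U \<psi>" "b \<in> Basis"
  from grad_graph_weak[OF assms(2) this] show "g \<bullet> abs_l2 (%x. \<psi> x *\<^sub>R b) = 0" by simp
qed

text \<open>Test functions are among the first components, so this is the fundamental lemma
  again.\<close>

lemma grad_graph_dense:
  assumes "open U" "h \<in> supp_in U" "!!\<phi> q. (\<phi>, q) \<in> grad_graph U ==> h \<bullet> \<phi> = 0" shows "h = 0"
  by (rule l2_zero_if_test_zero[OF assms(1,2)]) (use assms(3)[OF test_fun_in_grad_graph] in simp)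

lemma open_lebesgue: "open U ==> U \<in> sets lebesgue" by (rule sets_completionI_sets) simp

lemma sqint_L2vec:
  assumes "open U" "sqint f" shows "L2vec U f"
proof (rule L2vec_rep[OF open_lebesgue[OF assms(1)]])
  show "f \<in> borel_measurable lebesgue" using assms(2) by (intro measurable_completion) (simp add: sqint_def)
  show "AE x in lebesgue. x \<in> U --> f x = rep_l2 (abs_l2 f) x" using rep_abs_lebesgue[OF assms(2)] by eventually_elim simp
qed

lemma emb_sqint:
  assumes "sqint f" "!!x. x \<notin> U ==> f x = 0" shows "emb U f = abs_l2 f"
  by (rule emb_rep[OF abs_supp_in[OF assms]]) (use rep_abs_lebesgue[OF assms(1)] in \<open>auto elim: eventually_mono\<close>)

text \<open>The approximating test functions in \<open>H10\<close> are exactly a sequence in the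
  graph converging to the embedded pair.\<close>

lemma H10_D:
  assumes U: "open U" and v: "H10 U v"
  shows "L2 U v" "L2vec U (wgrad U v)" "(emb U v, emb U (wgrad U v)) \<in> grad_graph U"
proof -
  note Ul = open_lebesgue[OF U]
  show L: "L2 U v" using v by (simp add: H10_def H1_def)
  have "\<exists>G. L2vec U G \<and> is_weak_grad U v G" using v by (simp add: H10_def H1_def)
  then have "L2vec U (wgrad U v) \<and> is_weak_grad U v (wgrad U v)" unfolding wgrad_def by (rule someI_ex)
  then show g: "L2vec U (wgrad U v)" by simp
  obtain \<phi>s where \<phi>s: "!!k. test_fun U (\<phi>s k)" "(%k. L2sq U (%x. \<phi>s k x - v x)) ----> 0"
    "(%k. \<integral>x. (norm (grad (\<phi>s k) x - wgrad U v x))\<^sup>2 \<partial>lebesgue_on U) ----> 0"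
    using v unfolding H10_def by blast
  note t = test_fun_integrable[OF \<phi>s(1)]
  have lv: "L2 U (\<phi>s k)" "L2vec U (grad (\<phi>s k))" for k using t U by (auto simp: L2_iff_L2vec intro: sqint_L2vec)
  have em: "emb U (\<phi>s k) = abs_l2 (\<phi>s k)" "emb U (grad (\<phi>s k)) = abs_l2 (grad (\<phi>s k))" for k
    using t test_fun_outside[OF \<phi>s(1)] grad_outside[OF \<phi>s(1)] by (auto intro!: emb_sqint)
  have sq0: "(%k. a k) ----> l" if "(%k. (norm (a k - l))\<^sup>2) ----> 0" for a :: "nat => 'z::real_normed_vector" and l
  proof -
    have "(%k. norm (a k - l)) ----> 0" using tendsto_real_sqrt[OF that] by simp
    then show ?thesis by (simp add: LIM_zero_iff tendsto_norm_zero_iff)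
  qed
  have "(%k. abs_l2 (\<phi>s k)) ----> emb U v"
    by (rule sq0) (use \<phi>s(2) in \<open>simp add: L2sq_emb[OF Ul] L2_diff[OF Ul lv(1) L] em\<close>)
  moreover have "(%k. abs_l2 (grad (\<phi>s k))) ----> emb U (wgrad U v)"
    by (rule sq0) (use \<phi>s(3) in \<open>simp add: norm_sq_emb_diff[OF Ul lv(2) g] em\<close>)
  ultimately have "(%k. (abs_l2 (\<phi>s k), abs_l2 (grad (\<phi>s k)))) ----> (emb U v, emb U (wgrad U v))" by (rule tendsto_Pair)
  then show "(emb U v, emb U (wgrad U v)) \<in> grad_graph U"
    by (rule closed_sequentially[OF closed_grad_graph, rotated]) (rule test_fun_in_grad_graph[OF \<phi>s(1)])
qed

text \<open>A graph element carries its own weak gradient and, being in a closure, an approximating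
  sequence of test functions.\<close>

lemma H10_I:
  assumes U: "open U" and L: "L2 U v" and hg: "(emb U v, g) \<in> grad_graph U"
  shows "H10 U v" "emb U (wgrad U v) = g"
proof -
  note Ul = open_lebesgue[OF U]
  have gL: "L2vec U (rep_l2 g)" by (rule L2vec_rep[where h = g, OF Ul rep_lebesgue]) simp
  have gs: "emb U (rep_l2 g) = g" by (rule emb_rep[OF grad_graph_supp(2)[OF U hg]]) simp
  have wk: "(\<integral>x. v x * pd \<phi> b x \<partial>lebesgue_on U) = emb U v \<bullet> abs_l2 (pd \<phi> b)"
    "(\<integral>x. (G x \<bullet> b) * \<phi> x \<partial>lebesgue_on U) = emb U G \<bullet> abs_l2 (%x. \<phi> x *\<^sub>R b)"
    if \<phi>: "test_fun U \<phi>" "b \<in> Basis" and G: "L2vec U G" for \<phi> b G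
  proof -
    note t = test_fun_integrable[OF \<phi>(1)]
    have e: "emb U (pd \<phi> b) = abs_l2 (pd \<phi> b)" "emb U (%x. \<phi> x *\<^sub>R b) = abs_l2 (%x. \<phi> x *\<^sub>R b)"
      using t(2) t(4)[OF \<phi>(2)] test_fun_outside[OF \<phi>(1)] test_fun_pd_outside[OF \<phi>(1)] by (auto intro!: emb_sqint sqint_scaleR_vec)
    show "(\<integral>x. v x * pd \<phi> b x \<partial>lebesgue_on U) = emb U v \<bullet> abs_l2 (pd \<phi> b)"
      using integral_inner_emb[OF Ul L[unfolded L2_iff_L2vec] sqint_L2vec[OF U t(4)[OF \<phi>(2)]]] e by simp
    show "(\<integral>x. (G x \<bullet> b) * \<phi> x \<partial>lebesgue_on U) = emb U G \<bullet> abs_l2 (%x. \<phi> x *\<^sub>R b)"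
      using integral_inner_emb[OF Ul G sqint_L2vec[OF U sqint_scaleR_vec[OF t(2)]], of b] e by (simp add: mult.commute)
  qed
  have "is_weak_grad U v (rep_l2 g)"
    unfolding is_weak_grad_def using wk[OF _ _ gL] grad_graph_weak[OF hg] gs by simp
  then have ex: "\<exists>G. L2vec U G \<and> is_weak_grad U v G" using gL by blast
  then have H: "H1 U v" using L by (simp add: H1_def)
  from ex have w: "L2vec U (wgrad U v) \<and> is_weak_grad U v (wgrad U v)" unfolding wgrad_def by (rule someI_ex)
  \<comment> \<open>\<open>wgrad\<close> is some weak gradient picked by choice; it and
    \<open>g\<close> satisfy the same integration by parts formula, so their difference is
    orthogonal to all test fields.\<close>
  have "emb U (wgrad U v) - g = 0"
  proof (rule l2_zero_if_test_zero[OF U])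
    show "emb U (wgrad U v) - g \<in> supp_in U"
      using subspace_supp_in[of U] U w grad_graph_supp(2)[OF U hg] emb_supp_in[OF Ul] by (intro subspace_diff) auto
    fix \<psi> :: "'a => real" and b :: 'a assume \<psi>: "test_fun U \<psi>" "b \<in> Basis"
    have "emb U v \<bullet> abs_l2 (pd \<psi> b) = - (emb U (wgrad U v) \<bullet> abs_l2 (%x. \<psi> x *\<^sub>R b))"
      using w \<psi> wk[OF \<psi>, of "wgrad U v"] unfolding is_weak_grad_def by metis
    then show "(emb U (wgrad U v) - g) \<bullet> abs_l2 (%x. \<psi> x *\<^sub>R b) = 0"
      using grad_graph_weak[OF hg \<psi>] by (simp add: inner_diff_left)
  qed
  then show eq: "emb U (wgrad U v) = g" by simp
  obtain X where X: "!!n. X n \<in> {(abs_l2 \<phi>, abs_l2 (grad \<phi>)) |\<phi>. test_fun U \<phi>}" "X ----> (emb U v, g)"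
    using hg unfolding grad_graph_def closure_sequential by blast
  then have "\<forall>n. \<exists>\<phi>. test_fun U \<phi> \<and> X n = (abs_l2 \<phi>, abs_l2 (grad \<phi>))" by blast
  then obtain \<phi>s where \<phi>s: "!!n. test_fun U (\<phi>s n)" "!!n. X n = (abs_l2 (\<phi>s n), abs_l2 (grad (\<phi>s n)))" by metis
  note t = test_fun_integrable[OF \<phi>s(1)]
  have lv: "L2 U (\<phi>s k)" "L2vec U (grad (\<phi>s k))" for k using t U by (auto simp: L2_iff_L2vec intro: sqint_L2vec)
  have em: "emb U (\<phi>s k) = abs_l2 (\<phi>s k)" "emb U (grad (\<phi>s k)) = abs_l2 (grad (\<phi>s k))" for k
    using t test_fun_outside[OF \<phi>s(1)] grad_outside[OF \<phi>s(1)] by (auto intro!: emb_sqint)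
  have X1: "(%k. abs_l2 (\<phi>s k)) ----> emb U v" and X2: "(%k. abs_l2 (grad (\<phi>s k))) ----> g"
    using tendsto_fst[OF X(2)] tendsto_snd[OF X(2)] by (simp_all add: \<phi>s(2))
  have "(%k. (norm (abs_l2 (\<phi>s k) - emb U v))\<^sup>2) ----> (norm (emb U v - emb U v))\<^sup>2" by (intro tendsto_intros X1)
  moreover have "(%k. (norm (abs_l2 (grad (\<phi>s k)) - g))\<^sup>2) ----> (norm (g - g))\<^sup>2" by (intro tendsto_intros X2)
  ultimately have "(%k. L2sq U (%x. \<phi>s k x - v x)) ----> 0"
    "(%k. \<integral>x. (norm (grad (\<phi>s k) x - wgrad U v x))\<^sup>2 \<partial>lebesgue_on U) ----> 0"
    using w by (simp_all add: L2sq_emb[OF Ul] L2_diff[OF Ul lv(1) L] norm_sq_emb_diff[OF Ul lv(2)] em eq)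
  then show "H10 U v" unfolding H10_def using H \<phi>s(1) by blast
qed

lemma gradip_emb:
  assumes U: "open U" and "H10 U v" "H10 U w"
  shows "gradip U v w = emb U (wgrad U v) \<bullet> emb U (wgrad U w)"
  unfolding gradip_def by (rule integral_inner_emb[OF open_lebesgue[OF U] H10_D(2)[OF U assms(2)] H10_D(2)[OF U assms(3)]])

lemma gradsq_emb: "open U ==> H10 U v ==> gradsq U v = (norm (emb U (wgrad U v)))\<^sup>2"
  by (simp add: gradsq_def gradip_emb power2_norm_eq_inner)

lemma H1norm_emb: "open U ==> H10 U v ==> H1norm U v = norm (emb U v, emb U (wgrad U v))"
  by (simp add: H1norm_def L2sq_emb[OF open_lebesgue H10_D(1)] gradsq_emb norm_Pair)

lemma H10_test_fun:
  assumes U: "open U" and \<phi>: "test_fun U \<phi>"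
  shows "H10 U \<phi>" "emb U \<phi> = abs_l2 \<phi>" "emb U (wgrad U \<phi>) = abs_l2 (grad \<phi>)"
proof -
  note t = test_fun_integrable[OF \<phi>]
  show e: "emb U \<phi> = abs_l2 \<phi>" using t test_fun_outside[OF \<phi>] by (auto intro!: emb_sqint)
  have L: "L2 U \<phi>" using sqint_L2vec[OF U t(2)] by (simp add: L2_iff_L2vec)
  have "(emb U \<phi>, abs_l2 (grad \<phi>)) \<in> grad_graph U" unfolding e by (rule test_fun_in_grad_graph[OF \<phi>])
  from H10_I[OF U L this] show "H10 U \<phi>" "emb U (wgrad U \<phi>) = abs_l2 (grad \<phi>)" .
qed

section \<open>Absolutely continuous curves from weak time derivatives\<close>

lemma slice_norm_sq_integrable:
  fixes R :: "real \<times> 'x::euclidean_space => 'b::euclidean_space"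
  assumes "sqint R"
  shows "integrable lebesgue (%t. (norm (slice R t))\<^sup>2)"
proof -
  have i: "integrable lebesgue (%t. \<integral>x. (norm (R (t, x)))\<^sup>2 \<partial>lborel)"
    using integrable_slice[OF assms] by (simp add: integrable_completion borel_measurable_integrable)
  have ae: "AE t in lebesgue. (\<integral>x. (norm (R (t, x)))\<^sup>2 \<partial>lborel) = (norm (slice R t))\<^sup>2"
    using slice_norm_measurable[OF assms] unfolding AE_completion_iff by eventually_elim simp
  show ?thesis
    by (rule integrable_cong_AE_imp[OF i borel_measurable_AE[OF borel_measurable_integrable[OF i] ae] ae])
qed

lemma slice_bound_tintegrable:
  assumes "sqint R" shows "tintegrable a b (%t. 1 + (norm (slice R t))\<^sup>2)"
proof -
  have "tintegrable a b (%t. (norm (slice R t))\<^sup>2)"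
    unfolding set_integrable_def using slice_norm_sq_integrable[OF assms] by (intro integrable_mult_indicator) auto
  then show ?thesis by (intro set_integral_add(1) tintegrable_const)
qed

lemma norm_le_one_plus_sq: "norm x <= 1 + (norm x)\<^sup>2"
  using sum_squares_bound[of "norm x" 1, simplified] norm_ge_zero[of x] by linarith

lemma slice_inner_tintegrable:
  assumes "sqint R" shows "tintegrable a b (%t. slice R t \<bullet> h)"
proof (rule tintegrable_bound[OF _ slice_inner_measurable[OF assms]])
  show "tintegrable a b (%t. (1 + (norm (slice R t))\<^sup>2) * norm h)"
    by (intro set_integrable_mult_left slice_bound_tintegrable assms)
  have "\<bar>slice R t \<bullet> h\<bar> <= (1 + (norm (slice R t))\<^sup>2) * norm h" for t
    using Cauchy_Schwarz_ineq2[of "slice R t" h] mult_right_mono[OF norm_le_one_plus_sq[of "slice R t"] norm_ge_zero[of h]] by linarith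
  then show "AE t in lebesgue. t \<in> {a..<b} --> \<bar>slice R t \<bullet> h\<bar> <= (1 + (norm (slice R t))\<^sup>2) * norm h" by simp
qed

lemma integral_product_slice:
  fixes R :: "real \<times> 'x::euclidean_space => real"
  assumes R: "sqint R" and c: "sqint c" and ac: "sqint (%p. a (fst p) * c (snd p))" and a: "a \<in> borel_measurable borel"
  shows "(\<integral>p. R p * (a (fst p) * c (snd p)) \<partial>lborel) = (\<integral>t. a t * (slice R t \<bullet> abs_l2 c) \<partial>lebesgue)"
proof -
  have i: "integrable (lborel \<Otimes>\<^sub>M lborel) (%p. R p * (a (fst p) * c (snd p)))"
    using sqint_inner[OF R ac] by (simp add: lborel_prod)
  have "(\<integral>p. R p * (a (fst p) * c (snd p)) \<partial>lborel) = (\<integral>t. \<integral>x. R (t, x) * (a t * c x) \<partial>lborel \<partial>lborel)"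
    using lborel_pair.integral_fst'[OF i] by (simp add: lborel_prod)
  also have "\<dots> = (\<integral>t. \<integral>x. R (t, x) * (a t * c x) \<partial>lborel \<partial>lebesgue)"
    using borel_measurable_integrable[OF lborel_pair.integrable_fst'[OF i]] by (simp add: integral_completion)
  also have "\<dots> = (\<integral>t. a t * (slice R t \<bullet> abs_l2 c) \<partial>lebesgue)"
  proof (rule integral_cong_AE)
    show "(%t. \<integral>x. R (t, x) * (a t * c x) \<partial>lborel) \<in> borel_measurable lebesgue"
      using borel_measurable_integrable[OF lborel_pair.integrable_fst'[OF i]] by (intro measurable_completion) simp
    show "(%t. a t * (slice R t \<bullet> abs_l2 c)) \<in> borel_measurable lebesgue"
      by (intro borel_measurable_times slice_inner_measurable[OF R] measurable_completion) (use a in simp)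
    have "AE t in lebesgue. sqint (%x. R (t, x))" using AE_sqint_slice[OF R] by (simp only: AE_completion_iff)
    then show "AE t in lebesgue. (\<integral>x. R (t, x) * (a t * c x) \<partial>lborel) = a t * (slice R t \<bullet> abs_l2 c)"
    proof eventually_elim
      case (elim t)
      have "(\<integral>x. R (t, x) * (a t * c x) \<partial>lborel) = (\<integral>x. a t * (R (t, x) * c x) \<partial>lborel)" by (simp add: mult_ac)
      also have "\<dots> = a t * (\<integral>x. R (t, x) * c x \<partial>lborel)" by simp
      finally show ?case by (simp add: slice_def inner_abs_l2[OF elim c])
    qed
  qed
  finally show ?thesis .
qed

section \<open>Mollification in time\<close>

definition dstep :: "real => real" where "dstep = pd smooth_step 1"

lemma smooth_step_deriv: "(smooth_step has_real_derivative dstep x) (at x)"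
proof -
  have d: "smooth_step differentiable (at x)" using Ck_smooth_step[of 1] by simp
  have "pd smooth_step c x = dstep x * c" for c
    using linear_cmul[OF has_derivative_linear[OF has_derivative_pd[OF d]], of c 1] by (simp add: dstep_def mult.commute)
  then show ?thesis using has_derivative_pd[OF d] by (simp add: has_field_derivative_def)
qed

lemma dstep_continuous: "continuous_on UNIV dstep"
  unfolding dstep_def using Ck_smooth_step[of 1] by simp

lemma dstep_outside: assumes "x < 0 \<or> 1 < x" shows "dstep x = 0"
proof -
  have "(smooth_step has_real_derivative 0) (at x)"
  proof (cases "x < 0")
    case True
    have "((%x. 0) has_real_derivative 0) (at x)" by simp
    then show ?thesis
      by (rule has_field_derivative_transform_within_open[where S = "{..<0}"]) (use True in \<open>auto simp: smooth_step_simps\<close>)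
  next
    case False
    have "((%x. 1) has_real_derivative 0) (at x)" by simp
    then show ?thesis
      by (rule has_field_derivative_transform_within_open[where S = "{1<..}"]) (use False assms in \<open>auto simp: smooth_step_simps\<close>)
  qed
  then show ?thesis using DERIV_unique smooth_step_deriv by blast
qed

lemma dstep_integrable: "integrable lborel dstep" and dstep_measurable[measurable]: "dstep \<in> borel_measurable borel"
  and dstep_integral: "(\<integral>x. dstep x \<partial>lborel) = 1"
proof -
  have out: "x \<notin> {0..1} ==> dstep x = 0" for x by (rule dstep_outside) auto
  show "integrable lborel dstep" by (rule compact_support_integrable(1)[OF dstep_continuous compact_Icc out])
  show "dstep \<in> borel_measurable borel" using dstep_continuous by (rule borel_measurable_continuous_onI)
  have "(\<integral>x. dstep x * indicator {0..1} x \<partial>lborel) = smooth_step 1 - smooth_step 0"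
    by (rule integral_FTC_Icc_real[OF zero_le_one smooth_step_deriv])
      (use dstep_continuous in \<open>simp add: continuous_on_eq_continuous_at\<close>)
  moreover have "dstep x * indicator {0..1} x = dstep x" for x using out[of x] by (auto simp: indicator_def)
  ultimately show "(\<integral>x. dstep x \<partial>lborel) = 1" by (simp add: smooth_step_simps)
qed

text \<open>\<open>dstep\<close> is supported in the unit interval and has integral 1, so after
  rescaling it is a one-sided approximate identity; a change of variables moves the parameter into
  the continuous \<open>z\<close>.\<close>

lemma mollify_tendsto:
  fixes z :: "real => real"
  assumes z: "continuous_on UNIV z" and M: "!!r. \<bar>z r\<bar> <= M" and e: "!!n. 0 < e n" "e ----> 0"
  shows "(%n. \<integral>r. dstep ((r - s) / e n) / e n * z r \<partial>lborel) ----> z s"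
    and "integrable lborel (%r. dstep ((r - s) / e n) / e n * z r)"
proof -
  have [measurable]: "z \<in> borel_measurable borel" using z by (rule borel_measurable_continuous_onI)
  have i0: "integrable lborel (%x. dstep x * z (s + e n * x))" for n
  proof (rule Bochner_Integration.integrable_bound)
    show "integrable lborel (%x. M * \<bar>dstep x\<bar>)" using dstep_integrable by simp
    have "\<bar>dstep x * z (s + e n * x)\<bar> <= \<bar>M * \<bar>dstep x\<bar>\<bar>" for x
      using order_trans[OF mult_right_mono[OF M[of "s + e n * x"] abs_ge_zero[of "dstep x"]] mult_right_mono[OF abs_ge_self[of M] abs_ge_zero[of "dstep x"]]]
      by (simp add: abs_mult mult.commute)
    then show "AE x in lborel. norm (dstep x * z (s + e n * x)) <= norm (M * \<bar>dstep x\<bar>)" by simp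
  qed measurable
  have eq: "dstep ((s + e n * x - s) / e n) / e n * z (s + e n * x) = (1 / e n) * (dstep x * z (s + e n * x))" for n x
    using e(1)[of n] by simp
  show i: "integrable lborel (%r. dstep ((r - s) / e n) / e n * z r)" for n
  proof -
    have "integrable lborel (%x. dstep ((s + e n * x - s) / e n) / e n * z (s + e n * x))"
      unfolding eq by (intro integrable_mult_right i0)
    then show ?thesis
      using lborel_integrable_real_affine_iff[of "e n" "%r. dstep ((r - s) / e n) / e n * z r" s] e(1)[of n] by simp
  qed
  have "(\<integral>r. dstep ((r - s) / e n) / e n * z r \<partial>lborel) = (\<integral>x. dstep x * z (s + e n * x) \<partial>lborel)" for n
  proof -
    have "(\<integral>r. dstep ((r - s) / e n) / e n * z r \<partial>lborel)
        = \<bar>e n\<bar> *\<^sub>R (\<integral>x. dstep ((s + e n * x - s) / e n) / e n * z (s + e n * x) \<partial>lborel)"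
      using e(1)[of n] by (intro lborel_integral_real_affine) auto
    also have "\<dots> = \<bar>e n\<bar> * ((1 / e n) * (\<integral>x. dstep x * z (s + e n * x) \<partial>lborel))" unfolding eq by simp
    also have "\<dots> = (\<integral>x. dstep x * z (s + e n * x) \<partial>lborel)" using e(1)[of n] by simp
    finally show ?thesis .
  qed
  moreover have "(%n. \<integral>x. dstep x * z (s + e n * x) \<partial>lborel) ----> (\<integral>x. dstep x * z s \<partial>lborel)"
  proof (rule integral_dominated_convergence)
    show "integrable lborel (%x. M * \<bar>dstep x\<bar>)" using dstep_integrable by simp
    have "(%n. z (s + e n * x)) ----> z (s + 0 * x)" for x
      using z by (intro continuous_on_tendsto_compose[OF z] tendsto_intros e) auto
    then show "AE x in lborel. (%n. dstep x * z (s + e n * x)) ----> dstep x * z s" by (intro AE_I2 tendsto_mult tendsto_const) simp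
    have "\<bar>dstep x * z (s + e n * x)\<bar> <= M * \<bar>dstep x\<bar>" for x n
      using mult_right_mono[OF M[of "s + e n * x"] abs_ge_zero[of "dstep x"]]
      by (simp add: abs_mult mult.commute)
    then show "AE x in lborel. norm (dstep x * z (s + e n * x)) <= M * \<bar>dstep x\<bar>" for n by simp
  qed measurable
  ultimately show "(%n. \<integral>r. dstep ((r - s) / e n) / e n * z r \<partial>lborel) ----> z s" by (simp add: dstep_integral)
qed

lemma time_Basis: "(1, 0) \<in> (Basis :: (real \<times> 'x::euclidean_space) set)"
  by (simp add: Basis_prod_def)

text \<open>A smoothed indicator of the times between \<open>s\<close> and \<open>t\<close>, times a
  test function of space. Its time derivative is the difference of two mollifiers, sitting right of
  \<open>s\<close> and right of \<open>t\<close>.\<close>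

lemma test_fun_time_product:
  fixes c :: "'x::euclidean_space => real"
  assumes c: "test_fun Om c" and st: "0 < s" "s <= t" "t + e < T" and e: "0 < e"
  defines "\<phi> \<equiv> %p. (smooth_step ((fst p - s) / e) - smooth_step ((fst p - t) / e)) * c (snd p)"
  shows "test_fun ({0<..<T} \<times> Om) \<phi>"
    "pd \<phi> (1, 0) p = ((dstep ((fst p - s) / e) - dstep ((fst p - t) / e)) / e) * c (snd p)"
proof -
  have 1: "Ck k (%p :: real \<times> 'x. smooth_step ((fst p - r) / e))" for k r
  proof -
    have "bounded_linear (%p :: real \<times> 'x. (1 / e) * fst p)" by (intro bounded_linear_const_mult bounded_linear_fst)
    from Ck_compose_affine[OF this Ck_smooth_step, of k "- r / e"] show ?thesis by (simp add: diff_divide_distrib)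
  qed
  have 2: "Ck k (%p :: real \<times> 'x. c (snd p))" for k
    using Ck_compose_affine[OF bounded_linear_snd test_fun_Ck[OF c], of k 0] by simp
  show "test_fun ({0<..<T} \<times> Om) \<phi>"
  proof (rule test_funI)
    have "Ck k (%p. (smooth_step ((fst p - s) / e) + (-1) * smooth_step ((fst p - t) / e)) * c (snd p))" for k
      by (intro Ck_mult Ck_add Ck_cmult 1 2)
    then show "Ck k \<phi>" for k by (simp add: \<phi>_def)
    show "compact ({s..t + e} \<times> closure {x. c x \<noteq> 0})" by (intro compact_Times compact_Icc test_fun_compact[OF c])
    show "{s..t + e} \<times> closure {x. c x \<noteq> 0} \<subseteq> {0<..<T} \<times> Om"
      using test_fun_support[OF c] st by (intro Sigma_mono) auto
    fix p assume p: "p \<notin> {s..t + e} \<times> closure {x. c x \<noteq> 0}"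
    show "\<phi> p = 0"
    proof (cases "snd p \<in> closure {x. c x \<noteq> 0}")
      case True
      then have "fst p < s \<or> t + e < fst p" using p by (cases p) auto
      then show ?thesis
      proof
        assume "fst p < s"
        then have "(fst p - s) / e <= 0" "(fst p - t) / e <= 0" using e st by (auto simp: divide_nonpos_pos)
        then show ?thesis by (simp add: \<phi>_def smooth_step_simps)
      next
        assume "t + e < fst p"
        then have "1 <= (fst p - s) / e" "1 <= (fst p - t) / e" using e st by (auto simp: le_divide_eq)
        then show ?thesis by (simp add: \<phi>_def smooth_step_simps)
      qed
    next
      case False
      then have "c (snd p) = 0" using closure_subset[of "{x. c x \<noteq> 0}"] by auto
      then show ?thesis by (simp add: \<phi>_def)
    qed
  qed
  have d1: "((%p. smooth_step ((fst p - r) / e)) has_derivative (%d. dstep ((fst p - r) / e) * (fst d / e))) (at p)" for r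
  proof -
    have i: "((%p. (fst p - r) / e) has_derivative (%d. fst d / e)) (at p)"
      using e by (auto intro!: derivative_eq_intros)
    from has_derivative_compose[OF i smooth_step_deriv[unfolded has_field_derivative_def]] show ?thesis .
  qed
  have d2: "((%p. c (snd p)) has_derivative (%d. pd c (snd d) (snd p))) (at p)"
    by (rule has_derivative_compose[OF has_derivative_snd[OF has_derivative_ident] has_derivative_pd[OF test_fun_differentiable[OF c]]])
  have c0: "pd c 0 (snd p) = 0"
    using linear_0[OF has_derivative_linear[OF has_derivative_pd[OF test_fun_differentiable[OF c]]]] .
  show "pd \<phi> (1, 0) p = ((dstep ((fst p - s) / e) - dstep ((fst p - t) / e)) / e) * c (snd p)"
    unfolding \<phi>_def
    by (subst pd_eqI[OF has_derivative_mult[OF has_derivative_diff[OF d1 d1] d2]]) (simp add: c0 diff_divide_distrib)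
qed

text \<open>As the ramps shrink, the side with the time derivative tends to \<open>z s - z t\<close>
  by continuity of the curve, and the other side to the integral of the derivative from
  \<open>s\<close> to \<open>t\<close>.\<close>

lemma curve_from_weak_dt_test:
  fixes R Rd :: "real \<times> 'x::euclidean_space => real"
  assumes R: "sqint R" "sqint Rd" and E: "continuous_on {0..T} E" "AE t in lebesgue. t \<in> {0<..<T} --> E t = slice R t"
    and wk: "!!\<phi>. test_fun ({0<..<T} \<times> Om) \<phi> ==> (\<integral>p. R p * pd \<phi> (1, 0) p \<partial>lborel) = - (\<integral>p. Rd p * \<phi> p \<partial>lborel)"
    and c: "test_fun Om c" and st: "0 < s" "s <= t" "t < T"
  shows "(E t - E s) \<bullet> abs_l2 c = tint s t (%r. slice Rd r \<bullet> abs_l2 c)"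
proof -
  \<comment> \<open>Tends to zero and keeps the second ramp, which starts at \<open>t\<close>,
    strictly before \<open>T\<close>.\<close>
  define e where "e n = (T - t) / (2 + real n)" for n
  have e: "0 < e n" "t + e n < T" for n
    using st(3) mult_strict_left_mono[of 1 "2 + real n" "T - t"] by (auto simp: e_def field_simps)
  have e0: "e ----> 0" unfolding e_def
    by (rule real_tendsto_divide_at_top[OF tendsto_const filterlim_tendsto_add_at_top[OF tendsto_const filterlim_real_sequentially]])
  \<comment> \<open>Time is clamped to the interval from 0 to \<open>T\<close>, so that
    \<open>z\<close> is continuous and bounded on the whole line.\<close>
  define z where "z r = E (max 0 (min T r)) \<bullet> abs_l2 c" for r
  have cont: "continuous_on UNIV z"
    unfolding z_def using st
    by (intro continuous_intros continuous_on_compose2[OF E(1)]) auto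
  have "compact (E ` {0..T})" by (intro compact_continuous_image E compact_Icc)
  then have "bounded (E ` {0..T})" by (rule compact_imp_bounded)
  then obtain M0 where "\<forall>x\<in>E ` {0..T}. norm x <= M0" unfolding bounded_iff by (rule exE)
  then have M0: "norm (E x) <= M0" if "x \<in> {0..T}" for x using that by simp
  have zM: "\<bar>z r\<bar> <= M0 * norm (abs_l2 c)" for r
    using Cauchy_Schwarz_ineq2[of "E (max 0 (min T r))" "abs_l2 c"] mult_right_mono[OF M0[of "max 0 (min T r)"] norm_ge_zero[of "abs_l2 c"]] st
    by (auto simp: z_def)
  define \<psi> where "\<psi> n r = smooth_step ((r - s) / e n) - smooth_step ((r - t) / e n)" for n r
  define \<psi>' where "\<psi>' n r = (dstep ((r - s) / e n) - dstep ((r - t) / e n)) / e n" for n r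
  note tf = test_fun_time_product[OF c st(1,2) e(2) e(1)]
  note ci = test_fun_integrable(2)[OF c]
  have [measurable]: "smooth_step \<in> borel_measurable borel"
    using Ck_smooth_step[of 0] by (simp add: borel_measurable_continuous_onI)
  have m: "\<psi> n \<in> borel_measurable borel" "\<psi>' n \<in> borel_measurable borel" for n
    unfolding \<psi>_def \<psi>'_def by measurable
  have "(\<integral>r. \<psi>' n r * (slice R r \<bullet> abs_l2 c) \<partial>lebesgue) = - (\<integral>r. \<psi> n r * (slice Rd r \<bullet> abs_l2 c) \<partial>lebesgue)" for n
  proof -
    have s1: "sqint (%p. \<psi> n (fst p) * c (snd p))" unfolding \<psi>_def by (rule test_fun_integrable(2)[OF tf(1)])
    have s2: "sqint (%p. \<psi>' n (fst p) * c (snd p))"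
      using test_fun_integrable(4)[OF tf(1)[of n] time_Basis] unfolding tf(2) \<psi>'_def .
    show ?thesis
      using wk[OF tf(1)[of n]] integral_product_slice[OF R(1) ci s2 m(2)] integral_product_slice[OF R(2) ci s1 m(1)]
      unfolding tf(2) \<psi>_def \<psi>'_def by simp
  qed
  moreover have "(\<integral>r. \<psi>' n r * (slice R r \<bullet> abs_l2 c) \<partial>lebesgue) = (\<integral>r. \<psi>' n r * z r \<partial>lborel)" for n
  proof -
    have zm: "(%r. \<psi>' n r * z r) \<in> borel_measurable borel"
      by (intro borel_measurable_times m(2) borel_measurable_continuous_onI[OF cont])
    have "(\<integral>r. \<psi>' n r * (slice R r \<bullet> abs_l2 c) \<partial>lebesgue) = (\<integral>r. \<psi>' n r * z r \<partial>lebesgue)"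
    proof (rule integral_cong_AE)
      show "(%r. \<psi>' n r * (slice R r \<bullet> abs_l2 c)) \<in> borel_measurable lebesgue"
        using m(2)[of n] by (intro borel_measurable_times slice_inner_measurable[OF R(1)] measurable_completion) simp
      show "(%r. \<psi>' n r * z r) \<in> borel_measurable lebesgue" using zm by (intro measurable_completion) simp
      show "AE r in lebesgue. \<psi>' n r * (slice R r \<bullet> abs_l2 c) = \<psi>' n r * z r"
        using E(2)
      proof eventually_elim
        case (elim r)
        show ?case
        proof (cases "r \<in> {0<..<T}")
          case True
          then show ?thesis using elim by (simp add: z_def max_def min_def)
        next
          case False
          then have "(r - s) / e n < 0 \<and> (r - t) / e n < 0 \<or> 1 < (r - s) / e n \<and> 1 < (r - t) / e n"
            using st e[of n] by (auto simp: divide_less_0_iff less_divide_eq)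
          then have "\<psi>' n r = 0" using dstep_outside by (auto simp: \<psi>'_def)
          then show ?thesis by simp
        qed
      qed
    qed
    then show ?thesis using zm by (simp add: integral_completion)
  qed
  moreover have "(%n. \<integral>r. \<psi>' n r * z r \<partial>lborel) ----> z s - z t"
  proof -
    have "(\<integral>r. \<psi>' n r * z r \<partial>lborel) = (\<integral>r. dstep ((r - s) / e n) / e n * z r \<partial>lborel) - (\<integral>r. dstep ((r - t) / e n) / e n * z r \<partial>lborel)" for n
      unfolding \<psi>'_def
      using mollify_tendsto(2)[OF cont zM e(1) e0, of s n] mollify_tendsto(2)[OF cont zM e(1) e0, of t n]
      by (simp add: diff_divide_distrib left_diff_distrib)
    then show ?thesis using mollify_tendsto(1)[OF cont zM e(1) e0] by (simp add: tendsto_diff)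
  qed
  moreover have "(%n. \<integral>r. \<psi> n r * (slice Rd r \<bullet> abs_l2 c) \<partial>lebesgue) ----> (\<integral>r. indicator {s<..t} r * (slice Rd r \<bullet> abs_l2 c) \<partial>lebesgue)"
  proof (rule integral_dominated_convergence)
    show "integrable lebesgue (%r. \<bar>indicator {0..<T} r *\<^sub>R (slice Rd r \<bullet> abs_l2 c)\<bar>)"
      using slice_inner_tintegrable[OF R(2), of 0 T "abs_l2 c"] unfolding set_integrable_def by (rule integrable_abs)
    have sm: "{s<..t} \<in> sets lebesgue" by (intro sets_completionI_sets) simp
    show "(%r. indicator {s<..t} r * (slice Rd r \<bullet> abs_l2 c)) \<in> borel_measurable lebesgue"
      using sm by (intro borel_measurable_times slice_inner_measurable[OF R(2)] borel_measurable_indicator)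
    show "(%r. \<psi> n r * (slice Rd r \<bullet> abs_l2 c)) \<in> borel_measurable lebesgue" for n
      using m(1)[of n] by (intro borel_measurable_times slice_inner_measurable[OF R(2)] measurable_completion) simp
    have lim1: "(%n. smooth_step ((r - a) / e n)) ----> (if a < r then 1 else 0)" for r a
    proof (cases "a < r")
      case True
      have "\<forall>\<^sub>F n in sequentially. e n < r - a" using e0 True by (intro order_tendstoD) auto
      then have "\<forall>\<^sub>F n in sequentially. smooth_step ((r - a) / e n) = 1"
      proof eventually_elim
        case (elim n)
        then have "1 <= (r - a) / e n" using e(1)[of n] by (simp add: le_divide_eq)
        then show ?case by (rule smooth_step_simps(2))
      qed
      then show ?thesis using True by (simp add: tendsto_eventually)
    next
      case False
      then have "smooth_step ((r - a) / e n) = 0" for n using e(1)[of n] by (intro smooth_step_simps(1)) (auto simp: divide_nonpos_pos)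
      then show ?thesis using False by simp
    qed
    have "(%n. \<psi> n r) ----> indicator {s<..t} r" for r
      using tendsto_diff[OF lim1[of r s] lim1[of r t]] st(2) unfolding \<psi>_def by (auto simp: indicator_def split: if_splits)
    then show "AE r in lebesgue. (%n. \<psi> n r * (slice Rd r \<bullet> abs_l2 c)) ----> indicator {s<..t} r * (slice Rd r \<bullet> abs_l2 c)"
      by (intro AE_I2 tendsto_mult tendsto_const)
    have pb: "\<bar>\<psi> n r\<bar> <= indicator {0..<T} r" for n r
    proof (cases "r \<in> {0..<T}")
      case True
      then show ?thesis using smooth_step_simps(3,4)[of "(r - s) / e n"] smooth_step_simps(3,4)[of "(r - t) / e n"] by (simp add: \<psi>_def)
    next
      case False
      then have "(r - s) / e n <= 0 \<and> (r - t) / e n <= 0 \<or> 1 <= (r - s) / e n \<and> 1 <= (r - t) / e n"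
        using st e[of n] by (auto simp: divide_le_0_iff le_divide_eq)
      then show ?thesis using False by (auto simp: \<psi>_def smooth_step_simps)
    qed
    show "AE r in lebesgue. norm (\<psi> n r * (slice Rd r \<bullet> abs_l2 c)) <= \<bar>indicator {0..<T} r *\<^sub>R (slice Rd r \<bullet> abs_l2 c)\<bar>" for n
    proof (rule AE_I2)
      fix r show "norm (\<psi> n r * (slice Rd r \<bullet> abs_l2 c)) <= \<bar>indicator {0..<T} r *\<^sub>R (slice Rd r \<bullet> abs_l2 c)\<bar>"
        using mult_right_mono[OF pb[of n r] abs_ge_zero[of "slice Rd r \<bullet> abs_l2 c"]] by (simp add: abs_mult)
    qed
  qed
  moreover have "(\<integral>r. indicator {s<..t} r * (slice Rd r \<bullet> abs_l2 c) \<partial>lebesgue) = tint s t (%r. slice Rd r \<bullet> abs_l2 c)"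
    unfolding tint_def set_lebesgue_integral_def
  proof (rule integral_cong_AE)
    have "{s<..t} \<in> sets lebesgue" by (intro sets_completionI_sets) simp
    then show "(%r. indicator {s<..t} r * (slice Rd r \<bullet> abs_l2 c)) \<in> borel_measurable lebesgue"
      by (intro borel_measurable_times slice_inner_measurable[OF R(2)] borel_measurable_indicator)
    show "(%r. indicator {s..<t} r *\<^sub>R (slice Rd r \<bullet> abs_l2 c)) \<in> borel_measurable lebesgue"
      by (intro borel_measurable_scaleR slice_inner_measurable[OF R(2)] borel_measurable_indicator ivl_lebesgue)
    have "AE r in lebesgue. r \<noteq> s \<and> r \<noteq> t" by (simp add: AE_completion_iff AE_lborel_singleton AE_conj_iff)
    then show "AE r in lebesgue. indicator {s<..t} r * (slice Rd r \<bullet> abs_l2 c) = indicator {s..<t} r *\<^sub>R (slice Rd r \<bullet> abs_l2 c)"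
      by eventually_elim (auto simp: indicator_def)
  qed
  ultimately have "(%n. - (\<integral>r. \<psi> n r * (slice Rd r \<bullet> abs_l2 c) \<partial>lebesgue)) ----> z s - z t"
    "(%n. - (\<integral>r. \<psi> n r * (slice Rd r \<bullet> abs_l2 c) \<partial>lebesgue)) ----> - tint s t (%r. slice Rd r \<bullet> abs_l2 c)"
    by (simp_all add: tendsto_minus)
  then have "z s - z t = - tint s t (%r. slice Rd r \<bullet> abs_l2 c)" by (rule LIMSEQ_unique)
  then show ?thesis using st by (simp add: z_def inner_diff_left max_def min_def)
qed

text \<open>Two extensions of the previous lemma: to the end points by continuity of the curve, and
  to arbitrary \<open>h\<close> because test functions are total in \<open>supp_in Om\<close> and
  the part of \<open>h\<close> orthogonal to that space is seen by neither side.\<close>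

lemma curve_from_weak_dt:
  fixes R Rd :: "real \<times> 'x::euclidean_space => real"
  assumes R: "sqint R" "sqint Rd" and E: "continuous_on {0..T} E" "AE t in lebesgue. t \<in> {0<..<T} --> E t = slice R t"
    and wk: "!!\<phi>. test_fun ({0<..<T} \<times> Om) \<phi> ==> (\<integral>p. R p * pd \<phi> (1, 0) p \<partial>lborel) = - (\<integral>p. Rd p * \<phi> p \<partial>lborel)"
    and Om: "open Om" and sE: "!!t. t \<in> {0..T} ==> E t \<in> supp_in Om"
    and sR: "AE t in lebesgue. t \<in> {0<..<T} --> slice Rd t \<in> supp_in Om"
    and st: "0 <= s" "s <= t" "t <= T"
  shows "(E t - E s) \<bullet> h = tint s t (%r. slice Rd r \<bullet> h)"
proof (cases "s = t")
  case True then show ?thesis by (simp add: tint_empty)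
next
  case False
  then have slt: "s < t" using st by simp
  have test: "(E t - E s) \<bullet> abs_l2 c = tint s t (%r. slice Rd r \<bullet> abs_l2 c)" if c: "test_fun Om c" for c
  proof -
    \<comment> \<open>Shrinks the interval at both ends by less than half of its length, so that
      interior end points in the right order remain.\<close>
    define d where "d n = (t - s) / (3 + real n)" for n
    have d: "0 < d n" "2 * d n < t - s" for n
      using slt mult_strict_left_mono[of 2 "3 + real n" "t - s"] by (auto simp: d_def field_simps)
    have d0: "d ----> 0" unfolding d_def
      by (rule real_tendsto_divide_at_top[OF tendsto_const filterlim_tendsto_add_at_top[OF tendsto_const filterlim_real_sequentially]])
    have eq: "(E (t - d n) - E (s + d n)) \<bullet> abs_l2 c = tint (s + d n) (t - d n) (%r. slice Rd r \<bullet> abs_l2 c)" for n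
      using d[of n] st by (intro curve_from_weak_dt_test[OF R E wk c]) auto
    have lt: "(%n. t - d n) ----> t" "(%n. s + d n) ----> s"
      using tendsto_diff[OF tendsto_const[of t] d0] tendsto_add[OF tendsto_const[of s] d0] by auto
    have dm: "t - d n \<in> {0..T}" "s + d n \<in> {0..T}" for n using d[of n] st by auto
    have L1: "(%n. E (t - d n)) ----> E t"
      by (rule continuous_on_tendsto_compose[OF E(1) lt(1)]) (use st dm in \<open>auto intro!: always_eventually\<close>)
    have L2: "(%n. E (s + d n)) ----> E s"
      by (rule continuous_on_tendsto_compose[OF E(1) lt(2)]) (use st dm in \<open>auto intro!: always_eventually\<close>)
    have "(%n. (E (t - d n) - E (s + d n)) \<bullet> abs_l2 c) ----> (E t - E s) \<bullet> abs_l2 c"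
      by (intro tendsto_intros L1 L2)
    moreover have "(%n. tint s t (%r. indicator {s + d n..<t - d n} r * (slice Rd r \<bullet> abs_l2 c))) ----> tint s t (%r. slice Rd r \<bullet> abs_l2 c)"
    proof (rule tint_dominated_convergence(2))
      show "(%r. indicator {s + d n..<t - d n} r * (slice Rd r \<bullet> abs_l2 c)) \<in> borel_measurable lebesgue" for n
        by (intro borel_measurable_times slice_inner_measurable[OF R(2)] borel_measurable_indicator ivl_lebesgue)
      show "tintegrable s t (%r. \<bar>slice Rd r \<bullet> abs_l2 c\<bar>)" by (intro set_integrable_abs slice_inner_tintegrable R)
      have "AE r in lebesgue. r \<noteq> s" by (simp add: AE_completion_iff AE_lborel_singleton)
      then show "AE r in lebesgue. r \<in> {s..<t} --> (%n. indicator {s + d n..<t - d n} r * (slice Rd r \<bullet> abs_l2 c)) ----> slice Rd r \<bullet> abs_l2 c"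
      proof eventually_elim
        case (elim r)
        show ?case
        proof
          assume r: "r \<in> {s..<t}"
          have "\<forall>\<^sub>F n in sequentially. s + d n < r" "\<forall>\<^sub>F n in sequentially. r < t - d n"
            using order_tendstoD(2)[OF lt(2), of r] order_tendstoD(1)[OF lt(1), of r] elim r by auto
          then have "\<forall>\<^sub>F n in sequentially. indicator {s + d n..<t - d n} r * (slice Rd r \<bullet> abs_l2 c) = slice Rd r \<bullet> abs_l2 c"
            by eventually_elim simp
          then show "(%n. indicator {s + d n..<t - d n} r * (slice Rd r \<bullet> abs_l2 c)) ----> slice Rd r \<bullet> abs_l2 c" by (rule tendsto_eventually)
        qed
      qed
      show "AE r in lebesgue. r \<in> {s..<t} --> \<bar>indicator {s + d n..<t - d n} r * (slice Rd r \<bullet> abs_l2 c)\<bar> <= \<bar>slice Rd r \<bullet> abs_l2 c\<bar>" for n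
        by (rule AE_I2) (simp add: indicator_def)
    qed
    moreover have "tint s t (%r. indicator {s + d n..<t - d n} r * (slice Rd r \<bullet> abs_l2 c)) = tint (s + d n) (t - d n) (%r. slice Rd r \<bullet> abs_l2 c)" for n
      unfolding tint_def set_lebesgue_integral_def using d[of n]
      by (intro Bochner_Integration.integral_cong) (auto simp: indicator_def)
    ultimately show ?thesis using LIMSEQ_unique by (simp add: eq)
  qed
  let ?S = "{h. (E t - E s) \<bullet> h = tint s t (%r. slice Rd r \<bullet> h)}"
  note ti = slice_inner_tintegrable[OF R(2), of s t]
  have "subspace ?S"
    by (rule subspaceI) (auto simp: inner_add_right tint_add ti tint_cmult, simp add: tint_def)
  moreover have "abs_l2 ` {c. test_fun Om c} \<subseteq> ?S" using test by auto
  ultimately have sp: "span (abs_l2 ` {c. test_fun Om c}) \<subseteq> ?S" by (rule span_minimal[rotated])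
  have cl: "closed ?S"
    unfolding closed_sequential_limits
  proof (intro allI impI, elim conjE)
    fix x l assume x: "\<forall>n. x n \<in> ?S" "x ----> l"
    obtain C where C: "!!n. norm (x n) <= C"
      using convergent_imp_bounded[OF x(2)] unfolding bounded_iff by auto
    have "(%n. tint s t (%r. slice Rd r \<bullet> x n)) ----> tint s t (%r. slice Rd r \<bullet> l)"
    proof (rule tint_dominated_convergence(2)[OF slice_inner_measurable[OF R(2)]])
      show "tintegrable s t (%r. (1 + (norm (slice Rd r))\<^sup>2) * C)" by (intro set_integrable_mult_left slice_bound_tintegrable R)
      show "AE r in lebesgue. r \<in> {s..<t} --> (%n. slice Rd r \<bullet> x n) ----> slice Rd r \<bullet> l"
        by (intro AE_I2 impI tendsto_intros x)
      have "\<bar>slice Rd r \<bullet> x n\<bar> <= (1 + (norm (slice Rd r))\<^sup>2) * C" for r n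
        using Cauchy_Schwarz_ineq2[of "slice Rd r" "x n"] mult_mono[OF norm_le_one_plus_sq[of "slice Rd r"] C[of n]] by auto
      then show "AE r in lebesgue. r \<in> {s..<t} --> \<bar>slice Rd r \<bullet> x n\<bar> <= (1 + (norm (slice Rd r))\<^sup>2) * C" for n by simp
    qed
    moreover have "(%n. (E t - E s) \<bullet> x n) ----> (E t - E s) \<bullet> l" by (intro tendsto_intros x)
    ultimately show "l \<in> ?S" using x(1) LIMSEQ_unique by auto
  qed
  have Omb: "Om \<in> sets borel" using Om by simp
  have inS: "k \<in> ?S" if k: "k \<in> supp_in Om" for k
  proof -
    have "k \<in> closure (span (abs_l2 ` {c. test_fun Om c}))"
    proof (rule in_closure_span_if_total[OF subspace_supp_in[OF Omb] closed_supp_in[OF Omb] _ k])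
      show "abs_l2 ` {c. test_fun Om c} \<subseteq> supp_in Om"
        using test_fun_integrable(2) test_fun_outside by (auto intro!: abs_supp_in)
      fix x :: "('x, real) l2" assume x: "x \<in> supp_in Om" "!!d. d \<in> abs_l2 ` {c. test_fun Om c} ==> x \<bullet> d = 0"
      show "x = 0" by (rule l2_zero_if_test_zero[OF Om x(1)]) (use x(2) in simp)
    qed
    then show ?thesis using closure_minimal[OF sp cl] by blast
  qed
  obtain p where p: "p \<in> supp_in Om" "!!k. k \<in> supp_in Om ==> (h - p) \<bullet> k = 0"
    using orthogonal_projection[OF closed_supp_in[OF Omb] subspace_supp_in[OF Omb]] by metis
  have hp: "k \<bullet> h = k \<bullet> p" if "k \<in> supp_in Om" for k using p(2)[OF that] unfolding inner_commute[of "h - p" k] inner_diff_right by simp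
  have "E t - E s \<in> supp_in Om" using sE[of t] sE[of s] st subspace_supp_in[OF Omb] by (intro subspace_diff) auto
  then have "(E t - E s) \<bullet> h = tint s t (%r. slice Rd r \<bullet> p)" using hp inS[OF p(1)] by simp
  also have "\<dots> = tint s t (%r. slice Rd r \<bullet> h)"
  proof (rule tint_cong_AE[OF slice_inner_measurable[OF R(2)] _ slice_inner_measurable[OF R(2)]])
    have "AE r in lebesgue. r \<noteq> 0" by (simp add: AE_completion_iff AE_lborel_singleton)
    then show "AE r in lebesgue. r \<in> {s..<t} --> slice Rd r \<bullet> p = slice Rd r \<bullet> h"
      using sR by eventually_elim (use st hp in auto)
  qed
  finally show ?thesis .
qed

section \<open>The wave equation on growing domains\<close>

lemma AE_slice:
  fixes Q :: "real \<times> 'x::euclidean_space => bool"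
  assumes "AE p in lebesgue. Q p" shows "AE t in lebesgue. AE x in lebesgue. Q (t, x)"
  using AE_lborel_pair[of Q] assms by (simp add: AE_completion_iff)

lemma AE_fst:
  assumes "AE t in lebesgue. Q t"
  shows "AE p in (lebesgue :: (real \<times> 'x::euclidean_space) measure). Q (fst p)"
proof -
  have "AE t in lborel. Q t" using assms by (simp add: AE_completion_iff)
  then obtain N where N: "{t \<in> space lborel. \<not> Q t} \<subseteq> N" "emeasure lborel N = 0" "N \<in> sets lborel" by (rule AE_E)
  have "emeasure (lborel \<Otimes>\<^sub>M lborel) (N \<times> (UNIV :: 'x set)) = 0"
    using N by (subst lborel.emeasure_pair_measure_Times) auto
  then have "N \<times> (UNIV :: 'x set) \<in> null_sets lborel"
    using N(3) by (intro null_setsI) (auto simp: lborel_prod borel_Times)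
  then have "AE p in (lborel :: (real \<times> 'x) measure). Q (fst p)"
    by (rule AE_I') (use N(1) in auto)
  then show ?thesis by (simp add: AE_completion_iff)
qed

lemma rep_slice:
  fixes R :: "real \<times> 'x::euclidean_space => 'b::euclidean_space"
  assumes "sqint R"
  shows "AE t in lebesgue. AE x in lebesgue. rep_l2 (slice R t) x = R (t, x)"
proof -
  have "AE t in lebesgue. sqint (%x. R (t, x))" using AE_sqint_slice[OF assms] by (simp only: AE_completion_iff)
  then show ?thesis by eventually_elim (simp add: slice_def rep_abs_lebesgue)
qed

lemma emb_full:
  fixes h :: "('a::euclidean_space, 'b::euclidean_space) l2"
  assumes U: "U \<in> sets lebesgue" and h: "AE x in lebesgue. rep_l2 h x = indicator U x *\<^sub>R w x"
  shows "L2vec U w" "emb U w = h"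
proof -
  show "emb U w = h" by (rule emb_eqI[OF h])
  have "(%x. indicator U x *\<^sub>R w x) \<in> borel_measurable lebesgue" by (rule borel_measurable_AE[OF rep_lebesgue h])
  then have m: "w \<in> borel_measurable (lebesgue_on U)" using U by (simp add: borel_measurable_restrict_space_iff)
  have "L2vec U (rep_l2 h)" by (rule L2vec_rep[where h = h, OF U rep_lebesgue]) simp
  then have i: "integrable lebesgue (%x. indicator U x *\<^sub>R (norm (rep_l2 h x))\<^sup>2)"
    using U by (simp add: L2vec_def integrable_restrict_space)
  have "integrable lebesgue (%x. indicator U x *\<^sub>R (norm (w x))\<^sup>2)"
  proof (rule integrable_cong_AE_imp[OF i])
    have "(%x. norm (w x)) \<in> borel_measurable (lebesgue_on U)" using m by measurable
    then have "(%x. (norm (w x))\<^sup>2) \<in> borel_measurable (lebesgue_on U)" by measurable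
    then show "(%x. indicator U x *\<^sub>R (norm (w x))\<^sup>2) \<in> borel_measurable lebesgue"
      by (rule iffD1[OF borel_measurable_restrict_space_iff, rotated]) (use U in simp)
    show "AE x in lebesgue. indicator U x *\<^sub>R (norm (rep_l2 h x))\<^sup>2 = indicator U x *\<^sub>R (norm (w x))\<^sup>2"
      using h by eventually_elim (auto simp: indicator_def)
  qed
  then show "L2vec U w" using m U by (simp add: L2vec_def integrable_restrict_space)
qed

text \<open>Embedding on \<open>U\<close> cuts \<open>w\<close> down to \<open>U\<close>, which
  changes the class in general, but not its scalar products with elements supported in
  \<open>U\<close>. It is used where a function living on a larger domain is restricted to a smaller
  one.\<close>

lemma emb_inner_supp:
  assumes U: "U \<in> sets lebesgue" and w: "w \<in> borel_measurable lebesgue" "AE x in lebesgue. w x = rep_l2 h x" and k: "k \<in> supp_in U"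
  shows "emb U w \<bullet> k = h \<bullet> k"
proof -
  have L: "L2vec U w" by (rule L2vec_rep[where h = h, OF U w(1)]) (use w(2) in \<open>auto elim: eventually_mono\<close>)
  have "AE x in lebesgue. rep_l2 (emb U w) x \<bullet> rep_l2 k x = rep_l2 h x \<bullet> rep_l2 k x"
    using rep_emb[OF U L] w(2) k[unfolded supp_in_def mem_Collect_eq]
    by eventually_elim (auto simp: indicator_def)
  then have "AE x in lborel. rep_l2 (emb U w) x \<bullet> rep_l2 k x = rep_l2 h x \<bullet> rep_l2 k x" by (simp only: AE_completion_iff)
  then show ?thesis unfolding inner_rep
    using borel_measurable_integrable[OF sqint_inner[OF sqint_rep sqint_rep]] by (intro integral_cong_AE)
qed

lemma integral_lebesgue_on_tint:
  assumes "AE t in lebesgue. t \<in> {a<..<b} --> X t = Y t"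
  shows "(\<integral>t. X t \<partial>lebesgue_on {a..b}) = tint a b Y"
proof -
  have I: "{a..b} \<in> sets lebesgue" by (intro sets_completionI_sets) simp
  have "AE t in lebesgue. t \<noteq> a \<and> t \<noteq> b" by (simp add: AE_completion_iff AE_lborel_singleton AE_conj_iff)
  then have e: "AE t in lebesgue. indicator {a..b} t *\<^sub>R X t = indicator {a..<b} t *\<^sub>R Y t"
    using assms by eventually_elim (auto simp: indicator_def)
  then have e': "AE t in lebesgue. indicator {a..<b} t *\<^sub>R Y t = indicator {a..b} t *\<^sub>R X t" by eventually_elim simp
  have "(\<integral>t. indicator {a..b} t *\<^sub>R X t \<partial>lebesgue) = (\<integral>t. indicator {a..<b} t *\<^sub>R Y t \<partial>lebesgue)"
  proof (cases "(%t. indicator {a..<b} t *\<^sub>R Y t) \<in> borel_measurable lebesgue")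
    case True
    then show ?thesis using borel_measurable_AE[OF True e'] e by (intro integral_cong_AE)
  next
    \<comment> \<open>If one integrand is not measurable, neither is the other, and both integrals
      take the default value 0.\<close>
    case False
    then have "(%t. indicator {a..b} t *\<^sub>R X t) \<notin> borel_measurable lebesgue" using borel_measurable_AE[OF _ e] by blast
    then show ?thesis using False borel_measurable_integrable by (metis (no_types, lifting) not_integrable_integral_eq)
  qed
  then show ?thesis using I by (simp add: integral_restrict_space tint_def set_lebesgue_integral_def)
qed

lemma integral_slice_inner:
  fixes R S :: "real \<times> 'x::euclidean_space => real"
  assumes R: "sqint R" and S: "sqint S" and out: "!!t x. t \<notin> {0..<T} ==> S (t, x) = 0"
  shows "(\<integral>p. R p * S p \<partial>lborel) = tint 0 T (%t. slice R t \<bullet> slice S t)"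
proof -
  have i: "integrable (lborel \<Otimes>\<^sub>M lborel) (%p. R p * S p)" using sqint_inner[OF R S] by (simp add: lborel_prod)
  note m = borel_measurable_integrable[OF lborel_pair.integrable_fst'[OF i]]
  have m': "(%t. \<integral>x. R (t, x) * S (t, x) \<partial>lborel) \<in> borel_measurable lebesgue" using m by (intro measurable_completion) simp
  have "AE t in lebesgue. sqint (%x. R (t, x))" "AE t in lebesgue. sqint (%x. S (t, x))"
    using AE_sqint_slice[OF R] AE_sqint_slice[OF S] by (simp_all only: AE_completion_iff)
  then have e: "AE t in lebesgue. (\<integral>x. R (t, x) * S (t, x) \<partial>lborel) = indicator {0..<T} t *\<^sub>R (slice R t \<bullet> slice S t)"
  proof eventually_elim
    case (elim t)
    show ?case
    proof (cases "t \<in> {0..<T}")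
      case True
      then show ?thesis using inner_abs_l2[OF elim] by (simp add: slice_def)
    next
      case False
      then show ?thesis using out[OF False] by simp
    qed
  qed
  have "(\<integral>p. R p * S p \<partial>lborel) = (\<integral>t. \<integral>x. R (t, x) * S (t, x) \<partial>lborel \<partial>lborel)"
    using lborel_pair.integral_fst'[OF i] by (simp add: lborel_prod)
  also have "\<dots> = (\<integral>t. \<integral>x. R (t, x) * S (t, x) \<partial>lborel \<partial>lebesgue)" using m by (simp add: integral_completion)
  also have "\<dots> = (\<integral>t. indicator {0..<T} t *\<^sub>R (slice R t \<bullet> slice S t) \<partial>lebesgue)"
    by (rule integral_cong_AE[OF m' borel_measurable_AE[OF m' e] e])
  finally show ?thesis by (simp add: tint_def set_lebesgue_integral_def)
qed

text \<open>The projection of the support to space is one compact set for all times, so pointwise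
  continuity and dominated convergence give continuity in norm.\<close>

lemma slice_continuous:
  fixes \<phi> :: "real \<times> 'x::euclidean_space => real"
  assumes \<phi>: "test_fun Q \<phi>"
  shows "sqint (%x. \<phi> (t, x))" "continuous_on S (slice \<phi>)"
proof -
  let ?K = "closure {p. \<phi> p \<noteq> 0}"
  have K: "compact (snd ` ?K)" by (intro compact_continuous_image continuous_intros test_fun_compact[OF \<phi>])
  have out: "\<phi> (t, x) = 0" if "x \<notin> snd ` ?K" for t x
    using that closure_subset[of "{p. \<phi> p \<noteq> 0}"] by force
  have cont: "continuous_on UNIV (%x. \<phi> (t, x))" for t
    by (intro continuous_on_compose2[OF test_fun_continuous[OF \<phi>, of UNIV]] continuous_intros) auto
  show s: "sqint (%x. \<phi> (t, x))" for t by (rule compact_support_integrable(2)[OF cont K out])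
  have "compact (\<phi> ` ?K)" by (intro compact_continuous_image test_fun_continuous[OF \<phi>] test_fun_compact[OF \<phi>])
  then have "bounded (\<phi> ` ?K)" by (rule compact_imp_bounded)
  then obtain M where "\<forall>y\<in>\<phi> ` ?K. norm y <= M" unfolding bounded_iff by (rule exE)
  then have M: "\<bar>\<phi> p\<bar> <= M" if "p \<in> ?K" for p using that by simp
  have M': "\<bar>\<phi> p\<bar> <= max 0 M" for p
    using M[of p] closure_subset[of "{p. \<phi> p \<noteq> 0}"] by (cases "\<phi> p = 0") auto
  show "continuous_on S (slice \<phi>)"
    unfolding continuous_on_sequentially
  proof (intro allI ballI impI, elim conjE)
    fix t a assume a: "\<forall>n. a n \<in> S" "a ----> t"
    have "(%n. \<integral>x. (norm (\<phi> (a n, x) - \<phi> (t, x)))\<^sup>2 \<partial>lborel) ----> integral\<^sup>L lborel (%x::'x. 0)"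
    proof (rule integral_dominated_convergence)
      show "integrable lborel (%x. (2 * max 0 M)\<^sup>2 * indicator (snd ` ?K) x :: real)"
        using emeasure_bounded_finite[OF compact_imp_bounded[OF K]] borel_compact[OF K]
        by (intro integrable_mult_right integrable_real_indicator) auto
      show "(%x. (norm (\<phi> (a n, x) - \<phi> (t, x)))\<^sup>2) \<in> borel_measurable lborel" for n
        using s[of "a n"] s[of t] by (auto simp: sqint_def)
      have "(%n. \<phi> (a n, x)) ----> \<phi> (t, x)" for x
        by (rule continuous_on_tendsto_compose[OF test_fun_continuous[OF \<phi>, of UNIV]]) (auto intro!: tendsto_intros a)
      then have "(%n. (norm (\<phi> (a n, x) - \<phi> (t, x)))\<^sup>2) ----> (norm (\<phi> (t, x) - \<phi> (t, x)))\<^sup>2" for x by (intro tendsto_intros)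
      then show "AE x in lborel. (%n. (norm (\<phi> (a n, x) - \<phi> (t, x)))\<^sup>2) ----> 0" by (intro AE_I2) simp
      have "(norm (\<phi> (a n, x) - \<phi> (t, x)))\<^sup>2 <= (2 * max 0 M)\<^sup>2 * indicator (snd ` ?K) x" for n x
      proof (cases "x \<in> snd ` ?K")
        case True
        have "norm (\<phi> (a n, x) - \<phi> (t, x)) <= 2 * max 0 M" using M'[of "(a n, x)"] M'[of "(t, x)"] by simp
        from power_mono[OF this norm_ge_zero, of 2] show ?thesis using True by (simp add: power_mult_distrib)
      qed (simp add: out)
      then show "AE x in lborel. norm ((norm (\<phi> (a n, x) - \<phi> (t, x)))\<^sup>2) <= (2 * max 0 M)\<^sup>2 * indicator (snd ` ?K) x" for n by simp
    qed simp
    moreover have "(\<integral>x. (norm (\<phi> (a n, x) - \<phi> (t, x)))\<^sup>2 \<partial>lborel) = (norm (slice \<phi> (a n) - slice \<phi> t))\<^sup>2" for n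
      using norm_abs_l2_sq[OF sqint_diff[OF s s, of "a n" t]] by (simp add: slice_def abs_l2_diff[OF s s])
    ultimately have "(%n. (norm (slice \<phi> (a n) - slice \<phi> t))\<^sup>2) ----> 0" by simp
    then have "(%n. norm (slice \<phi> (a n) - slice \<phi> t)) ----> 0" using tendsto_real_sqrt by fastforce
    then show "(slice \<phi> \<circ> a) ----> slice \<phi> t" by (simp add: o_def LIM_zero_iff tendsto_norm_zero_iff)
  qed
qed

locale growing =
  fixes T :: real and \<Omega> :: "real => 'x::euclidean_space set"
  assumes T: "0 < T" and op: "!!t. t \<in> {0..T} ==> open (\<Omega> t)"
    and mono: "!!s t. 0 <= s ==> s <= t ==> t <= T ==> \<Omega> s \<subseteq> \<Omega> t"
begin

text \<open>The domains are frozen outside $[0,T]$, so that the scheme can be run past time $T$.\<close>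
definition Oc :: "real => 'x set" where "Oc t = \<Omega> (max 0 (min T t))"

lemma Oc_eq: "t \<in> {0..T} ==> Oc t = \<Omega> t" by (simp add: Oc_def)
lemma Oc_open: "open (Oc t)" unfolding Oc_def using T by (intro op) auto
lemma Oc_mono: "s <= t ==> Oc s \<subseteq> Oc t" unfolding Oc_def using T by (intro mono) auto
lemma leb: "t \<in> {0..T} ==> \<Omega> t \<in> sets lebesgue" by (intro open_lebesgue op)
lemma T_mem: "T \<in> {0..T}" "0 \<in> {0..T}" using T by auto
lemma Q_open: "open (Qcyl T \<Omega>)" unfolding Qcyl_def by (intro open_Times op T_mem) simp
lemma Q_leb: "Qcyl T \<Omega> \<in> sets lebesgue" by (rule open_lebesgue[OF Q_open])
lemma I_leb: "{0<..<T} \<in> sets lebesgue" by (intro sets_completionI_sets) simp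

text \<open>Up to a null set, \<open>Oset\<close> is a countable union of rectangles: for each point of space there
  is at most one time at which the domain reaches it.\<close>
lemma Oset_leb: "Oset T \<Omega> \<in> sets lebesgue"
proof -
  \<comment> \<open>All points whose space component has been reached at some rational time not
    later than their own time.\<close>
  define A :: "(real \<times> 'x) set" where "A = (\<Union>q::rat. ({of_rat q..} \<inter> {0<..<T}) \<times> Oc (of_rat q))"
  \<comment> \<open>Contains what is left: points \<open>(t, x)\<close> such that \<open>x\<close>
    is missing at every rational time before \<open>t\<close> and present at every later one. Two
    times over the same \<open>x\<close> would be separated by a rational, so each fibre has at most
    one point.\<close>
  define C :: "(real \<times> 'x) set" where "C = (\<Inter>q::rat. ({..of_rat q} \<times> UNIV \<union> UNIV \<times> (- Oc (of_rat q))) \<inter> ({of_rat q..} \<times> UNIV \<union> UNIV \<times> Oc (of_rat q)))"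
  have Ob: "Oc r \<in> sets borel" for r using Oc_open by simp
  have Ab: "A \<in> sets borel" unfolding A_def by (intro sets.countable_UN'') (auto intro!: borel_Times Ob)
  have Cb: "C \<in> sets borel" unfolding C_def
    by (intro sets.countable_INT'' sets.Int sets.Un) (auto intro!: borel_Times borel_comp Ob)
  have AO: "A \<subseteq> Oset T \<Omega>"
  proof
    fix p assume "p \<in> A"
    then obtain q t x where p: "p = (t, x)" "of_rat q <= t" "0 < t" "t < T" "x \<in> Oc (of_rat q)" unfolding A_def by auto
    then have "x \<in> Oc t" using Oc_mono by blast
    then show "p \<in> Oset T \<Omega>" using p Oc_eq[of t] by (simp add: Oset_def)
  qed
  have OC: "Oset T \<Omega> - A \<subseteq> C"
  proof
    fix p assume "p \<in> Oset T \<Omega> - A"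
    then obtain t x where p: "p = (t, x)" "0 < t" "t < T" "x \<in> Oc t" "(t, x) \<notin> A" using Oc_eq by (auto simp: Oset_def)
    have "t <= of_rat q \<or> x \<notin> Oc (of_rat q)" for q using p less_imp_le unfolding A_def by fastforce
    moreover have "of_rat q <= t \<or> x \<in> Oc (of_rat q)" for q using p(4) Oc_mono[of t "of_rat q"] linear[of t "of_rat q"] by auto
    ultimately show "p \<in> C" unfolding C_def p(1) by auto
  qed
  have "emeasure lborel ((%t. (t, x)) -` C) = 0" for x
  proof -
    have "t = t'" if "(t, x) \<in> C" "(t', x) \<in> C" for t t'
    proof (rule ccontr)
      assume "t \<noteq> t'"
      have no: False if lt: "a < b" and ab: "(a, x) \<in> C" "(b, x) \<in> C" for a b
      proof -
        obtain q where q: "a < of_rat q" "of_rat q < b" using of_rat_dense[OF lt] by blast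
        have "x \<in> Oc (of_rat q)" using ab(1) q(1) unfolding C_def by (auto simp: not_le[symmetric])
        moreover have "x \<notin> Oc (of_rat q)" using ab(2) q(2) unfolding C_def by (auto simp: not_le[symmetric])
        ultimately show False by simp
      qed
      show False using no[of t t'] no[of t' t] that \<open>t \<noteq> t'\<close> by (cases "t < t'") auto
    qed
    then have "(%t. (t, x)) -` C \<subseteq> {SOME t. (t, x) \<in> C}" by (auto intro!: some_equality[symmetric])
    then have "finite ((%t. (t, x)) -` C)" by (rule finite_subset) simp
    then show ?thesis by (intro emeasure_lborel_countable countable_finite)
  qed
  moreover have "C \<in> sets (lborel \<Otimes>\<^sub>M lborel)" using Cb by (simp only: lborel_prod sets_lborel)
  ultimately have "emeasure (lborel \<Otimes>\<^sub>M lborel) C = 0" by (simp add: lborel_pair.emeasure_pair_measure_alt2)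
  then have "C \<in> null_sets lborel" using Cb by (simp add: null_sets_def lborel_prod)
  then have "Oset T \<Omega> - A \<in> null_sets lebesgue" using OC null_sets_completion_subset[of _ C lborel] null_sets_completionI by blast
  then have "Oset T \<Omega> - A \<in> sets lebesgue" by (rule null_setsD2)
  moreover have "A \<in> sets lebesgue" using Ab by (intro sets_completionI_sets) simp
  moreover have "Oset T \<Omega> = A \<union> (Oset T \<Omega> - A)" using AO by auto
  ultimately show ?thesis by (metis sets.Un)
qed

lemma L2_L2_emb:
  assumes "zero_ext T \<Omega> v" "AE t in lebesgue_on {0<..<T}. L2 (\<Omega> t) (v t)"
  shows "AE t in lebesgue. t \<in> {0<..<T} --> L2 (\<Omega> t) (v t) \<and> L2 (\<Omega> T) (v t) \<and> emb (\<Omega> T) (v t) = emb (\<Omega> t) (v t)"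
proof -
  have "AE t in lebesgue. t \<in> {0<..<T} --> (AE x in lebesgue. x \<notin> \<Omega> t --> v t x = 0)"
    "AE t in lebesgue. t \<in> {0<..<T} --> L2 (\<Omega> t) (v t)"
    using assms I_leb by (simp_all add: zero_ext_def AE_restrict_space_iff)
  then show ?thesis
  proof eventually_elim
    case (elim t)
    show ?case
    proof
      assume t: "t \<in> {0<..<T}"
      then have tt: "t \<in> {0..T}" "\<Omega> t \<subseteq> \<Omega> T" using mono by auto
      have L: "L2 (\<Omega> t) (v t)" and z: "AE x in lebesgue. x \<notin> \<Omega> t --> v t x = 0" using elim t by auto
      have "AE x in lebesgue. rep_l2 (emb (\<Omega> t) (v t)) x = indicator (\<Omega> T) x *\<^sub>R v t x"
        using rep_emb[OF leb[OF tt(1)] L[unfolded L2_iff_L2vec]] z by eventually_elim (use tt(2) in \<open>auto simp: indicator_def\<close>)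
      from emb_full[OF leb[OF T_mem(1)] this] L
      show "L2 (\<Omega> t) (v t) \<and> L2 (\<Omega> T) (v t) \<and> emb (\<Omega> T) (v t) = emb (\<Omega> t) (v t)" by (simp add: L2_iff_L2vec)
    qed
  qed
qed

text \<open>A single Borel function on space-time represents \<open>v\<close> with its zero
  extension. The majorant \<open>g\<close> enters because for members of \<open>L2_H10\<close>
  integrability in time is given for the full squared norm, which dominates
  \<open>L2sq\<close>.\<close>

lemma joint_rep:
  assumes v: "jointly_meas T \<Omega> v" "zero_ext T \<Omega> v" "AE t in lebesgue_on {0<..<T}. L2 (\<Omega> t) (v t)"
    and g: "integrable (lebesgue_on {0<..<T}) g" "AE t in lebesgue_on {0<..<T}. L2sq (\<Omega> t) (v t) <= g t"
  obtains R where "sqint R" "AE p in lebesgue. R p = indicator (Qcyl T \<Omega>) p * v (fst p) (snd p)"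
    "AE t in lebesgue. t \<in> {0<..<T} --> L2 (\<Omega> t) (v t) \<and> L2 (\<Omega> T) (v t) \<and> slice R t = emb (\<Omega> t) (v t) \<and> slice R t = emb (\<Omega> T) (v t)"
    "AE t in lebesgue. t \<notin> {0<..<T} --> slice R t = 0"
proof -
  have "(%p. indicator (Qcyl T \<Omega>) p *\<^sub>R v (fst p) (snd p)) \<in> borel_measurable lebesgue"
    using v(1)[unfolded jointly_meas_def] by (rule iffD1[OF borel_measurable_restrict_space_iff, rotated]) (use Q_leb in simp)
  then obtain R where R: "R \<in> borel_measurable borel" "AE p in lebesgue. indicator (Qcyl T \<Omega>) p *\<^sub>R v (fst p) (snd p) = R p"
    by (rule borel_version)
  have RQ: "AE p in lebesgue. R p = indicator (Qcyl T \<Omega>) p * v (fst p) (snd p)" using R(2) by eventually_elim simp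
  note sl = AE_slice[OF RQ]
  have emb: "AE t in lebesgue. t \<in> {0<..<T} --> L2 (\<Omega> t) (v t) \<and> L2 (\<Omega> T) (v t) \<and> emb (\<Omega> T) (v t) = emb (\<Omega> t) (v t)"
    by (rule L2_L2_emb[OF v(2,3)])
  have both: "AE t in lebesgue. (t \<in> {0<..<T} --> (AE x in lborel. R (t, x) = rep_l2 (emb (\<Omega> T) (v t)) x)) \<and> (t \<notin> {0<..<T} --> (AE x in lborel. R (t, x) = 0))"
    using sl emb
  proof eventually_elim
    case (elim t)
    have "AE x in lborel. R (t, x) = rep_l2 (emb (\<Omega> T) (v t)) x" if t: "t \<in> {0<..<T}"
    proof -
      have "AE x in lebesgue. rep_l2 (emb (\<Omega> T) (v t)) x = indicator (\<Omega> T) x *\<^sub>R v t x"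
        using elim(2) t by (intro rep_emb leb T_mem) (simp add: L2_iff_L2vec)
      then have "AE x in lebesgue. R (t, x) = rep_l2 (emb (\<Omega> T) (v t)) x"
        using elim(1) by eventually_elim (use t in \<open>auto simp: indicator_def Qcyl_def\<close>)
      then show ?thesis by (simp only: AE_completion_iff)
    qed
    moreover have "AE x in lborel. R (t, x) = 0" if t: "t \<notin> {0<..<T}"
    proof -
      have "AE x in lebesgue. R (t, x) = 0" using elim(1) by eventually_elim (use t in \<open>auto simp: indicator_def Qcyl_def\<close>)
      then show ?thesis by (simp only: AE_completion_iff)
    qed
    ultimately show ?case by blast
  qed
  have i: "integrable lebesgue (%t. indicator {0<..<T} t *\<^sub>R g t)" using g(1) I_leb by (simp add: integrable_restrict_space)
  have gle: "AE t in lebesgue. t \<in> {0<..<T} --> L2sq (\<Omega> t) (v t) <= g t" using g(2) I_leb by (simp add: AE_restrict_space_iff)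
  have s: "sqint R"
    unfolding sqint_iff
  proof
    show "R \<in> borel_measurable borel" by (rule R(1))
    have "(\<integral>\<^sup>+p. ennreal ((norm (R p))\<^sup>2) \<partial>lborel) = (\<integral>\<^sup>+t. \<integral>\<^sup>+x. ennreal ((norm (R (t, x)))\<^sup>2) \<partial>lborel \<partial>lborel)"
    proof (subst lborel.nn_integral_fst)
      show "(%p. ennreal ((norm (R p))\<^sup>2)) \<in> borel_measurable (lborel \<Otimes>\<^sub>M lborel)" using R(1) by (simp add: lborel_prod)
    qed (simp add: lborel_prod)
    also have "\<dots> = (\<integral>\<^sup>+t. \<integral>\<^sup>+x. ennreal ((norm (R (t, x)))\<^sup>2) \<partial>lborel \<partial>lebesgue)" by (simp add: nn_integral_completion)
    also have "\<dots> = (\<integral>\<^sup>+t. ennreal (indicator {0<..<T} t *\<^sub>R L2sq (\<Omega> t) (v t)) \<partial>lebesgue)"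
    proof (rule nn_integral_cong_AE)
      show "AE t in lebesgue. (\<integral>\<^sup>+x. ennreal ((norm (R (t, x)))\<^sup>2) \<partial>lborel) = ennreal (indicator {0<..<T} t *\<^sub>R L2sq (\<Omega> t) (v t))"
        using both emb
      proof eventually_elim
        case (elim t)
        show ?case
        proof (cases "t \<in> {0<..<T}")
          case True
          have "(\<integral>\<^sup>+x. ennreal ((norm (R (t, x)))\<^sup>2) \<partial>lborel) = (\<integral>\<^sup>+x. ennreal ((norm (rep_l2 (emb (\<Omega> T) (v t)) x))\<^sup>2) \<partial>lborel)"
            using elim(1) True by (intro nn_integral_cong_AE) (auto elim: eventually_mono)
          also have "\<dots> = ennreal ((norm (emb (\<Omega> T) (v t)))\<^sup>2)" by (subst nn_integral_norm_abs_l2[OF sqint_rep]) (simp add: abs_rep_l2)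
          also have "(norm (emb (\<Omega> T) (v t)))\<^sup>2 = L2sq (\<Omega> t) (v t)" using elim(2) True L2sq_emb[OF leb, of t] by simp
          finally show ?thesis using True by simp
        next
          case False
          have "(\<integral>\<^sup>+x. ennreal ((norm (R (t, x)))\<^sup>2) \<partial>lborel) = integral\<^sup>N lborel (%x::'x. 0)"
            using elim(1) False by (intro nn_integral_cong_AE) (auto elim: eventually_mono)
          then show ?thesis using False by simp
        qed
      qed
    qed
    also have "\<dots> <= (\<integral>\<^sup>+t. ennreal (norm (indicator {0<..<T} t *\<^sub>R g t)) \<partial>lebesgue)"
    proof (rule nn_integral_mono_AE)
      show "AE t in lebesgue. ennreal (indicator {0<..<T} t *\<^sub>R L2sq (\<Omega> t) (v t)) <= ennreal (norm (indicator {0<..<T} t *\<^sub>R g t))"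
        using gle by eventually_elim (auto simp: indicator_def intro!: ennreal_leI)
    qed
    also have "\<dots> < \<infinity>" using i by (simp only: integrable_iff_bounded)
    finally show "(\<integral>\<^sup>+p. ennreal ((norm (R p))\<^sup>2) \<partial>lborel) < \<infinity>" .
  qed
  have rs: "AE t in lebesgue. sqint (%x. R (t, x))" using AE_sqint_slice[OF s] by (simp only: AE_completion_iff)
  show thesis
  proof (rule that[OF s RQ])
    show "AE t in lebesgue. t \<in> {0<..<T} --> L2 (\<Omega> t) (v t) \<and> L2 (\<Omega> T) (v t) \<and> slice R t = emb (\<Omega> t) (v t) \<and> slice R t = emb (\<Omega> T) (v t)"
      using both emb rs
    proof eventually_elim
      case (elim t)
      show ?case
      proof
        assume t: "t \<in> {0<..<T}"
        have "slice R t = abs_l2 (rep_l2 (emb (\<Omega> T) (v t)))"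
          unfolding slice_def using elim(1) t abs_l2_eq_iff[OF elim(3) sqint_rep] by blast
        then show "L2 (\<Omega> t) (v t) \<and> L2 (\<Omega> T) (v t) \<and> slice R t = emb (\<Omega> t) (v t) \<and> slice R t = emb (\<Omega> T) (v t)"
          using elim(2) t by (simp add: abs_rep_l2)
      qed
    qed
    show "AE t in lebesgue. t \<notin> {0<..<T} --> slice R t = 0"
      using both rs
    proof eventually_elim
      case (elim t)
      show ?case
      proof
        assume "t \<notin> {0<..<T}"
        then have "slice R t = abs_l2 (%x. 0)"
          unfolding slice_def using elim(1) abs_l2_eq_iff[OF elim(2) sqint_zero] by blast
        then show "slice R t = 0" by (simp add: abs_l2_zero)
      qed
    qed
  qed
qed

lemma Q_integral:
  fixes R :: "real \<times> 'x => real"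
  assumes R: "AE p in lebesgue. p \<in> Qcyl T \<Omega> --> R p = v (fst p) (snd p)" and Rm: "R \<in> borel_measurable borel"
    and \<phi>: "!!p. p \<notin> Qcyl T \<Omega> ==> \<phi> p = 0" "\<phi> \<in> borel_measurable borel"
  shows "(\<integral>p. v (fst p) (snd p) * \<phi> p \<partial>lebesgue_on (Qcyl T \<Omega>)) = (\<integral>p. R p * \<phi> p \<partial>lborel)"
proof -
  have m: "(%p. R p * \<phi> p) \<in> borel_measurable lborel" using Rm \<phi>(2) by simp
  have m': "(%p. R p * \<phi> p) \<in> borel_measurable lebesgue" by (rule measurable_completion[OF m])
  have e: "AE p in lebesgue. R p * \<phi> p = indicator (Qcyl T \<Omega>) p *\<^sub>R (v (fst p) (snd p) * \<phi> p)"
    using R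
  proof eventually_elim
    case (elim p)
    then show ?case using \<phi>(1)[of p] by (cases "p \<in> Qcyl T \<Omega>") auto
  qed
  have "(\<integral>p. v (fst p) (snd p) * \<phi> p \<partial>lebesgue_on (Qcyl T \<Omega>)) = (\<integral>p. indicator (Qcyl T \<Omega>) p *\<^sub>R (v (fst p) (snd p) * \<phi> p) \<partial>lebesgue)"
    using Q_leb by (simp add: integral_restrict_space)
  also have "\<dots> = (\<integral>p. R p * \<phi> p \<partial>lebesgue)" by (rule integral_cong_AE[symmetric, OF m' borel_measurable_AE[OF m' e] e])
  also have "\<dots> = (\<integral>p. R p * \<phi> p \<partial>lborel)" by (rule integral_completion[OF m])
  finally show ?thesis .
qed

end

section \<open>Riesz representation of functionals on the concrete function spaces\<close>

lemma functional_representation: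
  fixes em :: "('x => real) => 'h::{real_inner,complete_space}"
  assumes W: "closed W" "subspace W"
    and X: "!!v. X v ==> em v \<in> W" "!!v. X v ==> norm (em v) = nrm v"
    and lin: "!!v w a b. X v ==> X w ==> X (%x. a * v x + b * w x)"
      "!!v w a b. X v ==> X w ==> em (%x. a * v x + b * w x) = a *\<^sub>R em v + b *\<^sub>R em w"
    and onto: "!!p. p \<in> W ==> \<exists>v. X v \<and> em v = p"
    and lf: "bdd_lin_fun X nrm lf"
  obtains w where "w \<in> W" "!!v. X v ==> lf v = w \<bullet> em v"
proof -
  have lfl: "lf (%x. a * v x + b * w x) = a * lf v + b * lf w" if "X v" "X w" for v w a b
    using lf that unfolding bdd_lin_fun_def by blast
  obtain C where C: "!!v. X v ==> \<bar>lf v\<bar> <= C * nrm v" using lf unfolding bdd_lin_fun_def by blast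
  \<comment> \<open>A functional acts on functions, not on classes. Boundedness by a seminorm that
    vanishes on differences of equivalent functions makes it constant on each class.\<close>
  have cls: "lf v = lf w" if vw: "X v" "X w" "em v = em w" for v w
  proof -
    have "\<bar>lf (%x. 1 * v x + (-1) * w x)\<bar> <= C * nrm (%x. 1 * v x + (-1) * w x)" by (rule C[OF lin(1)[OF vw(1,2)]])
    also have "nrm (%x. 1 * v x + (-1) * w x) = norm (em (%x. 1 * v x + (-1) * w x))" by (rule X(2)[OF lin(1)[OF vw(1,2)], symmetric])
    also have "\<dots> = 0" using vw by (subst lin(2)) auto
    finally show ?thesis using lfl[OF vw(1,2), of 1 "-1"] by simp
  qed
  define r where "r p = (SOME v. X v \<and> em v = p)" for p
  have r: "X (r p)" "em (r p) = p" if "p \<in> W" for p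
    using someI_ex[OF onto[OF that]] unfolding r_def by auto
  obtain w where w: "w \<in> W" "!!z. z \<in> W ==> lf (r z) = w \<bullet> z"
  proof (rule riesz_on_subspace[OF W, where f = "%p. lf (r p)" and C = C])
    fix p q a b assume pq: "p \<in> W" "q \<in> W"
    then have c: "a *\<^sub>R p + b *\<^sub>R q \<in> W" using W(2) by (intro subspace_add subspace_scale)
    have "lf (r (a *\<^sub>R p + b *\<^sub>R q)) = lf (%x. a * r p x + b * r q x)"
      by (rule cls[OF r(1)[OF c] lin(1)[OF r(1)[OF pq(1)] r(1)[OF pq(2)]]]) (simp add: r c pq lin(2))
    then show "lf (r (a *\<^sub>R p + b *\<^sub>R q)) = a * lf (r p) + b * lf (r q)" using lfl r(1) pq by simp
  next
    fix p assume p: "p \<in> W"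
    show "\<bar>lf (r p)\<bar> <= C * norm p" using C[OF r(1)[OF p]] X(2)[OF r(1)[OF p]] r(2)[OF p] by simp
  qed (rule that; assumption)
  show thesis
  proof (rule that[OF w(1)])
    fix v assume v: "X v"
    show "lf v = w \<bullet> em v" using cls[OF v r(1)[OF X(1)[OF v]]] r(2)[OF X(1)[OF v]] w(2)[OF X(1)[OF v]] by simp
  qed
qed

lemma L2_functional_representation:
  assumes U: "open U" and lf: "bdd_lin_fun (L2 U) (L2norm U) lf"
  obtains w where "w \<in> supp_in U" "!!v. L2 U v ==> lf v = w \<bullet> emb U v"
proof (rule functional_representation[where W = "supp_in U" and em = "emb U" and X = "L2 U" and nrm = "L2norm U", OF _ _ _ _ _ _ _ lf])
  note Ul = open_lebesgue[OF U]
  show "closed (supp_in U :: ('a, real) l2 set)" "subspace (supp_in U :: ('a, real) l2 set)" using U by (auto intro: closed_supp_in subspace_supp_in)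
  show "emb U v \<in> supp_in U" "norm (emb U v) = L2norm U v" if "L2 U v" for v
    using that emb_supp_in[OF Ul] by (simp_all add: L2norm_def L2sq_emb[OF Ul] L2_iff_L2vec)
  show "L2 U (%x. a * v x + b * w x)" "emb U (%x. a * v x + b * w x) = a *\<^sub>R emb U v + b *\<^sub>R emb U w"
    if "L2 U v" "L2 U w" for v w a b
    using L2vec_linear[OF Ul, of v w a b] that by (simp_all add: L2_iff_L2vec)
  show "\<exists>v. L2 U v \<and> emb U v = p" if p: "p \<in> supp_in U" for p
  proof (intro exI[of _ "rep_l2 p"] conjI)
    show "L2 U (rep_l2 p)" unfolding L2_iff_L2vec by (rule L2vec_rep[where h = p, OF Ul rep_lebesgue]) simp
    show "emb U (rep_l2 p) = p" by (rule emb_rep[OF p]) simp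
  qed
qed (rule that; assumption)

lemma H10_functional_representation:
  assumes U: "open U" and lf: "bdd_lin_fun (H10 U) (H1norm U) lf"
  obtains w where "w \<in> grad_graph U" "!!v. H10 U v ==> lf v = w \<bullet> (emb U v, emb U (wgrad U v))"
proof (rule functional_representation[where W = "grad_graph U" and em = "%v. (emb U v, emb U (wgrad U v))" and X = "H10 U" and nrm = "H1norm U",
      OF closed_grad_graph subspace_grad_graph H10_D(3)[OF U] H1norm_emb[OF U, symmetric] _ _ _ lf])
  note Ul = open_lebesgue[OF U]
  have lin: "H10 U (%x. a * v x + b * w x) \<and> (emb U (%x. a * v x + b * w x), emb U (wgrad U (%x. a * v x + b * w x))) =
      a *\<^sub>R (emb U v, emb U (wgrad U v)) + b *\<^sub>R (emb U w, emb U (wgrad U w))" if vw: "H10 U v" "H10 U w" for v w a b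
  proof -
    have L: "L2 U (%x. a * v x + b * w x)" and e: "emb U (%x. a * v x + b * w x) = a *\<^sub>R emb U v + b *\<^sub>R emb U w"
      using L2vec_linear[OF Ul, of v w a b] H10_D(1)[OF U vw(1)] H10_D(1)[OF U vw(2)] by (simp_all add: L2_iff_L2vec)
    have "a *\<^sub>R (emb U v, emb U (wgrad U v)) + b *\<^sub>R (emb U w, emb U (wgrad U w)) \<in> grad_graph U"
      using H10_D(3)[OF U vw(1)] H10_D(3)[OF U vw(2)] subspace_grad_graph by (intro subspace_add subspace_scale)
    then have "(emb U (%x. a * v x + b * w x), a *\<^sub>R emb U (wgrad U v) + b *\<^sub>R emb U (wgrad U w)) \<in> grad_graph U" by (simp add: e)
    from H10_I[OF U L this] show ?thesis by (simp add: e)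
  qed
  then show "H10 U (%x. a * v x + b * w x)"
    "(emb U (%x. a * v x + b * w x), emb U (wgrad U (%x. a * v x + b * w x))) = a *\<^sub>R (emb U v, emb U (wgrad U v)) + b *\<^sub>R (emb U w, emb U (wgrad U w))"
    if "H10 U v" "H10 U w" for v w a b using that by blast+
  show "\<exists>v. H10 U v \<and> (emb U v, emb U (wgrad U v)) = p" if p: "p \<in> grad_graph U" for p
  proof (intro exI[of _ "rep_l2 (fst p)"])
    have L: "L2 U (rep_l2 (fst p))" unfolding L2_iff_L2vec by (rule L2vec_rep[where h = "fst p", OF Ul rep_lebesgue]) simp
    have "(fst p, snd p) \<in> grad_graph U" using p by simp
    note sp = grad_graph_supp(1)[OF U this]
    have e: "emb U (rep_l2 (fst p)) = fst p" by (rule emb_rep[OF sp]) simp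
    have "(emb U (rep_l2 (fst p)), snd p) \<in> grad_graph U" using p by (simp add: e)
    from H10_I[OF U L this] e show "H10 U (rep_l2 (fst p)) \<and> (emb U (rep_l2 (fst p)), emb U (wgrad U (rep_l2 (fst p)))) = p" by simp
  qed
qed (assumption+, (rule that; assumption))

text \<open>The zero test function keeps the supremum over a nonempty set and nonnegative, and the
  assumed bound keeps it finite.\<close>

lemma Hneg_norm_le:
  assumes U: "open U" and b: "!!\<phi>. test_fun U \<phi> ==> H1norm U \<phi> <= 1 ==> \<bar>\<integral>x. g x * \<phi> x \<partial>lebesgue_on U\<bar> <= b"
  shows "\<bar>Hneg_norm U g\<bar> <= b"
proof -
  let ?S = "{\<bar>\<integral>x. g x * \<phi> x \<partial>lebesgue_on U\<bar> |\<phi>. test_fun U \<phi> \<and> H1norm U \<phi> <= 1}"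
  have z: "test_fun U (%x. 0)" by (rule test_fun_zero)
  have "grad (%x::'a. 0) = (%x. 0)" using grad_outside[OF test_fun_zero[of "{} :: 'a set"]] by auto
  then have "H1norm U (%x. 0) = 0"
    using H10_test_fun[OF U z] H1norm_emb[OF U] by (simp add: abs_l2_zero)
  then have "\<bar>\<integral>x. g x * 0 \<partial>lebesgue_on U\<bar> \<in> ?S" using z by (intro CollectI exI[of _ "%x. 0"]) simp
  then have 0: "0 \<in> ?S" by simp
  have le: "y <= b" if "y \<in> ?S" for y using that b by auto
  have "Sup ?S <= b" using 0 le by (intro cSup_least) auto
  moreover have "bdd_above ?S" using le by (rule bdd_aboveI)
  then have "0 <= Sup ?S" by (rule cSup_upper[OF 0])
  ultimately show ?thesis unfolding Hneg_norm_def by simp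
qed

lemma rep_L2:
  assumes X: "X \<in> sets lebesgue" and w: "w \<in> borel_measurable lebesgue" "AE x in lebesgue. w x = rep_l2 h x"
  shows "L2 X w" "h \<in> supp_in X ==> emb X w = h"
proof -
  have e: "AE x in lebesgue. x \<in> X --> w x = rep_l2 h x" using w(2) by eventually_elim simp
  show "L2 X w" unfolding L2_iff_L2vec by (rule L2vec_rep[where h = h, OF X w(1) e])
  show "h \<in> supp_in X ==> emb X w = h" by (rule emb_rep[OF _ e])
qed

lemma within_eventually: "(!!t. t \<in> I ==> Q t) ==> \<forall>\<^sub>F t in at t0 within I. Q t"
  by (simp add: eventually_at_filter)

context growing begin

lemma jointly_measI:
  assumes R: "AE p in lebesgue. p \<in> Qcyl T \<Omega> --> v (fst p) (snd p) = R p" "R \<in> borel_measurable borel"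
  shows "jointly_meas T \<Omega> v"
proof -
  have "R \<in> borel_measurable lebesgue" using R(2) by (intro measurable_completion) simp
  then have m: "(%p. indicator (Qcyl T \<Omega>) p *\<^sub>R R p) \<in> borel_measurable lebesgue"
    using Q_leb by (intro borel_measurable_scaleR borel_measurable_indicator)
  have "AE p in lebesgue. indicator (Qcyl T \<Omega>) p *\<^sub>R R p = indicator (Qcyl T \<Omega>) p *\<^sub>R v (fst p) (snd p)"
    using R(1) by eventually_elim (auto simp: indicator_def)
  from borel_measurable_AE[OF m this] show ?thesis
    unfolding jointly_meas_def by (rule iffD2[OF borel_measurable_restrict_space_iff, rotated]) (use Q_leb in simp)
qed

lemma AE_onI: "(AE t in lebesgue. t \<in> {0<..<T} --> Q t) ==> AE t in lebesgue_on {0<..<T}. Q t"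
  using I_leb by (simp add: AE_restrict_space_iff)

lemma AE_onD: "(AE t in lebesgue_on {0<..<T}. Q t) ==> AE t in lebesgue. t \<in> {0<..<T} --> Q t"
  using I_leb by (simp add: AE_restrict_space_iff)

lemma integrable_onI:
  fixes k :: "real => real"
  assumes "integrable lebesgue g" "AE t in lebesgue. t \<in> {0<..<T} --> k t = g t"
  shows "integrable (lebesgue_on {0<..<T}) k"
proof -
  have i: "integrable lebesgue (%t. indicator {0<..<T} t *\<^sub>R g t)" by (rule integrable_mult_indicator[OF I_leb assms(1)])
  have e: "AE t in lebesgue. indicator {0<..<T} t *\<^sub>R g t = indicator {0<..<T} t *\<^sub>R k t"
    using assms(2) by eventually_elim (auto simp: indicator_def)
  have "integrable lebesgue (%t. indicator {0<..<T} t *\<^sub>R k t)"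
    by (rule integrable_cong_AE_imp[OF i borel_measurable_AE[OF borel_measurable_integrable[OF i] e] e])
  then show ?thesis using I_leb by (simp add: integrable_restrict_space)
qed

end

section \<open>The wave equation as an instance of the abstract evolution\<close>

locale wave_data = growing T \<Omega> for T :: real and \<Omega> :: "real => 'x::euclidean_space set" +
  fixes f :: "real => 'x => real" and u0 u1 :: "'x => real"
  assumes f_L2: "L2 (Oset T \<Omega>) (%p. f (fst p) (snd p))" and u0_H10: "H10 (\<Omega> 0) u0" and u1_L2: "L2 (\<Omega> 0) u1"
begin

definition F :: "real \<times> 'x => real" where "F = rep_l2 (emb (Oset T \<Omega>) (%p. f (fst p) (snd p)))"

lemma slice_F:
  "AE t in lebesgue. (t \<in> {0<..<T} --> L2 (\<Omega> t) (f t) \<and> slice F t = emb (\<Omega> t) (f t)) \<and> (0 < t --> slice F t \<in> supp_in (Oc t))"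
proof -
  have "AE p in lebesgue. F p = indicator (Oset T \<Omega>) p *\<^sub>R f (fst p) (snd p)"
    unfolding F_def by (rule rep_emb[OF Oset_leb f_L2[unfolded L2_iff_L2vec]])
  from AE_slice[OF this] have "AE t in lebesgue. AE x in lebesgue. F (t, x) = indicator (Oset T \<Omega>) (t, x) *\<^sub>R f t x" by simp
  moreover have "AE t in lebesgue. AE x in lebesgue. rep_l2 (slice F t) x = F (t, x)"
    unfolding F_def by (rule rep_slice[OF sqint_rep])
  ultimately show ?thesis
  proof eventually_elim
    case (elim t)
    then have r: "AE x in lebesgue. rep_l2 (slice F t) x = indicator (Oset T \<Omega>) (t, x) *\<^sub>R f t x" by eventually_elim simp
    have 1: "L2 (\<Omega> t) (f t) \<and> slice F t = emb (\<Omega> t) (f t)" if t: "t \<in> {0<..<T}"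
    proof -
      have "AE x in lebesgue. rep_l2 (slice F t) x = indicator (\<Omega> t) x *\<^sub>R f t x"
        using r by eventually_elim (use t in \<open>auto simp: indicator_def Oset_def\<close>)
      from emb_full[OF leb this] t show ?thesis by (simp add: L2_iff_L2vec)
    qed
    have "AE x in lebesgue. x \<notin> Oc t --> rep_l2 (slice F t) x = 0"
      using r
    proof eventually_elim
      case (elim x)
      show ?case using elim Oc_eq[of t] by (cases "t \<in> {0<..<T}") (auto simp: indicator_def Oset_def)
    qed
    then show ?case using 1 by (simp add: supp_in_def)
  qed
qed

sublocale E: evolution T "%t. grad_graph (Oc t)" "%t. supp_in (Oc t)" F "emb (\<Omega> 0) u0" "emb (\<Omega> 0) u1" "emb (\<Omega> 0) (wgrad (\<Omega> 0) u0)"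
proof
  have O0: "open (\<Omega> 0)" "Oc 0 = \<Omega> 0" using op[OF T_mem(2)] Oc_eq[OF T_mem(2)] by auto
  have Ob: "Oc t \<in> sets borel" for t using Oc_open by simp
  show "0 < T" by (rule T)
  show "closed (grad_graph (Oc t))" "subspace (grad_graph (Oc t))" for t by (rule closed_grad_graph subspace_grad_graph)+
  show "grad_graph (Oc s) \<subseteq> grad_graph (Oc t)" if "s <= t" for s t by (rule grad_graph_mono[OF Oc_mono[OF that]])
  show "g = 0" if "(0, g) \<in> grad_graph (Oc t)" for t g by (rule grad_graph_single[OF Oc_open that])
  show "closed (supp_in (Oc t) :: ('x, real) l2 set)" "subspace (supp_in (Oc t) :: ('x, real) l2 set)" for t
    by (rule closed_supp_in[OF Ob] subspace_supp_in[OF Ob])+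
  show "(supp_in (Oc s) :: ('x, real) l2 set) \<subseteq> supp_in (Oc t)" if "s <= t" for s t by (rule supp_in_mono[OF Oc_mono[OF that]])
  show "h \<in> supp_in (Oc t)" if "(h, g) \<in> grad_graph (Oc t)" for t h g by (rule grad_graph_supp(1)[OF Oc_open that])
  show "h = 0" if "h \<in> supp_in (Oc t)" "!!\<phi> q. (\<phi>, q) \<in> grad_graph (Oc t) ==> h \<bullet> \<phi> = 0" for t h
    by (rule grad_graph_dense[OF Oc_open that])
  show "sqint F" unfolding F_def by (rule sqint_rep)
  show "AE t in lebesgue. 0 < t --> slice F t \<in> supp_in (Oc t)" using slice_F by eventually_elim simp
  show "(emb (\<Omega> 0) u0, emb (\<Omega> 0) (wgrad (\<Omega> 0) u0)) \<in> grad_graph (Oc 0)" unfolding O0(2) by (rule H10_D(3)[OF O0(1) u0_H10])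
  show "emb (\<Omega> 0) u1 \<in> supp_in (Oc 0)" unfolding O0(2) by (rule emb_supp_in[OF leb[OF T_mem(2)] u1_L2[unfolded L2_iff_L2vec]])
qed

end

section \<open>From curves in the Hilbert space back to functions of time and space\<close>

locale wave_sol = wave_data T \<Omega> f u0 u1 for T :: real and \<Omega> :: "real => 'x::euclidean_space set" and f u0 u1 +
  fixes A B :: "real \<times> 'x => real" and D :: "real \<times> 'x => 'x" and U V Z C
  assumes sq: "sqint A" "sqint B" "sqint D"
    and init: "U 0 = emb (\<Omega> 0) u0" "V 0 = emb (\<Omega> 0) u1"
    and slices: "AE t in lebesgue. t \<in> {0..<T} --> U t = slice A t \<and> V t = slice B t \<and> Z t = slice D t"
    and at_time: "!!t. t \<in> {0..T} ==> (U t, Z t) \<in> grad_graph (Oc t) \<and> V t \<in> supp_in (Oc t) \<and> norm (V t) <= C \<and> norm (Z t) <= C \<and>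
      (norm (V t))\<^sup>2 / 2 + (norm (Z t))\<^sup>2 / 2 <= (norm (emb (\<Omega> 0) u1))\<^sup>2 / 2 + (norm (emb (\<Omega> 0) (wgrad (\<Omega> 0) u0)))\<^sup>2 / 2 + tint 0 t (%r. E.Fs r \<bullet> slice B r)"
    and lipschitz: "!!s t. s \<in> {0..T} ==> t \<in> {0..T} ==> norm (U t - U s) <= C * \<bar>t - s\<bar>"
    and increment: "!!tb s t \<phi> q. 0 <= tb ==> tb <= s ==> s <= t ==> t <= T ==> (\<phi>, q) \<in> grad_graph (Oc tb) ==>
      \<bar>(V t - V s) \<bullet> \<phi>\<bar> <= norm \<phi> * ((1 + E.FM) * sqrt (t - s)) + C * norm q * (t - s)"
    and deriv: "!!\<Phi> \<Phi>d b. E.curve \<Phi> \<Phi>d b ==> tint 0 T (%s. slice A s \<bullet> \<Phi>d s) = - tint 0 T (%s. slice B s \<bullet> \<Phi> s)"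
    and weak_form: "!!Y Yd b q. E.curve Y Yd b ==> (AE s in lebesgue. s \<in> {0..<T} --> (Y s, q s) \<in> grad_graph (Oc s) \<and> norm (q s) <= b s) ==>
      (AE s in lebesgue. s \<in> {0..<T} --> Yd s \<in> supp_in (Oc s)) ==>
      - tint 0 T (%s. slice B s \<bullet> Yd s) + tint 0 T (%s. slice D s \<bullet> q s) = tint 0 T (%s. E.Fs s \<bullet> Y s)"
begin

text \<open>Joint measurability forces the jointly measurable representative at almost every time, while
  the exceptional times need the value of the continuous curve.\<close>
definition nice :: "real => bool" where
  "nice t \<longleftrightarrow> t \<in> {0<..<T} \<and> U t = slice A t \<and> V t = slice B t \<and> sqint (%x. A (t, x)) \<and> sqint (%x. B (t, x))"
definition uu :: "real => 'x => real" where "uu t x = (if nice t then A (t, x) else rep_l2 (U t) x)"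
definition vv :: "real => 'x => real" where "vv t x = (if nice t then B (t, x) else rep_l2 (V t) x)"

lemma AE_nice: "AE t in lebesgue. t \<in> {0<..<T} --> nice t"
proof -
  have "AE t in lebesgue. sqint (%x. A (t, x))" "AE t in lebesgue. sqint (%x. B (t, x))"
    using AE_sqint_slice[OF sq(1)] AE_sqint_slice[OF sq(2)] by (simp_all only: AE_completion_iff)
  then show ?thesis using slices by eventually_elim (auto simp: nice_def)
qed

lemma rep: "uu t \<in> borel_measurable lebesgue" "AE x in lebesgue. uu t x = rep_l2 (U t) x"
  "vv t \<in> borel_measurable lebesgue" "AE x in lebesgue. vv t x = rep_l2 (V t) x"
proof -
  have "uu t \<in> borel_measurable lebesgue \<and> vv t \<in> borel_measurable lebesgue \<and>
    (AE x in lebesgue. uu t x = rep_l2 (U t) x) \<and> (AE x in lebesgue. vv t x = rep_l2 (V t) x)"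
  proof (cases "nice t")
    case True
    then have n: "sqint (%x. A (t, x))" "sqint (%x. B (t, x))" "U t = slice A t" "V t = slice B t" by (auto simp: nice_def)
    have e: "uu t = (%x. A (t, x))" "vv t = (%x. B (t, x))" using True by (auto simp: uu_def vv_def)
    have "(%x. A (t, x)) \<in> borel_measurable lebesgue" "(%x. B (t, x)) \<in> borel_measurable lebesgue"
      using n(1,2) by (auto intro!: measurable_completion simp: sqint_def)
    moreover have "AE x in lebesgue. A (t, x) = rep_l2 (U t) x"
      using rep_abs_lebesgue[OF n(1)] unfolding n(3) slice_def by eventually_elim simp
    moreover have "AE x in lebesgue. B (t, x) = rep_l2 (V t) x"
      using rep_abs_lebesgue[OF n(2)] unfolding n(4) slice_def by eventually_elim simp
    ultimately show ?thesis unfolding e by simp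
  next
    case False
    then have "uu t = rep_l2 (U t)" "vv t = rep_l2 (V t)" by (auto simp: uu_def vv_def)
    then show ?thesis using rep_lebesgue[of "U t"] rep_lebesgue[of "V t"] by simp
  qed
  then show "uu t \<in> borel_measurable lebesgue" "AE x in lebesgue. uu t x = rep_l2 (U t) x"
    "vv t \<in> borel_measurable lebesgue" "AE x in lebesgue. vv t x = rep_l2 (V t) x" by blast+
qed

text \<open>The larger domain at time \<open>s\<close> is allowed because the zero extension of
  \<open>uu t\<close> stays in the space of every later domain; the weak continuity statement views
  all times in the domain at \<open>T\<close>.\<close>

lemma uu_H10:
  assumes "0 <= t" "t <= s" "s <= T"
  shows "H10 (\<Omega> s) (uu t)" "emb (\<Omega> s) (uu t) = U t" "emb (\<Omega> s) (wgrad (\<Omega> s) (uu t)) = Z t"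
    "(U t, Z t) \<in> grad_graph (\<Omega> s)"
proof -
  have t: "t \<in> {0..T}" "s \<in> {0..T}" using assms by auto
  show g: "(U t, Z t) \<in> grad_graph (\<Omega> s)"
    using at_time[OF t(1)] grad_graph_mono[OF mono[OF assms]] unfolding Oc_eq[OF t(1)] by blast
  note L = rep_L2[OF leb[OF t(2)] rep(1,2)]
  show e: "emb (\<Omega> s) (uu t) = U t" by (rule L(2)[OF grad_graph_supp(1)[OF op[OF t(2)] g]])
  have "(emb (\<Omega> s) (uu t), Z t) \<in> grad_graph (\<Omega> s)" using g by (simp add: e)
  from H10_I[OF op[OF t(2)] L(1) this] show "H10 (\<Omega> s) (uu t)" "emb (\<Omega> s) (wgrad (\<Omega> s) (uu t)) = Z t" .
qed

lemma vv_L2: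
  assumes "t \<in> {0..T}"
  shows "L2 (\<Omega> t) (vv t)" "emb (\<Omega> t) (vv t) = V t" "V t \<in> supp_in (\<Omega> t)"
proof -
  show s: "V t \<in> supp_in (\<Omega> t)" using at_time[OF assms] by (simp add: Oc_eq[OF assms])
  show "L2 (\<Omega> t) (vv t)" "emb (\<Omega> t) (vv t) = V t" using rep_L2[OF leb[OF assms] rep(3,4)] s by auto
qed

lemma AE_slices: "AE t in lebesgue. t \<in> {0<..<T} --> U t = slice A t \<and> V t = slice B t \<and> Z t = slice D t"
  using slices by eventually_elim simp

lemma joint: "AE p in lebesgue. p \<in> Qcyl T \<Omega> --> uu (fst p) (snd p) = A p" "AE p in lebesgue. p \<in> Qcyl T \<Omega> --> vv (fst p) (snd p) = B p"
proof -
  have n: "AE p in (lebesgue :: (real \<times> 'x) measure). fst p \<in> {0<..<T} --> nice (fst p)" by (rule AE_fst[OF AE_nice])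
  show "AE p in lebesgue. p \<in> Qcyl T \<Omega> --> uu (fst p) (snd p) = A p" "AE p in lebesgue. p \<in> Qcyl T \<Omega> --> vv (fst p) (snd p) = B p"
    using n by (eventually_elim, auto simp: Qcyl_def uu_def vv_def)+
qed

lemma borel_AB: "A \<in> borel_measurable borel" "B \<in> borel_measurable borel"
  using sq by (auto simp: sqint_def)

lemma zero_ext: "zero_ext T \<Omega> uu" "zero_ext T \<Omega> vv"
proof -
  have u: "AE x in lebesgue. x \<notin> \<Omega> t --> uu t x = 0" if "t \<in> {0<..<T}" for t
  proof -
    have "U t \<in> supp_in (\<Omega> t)" using that by (intro grad_graph_supp(1)[OF op uu_H10(4)]) auto
    then have "AE x in lebesgue. x \<notin> \<Omega> t --> rep_l2 (U t) x = 0" by (simp add: supp_in_def)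
    then show ?thesis using rep(2)[of t] by eventually_elim simp
  qed
  have v: "AE x in lebesgue. x \<notin> \<Omega> t --> vv t x = 0" if "t \<in> {0<..<T}" for t
  proof -
    have "V t \<in> supp_in (\<Omega> t)" using that by (intro vv_L2) auto
    then have "AE x in lebesgue. x \<notin> \<Omega> t --> rep_l2 (V t) x = 0" by (simp add: supp_in_def)
    then show ?thesis using rep(4)[of t] by eventually_elim simp
  qed
  show "zero_ext T \<Omega> uu" unfolding zero_ext_def by (rule AE_onI, rule AE_I2, rule impI, rule u)
  show "zero_ext T \<Omega> vv" unfolding zero_ext_def by (rule AE_onI, rule AE_I2, rule impI, rule v)
qed

lemma uu_L2_H10: "L2_H10 T \<Omega> uu"
  unfolding L2_H10_def
proof (intro conjI)
  show "jointly_meas T \<Omega> uu" by (rule jointly_measI[OF joint(1) borel_AB(1)])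
  show "zero_ext T \<Omega> uu" by (rule zero_ext)
  have H: "H10 (\<Omega> t) (uu t)" if "t \<in> {0<..<T}" for t using that by (intro uu_H10) auto
  then show "AE t in lebesgue_on {0<..<T}. H10 (\<Omega> t) (uu t)" by (intro AE_onI AE_I2 impI)
  have n: "(H1norm (\<Omega> t) (uu t))\<^sup>2 = (norm (U t))\<^sup>2 + (norm (Z t))\<^sup>2" if "t \<in> {0<..<T}" for t
    using that H1norm_emb[OF op H, of t] uu_H10(2,3)[of t t] by (simp add: norm_Pair)
  show "integrable (lebesgue_on {0<..<T}) (%t. (H1norm (\<Omega> t) (uu t))\<^sup>2)"
  proof (rule integrable_onI)
    show "integrable lebesgue (%t. (norm (slice A t))\<^sup>2 + (norm (slice D t))\<^sup>2)"
      by (intro Bochner_Integration.integrable_add slice_norm_sq_integrable sq)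
    show "AE t in lebesgue. t \<in> {0<..<T} --> (H1norm (\<Omega> t) (uu t))\<^sup>2 = (norm (slice A t))\<^sup>2 + (norm (slice D t))\<^sup>2"
      using AE_slices by eventually_elim (simp add: n)
  qed
qed

lemma vv_L2_L2: "L2_L2 T \<Omega> vv"
  unfolding L2_L2_def
proof (intro conjI)
  show "jointly_meas T \<Omega> vv" by (rule jointly_measI[OF joint(2) borel_AB(2)])
  show "zero_ext T \<Omega> vv" by (rule zero_ext)
  have H: "L2 (\<Omega> t) (vv t)" if "t \<in> {0<..<T}" for t using that by (intro vv_L2) auto
  then show "AE t in lebesgue_on {0<..<T}. L2 (\<Omega> t) (vv t)" by (intro AE_onI AE_I2 impI)
  have n: "L2sq (\<Omega> t) (vv t) = (norm (V t))\<^sup>2" if "t \<in> {0<..<T}" for t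
    using that L2sq_emb[OF leb H, of t] vv_L2(2)[of t] by simp
  show "integrable (lebesgue_on {0<..<T}) (%t. L2sq (\<Omega> t) (vv t))"
  proof (rule integrable_onI[OF slice_norm_sq_integrable[OF sq(2)]])
    show "AE t in lebesgue. t \<in> {0<..<T} --> L2sq (\<Omega> t) (vv t) = (norm (slice B t))\<^sup>2"
      using AE_slices by eventually_elim (simp add: n)
  qed
qed

lemma vv_Linf_L2: "Linf_L2 T \<Omega> vv"
  unfolding Linf_L2_def
proof (intro conjI exI)
  note v = vv_L2_L2[unfolded L2_L2_def]
  show "jointly_meas T \<Omega> vv" "zero_ext T \<Omega> vv" "AE t in lebesgue_on {0<..<T}. L2 (\<Omega> t) (vv t)" using v by blast+
  have "(%t. L2sq (\<Omega> t) (vv t)) \<in> borel_measurable (lebesgue_on {0<..<T})" using v by (intro borel_measurable_integrable) blast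
  from measurable_compose[OF this borel_measurable_continuous_onI[OF continuous_on_real_sqrt[OF continuous_on_id]]]
  show "(%t. L2norm (\<Omega> t) (vv t)) \<in> borel_measurable (lebesgue_on {0<..<T})" by (simp only: L2norm_def)
  have "L2norm (\<Omega> t) (vv t) <= C" if "t \<in> {0<..<T}" for t
  proof -
    have t: "t \<in> {0..T}" using that by auto
    show ?thesis using at_time[OF t] by (simp add: L2norm_def L2sq_emb[OF leb[OF t] vv_L2(1)[OF t]] vv_L2(2)[OF t])
  qed
  then show "AE t in lebesgue_on {0<..<T}. L2norm (\<Omega> t) (vv t) <= C" by (intro AE_onI AE_I2 impI)
qed

text \<open>Integration by parts in space-time makes the classical time derivative a weak one, so
  the slices of a test function form a curve to which the abstract derivative identity
  applies.\<close>

lemma test_fun_curve: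
  assumes \<phi>: "test_fun (Qcyl T \<Omega>) \<phi>"
  shows "E.curve (slice \<phi>) (slice (pd \<phi> (1, 0))) (%t. 1 + (norm (slice (pd \<phi> (1, 0)) t))\<^sup>2)"
proof -
  let ?d = "pd \<phi> (1, 0)"
  note s = test_fun_integrable(2)[OF \<phi>] test_fun_integrable(4)[OF \<phi> time_Basis]
  have z: "slice \<phi> t = 0" if "t \<notin> {0<..<T}" for t
  proof -
    have "(%x. \<phi> (t, x)) = (%x. 0)" using that test_fun_outside[OF \<phi>] by (auto simp: Qcyl_def)
    then show ?thesis by (simp add: slice_def abs_l2_zero)
  qed
  have "(slice \<phi> t - slice \<phi> r) \<bullet> h = tint r t (%r. slice ?d r \<bullet> h)" if "0 <= r" "r <= t" "t <= T" for h r t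
  proof (rule curve_from_weak_dt[OF s slice_continuous(2)[OF \<phi>] _ _ op[OF T_mem(1)] _ _ that])
    show "AE t in lebesgue. t \<in> {0<..<T} --> slice \<phi> t = slice \<phi> t" by simp
    show "(\<integral>p. \<phi> p * pd \<psi> (1, 0) p \<partial>lborel) = - (\<integral>p. ?d p * \<psi> p \<partial>lborel)" if "test_fun ({0<..<T} \<times> \<Omega> T) \<psi>" for \<psi>
      by (rule integral_by_parts_pd[OF \<phi> that time_Basis])
    show "slice \<phi> t \<in> supp_in (\<Omega> T)" for t
      unfolding slice_def by (rule abs_supp_in[OF slice_continuous(1)[OF \<phi>] test_fun_outside[OF \<phi>]]) (simp add: Qcyl_def)
    have "AE t in lebesgue. sqint (%x. ?d (t, x))" using AE_sqint_slice[OF s(2)] by (simp only: AE_completion_iff)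
    then show "AE t in lebesgue. t \<in> {0<..<T} --> slice ?d t \<in> supp_in (\<Omega> T)"
    proof eventually_elim
      case (elim t)
      have "slice ?d t \<in> supp_in (\<Omega> T)" unfolding slice_def
        by (rule abs_supp_in[OF elim test_fun_pd_outside[OF \<phi>]]) (simp add: Qcyl_def)
      then show ?case by simp
    qed
  qed
  moreover have "AE t in lebesgue. t \<in> {0..<T} --> norm (slice ?d t) <= 1 + (norm (slice ?d t))\<^sup>2"
    by (rule AE_I2) (simp add: norm_le_one_plus_sq)
  ultimately show ?thesis unfolding E.curve_def
    using slice_continuous(2)[OF \<phi>] z slice_inner_measurable[OF s(1)] slice_inner_measurable[OF s(2)] slice_bound_tintegrable[OF s(2)] by simp
qed

lemma uu_weak_dt: "is_weak_dt T \<Omega> uu vv"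
  unfolding is_weak_dt_def
proof (intro allI impI)
  fix \<phi> :: "real \<times> 'x => real" assume \<phi>: "test_fun (Qcyl T \<Omega>) \<phi>"
  let ?d = "pd \<phi> (1, 0)"
  note s = test_fun_integrable(2)[OF \<phi>] test_fun_integrable(4)[OF \<phi> time_Basis]
  have m: "\<phi> \<in> borel_measurable borel" "?d \<in> borel_measurable borel" using s by (auto simp: sqint_def)
  have jA: "AE p in lebesgue. p \<in> Qcyl T \<Omega> --> A p = uu (fst p) (snd p)" using joint(1) by eventually_elim simp
  have jB: "AE p in lebesgue. p \<in> Qcyl T \<Omega> --> B p = vv (fst p) (snd p)" using joint(2) by eventually_elim simp
  have "(\<integral>p. uu (fst p) (snd p) * ?d p \<partial>lebesgue_on (Qcyl T \<Omega>)) = (\<integral>p. A p * ?d p \<partial>lborel)"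
    by (rule Q_integral[OF jA borel_AB(1) test_fun_pd_outside[OF \<phi>] m(2)])
  also have "\<dots> = tint 0 T (%t. slice A t \<bullet> slice ?d t)"
    by (rule integral_slice_inner[OF sq(1) s(2) test_fun_pd_outside[OF \<phi>]]) (auto simp: Qcyl_def)
  also have "\<dots> = - tint 0 T (%t. slice B t \<bullet> slice \<phi> t)" by (rule deriv[OF test_fun_curve[OF \<phi>]])
  also have "tint 0 T (%t. slice B t \<bullet> slice \<phi> t) = (\<integral>p. B p * \<phi> p \<partial>lborel)"
    by (rule integral_slice_inner[OF sq(2) s(1) test_fun_outside[OF \<phi>], symmetric]) (auto simp: Qcyl_def)
  also have "\<dots> = (\<integral>p. vv (fst p) (snd p) * \<phi> p \<partial>lebesgue_on (Qcyl T \<Omega>))"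
    by (rule Q_integral[OF jB borel_AB(2) test_fun_outside[OF \<phi>] m(1), symmetric])
  finally show "(\<integral>p. uu (fst p) (snd p) * ?d p \<partial>lebesgue_on (Qcyl T \<Omega>)) = - (\<integral>p. vv (fst p) (snd p) * \<phi> p \<partial>lebesgue_on (Qcyl T \<Omega>))" .
qed

text \<open>Restriction to the initial domain acts as an orthogonal projection and so does not
  increase distances; the Lipschitz bound of \<open>U\<close> is inherited.\<close>

lemma uu_cont_L2: "cont_L2_on {0..T} (\<Omega> 0) uu"
  unfolding cont_L2_on_def
proof (intro conjI ballI)
  note X = leb[OF T_mem(2)]
  have L: "L2 (\<Omega> 0) (uu t)" for t by (rule rep_L2(1)[OF X rep(1,2)])
  then show "L2 (\<Omega> 0) (uu t)" for t .
  have le: "L2norm (\<Omega> 0) (%x. uu t x - uu s x) <= norm (U t - U s)" for s t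
  proof -
    let ?d = "emb (\<Omega> 0) (uu t) - emb (\<Omega> 0) (uu s)"
    have d: "?d \<in> supp_in (\<Omega> 0)" using L2_diff[OF X L[of t] L[of s]] emb_supp_in[OF X] by (metis L2_iff_L2vec)
    have "(norm ?d)\<^sup>2 = emb (\<Omega> 0) (uu t) \<bullet> ?d - emb (\<Omega> 0) (uu s) \<bullet> ?d" by (simp only: power2_norm_eq_inner inner_diff_left)
    also have "\<dots> = (U t - U s) \<bullet> ?d"
      unfolding emb_inner_supp[OF X rep(1)[of t] rep(2)[of t] d] emb_inner_supp[OF X rep(1)[of s] rep(2)[of s] d] by (rule inner_diff_left[symmetric])
    also have "\<dots> <= norm (U t - U s) * norm ?d" by (rule norm_cauchy_schwarz)
    finally have "norm ?d <= norm (U t - U s)" by (cases "norm ?d = 0") (auto simp: power2_eq_square)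
    then show ?thesis using L2_diff[OF X L[of t] L[of s]] by (simp add: L2norm_def L2sq_emb[OF X])
  qed
  fix s assume s: "s \<in> {0..T}"
  have "((%t. C * \<bar>t - s\<bar>) \<longlongrightarrow> C * \<bar>s - s\<bar>) (at s within {0..T})" by (intro tendsto_intros)
  then have 0: "((%t. C * \<bar>t - s\<bar>) \<longlongrightarrow> 0) (at s within {0..T})" by simp
  show "((%t. L2norm (\<Omega> 0) (%x. uu t x - uu s x)) \<longlongrightarrow> 0) (at s within {0..T})"
  proof (rule Lim_null_comparison[OF within_eventually 0])
    fix t assume t: "t \<in> {0..T}"
    have "0 <= L2norm (\<Omega> 0) (%x. uu t x - uu s x)" using L2_diff(1)[OF X L[of t] L[of s]] by (simp add: L2norm_def L2sq_emb[OF X])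
    then show "norm (L2norm (\<Omega> 0) (%x. uu t x - uu s x)) <= C * \<bar>t - s\<bar>" using le[of t s] lipschitz[OF s t] by simp
  qed
qed

lemma V_increment:
  assumes st: "s \<in> {tb..T}" "t \<in> {tb..T}" and tb: "0 <= tb" and q: "(\<phi>, q) \<in> grad_graph (\<Omega> tb)"
  shows "\<bar>(V t - V s) \<bullet> \<phi>\<bar> <= norm \<phi> * ((1 + E.FM) * sqrt \<bar>t - s\<bar>) + C * norm q * \<bar>t - s\<bar>"
proof -
  have O: "Oc tb = \<Omega> tb" using st tb by (intro Oc_eq) auto
  show ?thesis
  proof (cases "s <= t")
    case True
    then show ?thesis using increment[OF tb, of s t \<phi> q] st q O by simp
  next
    case False
    have "\<bar>(V t - V s) \<bullet> \<phi>\<bar> = \<bar>(V s - V t) \<bullet> \<phi>\<bar>" by (simp add: inner_diff_left abs_minus_commute)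
    then show ?thesis using False increment[OF tb, of t s \<phi> q] st q O by simp
  qed
qed

lemma V_bound_tendsto:
  "((%t. a * ((1 + E.FM) * sqrt \<bar>t - s\<bar>) + C * b * \<bar>t - s\<bar>) \<longlongrightarrow> 0) (at s within S)"
proof -
  have "((%t. a * ((1 + E.FM) * sqrt \<bar>t - s\<bar>) + C * b * \<bar>t - s\<bar>) \<longlongrightarrow> a * ((1 + E.FM) * sqrt \<bar>s - s\<bar>) + C * b * \<bar>s - s\<bar>) (at s within S)"
    by (intro tendsto_intros)
  then show ?thesis by simp
qed

text \<open>Test functions of \<open>X\<close> extend by zero to the graph over the initial domain,
  where the increment bound holds from time 0 on. On the unit ball of test functions it is uniform,
  with modulus of order \<open>sqrt \<bar>t - s\<bar>\<close>.\<close>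

lemma vv_cont_Hneg:
  assumes \<delta>: "\<delta> < T" and X: "open X" "X \<subseteq> \<Omega> 0"
  shows "cont_Hneg_on {0..\<delta>} X vv"
  unfolding cont_Hneg_on_def
proof (intro conjI ballI)
  note Xl = open_lebesgue[OF X(1)]
  have L: "L2 X (vv t)" for t by (rule rep_L2(1)[OF Xl rep(3,4)])
  then show "L2 X (vv t)" for t .
  fix s assume s: "s \<in> {0..\<delta>}"
  show "((%t. Hneg_norm X (%x. vv t x - vv s x)) \<longlongrightarrow> 0) (at s within {0..\<delta>})"
  proof (rule Lim_null_comparison[OF within_eventually V_bound_tendsto[of 1 s 1]])
    fix t assume t: "t \<in> {0..\<delta>}"
    have "\<bar>Hneg_norm X (%x. vv t x - vv s x)\<bar> <= 1 * ((1 + E.FM) * sqrt \<bar>t - s\<bar>) + C * 1 * \<bar>t - s\<bar>"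
    proof (rule Hneg_norm_le[OF X(1)])
      fix \<phi> assume \<phi>: "test_fun X \<phi>" "H1norm X \<phi> <= 1"
      note h = H10_test_fun[OF X(1) \<phi>(1)]
      have sp: "abs_l2 \<phi> \<in> supp_in X" using emb_supp_in[OF Xl, of \<phi>] H10_D(1)[OF X(1) h(1)] by (simp add: h(2) L2_iff_L2vec)
      have "(\<integral>x. (vv t x - vv s x) * \<phi> x \<partial>lebesgue_on X) = emb X (%x. vv t x - vv s x) \<bullet> emb X \<phi>"
        using L2ip_emb[OF Xl L2_diff(1)[OF Xl L L] H10_D(1)[OF X(1) h(1)], of t s] by (simp add: L2ip_def)
      also have "\<dots> = (V t - V s) \<bullet> abs_l2 \<phi>"
        using emb_inner_supp[OF Xl rep(3,4) sp, of t] emb_inner_supp[OF Xl rep(3,4) sp, of s]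
        by (simp add: L2_diff(2)[OF Xl L L] h(2) inner_diff_left)
      finally have e: "(\<integral>x. (vv t x - vv s x) * \<phi> x \<partial>lebesgue_on X) = (V t - V s) \<bullet> abs_l2 \<phi>" .
      have "norm (abs_l2 \<phi>, abs_l2 (grad \<phi>)) <= 1" using \<phi>(2) H1norm_emb[OF X(1) h(1)] by (simp add: h)
      then have n: "norm (abs_l2 \<phi>) <= 1" "norm (abs_l2 (grad \<phi>)) <= 1"
        using norm_fst_le[of "abs_l2 \<phi>" "abs_l2 (grad \<phi>)"] norm_snd_le[of "abs_l2 (grad \<phi>)" "abs_l2 \<phi>"] by linarith+
      have "(abs_l2 \<phi>, abs_l2 (grad \<phi>)) \<in> grad_graph (\<Omega> 0)" by (rule subsetD[OF grad_graph_mono[OF X(2)] test_fun_in_grad_graph[OF \<phi>(1)]])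
      then have "\<bar>(V t - V s) \<bullet> abs_l2 \<phi>\<bar> <= norm (abs_l2 \<phi>) * ((1 + E.FM) * sqrt \<bar>t - s\<bar>) + C * norm (abs_l2 (grad \<phi>)) * \<bar>t - s\<bar>"
        using s t \<delta> by (intro V_increment[where tb = 0]) auto
      also have "\<dots> <= 1 * ((1 + E.FM) * sqrt \<bar>t - s\<bar>) + C * 1 * \<bar>t - s\<bar>"
      proof (intro add_mono mult_right_mono mult_left_mono n)
        show "0 <= (1 + E.FM) * sqrt \<bar>t - s\<bar>" using E.FM_nonneg by simp
        show "0 <= C" using at_time[OF T_mem(1)] norm_ge_zero[of "V T"] by linarith
      qed simp
      finally show "\<bar>\<integral>x. (vv t x - vv s x) * \<phi> x \<partial>lebesgue_on X\<bar> <= 1 * ((1 + E.FM) * sqrt \<bar>t - s\<bar>) + C * 1 * \<bar>t - s\<bar>" unfolding e .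
    qed
    then show "norm (Hneg_norm X (%x. vv t x - vv s x)) <= 1 * ((1 + E.FM) * sqrt \<bar>t - s\<bar>) + C * 1 * \<bar>t - s\<bar>" by simp
  qed
qed

lemma initial: "AE x in lebesgue. x \<in> \<Omega> 0 --> uu 0 x = u0 x" "AE x in lebesgue. x \<in> \<Omega> 0 --> vv 0 x = u1 x"
proof -
  note X = leb[OF T_mem(2)]
  have "AE x in lebesgue. rep_l2 (U 0) x = indicator (\<Omega> 0) x *\<^sub>R u0 x"
    unfolding init(1) using H10_D(1)[OF op[OF T_mem(2)] u0_H10] by (intro rep_emb[OF X]) (simp add: L2_iff_L2vec)
  then show "AE x in lebesgue. x \<in> \<Omega> 0 --> uu 0 x = u0 x" using rep(2)[of 0] by eventually_elim simp
  have "AE x in lebesgue. rep_l2 (V 0) x = indicator (\<Omega> 0) x *\<^sub>R u1 x"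
    unfolding init(2) using u1_L2 by (intro rep_emb[OF X]) (simp add: L2_iff_L2vec)
  then show "AE x in lebesgue. x \<in> \<Omega> 0 --> vv 0 x = u1 x" using rep(4)[of 0] by eventually_elim simp
qed

lemma uu_initial: "L2sq (\<Omega> 0) (%x. uu 0 x - u0 x) = 0"
proof -
  have "AE x in lebesgue_on (\<Omega> 0). (uu 0 x - u0 x) * (uu 0 x - u0 x) = 0"
    using initial(1) leb[OF T_mem(2)] by (simp add: AE_restrict_space_iff)
  then show ?thesis unfolding L2sq_def L2ip_def by (rule integral_eq_zero_AE)
qed

lemma vv_initial:
  assumes X: "open X" "X \<subseteq> \<Omega> 0" shows "Hneg_norm X (%x. vv 0 x - u1 x) = 0"
proof -
  have z: "AE x in lebesgue. x \<in> X --> (vv 0 x - u1 x) * \<phi> x = 0" for \<phi> :: "'x => real"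
    using initial(2) by eventually_elim (use X(2) in auto)
  have "\<bar>Hneg_norm X (%x. vv 0 x - u1 x)\<bar> <= 0"
  proof (rule Hneg_norm_le[OF X(1)])
    fix \<phi> :: "'x => real"
    have "AE x in lebesgue_on X. (vv 0 x - u1 x) * \<phi> x = 0"
      using z[of \<phi>] open_lebesgue[OF X(1)] by (simp add: AE_restrict_space_iff)
    then have "(\<integral>x. (vv 0 x - u1 x) * \<phi> x \<partial>lebesgue_on X) = 0" by (rule integral_eq_zero_AE)
    then show "\<bar>\<integral>x. (vv 0 x - u1 x) * \<phi> x \<partial>lebesgue_on X\<bar> <= 0" by simp
  qed
  then show ?thesis by simp
qed

text \<open>An admissible test function is converted into an abstract \<open>curve\<close>: Borel
  representatives provide the slices, the weak time derivative provides the increments, and the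
  continuous representative provides the values at every time. The three integrals are then
  translated one by one.\<close>

lemma weak_formulation:
  assumes adm: "admissible_test T \<Omega> \<eta> \<eta>d"
  shows "- (\<integral>t. L2ip (\<Omega> t) (vv t) (\<eta>d t) \<partial>lebesgue_on {0..T}) + (\<integral>t. gradip (\<Omega> t) (uu t) (\<eta> t) \<partial>lebesgue_on {0..T})
    = (\<integral>t. L2ip (\<Omega> t) (f t) (\<eta> t) \<partial>lebesgue_on {0..T})"
proof -
  note X = leb[OF T_mem(1)]
  have a: "L2_H10 T \<Omega> \<eta>" "is_weak_dt T \<Omega> \<eta> \<eta>d" "L2_L2 T \<Omega> \<eta>d" "cont_L2_on {0..T} (\<Omega> T) \<eta>" "L2sq (\<Omega> T) (\<eta> 0) = 0" "L2sq (\<Omega> T) (\<eta> T) = 0"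
    using adm unfolding admissible_test_def by blast+
  have aH: "AE t in lebesgue_on {0<..<T}. H10 (\<Omega> t) (\<eta> t)" and aI: "integrable (lebesgue_on {0<..<T}) (%t. (H1norm (\<Omega> t) (\<eta> t))\<^sup>2)"
    and aJ: "jointly_meas T \<Omega> \<eta>" and aZ: "zero_ext T \<Omega> \<eta>" using a(1) unfolding L2_H10_def by blast+
  note H = AE_onD[OF aH]
  have HL: "L2 (\<Omega> t) (\<eta> t)" "L2sq (\<Omega> t) (\<eta> t) <= (H1norm (\<Omega> t) (\<eta> t))\<^sup>2" "norm (emb (\<Omega> t) (wgrad (\<Omega> t) (\<eta> t))) <= 1 + (H1norm (\<Omega> t) (\<eta> t))\<^sup>2"
    if "t \<in> {0<..<T}" "H10 (\<Omega> t) (\<eta> t)" for t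
  proof -
    have t: "t \<in> {0..T}" using that by auto
    show L: "L2 (\<Omega> t) (\<eta> t)" by (rule H10_D(1)[OF op[OF t] that(2)])
    have n: "(H1norm (\<Omega> t) (\<eta> t))\<^sup>2 = (norm (emb (\<Omega> t) (\<eta> t)))\<^sup>2 + (norm (emb (\<Omega> t) (wgrad (\<Omega> t) (\<eta> t))))\<^sup>2"
      using H1norm_emb[OF op[OF t] that(2)] by (simp add: norm_Pair)
    show "L2sq (\<Omega> t) (\<eta> t) <= (H1norm (\<Omega> t) (\<eta> t))\<^sup>2" unfolding n L2sq_emb[OF leb[OF t] L] by simp
    show "norm (emb (\<Omega> t) (wgrad (\<Omega> t) (\<eta> t))) <= 1 + (H1norm (\<Omega> t) (\<eta> t))\<^sup>2"
      unfolding n using norm_le_one_plus_sq[of "emb (\<Omega> t) (wgrad (\<Omega> t) (\<eta> t))"] zero_le_power2[of "norm (emb (\<Omega> t) (\<eta> t))"] by linarith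
  qed
  have l2: "AE t in lebesgue_on {0<..<T}. L2 (\<Omega> t) (\<eta> t)" "AE t in lebesgue_on {0<..<T}. L2sq (\<Omega> t) (\<eta> t) <= (H1norm (\<Omega> t) (\<eta> t))\<^sup>2"
    by (intro AE_onI; use H in eventually_elim; use HL in blast)+
  obtain R where R: "sqint R" "AE p in lebesgue. R p = indicator (Qcyl T \<Omega>) p * \<eta> (fst p) (snd p)"
    "AE t in lebesgue. t \<in> {0<..<T} --> L2 (\<Omega> t) (\<eta> t) \<and> L2 (\<Omega> T) (\<eta> t) \<and> slice R t = emb (\<Omega> t) (\<eta> t) \<and> slice R t = emb (\<Omega> T) (\<eta> t)"
    "AE t in lebesgue. t \<notin> {0<..<T} --> slice R t = 0"
    by (rule joint_rep[OF aJ aZ l2(1) aI l2(2)])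
  have d: "jointly_meas T \<Omega> \<eta>d" "zero_ext T \<Omega> \<eta>d" "AE t in lebesgue_on {0<..<T}. L2 (\<Omega> t) (\<eta>d t)" "integrable (lebesgue_on {0<..<T}) (%t. L2sq (\<Omega> t) (\<eta>d t))"
    using a(3) unfolding L2_L2_def by blast+
  obtain Rd where Rd: "sqint Rd" "AE p in lebesgue. Rd p = indicator (Qcyl T \<Omega>) p * \<eta>d (fst p) (snd p)"
    "AE t in lebesgue. t \<in> {0<..<T} --> L2 (\<Omega> t) (\<eta>d t) \<and> L2 (\<Omega> T) (\<eta>d t) \<and> slice Rd t = emb (\<Omega> t) (\<eta>d t) \<and> slice Rd t = emb (\<Omega> T) (\<eta>d t)"
    "AE t in lebesgue. t \<notin> {0<..<T} --> slice Rd t = 0"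
    by (rule joint_rep[OF d AE_I2[OF order_refl]])
  \<comment> \<open>Set to zero off the time interval, \<open>Y\<close> agrees with the slices of
    \<open>R\<close> at almost every real time and is therefore weakly measurable on the whole
    line.\<close>
  define Y where "Y t = (if t \<in> {0..T} then emb (\<Omega> T) (\<eta> t) else 0)" for t
  define q where "q t = emb (\<Omega> t) (wgrad (\<Omega> t) (\<eta> t))" for t
  \<comment> \<open>One integrable majorant for both the time derivative and the gradient of the
    test function.\<close>
  define b where "b t = 1 + (norm (slice Rd t))\<^sup>2 + indicator {0<..<T} t *\<^sub>R (H1norm (\<Omega> t) (\<eta> t))\<^sup>2" for t
  have L: "L2 (\<Omega> T) (\<eta> t)" if "t \<in> {0..T}" for t using a(4) that unfolding cont_L2_on_def by blast
  have Y0: "Y 0 = 0" "Y T = 0"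
    using a(5,6) L2sq_emb[OF X L[OF T_mem(1)]] L2sq_emb[OF X L[OF T_mem(2)]] T by (auto simp: Y_def)
  have AEne: "AE t in lebesgue. t \<noteq> (0::real) \<and> t \<noteq> T" by (simp add: AE_completion_iff AE_lborel_singleton AE_conj_iff)
  have YR: "AE t in lebesgue. slice R t = Y t"
    using R(3,4) AEne by eventually_elim (auto simp: Y_def)
  have Ycont: "continuous_on {0..T} Y"
    unfolding continuous_on
  proof
    fix s assume s: "s \<in> {0..T}"
    have lim: "((%t. L2norm (\<Omega> T) (%x. \<eta> t x - \<eta> s x)) \<longlongrightarrow> 0) (at s within {0..T})" using a(4) s unfolding cont_L2_on_def by blast
    have "((%t. Y t - Y s) \<longlongrightarrow> 0) (at s within {0..T})"
    proof (rule Lim_null_comparison[OF within_eventually lim])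
      fix t assume t: "t \<in> {0..T}"
      show "norm (Y t - Y s) <= L2norm (\<Omega> T) (%x. \<eta> t x - \<eta> s x)"
        using s t by (simp add: Y_def L2norm_def L2sq_emb[OF X L2_diff(1)[OF X L L]] L2_diff(2)[OF X L L])
    qed
    then show "(Y \<longlongrightarrow> Y s) (at s within {0..T})" by (simp only: Lim_null[of Y])
  qed
  have Rm: "R \<in> borel_measurable borel" "Rd \<in> borel_measurable borel" using R(1) Rd(1) by (auto simp: sqint_def)
  have inc: "(Y t - Y s) \<bullet> h = tint s t (%r. slice Rd r \<bullet> h)" if st: "0 <= s" "s <= t" "t <= T" for h s t
  proof (rule curve_from_weak_dt[OF R(1) Rd(1) Ycont _ _ op[OF T_mem(1)] _ _ st])
    show "AE t in lebesgue. t \<in> {0<..<T} --> Y t = slice R t" using YR by eventually_elim simp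
    show "(\<integral>p. R p * pd \<phi> (1, 0) p \<partial>lborel) = - (\<integral>p. Rd p * \<phi> p \<partial>lborel)" if "test_fun ({0<..<T} \<times> \<Omega> T) \<phi>" for \<phi>
    proof -
      have \<phi>: "test_fun (Qcyl T \<Omega>) \<phi>" using that by (simp add: Qcyl_def)
      have m: "\<phi> \<in> borel_measurable borel" "pd \<phi> (1, 0) \<in> borel_measurable borel"
        using test_fun_integrable(2)[OF \<phi>] test_fun_integrable(4)[OF \<phi> time_Basis] by (auto simp: sqint_def)
      have j: "AE p in lebesgue. p \<in> Qcyl T \<Omega> --> R p = \<eta> (fst p) (snd p)" using R(2) by eventually_elim simp
      have jd: "AE p in lebesgue. p \<in> Qcyl T \<Omega> --> Rd p = \<eta>d (fst p) (snd p)" using Rd(2) by eventually_elim simp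
      have "(\<integral>p. R p * pd \<phi> (1, 0) p \<partial>lborel) = (\<integral>p. \<eta> (fst p) (snd p) * pd \<phi> (1, 0) p \<partial>lebesgue_on (Qcyl T \<Omega>))"
        by (rule Q_integral[OF j Rm(1) test_fun_pd_outside[OF \<phi>] m(2), symmetric])
      also have "\<dots> = - (\<integral>p. \<eta>d (fst p) (snd p) * \<phi> p \<partial>lebesgue_on (Qcyl T \<Omega>))"
        using a(2) \<phi> unfolding is_weak_dt_def by blast
      also have "(\<integral>p. \<eta>d (fst p) (snd p) * \<phi> p \<partial>lebesgue_on (Qcyl T \<Omega>)) = (\<integral>p. Rd p * \<phi> p \<partial>lborel)"
        by (rule Q_integral[OF jd Rm(2) test_fun_outside[OF \<phi>] m(1)])
      finally show ?thesis .
    qed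
    show "Y t \<in> supp_in (\<Omega> T)" if "t \<in> {0..T}" for t
      using that emb_supp_in[OF X L[OF that, unfolded L2_iff_L2vec]] by (simp add: Y_def)
    show "AE t in lebesgue. t \<in> {0<..<T} --> slice Rd t \<in> supp_in (\<Omega> T)"
      using Rd(3)
    proof eventually_elim
      case (elim t)
      show ?case
      proof
        assume "t \<in> {0<..<T}"
        then have e: "slice Rd t = emb (\<Omega> T) (\<eta>d t)" and l: "L2 (\<Omega> T) (\<eta>d t)" using elim by blast+
        show "slice Rd t \<in> supp_in (\<Omega> T)" unfolding e by (rule emb_supp_in[OF X l[unfolded L2_iff_L2vec]])
      qed
    qed
  qed
  have curve: "E.curve Y (slice Rd) b"
    unfolding E.curve_def
  proof (intro conjI allI impI)
    show "continuous_on {0..T} Y" "Y 0 = 0" "Y T = 0" by (rule Ycont Y0)+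
    show "(%s. Y s \<bullet> h) \<in> borel_measurable lebesgue" for h
      by (rule borel_measurable_AE[OF slice_inner_measurable[OF R(1)]]) (use YR in eventually_elim, simp)
    show "(%s. slice Rd s \<bullet> h) \<in> borel_measurable lebesgue" for h by (rule slice_inner_measurable[OF Rd(1)])
    have i: "integrable lebesgue (%t. indicator {0<..<T} t *\<^sub>R (H1norm (\<Omega> t) (\<eta> t))\<^sup>2)" using aI I_leb by (simp add: integrable_restrict_space)
    have "tintegrable 0 T (%t. indicator {0<..<T} t *\<^sub>R (H1norm (\<Omega> t) (\<eta> t))\<^sup>2)"
      unfolding set_integrable_def by (rule integrable_mult_indicator[OF ivl_lebesgue i])
    then show "tintegrable 0 T b" unfolding b_def by (intro set_integral_add(1)[OF slice_bound_tintegrable[OF Rd(1)]])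
    show "AE s in lebesgue. s \<in> {0..<T} --> norm (slice Rd s) <= b s"
    proof (rule AE_I2)
      fix s
      have "0 <= indicator {0<..<T} s *\<^sub>R (H1norm (\<Omega> s) (\<eta> s))\<^sup>2" by simp
      then have "norm (slice Rd s) <= b s" using norm_le_one_plus_sq[of "slice Rd s"] unfolding b_def by linarith
      then show "s \<in> {0..<T} --> norm (slice Rd s) <= b s" by simp
    qed
    show "(Y t - Y s) \<bullet> h = tint s t (%r. slice Rd r \<bullet> h)" if "0 <= s" "s <= t" "t <= T" for h s t by (rule inc[OF that])
  qed
  have g1: "AE s in lebesgue. s \<in> {0..<T} --> (Y s, q s) \<in> grad_graph (Oc s) \<and> norm (q s) <= b s"
    using H R(3) YR AEne
  proof eventually_elim
    case (elim s)
    show ?case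
    proof
      assume "s \<in> {0..<T}"
      then have s: "s \<in> {0<..<T}" "s \<in> {0..T}" using elim(4) by auto
      have h: "H10 (\<Omega> s) (\<eta> s)" using elim(1) s by simp
      have "Y s = emb (\<Omega> s) (\<eta> s)" using elim(2,3) s by simp
      then have "(Y s, q s) \<in> grad_graph (Oc s)" using H10_D(3)[OF op[OF s(2)] h] by (simp add: Oc_eq[OF s(2)] q_def)
      moreover have "b s = 1 + (norm (slice Rd s))\<^sup>2 + (H1norm (\<Omega> s) (\<eta> s))\<^sup>2" using s(1) by (simp add: b_def)
      then have "norm (q s) <= b s" using HL(3)[OF s(1) h] zero_le_power2[of "norm (slice Rd s)"] unfolding q_def by linarith
      ultimately show "(Y s, q s) \<in> grad_graph (Oc s) \<and> norm (q s) <= b s" by simp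
    qed
  qed
  have g2: "AE s in lebesgue. s \<in> {0..<T} --> slice Rd s \<in> supp_in (Oc s)"
    using Rd(3) AEne
  proof eventually_elim
    case (elim s)
    show ?case
    proof
      assume "s \<in> {0..<T}"
      then have s: "s \<in> {0<..<T}" "s \<in> {0..T}" using elim(2) by auto
      then show "slice Rd s \<in> supp_in (Oc s)"
        using elim(1) emb_supp_in[OF leb[OF s(2)], of "\<eta>d s"] by (simp add: Oc_eq[OF s(2)] L2_iff_L2vec)
    qed
  qed
  have 1: "(\<integral>t. L2ip (\<Omega> t) (vv t) (\<eta>d t) \<partial>lebesgue_on {0..T}) = tint 0 T (%t. slice B t \<bullet> slice Rd t)"
  proof (rule integral_lebesgue_on_tint)
    show "AE t in lebesgue. t \<in> {0<..<T} --> L2ip (\<Omega> t) (vv t) (\<eta>d t) = slice B t \<bullet> slice Rd t"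
      using Rd(3) AE_slices
    proof eventually_elim
      case (elim t)
      show ?case
      proof
        assume t: "t \<in> {0<..<T}"
        then have t': "t \<in> {0..T}" by auto
        have "L2 (\<Omega> t) (\<eta>d t)" "emb (\<Omega> t) (\<eta>d t) = slice Rd t" "V t = slice B t" using elim t by auto
        then show "L2ip (\<Omega> t) (vv t) (\<eta>d t) = slice B t \<bullet> slice Rd t"
          by (simp add: L2ip_emb[OF leb[OF t'] vv_L2(1)[OF t']] vv_L2(2)[OF t'])
      qed
    qed
  qed
  have 2: "(\<integral>t. gradip (\<Omega> t) (uu t) (\<eta> t) \<partial>lebesgue_on {0..T}) = tint 0 T (%t. slice D t \<bullet> q t)"
  proof (rule integral_lebesgue_on_tint)
    show "AE t in lebesgue. t \<in> {0<..<T} --> gradip (\<Omega> t) (uu t) (\<eta> t) = slice D t \<bullet> q t"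
      using H AE_slices
    proof eventually_elim
      case (elim t)
      show ?case
      proof
        assume t: "t \<in> {0<..<T}"
        then have t': "t \<in> {0..T}" "0 <= t" "t <= t" "t <= T" by auto
        have "H10 (\<Omega> t) (\<eta> t)" "Z t = slice D t" using elim t by auto
        then show "gradip (\<Omega> t) (uu t) (\<eta> t) = slice D t \<bullet> q t"
          by (simp add: gradip_emb[OF op[OF t'(1)] uu_H10(1)[OF t'(2-4)]] uu_H10(3)[OF t'(2-4)] q_def)
      qed
    qed
  qed
  have 3: "(\<integral>t. L2ip (\<Omega> t) (f t) (\<eta> t) \<partial>lebesgue_on {0..T}) = tint 0 T (%t. E.Fs t \<bullet> Y t)"
  proof (rule integral_lebesgue_on_tint)
    show "AE t in lebesgue. t \<in> {0<..<T} --> L2ip (\<Omega> t) (f t) (\<eta> t) = E.Fs t \<bullet> Y t"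
      using slice_F R(3) YR
    proof eventually_elim
      case (elim t)
      show ?case
      proof
        assume t: "t \<in> {0<..<T}"
        then have t': "t \<in> {0..T}" by auto
        have "L2 (\<Omega> t) (f t)" "E.Fs t = emb (\<Omega> t) (f t)" "L2 (\<Omega> t) (\<eta> t)" "Y t = emb (\<Omega> t) (\<eta> t)"
          using elim t by (auto simp: E.Fs_def)
        then show "L2ip (\<Omega> t) (f t) (\<eta> t) = E.Fs t \<bullet> Y t" by (simp add: L2ip_emb[OF leb[OF t']])
      qed
    qed
  qed
  show ?thesis unfolding 1 2 3 by (rule weak_form[OF curve g1 g2])
qed

text \<open>A functional is represented by a pair in the graph over the largest domain. The position
  part converges strongly by the Lipschitz bound, and then \<open>graph_weak_tendsto\<close> forces
  weak convergence of the gradient part.\<close>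

lemma uu_weakly_cont: "weakly_cont_on {0..T} (H10 (\<Omega> T)) (H1norm (\<Omega> T)) uu"
  unfolding weakly_cont_on_def
proof (intro conjI ballI allI impI)
  show "H10 (\<Omega> T) (uu t)" if "t \<in> {0..T}" for t using that by (intro uu_H10) auto
  fix lf assume "bdd_lin_fun (H10 (\<Omega> T)) (H1norm (\<Omega> T)) lf"
  then obtain w where w: "!!v. H10 (\<Omega> T) v ==> lf v = w \<bullet> (emb (\<Omega> T) v, emb (\<Omega> T) (wgrad (\<Omega> T) v))"
    using H10_functional_representation[OF op[OF T_mem(1)]] by metis
  have e: "lf (uu t) = U t \<bullet> fst w + Z t \<bullet> snd w" if "t \<in> {0..T}" for t
    using that uu_H10[of t T] by (simp add: w inner_prod_def inner_commute)
  have "continuous_on {0..T} (%t. U t \<bullet> fst w + Z t \<bullet> snd w)"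
    unfolding continuous_on_sequentially
  proof (intro allI ballI impI, elim conjE)
    fix t r assume t: "t \<in> {0..T}" and r: "\<forall>n. r n \<in> {0..T}" "r ----> t"
    have "(%n. U (r n) - U t) ----> 0"
    proof (rule Lim_null_comparison)
      show "\<forall>\<^sub>F n in sequentially. norm (U (r n) - U t) <= C * \<bar>r n - t\<bar>" using lipschitz[OF t] r(1) by (intro always_eventually) auto
      have "(%n. C * \<bar>r n - t\<bar>) ----> C * \<bar>t - t\<bar>" by (intro tendsto_intros r)
      then show "(%n. C * \<bar>r n - t\<bar>) ----> 0" by simp
    qed
    then have Ul: "(%n. U (r n)) ----> U t" by (rule LIM_zero_cancel)
    have W: "(U s, Z s) \<in> grad_graph (Oc T)" if "s \<in> {0..T}" for s using that uu_H10(4)[of s T] by (simp add: Oc_eq[OF T_mem(1)])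
    have Zl: "(%n. Z (r n) \<bullet> snd w) ----> Z t \<bullet> snd w"
    proof (rule E.graph_weak_tendsto[where t = T and x = "%n. U (r n)" and C = C])
      show "0 <= T" using T by simp
      show "(U (r n), Z (r n)) \<in> grad_graph (Oc T)" "norm (Z (r n)) <= C" for n using W at_time r(1) by auto
    qed (rule Ul W[OF t])+
    show "((%t. U t \<bullet> fst w + Z t \<bullet> snd w) \<circ> r) ----> U t \<bullet> fst w + Z t \<bullet> snd w"
      unfolding o_def by (rule tendsto_add[OF tendsto_inner[OF Ul tendsto_const] Zl])
  qed
  moreover have "continuous_on {0..T} (%t. lf (uu t)) \<longleftrightarrow> continuous_on {0..T} (%t. U t \<bullet> fst w + Z t \<bullet> snd w)"
    by (rule continuous_on_cong[OF refl]) (rule e)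
  ultimately show "continuous_on {0..T} (%t. lf (uu t))" by (rule iffD2[rotated])
qed

text \<open>First components of the graph at \<open>tb\<close> are total in the space over the
  domain at \<open>tb\<close>, and tested with them the velocity is continuous by the increment
  bound, valid from \<open>tb\<close> on. The uniform bound of the velocities extends this to all
  functionals.\<close>

lemma vv_weakly_cont:
  assumes tb: "tb \<in> {0..<T}" shows "weakly_cont_on {tb..T} (L2 (\<Omega> tb)) (L2norm (\<Omega> tb)) vv"
  unfolding weakly_cont_on_def
proof (intro conjI ballI allI impI)
  have tb': "tb \<in> {0..T}" "0 <= tb" using tb by auto
  note X = op[OF tb'(1)] and Xl = leb[OF tb'(1)]
  have Xb: "\<Omega> tb \<in> sets borel" using X by simp
  have L: "L2 (\<Omega> tb) (vv t)" for t by (rule rep_L2(1)[OF Xl rep(3,4)])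
  then show "L2 (\<Omega> tb) (vv t)" for t .
  fix lf assume "bdd_lin_fun (L2 (\<Omega> tb)) (L2norm (\<Omega> tb)) lf"
  then obtain w where w: "w \<in> supp_in (\<Omega> tb)" "!!v. L2 (\<Omega> tb) v ==> lf v = w \<bullet> emb (\<Omega> tb) v"
    using L2_functional_representation[OF X] by metis
  have e: "lf (vv t) = V t \<bullet> w" for t
    using w(2)[OF L] emb_inner_supp[OF Xl rep(3,4) w(1), of t] by (simp add: inner_commute)
  show "continuous_on {tb..T} (%t. lf (vv t))"
    unfolding e continuous_on
  proof
    fix s assume s: "s \<in> {tb..T}"
    show "((%t. V t \<bullet> w) \<longlongrightarrow> V s \<bullet> w) (at s within {tb..T})"
    proof (rule weak_tendsto_if_total[OF subspace_supp_in[OF Xb] closed_supp_in[OF Xb] _ w(1), where D = "fst ` grad_graph (\<Omega> tb)" and C = C])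
      show "fst ` grad_graph (\<Omega> tb) \<subseteq> supp_in (\<Omega> tb)" using grad_graph_supp(1)[OF X] by auto
      show "h = 0" if h: "h \<in> supp_in (\<Omega> tb)" "!!d. d \<in> fst ` grad_graph (\<Omega> tb) ==> h \<bullet> d = 0" for h
        by (rule grad_graph_dense[OF X h(1)]) (rule h(2)[OF image_eqI[rotated]], assumption, simp)
      show "\<forall>\<^sub>F t in at s within {tb..T}. norm (V t) <= C" using at_time tb' by (intro within_eventually) auto
      fix d assume "d \<in> fst ` grad_graph (\<Omega> tb)"
      then obtain q where q: "(d, q) \<in> grad_graph (\<Omega> tb)" by auto
      have "((%t. V t \<bullet> d - V s \<bullet> d) \<longlongrightarrow> 0) (at s within {tb..T})"
      proof (rule Lim_null_comparison[OF within_eventually V_bound_tendsto[of "norm d" s "norm q"]])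
        fix t assume t: "t \<in> {tb..T}"
        show "norm (V t \<bullet> d - V s \<bullet> d) <= norm d * ((1 + E.FM) * sqrt \<bar>t - s\<bar>) + C * norm q * \<bar>t - s\<bar>"
          using V_increment[OF s t tb'(2) q] by (simp add: inner_diff_left)
      qed
      then show "((%t. V t \<bullet> d) \<longlongrightarrow> V s \<bullet> d) (at s within {tb..T})" by (rule LIM_zero_cancel)
    qed
  qed
qed

lemma energy:
  assumes t: "t \<in> {0..T}"
  shows "L2sq (\<Omega> t) (vv t) / 2 + gradsq (\<Omega> t) (uu t) / 2
    <= L2sq (\<Omega> 0) u1 / 2 + gradsq (\<Omega> 0) u0 / 2 + (\<integral>s. L2ip (\<Omega> s) (f s) (vv s) \<partial>lebesgue_on {0..t})"
proof -
  have t': "0 <= t" "t <= t" "t <= T" using t by auto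
  have "(\<integral>s. L2ip (\<Omega> s) (f s) (vv s) \<partial>lebesgue_on {0..t}) = tint 0 t (%r. E.Fs r \<bullet> slice B r)"
  proof (rule integral_lebesgue_on_tint)
    show "AE s in lebesgue. s \<in> {0<..<t} --> L2ip (\<Omega> s) (f s) (vv s) = E.Fs s \<bullet> slice B s"
      using slice_F AE_slices
    proof eventually_elim
      case (elim s)
      show ?case
      proof
        assume "s \<in> {0<..<t}"
        then have s: "s \<in> {0<..<T}" "s \<in> {0..T}" using t by auto
        have "L2 (\<Omega> s) (f s)" "E.Fs s = emb (\<Omega> s) (f s)" "V s = slice B s" using elim s by (auto simp: E.Fs_def)
        then show "L2ip (\<Omega> s) (f s) (vv s) = E.Fs s \<bullet> slice B s"
          using L2ip_emb[OF leb[OF s(2)] _ vv_L2(1)[OF s(2)]] vv_L2(2)[OF s(2)] by simp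
      qed
    qed
  qed
  moreover have "L2sq (\<Omega> t) (vv t) = (norm (V t))\<^sup>2" using L2sq_emb[OF leb[OF t] vv_L2(1)[OF t]] by (simp add: vv_L2(2)[OF t])
  moreover have "gradsq (\<Omega> t) (uu t) = (norm (Z t))\<^sup>2" using gradsq_emb[OF op[OF t] uu_H10(1)[OF t']] by (simp add: uu_H10(3)[OF t'])
  moreover have "L2sq (\<Omega> 0) u1 = (norm (emb (\<Omega> 0) u1))\<^sup>2" by (rule L2sq_emb[OF leb[OF T_mem(2)] u1_L2])
  moreover have "gradsq (\<Omega> 0) u0 = (norm (emb (\<Omega> 0) (wgrad (\<Omega> 0) u0)))\<^sup>2" by (rule gradsq_emb[OF op[OF T_mem(2)] u0_H10])
  ultimately show ?thesis using at_time[OF t] by simp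
qed

lemma uu_solution: "weak_solution T \<Omega> f u0 u1 uu vv"
  unfolding weak_solution_def
proof (intro conjI allI impI)
  show "L2_H10 T \<Omega> uu" "is_weak_dt T \<Omega> uu vv" "L2_L2 T \<Omega> vv" "cont_L2_on {0..T} (\<Omega> 0) uu" "L2sq (\<Omega> 0) (%x. uu 0 x - u0 x) = 0"
    by (rule uu_L2_H10 uu_weak_dt vv_L2_L2 uu_cont_L2 uu_initial)+
  fix \<delta> \<Omega>' assume h: "0 < \<delta> \<and> \<delta> < T \<and> open \<Omega>' \<and> \<Omega>' \<subseteq> \<Omega> 0 \<and> (\<forall>t\<in>{0<..\<delta>}. \<Omega>' \<subseteq> \<Omega> t)"
  show "cont_Hneg_on {0..\<delta>} \<Omega>' vv" using h by (intro vv_cont_Hneg) auto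
  show "Hneg_norm \<Omega>' (%x. vv 0 x - u1 x) = 0" using h by (intro vv_initial) auto
qed (rule weak_formulation)

end

theorem theorem1p8:
  fixes T :: real and \<Omega> :: "real \<Rightarrow> 'x::euclidean_space set"
    and f :: "real \<Rightarrow> 'x \<Rightarrow> real" and u0 u1 :: "'x \<Rightarrow> real"
  assumes T_pos: "T > 0"
    and dom: "\<And>t. t \<in> {0..T} \<Longrightarrow> \<Omega> t \<noteq> {} \<and> open (\<Omega> t) \<and> bounded (\<Omega> t) \<and> lipschitz_boundary (\<Omega> t)"
    and mono: "\<And>s t. 0 \<le> s \<Longrightarrow> s \<le> t \<Longrightarrow> t \<le> T \<Longrightarrow> \<Omega> s \<subseteq> \<Omega> t"
    and f_L2: "L2 (Oset T \<Omega>) (\<lambda>p. f (fst p) (snd p))"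
    and u0_H10: "H10 (\<Omega> 0) u0"
    and u1_L2: "L2 (\<Omega> 0) u1"
  shows "\<exists>u ud. weak_solution T \<Omega> f u0 u1 u ud
    \<and> weakly_cont_on {0..T} (H10 (\<Omega> T)) (H1norm (\<Omega> T)) u
    \<and> Linf_L2 T \<Omega> ud
    \<and> (\<forall>tb\<in>{0..<T}. weakly_cont_on {tb..T} (L2 (\<Omega> tb)) (L2norm (\<Omega> tb)) ud)
    \<and> (\<forall>t\<in>{0..T}. H10 (\<Omega> t) (u t) \<and> L2 (\<Omega> t) (ud t) \<and>
         L2sq (\<Omega> t) (ud t) / 2 + gradsq (\<Omega> t) (u t) / 2
           \<le> L2sq (\<Omega> 0) u1 / 2 + gradsq (\<Omega> 0) u0 / 2
              + (\<integral>s. L2ip (\<Omega> s) (f s) (ud s) \<partial>lebesgue_on {0..t}))"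
proof -
  interpret wave_data T \<Omega> f u0 u1
  proof
    show "open (\<Omega> t)" if "t \<in> {0..T}" for t using dom[OF that] by blast
  qed (rule T_pos mono f_L2 u0_H10 u1_L2; assumption?)+
  obtain A B D U V Z C where s: "sqint A" "sqint B" "sqint D" "U 0 = emb (\<Omega> 0) u0" "V 0 = emb (\<Omega> 0) u1"
    "AE t in lebesgue. t \<in> {0..<T} --> U t = slice A t \<and> V t = slice B t \<and> Z t = slice D t"
    "\<forall>t\<in>{0..T}. (U t, Z t) \<in> grad_graph (Oc t) \<and> V t \<in> supp_in (Oc t) \<and> norm (V t) <= C \<and> norm (Z t) <= C \<and>
      (norm (V t))\<^sup>2 / 2 + (norm (Z t))\<^sup>2 / 2 <= (norm (emb (\<Omega> 0) u1))\<^sup>2 / 2 + (norm (emb (\<Omega> 0) (wgrad (\<Omega> 0) u0)))\<^sup>2 / 2 + tint 0 t (%r. E.Fs r \<bullet> slice B r)"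
    "\<forall>s\<in>{0..T}. \<forall>t\<in>{0..T}. norm (U t - U s) <= C * \<bar>t - s\<bar>"
    "\<forall>tb s t \<phi> q. 0 <= tb --> tb <= s --> s <= t --> t <= T --> (\<phi>, q) \<in> grad_graph (Oc tb) -->
      (V t - V s) \<bullet> \<phi> = tint s t (%r. E.Fs r \<bullet> \<phi> - slice D r \<bullet> q) \<and>
      \<bar>tint s t (%r. E.Fs r \<bullet> \<phi> - slice D r \<bullet> q)\<bar> <= norm \<phi> * ((1 + E.FM) * sqrt (t - s)) + C * norm q * (t - s)"
    "\<forall>\<Phi> \<Phi>d b. E.curve \<Phi> \<Phi>d b --> tint 0 T (%s. slice A s \<bullet> \<Phi>d s) = - tint 0 T (%s. slice B s \<bullet> \<Phi> s)"
    "\<forall>E Ed b q. E.curve E Ed b --> (AE s in lebesgue. s \<in> {0..<T} --> (E s, q s) \<in> grad_graph (Oc s) \<and> norm (q s) <= b s) -->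
      (AE s in lebesgue. s \<in> {0..<T} --> Ed s \<in> supp_in (Oc s)) -->
      - tint 0 T (%s. slice B s \<bullet> Ed s) + tint 0 T (%s. slice D s \<bullet> q s) = tint 0 T (%s. E.Fs s \<bullet> E s)"
    using E.solution_exists by (elim exE conjE)
  interpret wave_sol T \<Omega> f u0 u1 A B D U V Z C
  proof
    show "sqint A" "sqint B" "sqint D" "U 0 = emb (\<Omega> 0) u0" "V 0 = emb (\<Omega> 0) u1"
      "AE t in lebesgue. t \<in> {0..<T} --> U t = slice A t \<and> V t = slice B t \<and> Z t = slice D t" by (rule s)+
  next
    fix t assume t: "t \<in> {0..T}"
    show "(U t, Z t) \<in> grad_graph (Oc t) \<and> V t \<in> supp_in (Oc t) \<and> norm (V t) <= C \<and> norm (Z t) <= C \<and>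
      (norm (V t))\<^sup>2 / 2 + (norm (Z t))\<^sup>2 / 2 <= (norm (emb (\<Omega> 0) u1))\<^sup>2 / 2 + (norm (emb (\<Omega> 0) (wgrad (\<Omega> 0) u0)))\<^sup>2 / 2 + tint 0 t (%r. E.Fs r \<bullet> slice B r)"
      by (rule bspec[OF s(7) t])
  next
    fix r t assume "r \<in> {0..T}" "t \<in> {0..T}"
    then show "norm (U t - U r) <= C * \<bar>t - r\<bar>" by (rule bspec[OF bspec[OF s(8)]])
  next
    fix tb r t \<phi> q assume h: "0 <= tb" "tb <= r" "r <= t" "t <= T" "(\<phi>, q) \<in> grad_graph (Oc tb)"
    note i = s(9)[rule_format, OF h]
    show "\<bar>(V t - V r) \<bullet> \<phi>\<bar> <= norm \<phi> * ((1 + E.FM) * sqrt (t - r)) + C * norm q * (t - r)"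
      unfolding conjunct1[OF i] by (rule conjunct2[OF i])
  next
    fix \<Phi> \<Phi>d b assume "E.curve \<Phi> \<Phi>d b"
    then show "tint 0 T (%s. slice A s \<bullet> \<Phi>d s) = - tint 0 T (%s. slice B s \<bullet> \<Phi> s)" by (rule s(10)[rule_format])
  next
    fix Y Yd b q assume h: "E.curve Y Yd b" "AE s in lebesgue. s \<in> {0..<T} --> (Y s, q s) \<in> grad_graph (Oc s) \<and> norm (q s) <= b s"
      "AE s in lebesgue. s \<in> {0..<T} --> Yd s \<in> supp_in (Oc s)"
    show "- tint 0 T (%s. slice B s \<bullet> Yd s) + tint 0 T (%s. slice D s \<bullet> q s) = tint 0 T (%s. E.Fs s \<bullet> Y s)"
      by (rule s(11)[rule_format, OF h])
  qed
  show ?thesis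
  proof (rule exI[of _ uu], rule exI[of _ vv], intro conjI ballI)
    show "weak_solution T \<Omega> f u0 u1 uu vv" "weakly_cont_on {0..T} (H10 (\<Omega> T)) (H1norm (\<Omega> T)) uu" "Linf_L2 T \<Omega> vv"
      by (rule uu_solution uu_weakly_cont vv_Linf_L2)+
    show "weakly_cont_on {tb..T} (L2 (\<Omega> tb)) (L2norm (\<Omega> tb)) vv" if "tb \<in> {0..<T}" for tb by (rule vv_weakly_cont[OF that])
    fix t assume t: "t \<in> {0..T}"
    show "H10 (\<Omega> t) (uu t)" using t by (intro uu_H10) auto
    show "L2 (\<Omega> t) (vv t)" by (rule vv_L2(1)[OF t])
    show "L2sq (\<Omega> t) (vv t) / 2 + gradsq (\<Omega> t) (uu t) / 2
      <= L2sq (\<Omega> 0) u1 / 2 + gradsq (\<Omega> 0) u0 / 2 + (\<integral>s. L2ip (\<Omega> s) (f s) (vv s) \<partial>lebesgue_on {0..t})" by (rule energy[OF t])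
  qed
qed

end
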